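(* Let $W$ be a finite Coxeter group of type $E_6$, $E_7$, $E_8$, $F_4$, or $H_4$, with Coxeter number $h$ and a fixed Coxeter element $c$. Then the map $\mathsf{Pop}_T(\cdot,c)$ has periodic orbits of size $h$. Furthermore, for any integer $k$ coprime to $h$ with $k\not\equiv\pm1\pmod h$ such that $c$ is conjugate to $c^k$ in $W$, the set \[O_k=\{w\in W: w^{-1}cw=c^k\}\] is a periodic orbit of $\mathsf{Pop}_T(\cdot,c)$ of size $h$.
   Context: $W$ has set of simple reflections $S$, set of reflections $T=\{wsw^{-1}: s\in S,\ w\in W\}$, and Coxeter number $h$ (its largest fundamental degree). $\ell_T(w)$ is the minimum number of reflections whose product is $w$; the absolute order is $v\le_T w$ iff $\ell_T(wv^{-1})=\ell_T(w)-\ell_T(v)$. A Coxeter element is a regular element of $W$ (one with an eigenvector lying on no reflecting hyperplane) of order $h$. $\mathrm{NC}(W,c)$ is the interval $[e,c]$ in absolute order, a lattice with join $\bigvee$. The noncrossing projection is $\pi_T(w,c)=\bigvee_{t\in T,\ t\le_T w} t$ (join in $\mathrm{NC}(W,c)$, empty join $=e$), and $\mathsf{Pop}_T(w,c)=w\,\pi_T(w,c)^{-1}$. An element $x$ is periodic if $\mathsf{Pop}_T^i(x)=x$ for some $i\ge1$; a periodic orbit is the forward orbit $\{x,\mathsf{Pop}_T(x),\mathsf{Pop}_T^2(x),\ldots\}$ of a periodic element $x$. *)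

theory Defs
  imports
    "HOL-Analysis.Analysis"
    "HOL-Algebra.Algebra"
    "HOL-Number_Theory.Cong"
begin

section \<open>Absolute order, noncrossing partitions and Pop in a group with a set of reflections\<close>

definition reflections :: "('a, 'b) monoid_scheme \<Rightarrow> 'a set \<Rightarrow> 'a set" where
  "reflections G S = {w \<otimes>\<^bsub>G\<^esub> s \<otimes>\<^bsub>G\<^esub> inv\<^bsub>G\<^esub> w | w s. w \<in> carrier G \<and> s \<in> S}"

definition reflection_length :: "('a, 'b) monoid_scheme \<Rightarrow> 'a set \<Rightarrow> 'a \<Rightarrow> nat" where
  "reflection_length G T w =
     (LEAST k. \<exists>ts. set ts \<subseteq> T \<and> length ts = k \<and> foldr (\<otimes>\<^bsub>G\<^esub>) ts \<one>\<^bsub>G\<^esub> = w)"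

definition absolute_le :: "('a, 'b) monoid_scheme \<Rightarrow> 'a set \<Rightarrow> 'a \<Rightarrow> 'a \<Rightarrow> bool" where
  "absolute_le G T v w \<longleftrightarrow>
     int (reflection_length G T (w \<otimes>\<^bsub>G\<^esub> inv\<^bsub>G\<^esub> v))
       = int (reflection_length G T w) - int (reflection_length G T v)"

definition NC :: "('a, 'b) monoid_scheme \<Rightarrow> 'a set \<Rightarrow> 'a \<Rightarrow> 'a gorder" where
  "NC G T c =
     \<lparr>carrier = {v \<in> carrier G. absolute_le G T \<one>\<^bsub>G\<^esub> v \<and> absolute_le G T v c},
      eq = (=),
      le = absolute_le G T\<rparr>"

definition nc_proj :: "('a, 'b) monoid_scheme \<Rightarrow> 'a set \<Rightarrow> 'a \<Rightarrow> 'a \<Rightarrow> 'a" where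
  "nc_proj G T w c = \<Squnion>\<^bsub>NC G T c\<^esub> {t \<in> T. absolute_le G T t w}"

definition PopT :: "('a, 'b) monoid_scheme \<Rightarrow> 'a set \<Rightarrow> 'a \<Rightarrow> 'a \<Rightarrow> 'a" where
  "PopT G T w c = w \<otimes>\<^bsub>G\<^esub> inv\<^bsub>G\<^esub> (nc_proj G T w c)"

definition periodic :: "('a \<Rightarrow> 'a) \<Rightarrow> 'a \<Rightarrow> bool" where
  "periodic f x \<longleftrightarrow> (\<exists>i\<ge>1. (f ^^ i) x = x)"

definition periodic_orbit_on :: "'a set \<Rightarrow> ('a \<Rightarrow> 'a) \<Rightarrow> 'a set \<Rightarrow> bool" where
  "periodic_orbit_on A f Orb \<longleftrightarrow> (\<exists>x\<in>A. periodic f x \<and> Orb = {(f ^^ i) x | i. True})"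


section \<open>Finite Coxeter groups as real reflection groups\<close>

datatype coxeter_type = E6 | E7 | E8 | F4 | H4

fun coxeter_rank :: "coxeter_type \<Rightarrow> nat" where
  "coxeter_rank E6 = 6"
| "coxeter_rank E7 = 7"
| "coxeter_rank E8 = 8"
| "coxeter_rank F4 = 4"
| "coxeter_rank H4 = 4"

text \<open>Edge labels of the Coxeter diagrams for \<open>i < j\<close>, with the Bourbaki numbering of the
  nodes shifted to start at 0; non-edges carry the label 2.\<close>

fun coxeter_label :: "coxeter_type \<Rightarrow> nat \<Rightarrow> nat \<Rightarrow> nat" where
  "coxeter_label E6 i j =
     (if (i, j) \<in> {(0,2), (1,3), (2,3), (3,4), (4,5)} then 3 else 2)"
| "coxeter_label E7 i j =
     (if (i, j) \<in> {(0,2), (1,3), (2,3), (3,4), (4,5), (5,6)} then 3 else 2)"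
| "coxeter_label E8 i j =
     (if (i, j) \<in> {(0,2), (1,3), (2,3), (3,4), (4,5), (5,6), (6,7)} then 3 else 2)"
| "coxeter_label F4 i j =
     (if (i, j) = (1,2) then 4 else if (i, j) \<in> {(0,1), (2,3)} then 3 else 2)"
| "coxeter_label H4 i j =
     (if (i, j) = (0,1) then 5 else if (i, j) \<in> {(1,2), (2,3)} then 3 else 2)"

definition coxeter_matrix :: "coxeter_type \<Rightarrow> nat \<Rightarrow> nat \<Rightarrow> nat" where
  "coxeter_matrix D i j = (if i = j then 1 else coxeter_label D (min i j) (max i j))"

text \<open>The simple roots of the geometric representation. The diagonal entry 1 of the Coxeter
  matrix makes them unit vectors; the Gram matrix is nonsingular for the types above, so they
  form a basis of \<open>\<real>\<^sup>n\<close>.\<close>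

definition simple_roots :: "coxeter_type \<Rightarrow> (nat \<Rightarrow> real^'n) \<Rightarrow> bool" where
  "simple_roots D \<alpha> \<longleftrightarrow>
     CARD('n) = coxeter_rank D \<and>
     (\<forall>i<coxeter_rank D. \<forall>j<coxeter_rank D.
        \<alpha> i \<bullet> \<alpha> j = - cos (pi / real (coxeter_matrix D i j)))"

definition reflection_matrix :: "real^'n \<Rightarrow> real^'n^'n" where
  "reflection_matrix a = matrix (\<lambda>x. x - (2 * (a \<bullet> x) / (a \<bullet> a)) *\<^sub>R a)"

definition simple_reflections :: "coxeter_type \<Rightarrow> (nat \<Rightarrow> real^'n) \<Rightarrow> (real^'n^'n) set" where
  "simple_reflections D \<alpha> = (\<lambda>i. reflection_matrix (\<alpha> i)) ` {..<coxeter_rank D}"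

definition GL :: "(real^'n^'n) monoid" where
  "GL = \<lparr>carrier = {A. invertible A}, mult = (**), one = mat 1\<rparr>"

definition coxeter_group :: "coxeter_type \<Rightarrow> (nat \<Rightarrow> real^'n) \<Rightarrow> (real^'n^'n) monoid" where
  "coxeter_group D \<alpha> = GL\<lparr>carrier := generate GL (simple_reflections D \<alpha>)\<rparr>"


section \<open>Fundamental degrees, the Coxeter number and Coxeter elements\<close>

text \<open>Over the reals, polynomials and polynomial functions agree. The polynomial functions
  \<open>g\<close> on \<open>\<real>\<^sup>n\<close> play the role of polynomials in the \<open>n\<close> invariants \<open>f i\<close>: the last two
  conjuncts say that the \<open>f i\<close> generate the invariant ring and are algebraically independent.\<close>

definition invariant_polynomials :: "(real^'n^'n) set \<Rightarrow> (real^'n \<Rightarrow> real) set" where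
  "invariant_polynomials W =
     {p. real_polynomial_function p \<and> (\<forall>A\<in>W. \<forall>x. p (A *v x) = p x)}"

definition fundamental_invariants ::
    "(real^'n^'n) set \<Rightarrow> ('n \<Rightarrow> real^'n \<Rightarrow> real) \<Rightarrow> ('n \<Rightarrow> nat) \<Rightarrow> bool" where
  "fundamental_invariants W f d \<longleftrightarrow>
     (\<forall>i. f i \<in> invariant_polynomials W \<and> (\<forall>r x. f i (r *\<^sub>R x) = r ^ d i * f i x)) \<and>
     (\<forall>p \<in> invariant_polynomials W.
        \<exists>g. real_polynomial_function (g :: real^'n \<Rightarrow> real) \<and> (\<forall>x. p x = g (\<chi> i. f i x))) \<and>
     (\<forall>g. real_polynomial_function (g :: real^'n \<Rightarrow> real) \<longrightarrow>
        (\<forall>x. g (\<chi> i. f i x) = 0) \<longrightarrow> (\<forall>y. g y = 0))"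

definition is_coxeter_number :: "(real^'n^'n) set \<Rightarrow> nat \<Rightarrow> bool" where
  "is_coxeter_number W h \<longleftrightarrow> (\<exists>f d. fundamental_invariants W f d \<and> h = Max (range d))"

definition complexify :: "real^'n^'n \<Rightarrow> complex^'n^'n" where
  "complexify A = (\<chi> i j. complex_of_real (A $ i $ j))"

text \<open>The (complexified) reflecting hyperplane of a reflection is its fixed space.\<close>

definition reflecting_hyperplane :: "real^'n^'n \<Rightarrow> (complex^'n) set" where
  "reflecting_hyperplane t = {v. complexify t *v v = v}"

definition regular_element :: "(real^'n^'n) set \<Rightarrow> real^'n^'n \<Rightarrow> bool" where
  "regular_element T w \<longleftrightarrow>
     (\<exists>v \<mu>. v \<noteq> 0 \<and> complexify w *v v = \<mu> *s v \<and> (\<forall>t\<in>T. v \<notin> reflecting_hyperplane t))"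

definition coxeter_element ::
    "(real^'n^'n) monoid \<Rightarrow> (real^'n^'n) set \<Rightarrow> nat \<Rightarrow> real^'n^'n \<Rightarrow> bool" where
  "coxeter_element W T h c \<longleftrightarrow> c \<in> carrier W \<and> regular_element T c \<and> group.ord W c = h"

end

theory Submission
  imports Defs "HOL-Computational_Algebra.Computational_Algebra" "HOL-Number_Theory.Number_Theory"
begin

text \<open>
  Let \<open>O\<^sub>k\<close> be the set of the \<open>w\<close> with \<open>w\<inverse>cw = c\<^sup>k\<close>, a coset of the centralizer of \<open>c\<close>. If \<open>\<pi>\<^sub>T(w, c) = c\<close>
  for every \<open>w\<close> in \<open>O\<^sub>k\<close>, then \<open>Pop\<^sub>T\<close> acts on \<open>O\<^sub>k\<close> as right multiplication by \<open>c\<inverse>\<close>, and the claim follows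
  because the centralizer is generated by \<open>c\<close>. By Carter's lemma, an upper bound \<open>u \<noteq> c\<close> of the reflections
  below \<open>w\<close> would give a root \<open>b = (c - 1)x\<close> with \<open>x\<close> fixed by \<open>w\<close>, and then
  \<open>(1 + c + \<dots> + c\<^sup>k\<^sup>-\<^sup>1) b = (c\<^sup>k - 1)x = w\<inverse>b\<close> would be a root. That this vector is never a root follows from its length:
  the autocorrelations \<open>2 (b, c\<^sup>jb)\<close> take few values and satisfy the linear recurrence given by
  a cyclotomic annihilator of \<open>b\<close>.

  The order of \<open>c\<close> is bounded above by the action on a root lattice (the Euler function of the order is at most
  the rank) and below by the degrees: if all degrees were smaller than the order of a product of the simple
  reflections, the invariants would be radial on its rotation plane and could not separate orbits.
  A conjugating element for some \<open>k\<close> is an explicit product of the reflections in the roots \<open>c\<^sup>ib\<close>, where \<open>b\<close> is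
  a root whose orbit under \<open>c\<close> spans; it depends only on the autocorrelations of \<open>b\<close>.
\<close>

section \<open>Integer polynomials acting on vectors, and roots of unity\<close>

hide_const (open) Module.smult up_ring.monom up_ring.coeff Divisibility.prime
  Divisibility.irreducible Polynomials.lead_coeff Polynomials.degree

text \<open>The obstacle is that \<open>c\<close> is an arbitrary regular element whose order is the
  largest degree: neither the value of \<open>h\<close> nor the conjugacy of all such elements is at
  hand. What is known of \<open>c\<close> is an eigenfunctional \<open>\<psi>\<close> that vanishes
  at no root. It turns every integer polynomial annihilating a root into one that vanishes at a root
  of unity of order \<open>h\<close>. The order, the centralizer, the fixed space and the
  autocorrelations are derived from this. The types differ in how the Euler function of
  \<open>h\<close> compares with the rank of the lattice. The two agree for E8, F4 and H4, so the
  cyclotomic polynomial annihilates every root in the lattice. For E7 and E6 there is a cofactor of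
  degree at most 1 and 2, and a root whose orbit spans is found by reducing the lattice modulo its
  determinant 2 or 3. F4 has two orbits of roots, only one of which lies in the lattice; the lattice
  of H4 has rank 8 in a space of dimension 4.\<close>

definition papp :: "int poly \<Rightarrow> ('v::real_vector \<Rightarrow> 'v) \<Rightarrow> 'v \<Rightarrow> 'v" where
  "papp P f x = fold_coeffs (\<lambda>a y. of_int a *\<^sub>R x + f y) P 0"

lemma papp_0 [simp]: "papp 0 f x = 0"
  by (simp add: papp_def)

lemma papp_pCons [simp]:
  assumes "linear f"
  shows "papp (pCons a P) f x = of_int a *\<^sub>R x + f (papp P f x)"
  using linear_0[OF assms] by (cases "P = 0 \<and> a = 0") (auto simp: papp_def)

lemma papp_1 [simp]: "linear f \<Longrightarrow> papp 1 f x = x"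
  by (simp add: one_pCons linear_0)

lemma papp_add [simp]:
  assumes "linear f"
  shows "papp (P + Q) f x = papp P f x + papp Q f x"
  by (induction P Q rule: poly_induct2)
     (auto simp: assms linear_add[OF assms] algebra_simps)

lemma papp_smult [simp]:
  assumes "linear f"
  shows "papp (smult a P) f x = of_int a *\<^sub>R papp P f x"
  by (induction P) (auto simp: assms linear_cmul[OF assms] algebra_simps)

lemma papp_minus [simp]:
  assumes "linear f"
  shows "papp (- P) f x = - papp P f x"
  using papp_smult[OF assms, of "-1"] by simp

lemma papp_diff [simp]:
  assumes "linear f"
  shows "papp (P - Q) f x = papp P f x - papp Q f x"
  using papp_add[OF assms, of P "- Q"] assms by simp

lemma papp_vec_add:
  assumes "linear f"
  shows "papp P f (x + y) = papp P f x + papp P f y"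
  by (induction P) (auto simp: assms linear_add[OF assms] algebra_simps)

lemma papp_vec_scale:
  assumes "linear f"
  shows "papp P f (r *\<^sub>R x) = r *\<^sub>R papp P f x"
  by (induction P) (auto simp: assms linear_cmul[OF assms] algebra_simps)

lemma linear_papp: "linear f \<Longrightarrow> linear (papp P f)"
  by (simp add: linear_iff papp_vec_add papp_vec_scale)

lemma papp_vec_0 [simp]: "linear f \<Longrightarrow> papp P f 0 = 0"
  using linear_0 linear_papp by blast

lemma papp_commute_linear:
  assumes "linear f" "linear g" "linear \<psi>" "\<And>x. \<psi> (f x) = g (\<psi> x)"
  shows "\<psi> (papp P f x) = papp P g (\<psi> x)"
  by (induction P)
     (auto simp: assms linear_0[OF assms(3)] linear_add[OF assms(3)] linear_cmul[OF assms(3)])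

lemma papp_mult [simp]:
  assumes "linear f"
  shows "papp (P * Q) f x = papp P f (papp Q f x)"
  by (induction P) (auto simp: assms)

lemma papp_monom: "linear f \<Longrightarrow> papp (monom a k) f x = of_int a *\<^sub>R (f ^^ k) x"
proof (induction k arbitrary: x)
  case 0 then show ?case by (simp add: monom_0 linear_0)
next
  case (Suc k) then show ?case by (simp add: monom_Suc linear_cmul)
qed

lemma papp_sum_coeffs:
  assumes "linear f" "degree P \<le> n"
  shows "papp P f x = (\<Sum>i\<le>n. of_int (coeff P i) *\<^sub>R (f ^^ i) x)"
proof -
  have "P = (\<Sum>i\<le>n. monom (coeff P i) i)"
    using poly_as_sum_of_monoms'[OF assms(2)] by simp
  also have "papp \<dots> f x = (\<Sum>i\<le>n. papp (monom (coeff P i) i) f x)"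
    by (induction n) (auto simp: assms(1))
  finally show ?thesis by (simp add: papp_monom assms(1))
qed

definition ieval :: "int poly \<Rightarrow> complex \<Rightarrow> complex" where
  "ieval P z = poly (map_poly of_int P) z"

lemma ieval_0 [simp]: "ieval 0 z = 0"
  by (simp add: ieval_def)

lemma ieval_pCons [simp]: "ieval (pCons a P) z = of_int a + z * ieval P z"
  by (simp add: ieval_def map_poly_pCons)

lemma ieval_1 [simp]: "ieval 1 z = 1"
  by (simp add: one_pCons)

lemma ieval_add [simp]: "ieval (P + Q) z = ieval P z + ieval Q z"
  by (induction P Q rule: poly_induct2) (auto simp: algebra_simps)

lemma ieval_smult [simp]: "ieval (smult a P) z = of_int a * ieval P z"
  by (induction P) (auto simp: algebra_simps)

lemma ieval_diff [simp]: "ieval (P - Q) z = ieval P z - ieval Q z"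
  using ieval_add[of P "smult (-1) Q"] ieval_smult[of "-1" Q] by simp

lemma ieval_mult [simp]: "ieval (P * Q) z = ieval P z * ieval Q z"
  by (induction P) (auto simp: algebra_simps)

lemma ieval_power [simp]: "ieval (P ^ k) z = ieval P z ^ k"
  by (induction k) auto

lemma ieval_monom [simp]: "ieval (monom a k) z = of_int a * z ^ k"
  by (induction k) (auto simp: monom_0 monom_Suc)

lemma ieval_pcompose [simp]: "ieval (pcompose P Q) z = ieval P (ieval Q z)"
  by (induction P) (auto simp: pcompose_pCons)

text \<open>Transports a relation between the iterates of x to the eigenvalue: if P(f) x = 0 and
  \<psi> x is nonzero, then P vanishes at \<nu>.\<close>

lemma papp_eigen:
  assumes "linear f" "linear \<psi>" "\<And>x. \<psi> (f x) = \<nu> * \<psi> x"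
  shows "\<psi> (papp P f x) = ieval P \<nu> * \<psi> x"
  by (induction P)
     (auto simp: assms linear_0[OF assms(2)] linear_add[OF assms(2)] linear_cmul[OF assms(2)]
        algebra_simps scaleR_conv_of_real)

lemma degree_map_poly_of_int [simp]:
  "degree (map_poly of_int P :: complex poly) = degree (P :: int poly)"
  by (cases "P = 0") (auto intro!: degree_map_poly)

lemma ieval_zeros_bound:
  assumes "P \<noteq> 0" "finite S" "\<And>z. z \<in> S \<Longrightarrow> ieval P z = 0"
  shows "card S \<le> degree P"
proof -
  let ?Q = "map_poly of_int P :: complex poly"
  have "?Q \<noteq> 0" using assms(1) by (simp add: map_poly_eq_0_iff)
  then have "finite {z. poly ?Q z = 0}" "card {z. poly ?Q z = 0} \<le> degree ?Q"
    by (rule poly_roots_finite, rule card_poly_roots_bound)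
  moreover have "S \<subseteq> {z. poly ?Q z = 0}"
    using assms(3) by (auto simp: ieval_def)
  ultimately show ?thesis by (metis card_mono degree_map_poly_of_int order_trans)
qed

text \<open>Gauss's lemma: the content is multiplicative, so a divides the content of q and can be
  cancelled.\<close>

lemma primitive_dvd_smult_cancel:
  fixes f P :: "int poly"
  assumes "content f = 1" "a \<noteq> 0" "smult a P = f * q"
  shows "f dvd P"
proof -
  have "a dvd content (f * q)"
    unfolding assms(3)[symmetric] by simp
  then have "a dvd content q" using assms(1) by (simp add: content_mult)
  then obtain q' where "q = [:a:] * q'"
    by (auto simp flip: const_poly_dvd_iff_dvd_content elim: dvdE)
  then have "smult a P = smult a (f * q')" using assms(3) by simp
  then have "P = f * q'" using smult_diff_right[of a P "f * q'"] assms(2) by simp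
  then show ?thesis by simp
qed

text \<open>Pseudo-division by a primitive polynomial of least degree replaces division over the
  rationals; Gauss's lemma removes the extra factor.\<close>

lemma minimal_int_poly:
  assumes "P0 \<noteq> 0" "ieval P0 z = 0"
  obtains f where "f \<noteq> 0" "ieval f z = 0" "content f = 1"
    "\<And>P. ieval P z = 0 \<Longrightarrow> f dvd P"
proof -
  define d where "d = (LEAST d. \<exists>f. f \<noteq> 0 \<and> ieval f z = 0 \<and> degree f = d)"
  have "\<exists>f. f \<noteq> 0 \<and> ieval f z = 0 \<and> degree f = d"
    unfolding d_def by (rule LeastI[of _ "degree P0"]) (use assms in blast)
  then obtain g where g: "g \<noteq> 0" "ieval g z = 0" "degree g = d" by blast
  have min: "degree f \<ge> d" if "f \<noteq> 0" "ieval f z = 0" for f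
    unfolding d_def by (rule Least_le) (use that in blast)
  define f where "f = primitive_part g"
  have gf: "g = smult (content g) f" by (simp add: f_def)
  have f0: "f \<noteq> 0" using g by (simp add: f_def)
  have "ieval g z = of_int (content g) * ieval f z" by (subst gf) simp
  then have fz: "ieval f z = 0" using g by simp
  have fd: "degree f = d" using g by (simp add: f_def)
  have cf: "content f = 1" using g by (simp add: f_def)
  have "f dvd P" if P: "ieval P z = 0" for P
  proof -
    obtain a q where aq: "a \<noteq> 0" "smult a P = f * q + pseudo_mod P f"
      using pseudo_mod(1)[OF f0] by blast
    have "ieval (smult a P) z = 0" using P by simp
    then have "ieval (pseudo_mod P f) z = 0" unfolding aq(2) using fz by simp
    then have "pseudo_mod P f = 0"
      using min pseudo_mod(2)[OF f0, of P] fd by fastforce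
    then show ?thesis using primitive_dvd_smult_cancel[OF cf aq(1)] aq(2) by simp
  qed
  then show ?thesis using that f0 fz cf by blast
qed

section \<open>Conjugate roots of unity\<close>

lemma prime_dvd_binomial_power:
  fixes x y :: "'a :: comm_ring_1"
  assumes "prime p"
  shows "of_nat p dvd (x + y) ^ p - (x ^ p + y ^ p)"
proof -
  have p: "p > 1" using assms prime_gt_1_nat by blast
  have "(x + y) ^ p = (\<Sum>k\<le>p. of_nat (p choose k) * x ^ k * y ^ (p - k))"
    by (rule binomial_ring)
  also have "{..p} = insert 0 (insert p {1..<p})" using p by auto
  also have "(\<Sum>k\<in>\<dots>. of_nat (p choose k) * x ^ k * y ^ (p - k)) =
      y ^ p + x ^ p + (\<Sum>k\<in>{1..<p}. of_nat (p choose k) * x ^ k * y ^ (p - k))"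
    using p by (simp add: add.assoc)
  finally have "(x + y) ^ p - (x ^ p + y ^ p) =
      (\<Sum>k\<in>{1..<p}. of_nat (p choose k) * x ^ k * y ^ (p - k))" by simp
  moreover have "of_nat p dvd (of_nat (p choose k) * x ^ k * y ^ (p - k) :: 'a)"
    if "k \<in> {1..<p}" for k
  proof -
    have "p dvd (p choose k)" by (rule dvd_choose_prime) (use that assms in auto)
    then have "(of_nat p :: 'a) dvd of_nat (p choose k)" by (auto elim!: dvdE)
    then show ?thesis by (simp add: dvd_mult2)
  qed
  ultimately show ?thesis by (simp only: dvd_sum)
qed

text \<open>Modulo p the p-th power is additive, and it fixes constants by Fermat's little
  theorem.\<close>

lemma int_poly_frobenius:
  fixes g :: "int poly"
  assumes "prime p"
  shows "of_nat p dvd g ^ p - pcompose g (monom 1 p)"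
proof (induction g)
  case 0
  then show ?case using assms prime_gt_0_nat by (simp add: power_0_left)
next
  case (pCons a g)
  let ?X = "monom 1 1 :: int poly"
  have pc: "pCons a g = [:a:] + ?X * g" by (simp add: monom_altdef)
  have 1: "of_nat p dvd ([:a:] + ?X * g) ^ p - ([:a:] ^ p + (?X * g) ^ p)"
    by (rule prime_dvd_binomial_power[OF assms])
  have 2: "of_nat p dvd [:a:] ^ p - [:a:]"
  proof -
    have "int p dvd a ^ p - a"
    proof (cases "p dvd nat \<bar>a\<bar>")
      case True
      then have "int p dvd a" by (simp add: dvd_nat_abs_iff)
      then show ?thesis using assms prime_gt_0_nat
        by (meson dvd_diff dvd_power dvd_trans)
    next
      case False
      define b where "b = nat (a mod int p)"
      have b: "int b = a mod int p" using assms prime_gt_0_nat by (simp add: b_def)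
      have "\<not> int p dvd int b" unfolding b using False by (simp add: dvd_nat_abs_iff dvd_mod_iff)
      then have "[b ^ (p - 1) = 1] (mod p)" by (intro fermat_theorem[OF assms]) auto
      then have "[int b ^ (p - 1) = 1] (mod int p)" by (metis cong_int_iff of_nat_1 of_nat_power)
      moreover have "[a ^ (p - 1) = int b ^ (p - 1)] (mod int p)"
        unfolding b by (intro cong_pow) (simp add: cong_def)
      ultimately have "[a ^ (p - 1) = 1] (mod int p)" using cong_trans by blast
      then have "int p dvd a ^ (p - 1) - 1" by (simp add: cong_iff_dvd_diff)
      then have "int p dvd a * (a ^ (p - 1) - 1)" by simp
      moreover have "a * (a ^ (p - 1) - 1) = a ^ p - a"
        using assms prime_gt_0_nat[of p] by (simp add: algebra_simps flip: power_Suc)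
      ultimately show ?thesis by simp
    qed
    then obtain t where "a ^ p - a = int p * t" by blast
    then have "[:a ^ p - a:] = of_nat p * [:t:]" by (simp add: of_nat_poly)
    moreover have "[:a:] ^ p - [:a:] = [:a ^ p - a:]" by (simp add: poly_const_pow)
    ultimately show ?thesis by (metis dvd_triv_left)
  qed
  have 3: "of_nat p dvd ?X ^ p * (g ^ p - pcompose g (monom 1 p))"
    using pCons.IH by simp
  have "pCons a g ^ p - pcompose (pCons a g) (monom 1 p) =
     (([:a:] + ?X * g) ^ p - ([:a:] ^ p + (?X * g) ^ p)) + ([:a:] ^ p - [:a:])
      + ?X ^ p * (g ^ p - pcompose g (monom 1 p))"
    unfolding pc[symmetric]
    by (simp add: pcompose_pCons power_mult_distrib monom_power algebra_simps)
  then show ?case using 1 2 3 by (simp only: dvd_add)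
qed

text \<open>The leading coefficient of f is a unit, so f keeps its positive degree modulo p. A
  product f Z can then be constant modulo p only if Z, and with it the constant, vanishes modulo
  p.\<close>

lemma int_poly_mult_const_mod_prime:
  fixes f Z :: "int poly"
  assumes "prime p" "\<bar>lead_coeff f\<bar> = 1" "degree f \<ge> 1" "of_nat p dvd f * Z - of_int a"
  shows "int p dvd a"
proof (rule ccontr)
  assume na: "\<not> int p dvd a"
  have cong: "int p dvd coeff (f * Z - of_int a) i" for i
  proof -
    obtain k where k: "f * Z - of_int a = of_nat p * k" using assms(4) by blast
    show ?thesis unfolding k by (simp add: of_nat_poly)
  qed
  define A where "A = {i. \<not> int p dvd coeff Z i}"
  have "A \<subseteq> {..degree Z}" by (auto simp: A_def) (metis coeff_eq_0 dvd_0_right not_le)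
  then have fin: "finite A" using finite_subset by blast
  have "A \<noteq> {}"
  proof
    assume "A = {}"
    then have "int p dvd coeff (f * Z) 0" by (auto simp: A_def mult_poly_0 coeff_mult intro!: dvd_sum)
    then show False using cong[of 0] na by (simp add: of_int_poly dvd_diff_right_iff)
  qed
  define t where "t = Max A"
  have t: "t \<in> A" "\<And>i. i > t \<Longrightarrow> int p dvd coeff Z i"
    using Max_in[OF fin \<open>A \<noteq> {}\<close>] Max_ge[OF fin] by (auto simp: t_def A_def) force
  let ?d = "degree f"
  have "coeff (f * Z) (?d + t) = (\<Sum>i\<le>?d + t. coeff f i * coeff Z (?d + t - i))"
    by (simp add: coeff_mult)
  also have "\<dots> = coeff f ?d * coeff Z t + (\<Sum>i\<in>{..?d + t} - {?d}. coeff f i * coeff Z (?d + t - i))"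
    by (subst sum.remove[of _ ?d]) auto
  finally have eq: "coeff (f * Z) (?d + t) = \<dots>" .
  have "int p dvd (\<Sum>i\<in>{..?d + t} - {?d}. coeff f i * coeff Z (?d + t - i))"
  proof (rule dvd_sum)
    fix i assume i: "i \<in> {..?d + t} - {?d}"
    show "int p dvd coeff f i * coeff Z (?d + t - i)"
    proof (cases "i > ?d")
      case True then show ?thesis by (simp add: coeff_eq_0)
    next
      case False
      then have "?d + t - i > t" using i by auto
      then show ?thesis using t(2) by simp
    qed
  qed
  moreover have "int p dvd coeff (f * Z) (?d + t)"
    using cong[of "?d + t"] assms(3) by (simp add: of_int_poly coeff_pCons split: nat.splits)
  ultimately have "int p dvd coeff f ?d * coeff Z t" unfolding eq by (simp only: dvd_add_left_iff)
  then have "int p dvd coeff Z t" using assms(2) by (cases "coeff f ?d \<ge> 0") (auto simp: abs_if split: if_splits)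
  then show False using t(1) by (simp add: A_def)
qed

text \<open>Irreducibility of cyclotomic polynomials in disguise. If \<open>x\<^sup>m - 1 = f g\<close> and
  \<open>f(\<mu>) = 0 \<noteq> f(\<mu>\<^sup>p)\<close>, then \<open>g(\<mu>)\<^sup>p \<equiv> g(\<mu>\<^sup>p) = 0\<close> modulo \<open>p\<close>, while differentiation shows that
  \<open>g(\<mu>)\<close> divides \<open>m\<close>; hence \<open>p\<close> divides a power of \<open>m\<close>.\<close>

lemma int_poly_root_prime_power:
  assumes "m > 0" "z ^ m = 1" "prime p" "\<not> p dvd m" "ieval P z = 0"
  shows "ieval P (z ^ p) = 0"
proof (cases "P = 0")
  case False
  obtain f where f: "f \<noteq> 0" "ieval f z = 0" "content f = 1" "\<And>P. ieval P z = 0 \<Longrightarrow> f dvd P"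
    using minimal_int_poly[OF False assms(5)] by blast
  let ?c = "monom 1 m - 1 :: int poly"
  have "f dvd ?c" by (rule f(4)) (simp add: assms)
  then obtain g where g: "?c = f * g" by blast
  have lc: "\<bar>lead_coeff f\<bar> = 1"
  proof -
    have dm: "degree ?c = m"
      using degree_add_eq_left[of "-1" "monom 1 m :: int poly"] assms(1) by (simp add: degree_monom_eq)
    have "lead_coeff ?c = 1" unfolding dm using assms(1) by simp
    then have "lead_coeff f * lead_coeff g = 1" unfolding g by (simp add: lead_coeff_mult)
    then show ?thesis by (metis abs_zmult_eq_1 abs_1)
  qed
  have df: "degree f \<ge> 1"
  proof (rule ccontr)
    assume "\<not> ?thesis"
    then obtain a where "f = [:a:]" by (metis One_nat_def degree_eq_zeroE less_Suc0 not_le)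
    then show False using f(1,2) by simp
  qed
  have "ieval f (z ^ p) = 0"
  proof (rule ccontr)
    assume nz: "ieval f (z ^ p) \<noteq> 0"
    have "ieval ?c (z ^ p) = 0"
      using assms(2) by (simp flip: power_mult add: mult.commute[of p]) (simp add: power_mult)
    then have g0: "ieval g (z ^ p) = 0" unfolding g using nz by simp
    obtain u where u: "g ^ p - pcompose g (monom 1 p) = of_nat p * u"
      using int_poly_frobenius[OF assms(3)] by blast
    have "ieval (g ^ p - pcompose g (monom 1 p)) z = of_nat p * ieval u z"
      unfolding u by (simp add: of_nat_poly)
    then have gp: "ieval g z ^ p = of_nat p * ieval u z" using g0 by simp
    have "pderiv ?c = pderiv f * g + f * pderiv g" unfolding g pderiv_mult by (simp add: algebra_simps)
    moreover have "pderiv ?c = monom (int m) (m - 1)" by (simp add: pderiv_monom pderiv_diff)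
    ultimately have "ieval (monom (int m) (m - 1)) z = ieval (pderiv f * g + f * pderiv g) z" by simp
    then have "of_nat m * z ^ (m - 1) = ieval (pderiv f) z * ieval g z" using f(2) by simp
    then have "of_nat m * z ^ (m - 1) * z = ieval (pderiv f) z * ieval g z * z" by simp
    then have "of_nat m = ieval (pderiv f) z * ieval g z * z"
      using assms(1,2) by (simp flip: power_Suc2 add: mult.assoc)
    then have "of_nat m ^ p = (ieval (pderiv f) z * z) ^ p * (of_nat p * ieval u z)"
      unfolding gp[symmetric] by (simp add: power_mult_distrib)
    moreover define Y where "Y = (pderiv f * monom 1 1) ^ p * u"
    ultimately have "ieval (of_int (int m ^ p) - of_nat p * Y) z = 0"
      by (simp add: of_nat_poly Y_def)
    then obtain Z where Z: "of_int (int m ^ p) - of_nat p * Y = f * Z"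
      using f(4) by (metis dvdE)
    have "f * Z - of_int (int m ^ p) = of_nat p * (- Y)" unfolding Z[symmetric] by simp
    then have "int p dvd int m ^ p"
      by (intro int_poly_mult_const_mod_prime[OF assms(3) lc df, of Z]) (metis dvd_triv_left)
    then have "p dvd m ^ p" by (metis int_dvd_int_iff of_nat_power)
    then show False using assms(3,4) prime_dvd_power by blast
  qed
  moreover obtain q where "P = f * q" using f(4)[OF assms(5)] by blast
  ultimately show ?thesis by simp
qed simp

text \<open>The exponent is a product of primes not dividing m, and \<open>z ^ p\<close> is again an
  m-th root of unity, so the prime case can be iterated.\<close>

lemma int_poly_root_coprime_power:
  assumes "m > 0" "coprime j m" "z ^ m = 1" "ieval P z = 0"
  shows "ieval P (z ^ j) = 0"
  using assms(2-)
proof (induction j arbitrary: z rule: less_induct)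
  case (less j)
  show ?case
  proof (cases "j \<le> 1")
    case True
    then consider "j = 0" | "j = 1" by linarith
    then show ?thesis
    proof cases
      case 1
      then have "m = 1" using less.prems by simp
      then show ?thesis using less.prems 1 by simp
    qed (use less.prems in auto)
  next
    case False
    then obtain p where p: "prime p" "p dvd j" using prime_factor_nat[of j] by auto
    then obtain i where i: "j = p * i" by blast
    have "\<not> p dvd m" using p less.prems(1) not_coprimeI not_prime_unit by blast
    moreover have "i < j" "coprime i m"
      using i p False less.prems(1) prime_gt_1_nat[of p] by (auto intro: gr0I)
    moreover have "ieval P (z ^ p) = 0"
      using int_poly_root_prime_power[OF assms(1) less.prems(2) p(1)] less.prems calculation by blast
    moreover have "(z ^ p) ^ m = 1" using less.prems(2) by (metis mult.commute power_mult power_one)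
    ultimately show ?thesis using less.IH[of i "z ^ p"] i by (simp add: power_mult)
  qed
qed

section \<open>Exact orders and degrees of annihilating polynomials\<close>

definition exact_order :: "complex \<Rightarrow> nat \<Rightarrow> bool" where
  "exact_order z m \<longleftrightarrow> m > 0 \<and> z ^ m = 1 \<and> (\<forall>j. 0 < j \<and> j < m \<longrightarrow> z ^ j \<noteq> 1)"

lemma exact_order_pow_eq_1_iff:
  assumes "exact_order z m"
  shows "z ^ j = 1 \<longleftrightarrow> m dvd j"
proof
  assume "z ^ j = 1"
  have "z ^ j = z ^ (m * (j div m) + j mod m)" by simp
  also have "\<dots> = z ^ (j mod m)"
    unfolding power_add power_mult using assms by (simp add: exact_order_def)
  finally have "z ^ (j mod m) = 1" using \<open>z ^ j = 1\<close> by simp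
  then have "j mod m = 0" using assms by (metis exact_order_def gr0I mod_less_divisor)
  then show "m dvd j" by blast
next
  assume "m dvd j"
  then show "z ^ j = 1" using assms by (auto simp: exact_order_def power_mult elim!: dvdE)
qed

lemma exact_order_inj:
  assumes "exact_order z m"
  shows "inj_on (\<lambda>j. z ^ j) {..<m}"
proof (rule linorder_inj_onI)
  fix i j assume ij: "i < j" "i \<in> {..<m}" "j \<in> {..<m}"
  have "z \<noteq> 0" using assms by (auto simp: exact_order_def power_0_left)
  show "z ^ i \<noteq> z ^ j"
  proof
    assume "z ^ i = z ^ j"
    moreover have "z ^ j = z ^ i * z ^ (j - i)" using ij by (simp flip: power_add)
    ultimately have "z ^ (j - i) = 1" using \<open>z \<noteq> 0\<close> by simp
    then show False using assms ij by (auto simp: exact_order_def)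
  qed
qed auto

text \<open>The polynomial also vanishes at the powers \<open>z ^ j\<close> with j coprime to m,
  which are pairwise distinct.\<close>

lemma totient_le_degree:
  assumes "exact_order z m" "P \<noteq> 0" "ieval P z = 0"
  shows "totient m \<le> degree P"
proof (cases "m = 1")
  \<comment> \<open>The only totative of 1 is 1, which lies outside the range \<open>{..<1}\<close>
    of distinct powers; here it is enough that a nonzero constant has no root.\<close>
  case True
  have "degree P \<noteq> 0"
    using assms(2,3) by (metis degree_eq_zeroE ieval_0 ieval_pCons mult_zero_right add.right_neutral of_int_eq_0_iff pCons_0_0)
  then show ?thesis using True by simp
next
  case False
  then have m: "m > 1" using assms(1) by (auto simp: exact_order_def)
  let ?S = "(\<lambda>j. z ^ j) ` totatives m"
  have sub: "totatives m \<subseteq> {..<m}" using m totatives_less by auto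
  have "card ?S = totient m"
    unfolding totient_def using exact_order_inj[OF assms(1)] sub by (metis card_image inj_on_subset)
  moreover have "card ?S \<le> degree P"
  proof (rule ieval_zeros_bound[OF assms(2)])
    fix y assume "y \<in> ?S"
    then obtain j where "coprime j m" "y = z ^ j" by (auto simp: totatives_def)
    then show "ieval P y = 0"
      using int_poly_root_coprime_power[of m j z P] assms m by (auto simp: exact_order_def)
  qed simp
  ultimately show ?thesis by simp
qed

text \<open>C plays the role of the cyclotomic polynomial: a remainder modulo C vanishes at z and
  has degree below the Euler function of m, hence is 0.\<close>

lemma cyclotomic_factor:
  assumes "exact_order z m" "ieval C z = 0" "C \<noteq> 0" "degree C = totient m" "ieval P z = 0" "P \<noteq> 0"
  obtains a q where "a \<noteq> 0" "smult a P = C * q" "q \<noteq> 0" "degree P = totient m + degree q"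
proof -
  obtain a q where aq: "a \<noteq> 0" "smult a P = C * q + pseudo_mod P C"
    using pseudo_mod(1)[OF assms(3)] by blast
  have "ieval (smult a P) z = 0" using assms by simp
  then have "ieval (pseudo_mod P C) z = 0" unfolding aq(2) using assms by simp
  then have "pseudo_mod P C = 0"
    using pseudo_mod(2)[OF assms(3), of P] totient_le_degree[OF assms(1)] assms(4) by fastforce
  then have eq: "smult a P = C * q" using aq by simp
  then have "q \<noteq> 0" using assms aq by force
  moreover have "degree P = totient m + degree q"
    using arg_cong[OF eq, of degree] aq(1) assms \<open>q \<noteq> 0\<close> by (simp add: degree_mult_eq)
  ultimately show ?thesis using that aq eq by blast
qed

text \<open>Fraction-free Gaussian elimination: a vector with nonzero last coordinate clears that
  coordinate in all others.\<close>

lemma int_vectors_dependent: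
  fixes v :: "'j \<Rightarrow> nat \<Rightarrow> int"
  assumes "finite J" "card J > n"
  shows "\<exists>u. (\<exists>j\<in>J. u j \<noteq> 0) \<and> (\<forall>i<n. (\<Sum>j\<in>J. u j * v j i) = 0)"
  using assms
proof (induction n arbitrary: J v)
  case 0
  then obtain j where "j \<in> J" by fastforce
  then show ?case by (intro exI[of _ "\<lambda>_. 1"]) auto
next
  case (Suc n)
  show ?case
  proof (cases "\<forall>j\<in>J. v j n = 0")
    case True
    obtain u where "\<exists>j\<in>J. u j \<noteq> 0" "\<forall>i<n. (\<Sum>j\<in>J. u j * v j i) = 0"
      using Suc.IH[OF Suc.prems(1), of v] Suc.prems by auto
    then show ?thesis using True by (intro exI[of _ u]) (auto simp: less_Suc_eq)
  next
    case False
    then obtain j0 where j0: "j0 \<in> J" "v j0 n \<noteq> 0" by blast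
    define v' where "v' = (\<lambda>j i. v j0 n * v j i - v j n * v j0 i)"
    have fin: "finite (J - {j0})" "card (J - {j0}) > n" using Suc.prems j0 by auto
    obtain u where u: "\<exists>j\<in>J-{j0}. u j \<noteq> 0" "\<forall>i<n. (\<Sum>j\<in>J-{j0}. u j * v' j i) = 0"
      using Suc.IH[OF fin, of v'] by blast
    define w where "w = (\<lambda>j. if j = j0 then - (\<Sum>j\<in>J-{j0}. u j * v j n) else v j0 n * u j)"
    have "\<exists>j\<in>J. w j \<noteq> 0" using u(1) j0 by (auto simp: w_def)
    moreover have "(\<Sum>j\<in>J. w j * v j i) = (\<Sum>j\<in>J-{j0}. u j * v' j i)" for i
    proof -
      have "(\<Sum>j\<in>J. w j * v j i) = w j0 * v j0 i + (\<Sum>j\<in>J-{j0}. w j * v j i)"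
        using Suc.prems(1) j0 by (simp add: sum.remove)
      also have "(\<Sum>j\<in>J-{j0}. w j * v j i) = (\<Sum>j\<in>J-{j0}. v j0 n * u j * v j i)"
        by (rule sum.cong) (auto simp: w_def)
      finally show ?thesis
        by (simp add: w_def v'_def sum_subtractf sum_distrib_left sum_distrib_right algebra_simps)
    qed
    moreover have "(\<Sum>j\<in>J-{j0}. u j * v' j n) = 0" by (simp add: v'_def)
    ultimately show ?thesis using u(2) by (intro exI[of _ w]) (auto simp: less_Suc_eq)
  qed
qed

text \<open>The Euler function of a divisor of m is at most 8 as well. This excludes the divisors
  32, 27, 25 and 49, with values 16, 18, 20 and 42, and all primes from 11 on.\<close>

lemma totient_le_8_cases:
  assumes "m > 0" "totient m \<le> 8"
  obtains a b c d :: nat where "m = 2 ^ a * (3 ^ b * (5 ^ c * 7 ^ d))" "a < 5" "b < 3" "c < 2" "d < 2"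
proof -
  have bound: "totient k \<le> 8" if "k dvd m" for k
    using totient_dvd[OF that] assms dvd_imp_le[of "totient k" "totient m"] by fastforce
  have m0: "m \<noteq> 0" using assms by simp
  obtain m1 where m1: "m = 2 ^ multiplicity 2 m * m1" "\<not> 2 dvd m1"
    using multiplicity_decompose'[of m 2] m0 by auto
  have "m1 \<noteq> 0" using m1 by (metis dvd_0_right)
  then obtain m2 where m2: "m1 = 3 ^ multiplicity 3 m1 * m2" "\<not> 3 dvd m2"
    using multiplicity_decompose'[of m1 3] by auto
  have "m2 \<noteq> 0" using m2 by (metis dvd_0_right)
  then obtain m3 where m3: "m2 = 5 ^ multiplicity 5 m2 * m3" "\<not> 5 dvd m3"
    using multiplicity_decompose'[of m2 5] by auto
  have "m3 \<noteq> 0" using m3 by (metis dvd_0_right)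
  then obtain m4 where m4: "m3 = 7 ^ multiplicity 7 m3 * m4" "\<not> 7 dvd m4"
    using multiplicity_decompose'[of m3 7] by auto
  let ?a = "multiplicity 2 m" and ?b = "multiplicity 3 m1"
    and ?c = "multiplicity 5 m2" and ?d = "multiplicity 7 m3"
  have d1: "m1 dvd m" by (subst m1(1)) simp
  have d2: "m2 dvd m" using d1 by (subst (asm) m2(1)) (meson dvd_mult_right)
  have d3: "m3 dvd m" using d2 by (subst (asm) m3(1)) (meson dvd_mult_right)
  have d4: "m4 dvd m" using d3 by (subst (asm) m4(1)) (meson dvd_mult_right)
  have pow: "q ^ k dvd m" if "q ^ e dvd m" "k \<le> e" for q k e :: nat
    using that by (meson dvd_trans le_imp_power_dvd)
  have a: "?a < 5"
  proof (rule ccontr)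
    assume "\<not> ?a < 5"
    then have "2 ^ 5 dvd m" using pow[of 2 ?a 5] multiplicity_dvd[of 2 m] by simp
    then show False using bound[of "2 ^ 5"] totient_prime_power[of 2 5] by simp
  qed
  have b: "?b < 3"
  proof (rule ccontr)
    assume "\<not> ?b < 3"
    then have "3 ^ 3 dvd m" using pow[of 3 ?b 3] dvd_trans[OF multiplicity_dvd[of 3 m1] d1] by simp
    then show False using bound[of "3 ^ 3"] totient_prime_power[of 3 3] by simp
  qed
  have c: "?c < 2"
  proof (rule ccontr)
    assume "\<not> ?c < 2"
    then have "5 ^ 2 dvd m" using pow[of 5 ?c 2] dvd_trans[OF multiplicity_dvd[of 5 m2] d2] by simp
    then show False using bound[of "5 ^ 2"] totient_prime_power[of 5 2] by simp
  qed
  have d: "?d < 2"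
  proof (rule ccontr)
    assume "\<not> ?d < 2"
    then have "7 ^ 2 dvd m" using pow[of 7 ?d 2] dvd_trans[OF multiplicity_dvd[of 7 m3] d3] by simp
    then show False using bound[of "7 ^ 2"] totient_prime_power[of 7 2] by simp
  qed
  have "m4 = 1"
  proof (rule ccontr)
    assume "m4 \<noteq> 1"
    then obtain q where q: "prime q" "q dvd m4" using prime_factor_nat by blast
    have "q dvd m3" "q dvd m2" "q dvd m1"
      using q m4(1) m3(1) m2(1) by (metis dvd_mult)+
    then have "q \<noteq> 2" "q \<noteq> 3" "q \<noteq> 5" "q \<noteq> 7" using q m1 m2 m3 m4 by auto
    moreover have "totient q \<le> 8" using bound q(2) d4 dvd_trans by blast
    then have "q \<le> 9" using totient_prime[OF q(1)] by simp
    moreover have "\<not> prime (4::nat)" "\<not> prime (6::nat)" "\<not> prime (8::nat)" "\<not> prime (9::nat)"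
      by simp_all
    then have "q \<noteq> 4" "q \<noteq> 6" "q \<noteq> 8" "q \<noteq> 9" using q(1) by auto
    moreover have "q > 1" using q(1) prime_gt_1_nat by blast
    ultimately show False by presburger
  qed
  then have "m3 = 7 ^ ?d" using m4(1) by simp
  then have "m2 = 5 ^ ?c * 7 ^ ?d" using m3(1) by argo
  then have "m1 = 3 ^ ?b * (5 ^ ?c * 7 ^ ?d)" using m2(1) by argo
  then have "m = 2 ^ ?a * (3 ^ ?b * (5 ^ ?c * 7 ^ ?d))" using m1(1) by argo
  then show ?thesis using that a b c d by blast
qed

text \<open>One clause for each lattice rank: 8 for E8 and H4, 7 for E7, 6 for E6, 4 for F4. In rank
  6 the orders 14 and 18 survive besides 12 and have to be excluded in another way.\<close>

lemma totient_le_8_bound: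
  assumes "m > 0" "totient m \<le> 8"
  shows "m \<le> 30 \<and> (totient m \<le> 7 \<longrightarrow> m \<le> 18) \<and>
    (totient m \<le> 6 \<longrightarrow> 12 \<le> m \<longrightarrow> m \<in> {12, 14, 18}) \<and> (totient m \<le> 4 \<longrightarrow> m \<le> 12)"
proof -
  obtain a b c d where m: "m = 2 ^ a * (3 ^ b * (5 ^ c * 7 ^ d))" "a < 5" "b < 3" "c < 2" "d < 2"
    using totient_le_8_cases[OF assms] by blast
  have tp: "totient (q ^ e) = (if e = 0 then 1 else q ^ (e - 1) * (q - 1))" if "prime q" for q e :: nat
    using totient_prime_power[OF that, of e] by auto
  have "totient m = totient (2 ^ a) * (totient (3 ^ b) * (totient (5 ^ c) * totient (7 ^ d)))"
  proof -
    have cop: "coprime (2::nat) 3" "coprime (2::nat) 5" "coprime (2::nat) 7" "coprime (3::nat) 5"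
      "coprime (3::nat) 7" "coprime (5::nat) 7"
      by (auto intro!: primes_coprime)
    have 1: "coprime ((2::nat) ^ a) (3 ^ b * (5 ^ c * 7 ^ d))"
      using cop by (intro coprime_mult_right_iff[THEN iffD2] conjI coprime_power_left_iff[THEN iffD2]
        coprime_power_right_iff[THEN iffD2] disjI1)
    have 2: "coprime ((3::nat) ^ b) (5 ^ c * 7 ^ d)"
      using cop by (intro coprime_mult_right_iff[THEN iffD2] conjI coprime_power_left_iff[THEN iffD2]
        coprime_power_right_iff[THEN iffD2] disjI1)
    have 3: "coprime ((5::nat) ^ c) (7 ^ d)"
      using cop by (intro coprime_power_left_iff[THEN iffD2] coprime_power_right_iff[THEN iffD2] disjI1)
    show ?thesis
      unfolding m(1) totient_mult_coprime[OF 1] totient_mult_coprime[OF 2] totient_mult_coprime[OF 3] ..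
  qed
  also have "\<dots> = (if a = 0 then 1 else 2 ^ (a - 1)) * ((if b = 0 then 1 else 3 ^ (b - 1) * 2) *
      ((if c = 0 then 1 else 5 ^ (c - 1) * 4) * (if d = 0 then 1 else 7 ^ (d - 1) * 6)))"
    by (simp add: tp)
  finally have t: "totient m = \<dots>" .
  have "a \<in> {0,1,2,3,4}" "b \<in> {0,1,2}" "c \<in> {0,1}" "d \<in> {0,1}" using m(2-) by auto
  then show ?thesis using assms(2) unfolding t unfolding m(1)
    by (elim insertE emptyE) simp_all
qed

section \<open>Finite reflection groups\<close>

lemma reflection_matrix_apply:
  "reflection_matrix a *v x = x - (2 * (a \<bullet> x) / (a \<bullet> a)) *\<^sub>R a"
proof -
  have "linear (\<lambda>x. x - (2 * (a \<bullet> x) / (a \<bullet> a)) *\<^sub>R a)"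
    by (rule linearI) (auto simp: algebra_simps inner_add_right add_divide_distrib)
  then show ?thesis by (simp add: reflection_matrix_def matrix_works)
qed

lemma reflection_unit_apply:
  "a \<bullet> a = 1 \<Longrightarrow> reflection_matrix a *v x = x - (2 * (a \<bullet> x)) *\<^sub>R a"
  by (simp add: reflection_matrix_apply)

lemma reflection_unit_involution:
  assumes "a \<bullet> a = 1"
  shows "reflection_matrix a ** reflection_matrix a = mat 1"
proof -
  have "reflection_matrix a *v (reflection_matrix a *v x) = x" for x
    using assms by (simp add: reflection_unit_apply inner_diff_right scaleR_diff_left flip: scaleR_left.add)
  then show ?thesis by (simp add: matrix_eq flip: matrix_vector_mul_assoc)
qed

lemma reflection_unit_inner:
  assumes "a \<bullet> a = 1"
  shows "(reflection_matrix a *v x) \<bullet> (reflection_matrix a *v y) = x \<bullet> y"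
  using assms by (simp add: reflection_unit_apply algebra_simps inner_diff_right inner_diff_left inner_commute)

lemma reflection_unit_fixed_iff:
  assumes "a \<bullet> a = 1"
  shows "reflection_matrix a *v x = x \<longleftrightarrow> a \<bullet> x = 0"
  using assms by (auto simp: reflection_unit_apply)

lemma matrix_vector_mult_uminus: "A *v (- x) = - (A *v (x :: real^'n))"
  using matrix_vector_mult_scaleR[of A "-1" x] by simp

text \<open>A real vector space is not a finite union of proper subspaces: each hyperplane excludes
  at most one multiple of y to be added to x.\<close>

lemma subspace_avoid_hyperplanes:
  fixes U :: "'v::euclidean_space set"
  assumes "subspace U" "finite B" "\<And>b. b \<in> B \<Longrightarrow> \<exists>x\<in>U. b \<bullet> x \<noteq> 0"
  shows "\<exists>x\<in>U. \<forall>b\<in>B. b \<bullet> x \<noteq> 0"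
  using assms(2,3)
proof (induction B rule: finite_induct)
  case empty
  then show ?case using subspace_0[OF assms(1)] by auto
next
  case (insert b B)
  obtain x where x: "x \<in> U" "\<forall>b\<in>B. b \<bullet> x \<noteq> 0" using insert by auto
  obtain y where y: "y \<in> U" "b \<bullet> y \<noteq> 0" using insert.prems by auto
  define bad where "bad = (\<lambda>d. - (d \<bullet> x) / (d \<bullet> y)) ` insert b B"
  have "finite bad" using insert by (simp add: bad_def)
  then have "infinite (UNIV - insert 0 bad :: real set)"
    using infinite_UNIV_char_0[where 'a = real] by (simp add: Diff_infinite_finite)
  then obtain t where t: "t \<notin> insert 0 bad" by (metis Diff_iff finite.emptyI ex_in_conv)
  have "d \<bullet> (x + t *\<^sub>R y) \<noteq> 0" if "d \<in> insert b B" for d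
  proof
    assume eq: "d \<bullet> (x + t *\<^sub>R y) = 0"
    show False
    proof (cases "d \<bullet> y = 0")
      case True
      then have "d \<bullet> x = 0" using eq by (simp add: inner_add_right)
      then show False using x(2) y(2) that True by auto
    next
      case False
      then have "t = - (d \<bullet> x) / (d \<bullet> y)" using eq by (simp add: inner_add_right field_simps)
      then show False using t that by (auto simp: bad_def)
    qed
  qed
  moreover have "x + t *\<^sub>R y \<in> U" using x y assms(1) by (simp add: subspace_add subspace_mul)
  ultimately show ?case by blast
qed

definition fixsp :: "real^'n^'n \<Rightarrow> (real^'n) set" where
  "fixsp A = {x. A *v x = x}"

lemma subspace_fixsp [simp]: "subspace (fixsp A)"
  by (auto simp: fixsp_def subspace_def matrix_vector_right_distrib scaleR_matrix_vector_assoc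
      simp flip: matrix_vector_mul_assoc) (metis matrix_vector_mult_scaleR)

text \<open>Independence is assumed here, so that the general theory comes first;
  \<open>simple_roots_indep\<close> derives it from \<open>sr\<close> for each type.\<close>

locale coxeter_rep =
  fixes D :: coxeter_type and \<alpha> :: "nat \<Rightarrow> real^'n"
  assumes sr: "simple_roots D \<alpha>"
    and indep: "(\<Sum>i<coxeter_rank D. x i *\<^sub>R \<alpha> i) = 0 \<Longrightarrow> i < coxeter_rank D \<Longrightarrow> x i = 0"
begin

abbreviation n where "n \<equiv> coxeter_rank D"
abbreviation G where "G \<equiv> coxeter_group D \<alpha>"
abbreviation W where "W \<equiv> carrier G"
abbreviation T where "T \<equiv> reflections G (simple_reflections D \<alpha>)"
abbreviation s where "s i \<equiv> reflection_matrix (\<alpha> i)"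

section \<open>Words, roots and coordinates\<close>

definition wprod :: "nat list \<Rightarrow> real^'n^'n" where
  "wprod ws = foldr (\<lambda>i A. s i ** A) ws (mat 1)"

definition roots :: "(real^'n) set" where
  "roots = {A *v \<alpha> i | A i. A \<in> W \<and> i < n}"

lemma card_n: "CARD('n) = n"
  using sr by (simp add: simple_roots_def)

lemma unit [simp]: "i < n \<Longrightarrow> \<alpha> i \<bullet> \<alpha> i = 1"
  using sr by (simp add: simple_roots_def coxeter_matrix_def)

lemma s_apply: "i < n \<Longrightarrow> s i *v x = x - (2 * (\<alpha> i \<bullet> x)) *\<^sub>R \<alpha> i"
  by (simp add: reflection_unit_apply)

lemma s_s [simp]: "i < n \<Longrightarrow> s i ** s i = mat 1"
  by (simp add: reflection_unit_involution)

lemma s_s_apply [simp]: "i < n \<Longrightarrow> s i *v (s i *v x) = x"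
  by (simp add: matrix_vector_mul_assoc)

lemma wprod_Nil [simp]: "wprod [] = mat 1"
  and wprod_Cons [simp]: "wprod (i # ws) = s i ** wprod ws"
  by (simp_all add: wprod_def)

lemma wprod_append: "wprod (us @ vs) = wprod us ** wprod vs"
  by (induction us) (auto simp: matrix_mul_assoc)

lemma group_GL: "group (GL :: (real^'n^'n) monoid)"
proof (rule groupI)
  fix x :: "real^'n^'n" assume "x \<in> carrier GL"
  then obtain y where "y ** x = mat 1" "x ** y = mat 1" by (auto simp: GL_def invertible_def)
  then have "y \<in> carrier GL" "y \<otimes>\<^bsub>GL\<^esub> x = \<one>\<^bsub>GL\<^esub>" by (auto simp: GL_def invertible_def)
  then show "\<exists>y\<in>carrier GL. y \<otimes>\<^bsub>GL\<^esub> x = \<one>\<^bsub>GL\<^esub>" by blast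
next
  show "\<one>\<^bsub>GL\<^esub> \<in> carrier (GL :: (real^'n^'n) monoid)" by (auto simp: GL_def invertible_def)
qed (auto simp: GL_def invertible_mult matrix_mul_assoc)

lemma sref_GL: "simple_reflections D \<alpha> \<subseteq> carrier GL"
  by (auto simp: simple_reflections_def GL_def invertible_def) (use s_s in blast)

lemma subgroup_W: "subgroup W GL"
  using group.generate_is_subgroup[OF group_GL sref_GL] by (simp add: coxeter_group_def)

lemma G_simps [simp]: "(\<otimes>\<^bsub>G\<^esub>) = (**)" "\<one>\<^bsub>G\<^esub> = mat 1"
  by (simp_all add: coxeter_group_def GL_def)

lemma group_G: "group G"
  using subgroup.subgroup_is_group[OF subgroup_W group_GL] by (simp add: coxeter_group_def)

lemma s_in_W [simp]: "i < n \<Longrightarrow> s i \<in> W"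
  by (auto simp: coxeter_group_def simple_reflections_def intro!: generate.incl)

lemma mult_in_W [simp]: "A \<in> W \<Longrightarrow> B \<in> W \<Longrightarrow> A ** B \<in> W"
  using monoid.m_closed[OF group.is_monoid[OF group_G]] by simp

lemma one_in_W [simp]: "mat 1 \<in> W"
  using monoid.one_closed[OF group.is_monoid[OF group_G]] by simp

lemma wprod_in_W [simp]: "set ws \<subseteq> {..<n} \<Longrightarrow> wprod ws \<in> W"
  by (induction ws) auto

lemma W_word: "A \<in> W \<Longrightarrow> \<exists>ws. set ws \<subseteq> {..<n} \<and> A = wprod ws"
proof -
  assume "A \<in> W"
  then have "A \<in> generate GL (simple_reflections D \<alpha>)" by (simp add: coxeter_group_def)
  then show ?thesis
  proof (induction rule: generate.induct)
    case one
    then show ?case by (intro exI[of _ "[]"]) (auto simp: GL_def)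
  next
    case (incl h)
    then obtain i where "i < n" "h = s i" by (auto simp: simple_reflections_def)
    then show ?case by (intro exI[of _ "[i]"]) auto
  next
    case (inv h)
    then obtain i where i: "i < n" "h = s i" by (auto simp: simple_reflections_def)
    have "inv\<^bsub>GL\<^esub> h = h"
      by (rule group.inv_equality[OF group_GL]) (use i sref_GL inv in \<open>auto simp: GL_def\<close>)
    then show ?case using i by (intro exI[of _ "[i]"]) auto
  next
    case (eng h1 h2)
    then obtain us vs where "set us \<subseteq> {..<n}" "h1 = wprod us" "set vs \<subseteq> {..<n}" "h2 = wprod vs" by blast
    then show ?case by (intro exI[of _ "us @ vs"]) (auto simp: wprod_append GL_def)
  qed
qed

lemma W_inner: "A \<in> W \<Longrightarrow> (A *v x) \<bullet> (A *v y) = x \<bullet> y"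
proof -
  assume "A \<in> W"
  then obtain ws where ws: "set ws \<subseteq> {..<n}" "A = wprod ws" using W_word by blast
  have "(wprod ws *v x) \<bullet> (wprod ws *v y) = x \<bullet> y" using ws(1)
    by (induction ws arbitrary: x y) (auto simp: reflection_unit_inner simp flip: matrix_vector_mul_assoc)
  then show ?thesis using ws by simp
qed

lemma inv_in_W [simp]: "A \<in> W \<Longrightarrow> inv\<^bsub>G\<^esub> A \<in> W"
  using group.inv_closed[OF group_G] .

lemma inv_mult [simp]: "A \<in> W \<Longrightarrow> inv\<^bsub>G\<^esub> A ** A = mat 1" "A \<in> W \<Longrightarrow> A ** inv\<^bsub>G\<^esub> A = mat 1"
  using group.l_inv[OF group_G] group.r_inv[OF group_G] by simp_all

lemma inv_apply [simp]: "A \<in> W \<Longrightarrow> inv\<^bsub>G\<^esub> A *v (A *v x) = x" "A \<in> W \<Longrightarrow> A *v (inv\<^bsub>G\<^esub> A *v x) = x"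
  by (simp_all add: matrix_vector_mul_assoc)

lemma inv_eqI: "A \<in> W \<Longrightarrow> B \<in> W \<Longrightarrow> B ** A = mat 1 \<Longrightarrow> inv\<^bsub>G\<^esub> A = B"
  using group.inv_equality[OF group_G] by simp

lemma W_inner_inv: "A \<in> W \<Longrightarrow> (A *v x) \<bullet> y = x \<bullet> (inv\<^bsub>G\<^esub> A *v y)"
  using W_inner[of A x "inv\<^bsub>G\<^esub> A *v y"] by simp

lemma W_inj: "A \<in> W \<Longrightarrow> A *v x = A *v y \<longleftrightarrow> x = y"
  by (metis inv_apply(1))

lemma root_unit [simp]: "b \<in> roots \<Longrightarrow> b \<bullet> b = 1"
  by (auto simp: roots_def W_inner)

lemma root_nz: "b \<in> roots \<Longrightarrow> b \<noteq> 0"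
  by (metis inner_zero_left root_unit zero_neq_one)

lemma W_root [simp]: "A \<in> W \<Longrightarrow> b \<in> roots \<Longrightarrow> A *v b \<in> roots"
  by (auto simp: roots_def matrix_vector_mul_assoc) (metis mult_in_W)

lemma simple_root [simp]: "i < n \<Longrightarrow> \<alpha> i \<in> roots"
  unfolding roots_def by (smt (verit) mem_Collect_eq matrix_vector_mul_lid one_in_W)

lemma root_uminus [simp]: "b \<in> roots \<Longrightarrow> - b \<in> roots"
proof -
  assume "b \<in> roots"
  then obtain A i where Ai: "A \<in> W" "i < n" "b = A *v \<alpha> i" by (auto simp: roots_def)
  have "- \<alpha> i = s i *v \<alpha> i" using Ai by (simp add: s_apply scaleR_2)
  then have "- b = A *v (s i *v \<alpha> i)" using Ai by (metis matrix_vector_mult_uminus)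
  then show ?thesis using Ai by simp
qed

lemma refl_conj:
  assumes "A \<in> W" "b \<bullet> b = 1"
  shows "A ** reflection_matrix b ** inv\<^bsub>G\<^esub> A = reflection_matrix (A *v b)"
proof -
  have "A *v (reflection_matrix b *v (inv\<^bsub>G\<^esub> A *v x)) = reflection_matrix (A *v b) *v x" for x
  proof -
    have "b \<bullet> (inv\<^bsub>G\<^esub> A *v x) = (A *v b) \<bullet> x" using W_inner_inv assms by simp
    moreover have "(A *v b) \<bullet> (A *v b) = 1" using assms W_inner by simp
    ultimately show ?thesis using assms
      by (simp add: reflection_unit_apply matrix_vector_mult_diff_distrib matrix_vector_mult_scaleR)
  qed
  then show ?thesis by (simp add: matrix_eq flip: matrix_vector_mul_assoc)
qed

lemma refl_root_in_W [simp]: "b \<in> roots \<Longrightarrow> reflection_matrix b \<in> W"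
proof -
  assume "b \<in> roots"
  then obtain A i where Ai: "A \<in> W" "i < n" "b = A *v \<alpha> i" by (auto simp: roots_def)
  then have "reflection_matrix b = A ** s i ** inv\<^bsub>G\<^esub> A" by (simp add: refl_conj)
  then show ?thesis using Ai by simp
qed

lemma T_iff: "t \<in> T \<longleftrightarrow> (\<exists>b\<in>roots. t = reflection_matrix b)"
proof
  assume "t \<in> T"
  then obtain A i where "A \<in> W" "i < n" "t = A ** s i ** inv\<^bsub>G\<^esub> A"
    by (auto simp: reflections_def simple_reflections_def)
  then show "\<exists>b\<in>roots. t = reflection_matrix b"
    by (intro bexI[of _ "A *v \<alpha> i"]) (simp_all add: refl_conj)
next
  assume "\<exists>b\<in>roots. t = reflection_matrix b"
  then obtain A i where Ai: "A \<in> W" "i < n" "t = reflection_matrix (A *v \<alpha> i)" by (auto simp: roots_def)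
  then have "t = A ** s i ** inv\<^bsub>G\<^esub> A" by (simp add: refl_conj)
  then show "t \<in> T" using Ai by (auto simp: reflections_def simple_reflections_def)
qed

lemma simple_span: "span (\<alpha> ` {..<n}) = UNIV"
proof -
  have inj: "inj_on \<alpha> {..<n}"
  proof (rule inj_onI)
    fix i j assume ij: "i \<in> {..<n}" "j \<in> {..<n}" "\<alpha> i = \<alpha> j"
    show "i = j"
    proof (rule ccontr)
      assume "i \<noteq> j"
      have "(\<Sum>k<n. (if k = i then 1 else if k = j then -1 else 0) *\<^sub>R \<alpha> k) =
        (\<Sum>k\<in>{i,j}. (if k = i then 1 else if k = j then -1 else 0) *\<^sub>R \<alpha> k)"
        by (rule sum.mono_neutral_right) (use ij in auto)
      also have "\<dots> = 0" using \<open>i \<noteq> j\<close> ij by simp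
      finally have "(if i = i then 1 else if i = j then -1 else 0 :: real) = 0"
        using indep[of "\<lambda>k. if k = i then 1 else if k = j then -1 else 0" i] ij by auto
      then show False by simp
    qed
  qed
  have "independent (\<alpha> ` {..<n})"
  proof (rule independent_if_scalars_zero)
    fix f x assume f: "(\<Sum>x\<in>\<alpha> ` {..<n}. f x *\<^sub>R x) = 0" "x \<in> \<alpha> ` {..<n}"
    have "(\<Sum>i<n. f (\<alpha> i) *\<^sub>R \<alpha> i) = 0" using f(1) inj by (simp add: sum.reindex)
    then show "f x = 0" using indep f(2) by auto
  qed simp
  moreover have "card (\<alpha> ` {..<n}) = DIM(real^'n)" using inj by (simp add: card_image card_n)
  ultimately show ?thesis
    by (metis card_eq_dim dim_UNIV independent_bound subset_UNIV span_UNIV top.extremum_uniqueI dim_eq_card_independent span_eq_dim dim_eq_full)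
qed

definition cf :: "real^'n \<Rightarrow> nat \<Rightarrow> real" where
  "cf v = (SOME x. v = (\<Sum>i<n. x i *\<^sub>R \<alpha> i))"

lemma cf_expand: "v = (\<Sum>i<n. cf v i *\<^sub>R \<alpha> i)"
proof -
  have "\<exists>x. v = (\<Sum>i<n. x i *\<^sub>R \<alpha> i)"
  proof (rule span_induct_alt[of v "\<alpha> ` {..<n}" "\<lambda>v. \<exists>x. v = (\<Sum>i<n. x i *\<^sub>R \<alpha> i)"])
    show "v \<in> span (\<alpha> ` {..<n})" by (simp add: simple_span)
    show "\<exists>x. 0 = (\<Sum>i<n. x i *\<^sub>R \<alpha> i)" by (intro exI[of _ "\<lambda>_. 0"]) simp
  next
    fix c x y assume "x \<in> \<alpha> ` {..<n}" "\<exists>z. y = (\<Sum>i<n. z i *\<^sub>R \<alpha> i)"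
    then obtain j z where jz: "j < n" "x = \<alpha> j" "y = (\<Sum>i<n. z i *\<^sub>R \<alpha> i)" by auto
    have "c *\<^sub>R x = (\<Sum>i<n. (if i = j then c else 0) *\<^sub>R \<alpha> i)"
      using jz by (simp add: if_distrib[of "\<lambda>r. r *\<^sub>R _"] sum.delta cong: if_cong)
    then have "c *\<^sub>R x + y = (\<Sum>i<n. ((if i = j then c else 0) + z i) *\<^sub>R \<alpha> i)"
      using jz by (simp add: scaleR_add_left sum.distrib)
    then show "\<exists>x'. c *\<^sub>R x + y = (\<Sum>i<n. x' i *\<^sub>R \<alpha> i)"
      by (intro exI[of _ "\<lambda>i. (if i = j then c else 0) + z i"])
  qed
  then show ?thesis unfolding cf_def by (rule someI_ex)
qed

lemma cf_unique:
  assumes "v = (\<Sum>i<n. x i *\<^sub>R \<alpha> i)" "i < n"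
  shows "cf v i = x i"
proof -
  have "(\<Sum>i<n. (cf v i - x i) *\<^sub>R \<alpha> i) = 0"
    using assms(1) cf_expand[of v] by (simp add: scaleR_diff_left sum_subtractf)
  then show ?thesis using indep[of "\<lambda>i. cf v i - x i" i] assms(2) by simp
qed

lemma cf_lincomb: "i < n \<Longrightarrow> cf (u + r *\<^sub>R v) i = cf u i + r * cf v i"
proof (rule cf_unique)
  have "u + r *\<^sub>R v = (\<Sum>i<n. cf u i *\<^sub>R \<alpha> i) + r *\<^sub>R (\<Sum>i<n. cf v i *\<^sub>R \<alpha> i)"
    using cf_expand by metis
  then show "u + r *\<^sub>R v = (\<Sum>i<n. (cf u i + r * cf v i) *\<^sub>R \<alpha> i)"
    by (simp add: scaleR_add_left sum.distrib scaleR_sum_right)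
qed

lemma cf_simple: "i < n \<Longrightarrow> j < n \<Longrightarrow> cf (\<alpha> i) j = (if j = i then 1 else 0)"
  by (rule cf_unique) (simp_all add: if_distrib[of "\<lambda>r. r *\<^sub>R _"] sum.delta cong: if_cong)

lemma cf_uminus: "i < n \<Longrightarrow> cf (- v) i = - cf v i"
  using cf_lincomb[of i v "-2" v] cf_lincomb[of i v "-1" v] by (simp add: scaleR_2)

lemma orthogonal_all_roots:
  assumes "\<And>b. b \<in> roots \<Longrightarrow> b \<bullet> x = 0"
  shows "x = 0"
proof -
  have "x \<bullet> \<alpha> i = 0" if "i < n" for i using that assms[of "\<alpha> i"] by (simp add: inner_commute)
  moreover have "x \<bullet> x = (\<Sum>i<n. cf x i * (x \<bullet> \<alpha> i))"
    using arg_cong[OF cf_expand[of x], of "\<lambda>y. x \<bullet> y"] by (simp add: inner_sum_right)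
  ultimately have "x \<bullet> x = 0" by simp
  then show "x = 0" by simp
qed

end

text \<open>Both assumptions are verified on explicit lists of positive roots in
  \<open>finite_coxeter_repI\<close>; the classical theory of finite reflection groups is built on
  them.\<close>

locale finite_coxeter_rep = coxeter_rep D \<alpha> for D and \<alpha> :: "nat \<Rightarrow> real^'n" +
  assumes fin_roots: "finite roots"
    and dichotomy: "b \<in> roots \<Longrightarrow> (\<forall>i<n. cf b i \<ge> 0) \<or> (\<forall>i<n. cf b i \<le> 0)"
begin

section \<open>Positive roots and stabilizers of regular points\<close>

definition pos :: "real^'n \<Rightarrow> bool" where
  "pos b \<longleftrightarrow> b \<in> roots \<and> (\<forall>i<n. cf b i \<ge> 0)"

lemma pos_root: "pos b \<Longrightarrow> b \<in> roots"
  by (simp add: pos_def)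

lemma pos_or_neg: "b \<in> roots \<Longrightarrow> pos b \<or> pos (- b)"
  using dichotomy[of b] by (auto simp: pos_def cf_uminus)

lemma not_pos_both: "pos b \<Longrightarrow> \<not> pos (- b)"
proof
  assume "pos b" "pos (- b)"
  then have "cf b i = 0" if "i < n" for i using that by (force simp: pos_def cf_uminus)
  then have "b = 0" using cf_expand[of b] by simp
  then show False using root_nz[of b] \<open>pos b\<close> by (simp add: pos_def)
qed

lemma pos_simple: "i < n \<Longrightarrow> pos (\<alpha> i)"
  by (simp add: pos_def cf_simple)

text \<open>The reflection changes only the i-th coefficient. A positive root other than
  \<open>\<alpha> i\<close> has another positive coefficient, which survives, and the dichotomy
  fixes the signs of the rest.\<close>

lemma simple_reflection_pos:
  assumes "i < n" "pos b" "b \<noteq> \<alpha> i"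
  shows "pos (s i *v b)"
proof -
  have "\<exists>j<n. j \<noteq> i \<and> cf b j > 0"
  proof (rule ccontr)
    assume "\<not> ?thesis"
    then have z: "cf b j = 0" if "j < n" "j \<noteq> i" for j using that assms(2) by (force simp: pos_def)
    have "b = (\<Sum>j<n. cf b j *\<^sub>R \<alpha> j)" by (rule cf_expand)
    also have "\<dots> = (\<Sum>j\<in>{i}. cf b j *\<^sub>R \<alpha> j)"
      by (rule sum.mono_neutral_right) (use z assms in auto)
    finally have b: "b = cf b i *\<^sub>R \<alpha> i" by simp
    have "b \<bullet> b = cf b i * cf b i" by (subst (1 2) b) (use assms in simp)
    then have "cf b i * cf b i = 1" using assms(2) by (simp add: pos_def)
    then have "cf b i = 1" using assms(1,2) by (auto simp: pos_def square_eq_1_iff)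
    then show False using b assms(3) by simp
  qed
  then obtain j where j: "j < n" "j \<noteq> i" "cf b j > 0" by blast
  have "s i *v b = b + (- 2 * (\<alpha> i \<bullet> b)) *\<^sub>R \<alpha> i" using assms(1) by (simp add: s_apply)
  then have "cf (s i *v b) j > 0"
    using j assms(1) by (simp only: cf_lincomb cf_simple) simp
  moreover have "s i *v b \<in> roots" using assms pos_root by simp
  ultimately show ?thesis using dichotomy[of "s i *v b"] j(1) by (force simp: pos_def)
qed

text \<open>The exchange condition: at some letter j of the word the positive root obtained so far
  from \<open>\<alpha> i\<close> turns negative. It must then equal \<open>\<alpha> j\<close>, and
  this letter cancels against \<open>s i\<close>.\<close>

lemma exchange:
  assumes "set ws \<subseteq> {..<n}" "i < n" "\<not> pos (wprod ws *v \<alpha> i)"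
  shows "\<exists>vs. set vs \<subseteq> {..<n} \<and> length vs < length ws \<and> wprod ws ** s i = wprod vs"
  using assms
proof (induction ws)
  case Nil
  then show ?case using pos_simple by simp
next
  case (Cons j us)
  show ?case
  proof (cases "pos (wprod us *v \<alpha> i)")
    case False
    then obtain vs where "set vs \<subseteq> {..<n}" "length vs < length us" "wprod us ** s i = wprod vs"
      using Cons by auto
    then show ?thesis using Cons.prems
      by (intro exI[of _ "j # vs"]) (auto simp flip: matrix_mul_assoc)
  next
    case True
    let ?A = "wprod us"
    have A: "?A \<in> W" using Cons.prems by simp
    have "wprod us *v \<alpha> i = \<alpha> j"
      using simple_reflection_pos[OF _ True, of j] Cons.prems by (auto simp flip: matrix_vector_mul_assoc)
    then have "?A ** s i ** inv\<^bsub>G\<^esub> ?A = s j" using refl_conj[OF A, of "\<alpha> i"] Cons.prems by simp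
    then have "s j ** ?A = ?A ** s i"
      using A by (metis inv_mult(1) matrix_mul_assoc matrix_mul_rid)
    then have "wprod (j # us) ** s i = ?A" using Cons.prems
      by (metis matrix_mul_assoc matrix_mul_rid s_s wprod_Cons)
    then show ?thesis using Cons.prems by (intro exI[of _ us]) auto
  qed
qed

text \<open>A shortest word for A cannot end in a letter i: the rest of the word would send
  \<open>\<alpha> i\<close> to a negative root, and the exchange condition would give a shorter
  word.\<close>

lemma positive_preserving_trivial:
  assumes "A \<in> W" "\<And>i. i < n \<Longrightarrow> pos (A *v \<alpha> i)"
  shows "A = mat 1"
proof -
  define L where "L = (\<lambda>k. \<exists>ws. set ws \<subseteq> {..<n} \<and> A = wprod ws \<and> length ws = k)"
  have "\<exists>k. L k" using W_word[OF assms(1)] by (auto simp: L_def)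
  then obtain k where k: "L k" "\<And>j. j < k \<Longrightarrow> \<not> L j" by (metis LeastI_ex not_less_Least)
  then obtain ws where ws: "set ws \<subseteq> {..<n}" "A = wprod ws" "length ws = k" by (auto simp: L_def)
  show ?thesis
  proof (cases ws rule: rev_cases)
    case Nil
    then show ?thesis using ws by simp
  next
    case (snoc us i)
    have i: "i < n" "set us \<subseteq> {..<n}" using ws snoc by auto
    have A: "A = wprod us ** s i" using ws snoc by (simp add: wprod_append)
    have "A *v \<alpha> i = - (wprod us *v \<alpha> i)"
    proof -
      have "s i *v \<alpha> i = (-1) *\<^sub>R \<alpha> i" using i by (simp add: s_apply scaleR_2)
      then show ?thesis unfolding A by (simp only: matrix_vector_mult_scaleR flip: matrix_vector_mul_assoc) simp
    qed
    then have "\<not> pos (wprod us *v \<alpha> i)" using assms(2)[OF i(1)] not_pos_both by force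
    then obtain vs where "set vs \<subseteq> {..<n}" "length vs < length us" "A = wprod vs"
      using exchange[OF i(2,1)] A by auto
    then show ?thesis using k(2)[of "length vs"] ws(3) snoc by (auto simp: L_def)
  qed
qed

text \<open>Reflecting in a simple root that is negative at x lowers the number of positive roots
  negative at x. When none is left, x lies in the open fundamental chamber, and an element fixing x
  preserves positivity of the simple roots.\<close>

lemma regular_stabilizer_trivial:
  assumes "A \<in> W" "A *v x = x" "\<And>b. b \<in> roots \<Longrightarrow> b \<bullet> x \<noteq> 0"
  shows "A = mat 1"
  using assms
proof (induction "card {b. pos b \<and> b \<bullet> x < 0}" arbitrary: A x rule: less_induct)
  case less
  have fin: "finite {b. pos b \<and> b \<bullet> y < 0}" for y
    using fin_roots by (rule rev_finite_subset) (auto simp: pos_def)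
  show ?case
  proof (cases "\<exists>i<n. \<alpha> i \<bullet> x < 0")
    case False
    have pos0: "b \<bullet> x > 0" if "pos b" for b
    proof -
      have "b \<bullet> x = (\<Sum>i<n. cf b i * (\<alpha> i \<bullet> x))"
        by (subst cf_expand[of b]) (simp add: inner_sum_left)
      also have "\<dots> \<ge> 0" using False that by (intro sum_nonneg) (force simp: pos_def)
      finally show ?thesis using less.prems(3)[of b] that by (force simp: pos_def)
    qed
    have "pos (A *v \<alpha> i)" if "i < n" for i
    proof (rule ccontr)
      assume "\<not> pos (A *v \<alpha> i)"
      then have "pos (- (A *v \<alpha> i))" using pos_or_neg[of "A *v \<alpha> i"] that less.prems(1) by simp
      then have "(A *v \<alpha> i) \<bullet> x < 0" using pos0 by fastforce
      moreover have "(A *v \<alpha> i) \<bullet> x = \<alpha> i \<bullet> x"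
        using W_inner[OF less.prems(1), of "\<alpha> i" x] less.prems(2) by simp
      ultimately show False using pos0[OF pos_simple[OF that]] by simp
    qed
    then show ?thesis using positive_preserving_trivial less.prems by blast
  next
    case True
    then obtain i where i: "i < n" "\<alpha> i \<bullet> x < 0" by blast
    let ?x = "s i *v x" and ?A = "s i ** A ** s i"
    have si: "b \<bullet> ?x = (s i *v b) \<bullet> x" for b
      using W_inner[of "s i" b ?x] i by simp
    have sub: "(\<lambda>b. s i *v b) ` {b. pos b \<and> b \<bullet> ?x < 0} \<subseteq> {b. pos b \<and> b \<bullet> x < 0} - {\<alpha> i}"
    proof
      fix d assume "d \<in> (\<lambda>b. s i *v b) ` {b. pos b \<and> b \<bullet> ?x < 0}"
      then obtain b where b: "d = s i *v b" "pos b" "b \<bullet> ?x < 0" by blast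
      have sa: "s i *v \<alpha> i = - \<alpha> i" using i by (simp add: s_apply scaleR_2)
      have "b \<noteq> \<alpha> i"
      proof
        assume "b = \<alpha> i"
        then have "(- \<alpha> i) \<bullet> x < 0" using b(3) unfolding si by (simp add: sa)
        then show False using i by simp
      qed
      then have "pos d" using b simple_reflection_pos i by blast
      moreover have "d \<noteq> \<alpha> i"
      proof
        assume "d = \<alpha> i"
        then have "b = - \<alpha> i" using b(1) i sa by (metis s_s_apply)
        then show False using b(2) not_pos_both pos_simple i by blast
      qed
      ultimately show "d \<in> {b. pos b \<and> b \<bullet> x < 0} - {\<alpha> i}" using b si by auto
    qed
    have "card {b. pos b \<and> b \<bullet> ?x < 0} = card ((\<lambda>b. s i *v b) ` {b. pos b \<and> b \<bullet> ?x < 0})"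
      by (rule card_image[symmetric]) (use i in \<open>auto simp: inj_on_def W_inj\<close>)
    also have "\<dots> \<le> card ({b. pos b \<and> b \<bullet> x < 0} - {\<alpha> i})"
      by (rule card_mono) (use fin sub in auto)
    also have "\<dots> < card {b. pos b \<and> b \<bullet> x < 0}"
      using fin i pos_simple by (intro card_Diff1_less) auto
    finally have "card {b. pos b \<and> b \<bullet> ?x < 0} < card {b. pos b \<and> b \<bullet> x < 0}" .
    then have "?A = mat 1"
    proof (rule less.hyps)
      show "?A \<in> W" using less.prems i by simp
      show "?A *v ?x = ?x" using less.prems i by (simp flip: matrix_vector_mul_assoc)
      show "b \<bullet> ?x \<noteq> 0" if "b \<in> roots" for b using si that less.prems(3) i by simp
    qed
    then have "s i ** ?A ** s i = mat 1" using i by simp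
    moreover have "s i ** ?A ** s i = (s i ** s i) ** A ** (s i ** s i)" by (simp only: matrix_mul_assoc)
    ultimately show ?thesis using i by simp
  qed
qed

text \<open>For an orthogonal map A the image of A - 1 is the orthogonal complement of its fixed
  space: the component of b orthogonal to the image is fixed by A.\<close>

lemma mem_range_iff_orthogonal:
  assumes "A \<in> W"
  shows "(\<exists>x. b = A *v x - x) \<longleftrightarrow> (\<forall>y\<in>fixsp A. b \<bullet> y = 0)"
proof
  assume "\<exists>x. b = A *v x - x"
  then obtain x where x: "b = A *v x - x" by blast
  have "b \<bullet> y = 0" if "A *v y = y" for y
    using W_inner[OF assms, of x y] that by (simp add: x inner_diff_left)
  then show "\<forall>y\<in>fixsp A. b \<bullet> y = 0" by (simp add: fixsp_def)
next
  assume orth: "\<forall>y\<in>fixsp A. b \<bullet> y = 0"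
  let ?U = "range (\<lambda>x. A *v x - x)"
  have lin: "linear (\<lambda>x. A *v x - x)"
    by (intro linear_compose_sub matrix_vector_mul_linear linear_id[unfolded id_def])
  then have sub: "subspace ?U" using linear_subspace_image[of _ UNIV] by simp
  obtain u z where uz: "u \<in> span ?U" "\<And>w. w \<in> span ?U \<Longrightarrow> orthogonal z w" "b = u + z"
    by (rule orthogonal_subspace_decomp_exists[of ?U b]) blast
  have u: "u \<in> ?U" using uz(1) sub by (metis span_eq_iff)
  have "z \<bullet> (A *v x - x) = 0" for x
    using uz(2)[of "A *v x - x"] by (simp add: orthogonal_def span_base)
  then have "z \<bullet> (A *v x) = z \<bullet> x" for x by (simp add: inner_diff_right)
  then have "(inv\<^bsub>G\<^esub> A *v z - z) \<bullet> x = 0" for x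
    using W_inner_inv[OF assms, of x z] by (simp add: inner_diff_left inner_diff_right inner_commute)
  from this[of "inv\<^bsub>G\<^esub> A *v z - z"] have "inv\<^bsub>G\<^esub> A *v z = z" by simp
  then have "A *v z = z" by (metis inv_apply(2) assms)
  then have "b \<bullet> z = 0" using orth by (simp add: fixsp_def)
  moreover have "u \<bullet> z = 0" using uz(1,2) by (simp add: orthogonal_def inner_commute)
  ultimately have "z = 0" using uz(3) by (simp add: inner_add_left)
  then show "\<exists>x. b = A *v x - x" using uz(3) u by auto
qed

text \<open>Otherwise the fixed space is contained in no reflecting hyperplane, so it contains a
  point off all of them, whose stabilizer is trivial.\<close>

lemma root_orthogonal_to_fixed_space:
  assumes "A \<in> W" "A \<noteq> mat 1"
  shows "\<exists>b\<in>roots. \<forall>y\<in>fixsp A. b \<bullet> y = 0"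
proof (rule ccontr)
  assume "\<not> ?thesis"
  then have "\<And>b. b \<in> roots \<Longrightarrow> \<exists>y\<in>fixsp A. b \<bullet> y \<noteq> 0" by blast
  then obtain x where "x \<in> fixsp A" "\<forall>b\<in>roots. b \<bullet> x \<noteq> 0"
    using subspace_avoid_hyperplanes[OF subspace_fixsp fin_roots, of A] by blast
  then show False using regular_stabilizer_trivial[OF assms(1), of x] assms(2) by (auto simp: fixsp_def)
qed

lemma root_in_range:
  assumes "A \<in> W" "A \<noteq> mat 1"
  obtains b x where "b \<in> roots" "b = A *v x - x"
  using root_orthogonal_to_fixed_space[OF assms] mem_range_iff_orthogonal[OF assms(1)] by metis

lemma fin_W: "finite W"
proof -
  have "inj_on (\<lambda>A. restrict (\<lambda>i. A *v \<alpha> i) {..<n}) W"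
  proof (rule inj_onI)
    fix A B assume AB: "A \<in> W" "B \<in> W" "restrict (\<lambda>i. A *v \<alpha> i) {..<n} = restrict (\<lambda>i. B *v \<alpha> i) {..<n}"
    have ag: "A *v \<alpha> i = B *v \<alpha> i" if "i < n" for i using fun_cong[OF AB(3), of i] that by simp
    have "A *v x = B *v x" for x
    proof -
      have "A *v (\<Sum>i<n. cf x i *\<^sub>R \<alpha> i) = B *v (\<Sum>i<n. cf x i *\<^sub>R \<alpha> i)"
        by (simp add: matrix_vector_mult_scaleR ag linear_sum[OF matrix_vector_mul_linear])
      then show ?thesis by (simp flip: cf_expand)
    qed
    then show "A = B" by (simp add: matrix_eq)
  qed
  moreover have "(\<lambda>A. restrict (\<lambda>i. A *v \<alpha> i) {..<n}) ` W \<subseteq> PiE {..<n} (\<lambda>_. roots)"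
    by (auto simp: PiE_iff extensional_def split: if_splits)
  moreover have "finite (PiE {..<n} (\<lambda>_. roots))" using fin_roots by (intro finite_PiE) auto
  ultimately show ?thesis using finite_subset finite_imageD by metis
qed

section \<open>Reflection length as codimension of the fixed space\<close>

lemma dim_fixsp_le: "dim (fixsp (A :: real^'n^'n)) \<le> n"
  using dim_subset_UNIV[of "fixsp A"] card_n by simp

lemma dim_Int_hyperplane:
  assumes "subspace (S :: (real^'n) set)"
  shows "dim S \<le> dim (S \<inter> {x. b \<bullet> x = 0}) + 1"
proof (cases "b = 0")
  case False
  let ?H = "{x. b \<bullet> x = 0}"
  have "dim {x + y |x y. x \<in> S \<and> y \<in> ?H} + dim (S \<inter> ?H) = dim S + dim ?H"
    by (rule dim_sums_Int[OF assms subspace_hyperplane])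
  moreover have "dim {x + y |x y. x \<in> S \<and> y \<in> ?H} \<le> n"
    using dim_subset_UNIV[of "{x + y |x y. x \<in> S \<and> y \<in> ?H}"] card_n by simp
  moreover have "dim ?H = n - 1" using dim_hyperplane[OF False] card_n by simp
  moreover have "n > 0" using card_n by (metis zero_less_card_finite)
  ultimately show ?thesis by linarith
qed simp

lemma fixsp_refl_mult_subset:
  assumes "b \<in> roots"
  shows "fixsp A \<inter> {x. b \<bullet> x = 0} \<subseteq> fixsp (reflection_matrix b ** A)"
    and "fixsp A \<inter> {x. b \<bullet> x = 0} \<subseteq> fixsp (A ** reflection_matrix b)"
  using reflection_unit_fixed_iff[OF root_unit[OF assms]]
  by (auto simp: fixsp_def simp flip: matrix_vector_mul_assoc) metis

lemma refl_refl_root [simp]: "b \<in> roots \<Longrightarrow> reflection_matrix b ** reflection_matrix b = mat 1"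
  by (simp add: reflection_unit_involution)

lemma inv_refl [simp]: "b \<in> roots \<Longrightarrow> inv\<^bsub>G\<^esub> (reflection_matrix b) = reflection_matrix b"
  by (rule inv_eqI) auto

lemma fixsp_word_dim:
  assumes "set ts \<subseteq> T"
  shows "n \<le> dim (fixsp (foldr (\<otimes>\<^bsub>G\<^esub>) ts \<one>\<^bsub>G\<^esub>)) + length ts"
  using assms
proof (induction ts)
  case Nil
  have "fixsp (mat 1 :: real^'n^'n) = UNIV" by (simp add: fixsp_def)
  then show ?case using card_n by simp
next
  case (Cons t ts)
  let ?A = "foldr (\<otimes>\<^bsub>G\<^esub>) ts \<one>\<^bsub>G\<^esub>"
  obtain b where b: "b \<in> roots" "t = reflection_matrix b" using Cons.prems T_iff by auto
  have "dim (fixsp ?A) \<le> dim (fixsp ?A \<inter> {x. b \<bullet> x = 0}) + 1"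
    by (rule dim_Int_hyperplane) simp
  also have "\<dots> \<le> dim (fixsp (t ** ?A)) + 1"
    using fixsp_refl_mult_subset(1)[OF b(1), of ?A] b(2) by (simp add: dim_subset)
  finally show ?case using Cons by simp
qed

text \<open>Write b = (A - 1) x. Since A x = x + b is as long as x, the reflection in b sends A x
  back to x, so x is fixed in addition.\<close>

lemma root_reflection_fixsp:
  assumes "A \<in> W" "b \<in> roots" "\<And>y. y \<in> fixsp A \<Longrightarrow> b \<bullet> y = 0"
  shows "fixsp A \<subseteq> fixsp (reflection_matrix b ** A)"
    and "dim (fixsp A) < dim (fixsp (reflection_matrix b ** A))"
proof -
  obtain x where x: "b = A *v x - x"
    using mem_range_iff_orthogonal[OF assms(1), of b] assms(3) by blast
  have bb: "b \<bullet> b = 1" using assms(2) by simp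
  show sub: "fixsp A \<subseteq> fixsp (reflection_matrix b ** A)"
    using fixsp_refl_mult_subset(1)[OF assms(2), of A] assms(3) by auto
  have Ax: "A *v x = x + b" using x by simp
  have "(x + b) \<bullet> (x + b) = x \<bullet> x" using W_inner[OF assms(1), of x x] Ax by simp
  then have "2 * (b \<bullet> x) = -1" using bb by (simp add: inner_add_left inner_add_right inner_commute)
  then have "2 * (b \<bullet> (x + b)) = 1" using bb by (simp add: inner_add_right)
  then have "reflection_matrix b *v (A *v x) = x"
    unfolding Ax reflection_unit_apply[OF bb] by simp
  then have x1: "x \<in> fixsp (reflection_matrix b ** A)" by (simp add: fixsp_def flip: matrix_vector_mul_assoc)
  have x2: "x \<notin> fixsp A" using Ax root_nz[OF assms(2)] by (simp add: fixsp_def)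
  show "dim (fixsp A) < dim (fixsp (reflection_matrix b ** A))"
    by (rule dim_psubset) (use sub x1 x2 in \<open>auto simp: span_eq_iff[THEN iffD2]\<close>)
qed

lemma reflection_factorization:
  assumes "A \<in> W"
  shows "\<exists>bs. set bs \<subseteq> roots \<and> (\<forall>b\<in>set bs. \<forall>y\<in>fixsp A. b \<bullet> y = 0) \<and>
    length bs \<le> n - dim (fixsp A) \<and>
    foldr (\<otimes>\<^bsub>G\<^esub>) (map reflection_matrix bs) \<one>\<^bsub>G\<^esub> = A"
  using assms
proof (induction "n - dim (fixsp A)" arbitrary: A rule: less_induct)
  case less
  show ?case
  proof (cases "A = mat 1")
    case True
    then show ?thesis by (intro exI[of _ "[]"]) simp
  next
    case False
    obtain b where b: "b \<in> roots" "\<forall>y\<in>fixsp A. b \<bullet> y = 0"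
      using root_orthogonal_to_fixed_space[OF less.prems False] by blast
    let ?B = "reflection_matrix b ** A"
    have sub: "fixsp A \<subseteq> fixsp ?B" and dim: "dim (fixsp A) < dim (fixsp ?B)"
      using root_reflection_fixsp[OF less.prems b(1)] b(2) by auto
    have "dim (fixsp ?B) \<le> n" by (rule dim_fixsp_le)
    then have lt: "n - dim (fixsp ?B) < n - dim (fixsp A)" using dim by simp
    obtain bs where bs: "set bs \<subseteq> roots" "\<forall>b\<in>set bs. \<forall>y\<in>fixsp ?B. b \<bullet> y = 0"
      "length bs \<le> n - dim (fixsp ?B)" "foldr (\<otimes>\<^bsub>G\<^esub>) (map reflection_matrix bs) \<one>\<^bsub>G\<^esub> = ?B"
      using less.hyps[OF lt] less.prems b by auto
    have "reflection_matrix b ** ?B = A" using b by (simp add: matrix_mul_assoc)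
    then show ?thesis using bs b sub lt by (intro exI[of _ "b # bs"]) auto
  qed
qed

text \<open>Carter's lemma: one reflection lowers the dimension of the fixed space by at most 1, and
  peeling off roots orthogonal to the fixed space attains this bound.\<close>

theorem reflection_length_eq:
  assumes "A \<in> W"
  shows "reflection_length G T A = n - dim (fixsp A)"
proof -
  obtain bs where bs: "set bs \<subseteq> roots" "length bs \<le> n - dim (fixsp A)"
      "foldr (\<otimes>\<^bsub>G\<^esub>) (map reflection_matrix bs) \<one>\<^bsub>G\<^esub> = A"
    using reflection_factorization[OF assms] by blast
  have lower: "n - dim (fixsp A) \<le> length ts"
    if "set ts \<subseteq> T" "foldr (\<otimes>\<^bsub>G\<^esub>) ts \<one>\<^bsub>G\<^esub> = A" for ts
    using fixsp_word_dim[OF that(1)] that(2) by simp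
  have T: "set (map reflection_matrix bs) \<subseteq> T" using bs(1) T_iff by auto
  show ?thesis unfolding reflection_length_def
  proof (rule Least_equality)
    show "\<exists>ts. set ts \<subseteq> T \<and> length ts = n - dim (fixsp A) \<and> foldr (\<otimes>\<^bsub>G\<^esub>) ts \<one>\<^bsub>G\<^esub> = A"
      using lower[OF T bs(3)] bs T by (intro exI[of _ "map reflection_matrix bs"]) auto
  qed (use lower in blast)
qed

lemma fixsp_inv: "A \<in> W \<Longrightarrow> fixsp (inv\<^bsub>G\<^esub> A) = fixsp A"
  by (auto simp: fixsp_def) (metis inv_apply)+

lemma inv_mult_rev: "A \<in> W \<Longrightarrow> B \<in> W \<Longrightarrow> inv\<^bsub>G\<^esub> (A ** B) = inv\<^bsub>G\<^esub> B ** inv\<^bsub>G\<^esub> A"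
  using group.inv_mult_group[OF group_G, of A B] by simp

lemma dim_fixsp_refl:
  assumes "b \<in> roots"
  shows "dim (fixsp (reflection_matrix b)) = n - 1"
proof -
  have "fixsp (reflection_matrix b) = {x. b \<bullet> x = 0}"
    using reflection_unit_fixed_iff[OF root_unit[OF assms]] by (auto simp: fixsp_def)
  then show ?thesis using dim_hyperplane[OF root_nz[OF assms]] card_n by simp
qed

text \<open>By Carter's lemma t lies below A iff Fix (A t) has one dimension more than Fix A. As the
  part of Fix (A t) in the hyperplane of b lies in Fix A, this dimension forces equality, hence
  orthogonality of b to Fix A.\<close>

lemma absolute_le_refl_iff:
  assumes "b \<in> roots" "A \<in> W"
  shows "absolute_le G T (reflection_matrix b) A \<longleftrightarrow> (\<forall>y\<in>fixsp A. b \<bullet> y = 0)"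
proof -
  let ?t = "reflection_matrix b"
  have t: "?t \<in> W" using assms by simp
  have n0: "n > 0" using card_n by (metis zero_less_card_finite)
  have le: "dim (fixsp A) \<le> n" "dim (fixsp (A ** ?t)) \<le> n" by (rule dim_fixsp_le)+
  have rt: "reflection_length G T ?t = 1"
    using reflection_length_eq[OF t] dim_fixsp_refl[OF assms(1)] n0 by simp
  have tr: "fixsp (A ** ?t) = fixsp (?t ** inv\<^bsub>G\<^esub> A)"
    using fixsp_inv[of "A ** ?t"] inv_mult_rev[OF assms(2) t] assms by simp
  have "absolute_le G T ?t A \<longleftrightarrow> dim (fixsp (A ** ?t)) = dim (fixsp A) + 1"
    using le n0 reflection_length_eq[of "A ** ?t"] reflection_length_eq[of A] assms t rt
    by (auto simp: absolute_le_def)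
  also have "\<dots> \<longleftrightarrow> (\<forall>y\<in>fixsp A. b \<bullet> y = 0)"
  proof
    assume eq: "dim (fixsp (A ** ?t)) = dim (fixsp A) + 1"
    have sub: "fixsp (A ** ?t) \<inter> {x. b \<bullet> x = 0} \<subseteq> fixsp A"
      using fixsp_refl_mult_subset(2)[OF assms(1), of "A ** ?t"] assms by (simp flip: matrix_mul_assoc)
    have "dim (fixsp A) \<le> dim (fixsp (A ** ?t) \<inter> {x. b \<bullet> x = 0})"
      using dim_Int_hyperplane[of "fixsp (A ** ?t)" b] eq by simp
    then have "fixsp (A ** ?t) \<inter> {x. b \<bullet> x = 0} = fixsp A"
      by (intro subspace_dim_equal sub subspace_inter subspace_fixsp subspace_hyperplane)
    then show "\<forall>y\<in>fixsp A. b \<bullet> y = 0" by blast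
  next
    assume orth: "\<forall>y\<in>fixsp A. b \<bullet> y = 0"
    then have "dim (fixsp A) < dim (fixsp (A ** ?t))"
      using root_reflection_fixsp(2)[OF inv_in_W[OF assms(2)] assms(1)] assms(2)
      unfolding tr by (simp add: fixsp_inv)
    moreover have "dim (fixsp (A ** ?t)) \<le> dim (fixsp A) + 1"
    proof -
      have "fixsp (A ** ?t) \<inter> {x. b \<bullet> x = 0} \<subseteq> fixsp A"
        using fixsp_refl_mult_subset(2)[OF assms(1), of "A ** ?t"] assms by (simp flip: matrix_mul_assoc)
      then show ?thesis using dim_Int_hyperplane[of "fixsp (A ** ?t)" b] dim_subset
        by (metis (no_types, lifting) add_le_mono1 order_trans subspace_fixsp)
    qed
    ultimately show "dim (fixsp (A ** ?t)) = dim (fixsp A) + 1" by simp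
  qed
  finally show ?thesis .
qed

text \<open>A is a product of reflections in roots orthogonal to its own fixed space, and all of
  these fix U.\<close>

lemma fixsp_subset_of_reflections:
  assumes "A \<in> W" "\<And>b. b \<in> roots \<Longrightarrow> \<forall>y\<in>fixsp A. b \<bullet> y = 0 \<Longrightarrow> \<forall>y\<in>U. b \<bullet> y = 0"
  shows "U \<subseteq> fixsp A"
proof
  fix y assume y: "y \<in> U"
  obtain bs where bs: "set bs \<subseteq> roots" "\<forall>b\<in>set bs. \<forall>y\<in>fixsp A. b \<bullet> y = 0"
      "foldr (\<otimes>\<^bsub>G\<^esub>) (map reflection_matrix bs) \<one>\<^bsub>G\<^esub> = A"
    using reflection_factorization[OF assms(1)] by blast
  have "\<forall>b\<in>set bs. b \<bullet> y = 0" using bs(1,2) assms(2) y by blast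
  then have "foldr (\<otimes>\<^bsub>G\<^esub>) (map reflection_matrix bs) \<one>\<^bsub>G\<^esub> *v y = y"
    using bs(1)
  proof (induction bs)
    case (Cons b bs)
    then show ?case using reflection_unit_fixed_iff[OF root_unit, of b y]
      by (simp flip: matrix_vector_mul_assoc)
  qed simp
  then show "y \<in> fixsp A" using bs(3) by (simp add: fixsp_def)
qed

text \<open>If \<open>u\<close> lies strictly below \<open>c\<close> and above all reflections below \<open>w\<close>, then
  \<open>Fix u \<subseteq> Fix w\<close>, and \<open>c - 1\<close> maps \<open>Fix u\<close> onto the moved space of
  \<open>c u\<^sup>-\<^sup>1 \<noteq> 1\<close>, which contains a root.\<close>

lemma nc_proj_eq_coxeter:
  assumes c: "c \<in> W" "fixsp c = {0}" and w: "w \<in> W"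
    and no: "\<And>x. w *v x = x \<Longrightarrow> c *v x - x \<notin> roots"
  shows "nc_proj G T w c = c"
proof -
  let ?L = "NC G T c" and ?A = "{t \<in> T. absolute_le G T t w}"
  have rl1: "reflection_length G T (mat 1) = 0"
  proof -
    have "fixsp (mat 1 :: real^'n^'n) = UNIV" by (simp add: fixsp_def)
    then show ?thesis using reflection_length_eq[of "mat 1"] card_n by simp
  qed
  have inv1: "inv\<^bsub>G\<^esub> (mat 1) = (mat 1 :: real^'n^'n)" by (rule inv_eqI) auto
  have le1: "absolute_le G T \<one>\<^bsub>G\<^esub> v" for v
    by (simp add: absolute_le_def rl1 inv1)
  have lerefl: "absolute_le G T v v" if "v \<in> W" for v
    using that by (simp add: absolute_le_def rl1)
  have tc: "absolute_le G T t c" if "t \<in> T" for t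
    using that c absolute_le_refl_iff by (auto simp: T_iff)
  have TW: "t \<in> W" if "t \<in> T" for t using that T_iff by auto
  have Acar: "?A \<subseteq> carrier ?L" using tc le1 TW by (auto simp: NC_def)
  have ccar: "c \<in> carrier ?L" using le1 lerefl c by (simp add: NC_def)
  have upper: "u = c" if u: "u \<in> carrier ?L" and ub: "\<And>t. t \<in> ?A \<Longrightarrow> absolute_le G T t u" for u
  proof (rule ccontr)
    assume ne: "u \<noteq> c"
    have uW: "u \<in> W" and uc: "absolute_le G T u c" using u by (auto simp: NC_def)
    have sub: "fixsp u \<subseteq> fixsp w"
    proof (rule fixsp_subset_of_reflections[OF w])
      fix b assume b: "b \<in> roots" "\<forall>y\<in>fixsp w. b \<bullet> y = 0"
      then have "reflection_matrix b \<in> ?A" using absolute_le_refl_iff w T_iff by auto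
      then show "\<forall>y\<in>fixsp u. b \<bullet> y = 0" using ub absolute_le_refl_iff b(1) uW by blast
    qed
    let ?v = "c ** inv\<^bsub>G\<^esub> u"
    have vW: "?v \<in> W" using c uW by simp
    have vne: "?v \<noteq> mat 1"
    proof
      assume "?v = mat 1"
      then have "?v ** u = u" by simp
      then show False using ne uW by (simp flip: matrix_mul_assoc)
    qed
    have "int (reflection_length G T ?v) = int (reflection_length G T c) - int (reflection_length G T u)"
      using uc by (simp add: absolute_le_def)
    moreover have "dim (fixsp c) = 0" using c(2) by simp
    ultimately have dimv: "n = dim (fixsp ?v) + dim (fixsp u)"
      using reflection_length_eq[OF vW] reflection_length_eq[OF c(1)] reflection_length_eq[OF uW]
        dim_fixsp_le[of ?v] dim_fixsp_le[of u] by simp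
    let ?f = "\<lambda>x. c *v x - x" and ?g = "\<lambda>x. ?v *v x - x"
    have lin: "linear (\<lambda>x. A *v x - x)" for A :: "real^'n^'n"
      by (intro linear_compose_sub matrix_vector_mul_linear linear_id[unfolded id_def])
    have inj: "inj ?f"
    proof (rule linear_injective_0[OF lin, THEN iffD2], intro allI impI)
      fix x assume "c *v x - x = 0"
      then have "x \<in> fixsp c" by (simp add: fixsp_def)
      then show "x = 0" using c(2) by simp
    qed
    have imsub: "?f ` fixsp u \<subseteq> range ?g"
    proof
      fix y assume "y \<in> ?f ` fixsp u"
      then obtain x where x: "u *v x = x" "y = c *v x - x" by (auto simp: fixsp_def)
      have "inv\<^bsub>G\<^esub> u *v x = x" using x uW by (metis inv_apply(1))
      then have "?g x = y" using x by (simp flip: matrix_vector_mul_assoc)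
      then show "y \<in> range ?g" by blast
    qed
    have rng: "dim (range ?g) + dim (fixsp ?v) = n"
    proof -
      have "range ?g = {b. \<forall>y\<in>fixsp ?v. orthogonal y b}"
        using mem_range_iff_orthogonal[OF vW] by (auto simp: orthogonal_def inner_commute image_iff)
      then show ?thesis
        using dim_subspace_orthogonal_to_vectors[of "fixsp ?v" UNIV] card_n by simp
    qed
    have "dim (?f ` fixsp u) = dim (fixsp u)"
      by (rule dim_image_eq[OF lin]) (use inj in \<open>auto intro: inj_on_subset\<close>)
    \<comment> \<open>As the lengths of \<open>?v\<close> and u add up to n, the injective image of
      Fix u has the dimension of the moved space of \<open>?v\<close> and fills it.\<close>
    then have eq: "?f ` fixsp u = range ?g"
      using rng dimv lin linear_subspace_image[OF lin] subspace_fixsp subspace_UNIV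
      by (intro subspace_dim_equal imsub) auto
    obtain b x where b: "b \<in> roots" "b = ?v *v x - x" using root_in_range[OF vW vne] by blast
    then have "b \<in> ?f ` fixsp u" unfolding eq by blast
    then obtain x where "x \<in> fixsp u" "b = c *v x - x" by blast
    then show False using no sub b(1) by (auto simp: fixsp_def)
  qed
  have Upper: "Upper ?L ?A = {c}"
  proof
    show "Upper ?L ?A \<subseteq> {c}"
      using Acar upper by (auto simp: Upper_def NC_def)
    show "{c} \<subseteq> Upper ?L ?A" using ccar tc by (auto simp: Upper_def NC_def)
  qed
  have "least ?L x (Upper ?L ?A) \<longleftrightarrow> x = c" for x
    unfolding Upper using ccar lerefl[OF c(1)] by (auto simp: least_def NC_def)
  then show ?thesis unfolding nc_proj_def sup_def by simp
qed

end

section \<open>Invariants and the Coxeter number\<close>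

definition cvec :: "real^'n \<Rightarrow> real^'n \<Rightarrow> complex^'n" where
  "cvec p q = (\<chi> i. Complex (p $ i) (q $ i))"

lemma complexify_cvec: "complexify A *v cvec p q = cvec (A *v p) (A *v q)"
  by (simp add: vec_eq_iff cvec_def complexify_def matrix_vector_mult_def complex_eq_iff sum_subtractf)

lemma cvec_collapse: "v = cvec (\<chi> i. Re (v $ i)) (\<chi> i. Im (v $ i))"
  by (simp add: vec_eq_iff cvec_def)

lemma cvec_eq_iff: "cvec p q = cvec p' q' \<longleftrightarrow> p = p' \<and> q = q'"
  by (auto simp: vec_eq_iff cvec_def)

lemma scalar_cvec: "\<mu> *s cvec p q = cvec (Re \<mu> *\<^sub>R p - Im \<mu> *\<^sub>R q) (Im \<mu> *\<^sub>R p + Re \<mu> *\<^sub>R q)"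
  by (simp add: vec_eq_iff cvec_def complex_eq_iff)

definition capp :: "complex^'n^'n \<Rightarrow> complex poly \<Rightarrow> complex^'n \<Rightarrow> complex^'n" where
  "capp A Q u = fold_coeffs (\<lambda>a y. a *s u + A *v y) Q 0"

lemma capp_0 [simp]: "capp A 0 u = 0"
  by (simp add: capp_def)

lemma capp_pCons [simp]: "capp A (pCons a Q) u = a *s u + A *v capp A Q u"
  by (cases "Q = 0 \<and> a = 0") (auto simp: capp_def)

lemma capp_add: "capp A (P + Q) u = capp A P u + capp A Q u"
  by (induction P Q rule: poly_induct2)
     (auto simp: vector_add_ldistrib vector_sadd_rdistrib matrix_vector_right_distrib algebra_simps)

lemma capp_smult: "capp A (Polynomial.smult a Q) u = a *s capp A Q u"
  by (induction Q)
     (auto simp: vector_add_ldistrib vector_smult_assoc vector_scalar_commute)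

lemma capp_of_int: "capp (complexify A) (map_poly of_int P) (cvec u 0) = cvec (papp P ((*v) A) u) 0"
proof (induction P)
  case 0
  then show ?case by (simp add: vec_eq_iff cvec_def complex_eq_iff)
next
  case (pCons a P)
  then show ?case
    by (simp add: map_poly_pCons complexify_cvec matrix_vector_mul_linear)
       (simp add: vec_eq_iff cvec_def complex_eq_iff)
qed

text \<open>Q splits over the complex numbers. When its linear factors are removed one by one, the
  last nonzero vector met is an eigenvector.\<close>

lemma capp_eigenvector:
  assumes "Q \<noteq> 0" "u \<noteq> 0" "capp A Q u = 0"
  shows "\<exists>\<mu> y. poly Q \<mu> = 0 \<and> y \<noteq> 0 \<and> A *v y = \<mu> *s y"
  using assms(1,3)
proof (induction "degree Q" arbitrary: Q rule: less_induct)
  case less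
  show ?case
  proof (cases "degree Q = 0")
    case True
    then obtain a where "Q = [:a:]" by (metis degree_eq_zeroE)
    then show ?thesis using less.prems assms(2) by (simp add: vec_eq_iff)
  next
    case False
    then obtain \<mu> where \<mu>: "poly Q \<mu> = 0"
      using fundamental_theorem_of_algebra[of Q] by (auto simp: constant_degree)
    then obtain R where R: "Q = [:- \<mu>, 1:] * R" by (auto simp: poly_eq_0_iff_dvd elim: dvdE)
    have R0: "R \<noteq> 0" using R less.prems by auto
    have "capp A Q u = A *v capp A R u - \<mu> *s capp A R u"
      unfolding R using capp_add[of A "pCons 0 R" "Polynomial.smult (- \<mu>) R" u]
        capp_smult[of A "- \<mu>" R u] by simp
    then have eig: "A *v capp A R u = \<mu> *s capp A R u" using less.prems by simp
    show ?thesis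
    proof (cases "capp A R u = 0")
      case False
      then show ?thesis using eig \<mu> by blast
    next
      case True
      have "degree R < degree Q" using degree_mult_eq[of "[:- \<mu>, 1:]" R] R0 R by simp
      then show ?thesis using less.hyps[of R] True R0 R by auto
    qed
  qed
qed

text \<open>\<open>p + i q\<close> is a complex eigenvector, expressed by its real and imaginary
  parts.\<close>

lemma papp_eigenvector:
  fixes A :: "real^'n^'n"
  assumes "P \<noteq> 0" "u \<noteq> 0" "papp P ((*v) A) u = 0"
  obtains \<mu> p q where "ieval P \<mu> = 0" "p \<noteq> 0 \<or> q \<noteq> 0"
    "A *v p = Re \<mu> *\<^sub>R p - Im \<mu> *\<^sub>R q" "A *v q = Im \<mu> *\<^sub>R p + Re \<mu> *\<^sub>R q"
proof -
  have "(map_poly of_int P :: complex poly) \<noteq> 0" using assms(1) by (simp add: map_poly_eq_0_iff)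
  moreover have "cvec u 0 \<noteq> 0" using assms(2) by (auto simp: cvec_def vec_eq_iff complex_eq_iff)
  moreover have "capp (complexify A) (map_poly of_int P) (cvec u 0) = 0"
    unfolding capp_of_int using assms(3) by (simp add: cvec_def vec_eq_iff complex_eq_iff)
  ultimately obtain \<mu> y where y: "poly (map_poly of_int P) \<mu> = 0" "y \<noteq> 0"
    "complexify A *v y = \<mu> *s y" using capp_eigenvector by blast
  define p q where "p = (\<chi> i. Re (y $ i))" "q = (\<chi> i. Im (y $ i))"
  have ypq: "y = cvec p q" unfolding p_q_def by (rule cvec_collapse)
  have "cvec (A *v p) (A *v q) = cvec (Re \<mu> *\<^sub>R p - Im \<mu> *\<^sub>R q) (Im \<mu> *\<^sub>R p + Re \<mu> *\<^sub>R q)"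
    using y(3) unfolding ypq complexify_cvec scalar_cvec .
  moreover have "p \<noteq> 0 \<or> q \<noteq> 0" using y(2) unfolding ypq by (auto simp: cvec_def vec_eq_iff complex_eq_iff)
  ultimately show ?thesis using that y(1) by (simp add: cvec_eq_iff ieval_def)
qed

section \<open>Invariant polynomials on a rotation plane\<close>

lemma infinite_unit_circle: "infinite {u::complex. norm u = 1}"
proof
  assume "finite {u::complex. norm u = 1}"
  moreover have "inj_on cis {0..1}"
    by (rule inj_onI) (metis atLeastAtMost_iff cis.sel cos_inj_pi dual_order.trans pi_ge_two one_le_numeral)
  moreover have "cis ` {0..1} \<subseteq> {u. norm u = 1}" by auto
  ultimately have "finite {0..1::real}" using finite_subset finite_imageD by metis
  then show False using infinite_Icc[of 0 "1::real"] by simp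
qed

lemma poly_eqI_infinite:
  fixes p q :: "complex poly"
  assumes "infinite S" "\<And>z. z \<in> S \<Longrightarrow> poly p z = poly q z"
  shows "p = q"
proof (rule ccontr)
  assume "p \<noteq> q"
  then have "finite {z. poly (p - q) z = 0}" by (intro poly_roots_finite) simp
  moreover have "S \<subseteq> {z. poly (p - q) z = 0}" using assms(2) by auto
  ultimately show False using assms(1) finite_subset by blast
qed

text \<open>A real linear form on the plane is a combination of z and \<open>cnj z\<close>. The
  outer variable of P stands for \<open>cnj z\<close>, the inner one for z.\<close>

lemma real_polynomial_function_on_plane:
  fixes p q :: "'v::euclidean_space"
  assumes "real_polynomial_function f"
  shows "\<exists>P :: complex poly poly. \<forall>z. of_real (f (Re z *\<^sub>R p - Im z *\<^sub>R q)) = poly (poly P [:cnj z:]) z"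
  using assms
proof (induction rule: real_polynomial_function.induct)
  case (linear f)
  then interpret bounded_linear f .
  let ?P = "[: [:0, Complex (f p) (f q) / 2:], [:Complex (f p) (- f q) / 2:] :]"
  show ?case
    by (intro exI[of _ ?P]) (auto simp: complex_eq_iff diff scaleR field_simps)
next
  case (const c)
  then show ?case by (intro exI[of _ "[:[:of_real c:]:]"]) simp
next
  case (add f g)
  then obtain P Q where "\<forall>z. of_real (f (Re z *\<^sub>R p - Im z *\<^sub>R q)) = poly (poly P [:cnj z:]) z"
    "\<forall>z. of_real (g (Re z *\<^sub>R p - Im z *\<^sub>R q)) = poly (poly Q [:cnj z:]) z" by blast
  then show ?case by (intro exI[of _ "P + Q"]) simp
next
  case (mult f g)
  then obtain P Q where "\<forall>z. of_real (f (Re z *\<^sub>R p - Im z *\<^sub>R q)) = poly (poly P [:cnj z:]) z"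
    "\<forall>z. of_real (g (Re z *\<^sub>R p - Im z *\<^sub>R q)) = poly (poly Q [:cnj z:]) z" by blast
  then show ?case by (intro exI[of _ "P * Q"]) simp
qed

lemma poly_poly_expand:
  fixes P :: "complex poly poly"
  shows "poly (poly P [:w:]) z =
    (\<Sum>k\<le>degree P. \<Sum>j\<le>degree (coeff P k). coeff (coeff P k) j * z ^ j * w ^ k)"
proof -
  have "poly P [:w:] = (\<Sum>k\<le>degree P. coeff P k * [:w ^ k:])"
    by (simp add: poly_altdef poly_const_pow)
  then have "poly (poly P [:w:]) z = (\<Sum>k\<le>degree P. poly (coeff P k) z * w ^ k)"
    by (simp add: poly_sum mult.commute)
  then show ?thesis by (simp add: poly_altdef[of "coeff P _"] sum_distrib_right)
qed

text \<open>On the plane on which \<open>A\<close> rotates with order \<open>m\<close>, a homogeneous invariant polynomial of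
  degree \<open>d < m\<close> has only the Fourier mode of frequency 0 on the unit circle.\<close>

lemma homogeneous_rotation_invariant_const:
  fixes p q :: "'v::euclidean_space"
  assumes f: "real_polynomial_function f" "\<And>r x. f (r *\<^sub>R x) = r ^ d * f x"
    and inv: "\<And>x. f (A x) = f x"
    and A: "\<And>z. A (Re z *\<^sub>R p - Im z *\<^sub>R q) = Re (\<mu> * z) *\<^sub>R p - Im (\<mu> * z) *\<^sub>R q"
    and \<mu>: "exact_order \<mu> m" "d < m"
    and u: "norm u = 1"
  shows "f (Re u *\<^sub>R p - Im u *\<^sub>R q) = f p"
proof -
  define R where "R = (\<lambda>z. Re z *\<^sub>R p - Im z *\<^sub>R q)"
  obtain P where P: "\<And>z. of_real (f (R z)) = poly (poly P [:cnj z:]) z"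
    using real_polynomial_function_on_plane[OF f(1), of p q] unfolding R_def by blast
  define F where "F = (\<lambda>z. of_real (f (R z)) :: complex)"
  define a where "a = (\<lambda>k j. coeff (coeff P k) j)"
  define K where "K = degree P"
  define J where "J = (\<lambda>k. degree (coeff P k))"
  have F: "F z = (\<Sum>k\<le>K. \<Sum>j\<le>J k. a k j * z ^ j * cnj z ^ k)" for z
    unfolding F_def P poly_poly_expand a_def K_def J_def ..
  have hom: "F (of_real r * z) = of_real r ^ d * F z" for r z
  proof -
    have "R (of_real r * z) = r *\<^sub>R R z" by (simp add: R_def scaleR_diff_right)
    then show ?thesis by (simp add: F_def f(2))
  qed
  \<comment> \<open>Homogeneity, read as an identity of polynomials in a real scaling factor, keeps
    only the monomials of total degree d.\<close>
  have Fu: "F v = (\<Sum>k\<le>K. \<Sum>j\<le>J k. if j + k = d then a k j * v ^ j * cnj v ^ k else 0)" for v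
  proof -
    define S where "S = (\<Sum>k\<le>K. \<Sum>j\<le>J k. monom (a k j * v ^ j * cnj v ^ k) (j + k))"
    have "S = monom (F v) d"
    proof (rule poly_eqI_infinite[of "range complex_of_real"])
      show "infinite (range complex_of_real)"
        using infinite_UNIV_char_0[where 'a = real] by (simp add: finite_image_iff inj_of_real)
      fix z assume "z \<in> range complex_of_real"
      then obtain r where z: "z = of_real r" by blast
      have "poly S z = F (z * v)"
        unfolding S_def F z by (simp add: poly_sum poly_monom power_mult_distrib power_add mult_ac)
      then show "poly S z = poly (monom (F v) d) z"
        unfolding z hom by (simp add: poly_monom mult_ac)
    qed
    then have "coeff S d = F v" by simp
    moreover have "coeff S d = (\<Sum>k\<le>K. \<Sum>j\<le>J k. if j + k = d then a k j * v ^ j * cnj v ^ k else 0)"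
      unfolding S_def by (simp add: coeff_sum)
    ultimately show ?thesis by simp
  qed
  \<comment> \<open>On the unit circle \<open>cnj v\<close> is the inverse of v, so
    \<open>v ^ d * F v\<close> is the value of a polynomial in v of degree at most 2 d.\<close>
  define Q where "Q = (\<Sum>k\<le>K. \<Sum>j\<le>J k. if j + k = d then monom (a k j) (2 * j) else 0)"
  have Q: "poly Q v = v ^ d * F v" if "norm v = 1" for v
  proof -
    have vv: "v * cnj v = 1" using that by (simp add: complex_norm_square[symmetric])
    have "poly Q v = (\<Sum>k\<le>K. \<Sum>j\<le>J k. if j + k = d then a k j * v ^ (2 * j) else 0)"
      unfolding Q_def by (simp add: poly_sum poly_monom if_distrib[of "\<lambda>x. poly x v"] cong: if_cong)
    also have "\<dots> = (\<Sum>k\<le>K. \<Sum>j\<le>J k. v ^ d * (if j + k = d then a k j * v ^ j * cnj v ^ k else 0))"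
    proof (intro sum.cong refl)
      fix k j
      have "v ^ (2 * j) = v ^ (j + k) * v ^ j * cnj v ^ k"
      proof -
        have "v ^ (j + k) * v ^ j * cnj v ^ k = v ^ j * v ^ j * (v * cnj v) ^ k"
          by (simp add: power_add power_mult_distrib)
        then show ?thesis by (simp add: vv mult_2 power_add)
      qed
      then show "(if j + k = d then a k j * v ^ (2 * j) else 0) =
        v ^ d * (if j + k = d then a k j * v ^ j * cnj v ^ k else 0)" by auto
    qed
    also have "\<dots> = v ^ d * F v" unfolding Fu by (simp add: sum_distrib_left)
    finally show ?thesis .
  qed
  have n\<mu>: "norm \<mu> = 1"
  proof -
    have "norm \<mu> ^ m = 1" using \<mu>(1) by (metis exact_order_def norm_one norm_power)
    then show ?thesis using \<mu> by (metis exact_order_def norm_ge_zero power_eq_1_iff less_numeral_extra(3) real_norm_def abs_norm_cancel)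
  qed
  have Finv: "F (\<mu> * v) = F v" for v using inv[of "R v"] A[of v] by (simp add: F_def R_def)
  have "pcompose Q [:0, \<mu>:] = Polynomial.smult (\<mu> ^ d) Q"
  proof (rule poly_eqI_infinite[OF infinite_unit_circle])
    fix v :: complex assume "v \<in> {u. norm u = 1}"
    then have v: "norm v = 1" "norm (\<mu> * v) = 1" using n\<mu> by (auto simp: norm_mult)
    have "poly (pcompose Q [:0, \<mu>:]) v = poly Q (\<mu> * v)" by (simp add: poly_pcompose mult.commute)
    also have "\<dots> = \<mu> ^ d * (v ^ d * F v)" unfolding Q[OF v(2)] Finv by (simp add: power_mult_distrib)
    finally show "poly (pcompose Q [:0, \<mu>:]) v = poly (Polynomial.smult (\<mu> ^ d) Q) v" using Q[OF v(1)] by simp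
  qed
  then have co: "\<mu> ^ i * coeff Q i = \<mu> ^ d * coeff Q i" for i
    by (metis coeff_pcompose_linear coeff_smult)
  have bound: "coeff Q i = 0" if "i > 2 * d" for i
    unfolding Q_def using that by (auto simp: coeff_sum if_distrib[of "\<lambda>x. coeff x i"] intro!: sum.neutral)
  have \<mu>0: "\<mu> \<noteq> 0" using n\<mu> by auto
  \<comment> \<open>Invariance under \<mu> makes the power of \<mu> with exponent |i - d| equal to 1
    at a nonzero coefficient. This exponent is at most d, below the order m.\<close>
  have zero: "coeff Q i = 0" if "i \<noteq> d" for i
  proof (rule ccontr)
    assume nz: "coeff Q i \<noteq> 0"
    then have eq: "\<mu> ^ i = \<mu> ^ d" using co[of i] by simp
    have i: "i \<le> 2 * d" using bound nz by (meson not_le)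
    define e where "e = (if i < d then d - i else i - d)"
    have "\<mu> ^ e = 1"
    proof (cases "i < d")
      case True
      have "\<mu> ^ d = \<mu> ^ i * \<mu> ^ (d - i)" using True by (simp flip: power_add)
      then show ?thesis using eq \<mu>0 True by (simp add: e_def)
    next
      case False
      have "\<mu> ^ i = \<mu> ^ d * \<mu> ^ (i - d)" using False by (simp flip: power_add)
      then show ?thesis using eq \<mu>0 False by (simp add: e_def)
    qed
    moreover have "0 < e" "e < m" using that i \<mu>(2) by (auto simp: e_def)
    ultimately show False using \<mu>(1) by (auto simp: exact_order_def)
  qed
  have "Q = monom (coeff Q d) d" using zero by (intro poly_eqI) auto
  then have "v ^ d * F v = coeff Q d * v ^ d" if "norm v = 1" for v
    using Q[OF that] by (metis poly_monom)
  then have "F v = coeff Q d" if "norm v = 1" for v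
    using that by (metis mult.commute mult_cancel_left norm_zero power_eq_0_iff zero_neq_one)
  then have "F u = F 1" using u by simp
  then show ?thesis by (simp add: F_def R_def)
qed

lemma real_polynomial_function_dist2:
  fixes v :: "real^'n"
  shows "real_polynomial_function (\<lambda>x. (x - v) \<bullet> (x - v))"
proof -
  have "real_polynomial_function (\<lambda>x. \<Sum>i\<in>UNIV. (x $ i + (- (v $ i))) * (x $ i + (- (v $ i))))"
    by (intro real_polynomial_function_sum real_polynomial_function.intros bounded_linear_vec_nth) simp
  then show ?thesis by (simp add: inner_vec_def)
qed

lemma real_polynomial_function_prod':
  assumes "finite I" "\<And>i. i \<in> I \<Longrightarrow> real_polynomial_function (f i)"
  shows "real_polynomial_function (\<lambda>x. \<Prod>i\<in>I. f i x)"
  using assms by (induction I rule: finite_induct) (auto intro: real_polynomial_function.intros)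

lemma (in finite_coxeter_rep) invariant_degree_ge:
  assumes fi: "fundamental_invariants W f d" and A: "A \<in> W"
    and pq: "p \<noteq> 0 \<or> q \<noteq> 0"
      "A *v p = Re \<mu> *\<^sub>R p - Im \<mu> *\<^sub>R q" "A *v q = Im \<mu> *\<^sub>R p + Re \<mu> *\<^sub>R q"
    and m: "exact_order \<mu> m"
  shows "\<exists>i. m \<le> d i"
proof (rule ccontr)
  assume "\<not> ?thesis"
  then have small: "d i < m" for i by (meson not_le)
  define R where "R = (\<lambda>z. Re z *\<^sub>R p - Im z *\<^sub>R q)"
  have rot: "A *v R z = R (\<mu> * z)" for z
    by (simp add: R_def matrix_vector_mult_diff_distrib matrix_vector_mult_scaleR pq algebra_simps
        scaleR_add_left scaleR_diff_left)
  have const: "f i (R u) = f i p" if "norm u = 1" for i u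
    unfolding R_def
  proof (rule homogeneous_rotation_invariant_const[OF _ _ _ _ m small that])
    show "real_polynomial_function (f i)"
      using fi by (simp add: fundamental_invariants_def invariant_polynomials_def)
    show "f i (r *\<^sub>R x) = r ^ d i * f i x" for r x using fi by (simp add: fundamental_invariants_def)
    show "f i (A *v x) = f i x" for x
      using fi A by (simp add: fundamental_invariants_def invariant_polynomials_def)
  qed (use rot in \<open>simp add: R_def\<close>)
  \<comment> \<open>The product of the squared distances to the points of the orbit of p is
    invariant and vanishes exactly on this orbit. If all basic invariants were constant on the
    circle, the whole circle would lie in the finite orbit.\<close>
  define P where "P = (\<lambda>x. \<Prod>B\<in>W. (x - B *v p) \<bullet> (x - B *v p))"
  have "P \<in> invariant_polynomials W"
  proof -
    have "P (C *v x) = P x" if C: "C \<in> W" for C x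
    proof -
      have "P (C *v x) = (\<Prod>B\<in>W. (C *v x - (C ** B) *v p) \<bullet> (C *v x - (C ** B) *v p))"
        unfolding P_def
      proof (rule prod.reindex_bij_witness[of _ "\<lambda>B. C ** B" "\<lambda>B. inv\<^bsub>G\<^esub> C ** B"])
      qed (use C in \<open>auto simp: matrix_mul_assoc\<close>)
      also have "\<dots> = P x"
        unfolding P_def using W_inner[OF C]
        by (intro prod.cong refl) (simp flip: matrix_vector_mul_assoc matrix_vector_mult_diff_distrib)
      finally show ?thesis .
    qed
    moreover have "real_polynomial_function P"
      unfolding P_def by (intro real_polynomial_function_prod' fin_W real_polynomial_function_dist2)
    ultimately show ?thesis by (simp add: invariant_polynomials_def)
  qed
  then obtain g where g: "\<And>x. P x = g (\<chi> i. f i x)"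
    using fi by (auto simp: fundamental_invariants_def)
  have P0: "P p = 0" unfolding P_def using fin_W by (auto intro!: bexI[of _ "mat 1"])
  have "R u \<in> (\<lambda>B. B *v p) ` W" if "norm u = 1" for u
  proof -
    have "P (R u) = 0" using g const[OF that] P0 by simp
    then show ?thesis unfolding P_def using fin_W by auto
  qed
  then have "finite (R ` {u. norm u = 1})"
    by (intro finite_subset[OF _ finite_imageI[OF fin_W]]) auto
  moreover obtain i where i: "p $ i \<noteq> 0 \<or> q $ i \<noteq> 0" using pq(1) by (auto simp: vec_eq_iff)
  ultimately have "finite ((\<lambda>x. x $ i) ` R ` {u. norm u = 1})" by simp
  then have fin: "finite (range (\<lambda>t. cos t * (p $ i) - sin t * (q $ i)))"
  proof (rule rev_finite_subset, intro subsetI)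
    fix y assume "y \<in> range (\<lambda>t. cos t * (p $ i) - sin t * (q $ i))"
    then obtain t where "y = cos t * (p $ i) - sin t * (q $ i)" by blast
    then have "y = R (cis t) $ i" "cis t \<in> {u. norm u = 1}" by (simp_all add: R_def)
    then show "y \<in> (\<lambda>x. x $ i) ` R ` {u. norm u = 1}" by blast
  qed
  \<comment> \<open>A finite connected set of reals is a single point; the values at t = 0, pi and
    pi/2 then give \<open>p $ i = 0\<close> and \<open>q $ i = 0\<close>.\<close>
  have conn: "connected (range (\<lambda>t. cos t * (p $ i) - sin t * (q $ i)))"
    by (intro connected_continuous_image continuous_intros) simp
  then obtain y where y: "range (\<lambda>t. cos t * (p $ i) - sin t * (q $ i)) = {y}"
    using connected_finite_iff_sing[OF conn] fin by auto
  have "cos t * (p $ i) - sin t * (q $ i) = y" for t using y by auto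
  from this[of 0] this[of pi] this[of "pi / 2"] show False using i by auto
qed

section \<open>Regular elements and their centralizers\<close>

text \<open>The set is a coset of the centralizer, so it has h elements. Since c commutes with c',
  right multiplication by the inverse of c preserves it; the first h iterates of w0 are distinct
  because c has order h, so they exhaust it.\<close>

lemma (in group) conjugating_coset_periodic_orbit:
  assumes c: "c \<in> carrier G" "ord c = h" "h > 0"
    and cen: "card {z \<in> carrier G. z \<otimes> c = c \<otimes> z} = h"
    and w0: "w0 \<in> carrier G" "inv w0 \<otimes> c \<otimes> w0 = c'" and c': "c \<otimes> c' = c' \<otimes> c"
    and f: "\<And>w. w \<in> carrier G \<Longrightarrow> inv w \<otimes> c \<otimes> w = c' \<Longrightarrow> f w = w \<otimes> inv c"
  shows "periodic_orbit_on (carrier G) f {w \<in> carrier G. inv w \<otimes> c \<otimes> w = c'} \<and>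
    card {w \<in> carrier G. inv w \<otimes> c \<otimes> w = c'} = h"
proof -
  let ?O = "{w \<in> carrier G. inv w \<otimes> c \<otimes> w = c'}" and ?Z = "{z \<in> carrier G. z \<otimes> c = c \<otimes> z}"
  have c'in: "c' \<in> carrier G" using w0 c by auto
  have mem: "w \<in> ?O \<longleftrightarrow> w \<in> carrier G \<and> c \<otimes> w = w \<otimes> c'" for w
  proof (cases "w \<in> carrier G")
    case True
    then have "inv w \<otimes> c \<otimes> w = c' \<longleftrightarrow> c \<otimes> w = w \<otimes> c'"
      using c(1) c'in by (metis inv_closed inv_solve_left m_assoc m_closed)
    then show ?thesis using True by simp
  qed simp
  have "?O = (\<lambda>z. z \<otimes> w0) ` ?Z"
  proof (intro Set.set_eqI iffI)
    fix w assume w: "w \<in> ?O"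
    then have wc: "w \<in> carrier G" "c \<otimes> w = w \<otimes> c'" "c \<otimes> w0 = w0 \<otimes> c'" using mem w0 by auto
    let ?z = "w \<otimes> inv w0"
    have "c' \<otimes> inv w0 = inv w0 \<otimes> c"
      using wc(3) w0(1) c(1) c'in by (metis inv_closed inv_solve_left inv_solve_right m_assoc m_closed)
    then have "?z \<otimes> c = w \<otimes> (c' \<otimes> inv w0)" using wc w0 c by (simp add: m_assoc)
    also have "\<dots> = c \<otimes> ?z" using wc w0 c c'in by (simp add: m_assoc[symmetric])
    finally have "?z \<in> ?Z" using wc w0 by simp
    moreover have "w = ?z \<otimes> w0" using wc w0 by (simp add: m_assoc)
    ultimately show "w \<in> (\<lambda>z. z \<otimes> w0) ` ?Z" by blast
  next
    fix w assume "w \<in> (\<lambda>z. z \<otimes> w0) ` ?Z"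
    then obtain z where z: "z \<in> carrier G" "z \<otimes> c = c \<otimes> z" "w = z \<otimes> w0" by blast
    have "c \<otimes> w = z \<otimes> (c \<otimes> w0)" using z w0 c by (simp add: m_assoc[symmetric])
    also have "\<dots> = w \<otimes> c'" using z w0 c c'in mem[of w0] by (simp add: m_assoc)
    finally show "w \<in> ?O" using mem z w0 by simp
  qed
  moreover have "inj_on (\<lambda>z. z \<otimes> w0) ?Z" using w0 by (auto intro!: inj_onI)
  ultimately have cardO: "card ?O = h" using cen by (simp add: card_image)
  then have finO: "finite ?O" using c(3) card_ge_0_finite by metis
  have step: "w \<otimes> inv c \<in> ?O" if "w \<in> ?O" for w
  proof -
    have w: "w \<in> carrier G" "c \<otimes> w = w \<otimes> c'" using that mem by auto
    have "c' \<otimes> inv c = inv c \<otimes> c'"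
      using c' c(1) c'in by (metis inv_closed inv_solve_left inv_solve_right m_assoc m_closed)
    then have "c \<otimes> (w \<otimes> inv c) = w \<otimes> inv c \<otimes> c'"
      using w c c'in by (metis inv_closed m_assoc)
    then show ?thesis using mem w c by simp
  qed
  have iter: "(f ^^ i) w0 = w0 \<otimes> inv (c [^] i) \<and> (f ^^ i) w0 \<in> ?O" for i
  proof (induction i)
    case 0
    then show ?case using w0 by simp
  next
    case (Suc i)
    then have 1: "(f ^^ i) w0 \<in> ?O" and 2: "(f ^^ i) w0 = w0 \<otimes> inv (c [^] i)" by auto
    have "(f ^^ Suc i) w0 = (f ^^ i) w0 \<otimes> inv c" using f 1 by simp
    moreover have "w0 \<otimes> inv (c [^] i) \<otimes> inv c = w0 \<otimes> inv (c [^] Suc i)"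
    proof -
      have "c [^] Suc i = c \<otimes> c [^] i" using c(1) by (rule nat_pow_Suc2)
      then show ?thesis using c(1) w0(1) by (simp add: inv_mult_group m_assoc)
    qed
    ultimately show ?case using step[OF 1] 2 by simp
  qed
  have inj: "inj_on (\<lambda>i. (f ^^ i) w0) {..<h}"
  proof (rule inj_onI)
    fix i j assume ij: "i \<in> {..<h}" "j \<in> {..<h}" "(f ^^ i) w0 = (f ^^ j) w0"
    then have "w0 \<otimes> inv (c [^] i) = w0 \<otimes> inv (c [^] j)" using iter by simp
    then have "inv (c [^] i) = inv (c [^] j)" using w0(1) c(1) by simp
    then have "c [^] i = c [^] j" using c(1) by (metis inv_inv nat_pow_closed)
    moreover have "inj_on (\<lambda>x. c [^] x) {0..ord c - 1}" by (rule ord_inj[OF c(1)])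
    ultimately show "i = j" using ij c(2,3) by (auto simp: inj_on_def)
  qed
  have im: "(\<lambda>i. (f ^^ i) w0) ` {..<h} = ?O"
  proof (rule card_subset_eq[OF finO])
    show "(\<lambda>i. (f ^^ i) w0) ` {..<h} \<subseteq> ?O" using conjunct2[OF iter] by (rule image_subsetI)
    show "card ((\<lambda>i. (f ^^ i) w0) ` {..<h}) = card ?O" using inj cardO by (simp add: card_image)
  qed
  have orb: "?O = {(f ^^ i) w0 | i. True}"
  proof
    show "?O \<subseteq> {(f ^^ i) w0 | i. True}" unfolding im[symmetric] by blast
    show "{(f ^^ i) w0 | i. True} \<subseteq> ?O" using conjunct2[OF iter] by (intro subsetI) (elim CollectE exE conjE, simp only:)
  qed
  have "c [^] h = \<one>" using pow_ord_eq_1[OF c(1)] c(2) by simp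
  then have "(f ^^ h) w0 = w0" using conjunct1[OF iter, of h] w0(1) by simp
  then have "periodic f w0" unfolding periodic_def using c(3) by (intro exI[of _ h]) auto
  then show ?thesis unfolding periodic_orbit_on_def using w0(1) orb cardO by blast
qed

lemma exact_order_cis:
  assumes "M > 0"
  shows "exact_order (cis (2 * pi / M)) M"
proof -
  have bij: "bij_betw (\<lambda>k. cis (2 * pi * real k / real M)) {..<M} {z. z ^ M = 1}"
    using Complex.bij_betw_roots_unity[OF assms] by simp
  have pow: "cis (2 * pi / M) ^ j = cis (2 * pi * real j / real M)" for j
    unfolding Complex.DeMoivre by (simp add: mult.commute)
  have "cis (2 * pi / M) ^ j \<noteq> 1" if "0 < j" "j < M" for j
  proof
    assume "cis (2 * pi / M) ^ j = 1"
    then have "cis (2 * pi * real j / real M) = cis (2 * pi * real 0 / real M)" using pow by simp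
    then show False using inj_onD[OF bij_betw_imp_inj_on[OF bij], of j 0] that assms by simp
  qed
  moreover have "cis (2 * pi / M) ^ M = 1" using assms pow[of M] by simp
  ultimately show ?thesis using assms by (simp add: exact_order_def)
qed

section \<open>Lattices and cyclic vectors\<close>

definition lat :: "(nat \<Rightarrow> 'v::real_vector) \<Rightarrow> nat \<Rightarrow> 'v set" where
  "lat e N = {\<Sum>i<N. of_int (z i) *\<^sub>R e i | z :: nat \<Rightarrow> int. True}"

lemma lat_base [simp]: "i < N \<Longrightarrow> e i \<in> lat e N"
  unfolding lat_def
  by (intro CollectI exI[of _ "\<lambda>j. if j = i then 1 else 0"])
     (simp add: if_distrib[of "\<lambda>r. of_int r *\<^sub>R _"] sum.delta cong: if_cong)

lemma lat_0 [simp]: "0 \<in> lat e N"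
  unfolding lat_def by (intro CollectI exI[of _ "\<lambda>_. 0"]) simp

lemma lat_add: "x \<in> lat e N \<Longrightarrow> y \<in> lat e N \<Longrightarrow> x + y \<in> lat e N"
proof -
  assume "x \<in> lat e N" "y \<in> lat e N"
  then obtain z z' where "x = (\<Sum>i<N. of_int (z i) *\<^sub>R e i)" "y = (\<Sum>i<N. of_int (z' i) *\<^sub>R e i)"
    by (auto simp: lat_def)
  then have "x + y = (\<Sum>i<N. of_int (z i + z' i) *\<^sub>R e i)"
    by (simp add: sum.distrib scaleR_add_left)
  then show ?thesis unfolding lat_def by (intro CollectI exI[of _ "\<lambda>i. z i + z' i"]) simp
qed

lemma lat_scale: "x \<in> lat e N \<Longrightarrow> of_int a *\<^sub>R x \<in> lat e N"
proof -
  assume "x \<in> lat e N"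
  then obtain z where "x = (\<Sum>i<N. of_int (z i) *\<^sub>R e i)" by (auto simp: lat_def)
  then have "of_int a *\<^sub>R x = (\<Sum>i<N. of_int (a * z i) *\<^sub>R e i)"
    by (simp add: scaleR_sum_right)
  then show ?thesis unfolding lat_def by (intro CollectI exI[of _ "\<lambda>i. a * z i"]) simp
qed

lemma lat_sum: "(\<And>i. i \<in> I \<Longrightarrow> f i \<in> lat e N) \<Longrightarrow> sum f I \<in> lat e N"
  by (induction I rule: infinite_finite_induct) (auto intro: lat_add)

lemma lat_stable:
  assumes "linear f" "\<And>i. i < N \<Longrightarrow> f (e i) \<in> lat e N" "x \<in> lat e N"
  shows "f x \<in> lat e N"
proof -
  obtain z where "x = (\<Sum>i<N. of_int (z i) *\<^sub>R e i)" using assms(3) by (auto simp: lat_def)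
  then have "f x = (\<Sum>i<N. of_int (z i) *\<^sub>R f (e i))"
    by (simp add: linear_sum[OF assms(1)] linear_cmul[OF assms(1)])
  then show ?thesis using assms(2) by (auto intro!: lat_sum lat_scale)
qed

lemma lat_dependent:
  assumes "finite J" "card J > N" "\<And>j. j \<in> J \<Longrightarrow> v j \<in> lat e N"
  shows "\<exists>u :: _ \<Rightarrow> int. (\<exists>j\<in>J. u j \<noteq> 0) \<and> (\<Sum>j\<in>J. of_int (u j) *\<^sub>R v j) = 0"
proof -
  obtain z where z: "\<And>j. j \<in> J \<Longrightarrow> v j = (\<Sum>i<N. of_int (z j i) *\<^sub>R e i)"
    using assms(3) unfolding lat_def by simp metis
  obtain u where u: "\<exists>j\<in>J. u j \<noteq> 0" "\<forall>i<N. (\<Sum>j\<in>J. u j * z j i) = 0"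
    using int_vectors_dependent[OF assms(1,2), of z] by blast
  have "(\<Sum>j\<in>J. of_int (u j) *\<^sub>R v j) = (\<Sum>j\<in>J. \<Sum>i<N. of_int (u j * z j i) *\<^sub>R e i)"
    by (intro sum.cong refl) (simp add: z scaleR_sum_right)
  also have "\<dots> = (\<Sum>i<N. of_int (\<Sum>j\<in>J. u j * z j i) *\<^sub>R e i)"
    by (subst sum.swap) (simp add: scaleR_sum_left)
  also have "\<dots> = 0" using u(2) by simp
  finally show ?thesis using u(1) by blast
qed

lemma lat_iterate:
  assumes "\<And>x. x \<in> lat e N \<Longrightarrow> f x \<in> lat e N" "x \<in> lat e N"
  shows "(f ^^ j) x \<in> lat e N"
  by (induction j) (use assms in auto)

lemma poly_of_coeffs:
  fixes u :: "nat \<Rightarrow> int"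
  obtains P where "degree P \<le> M" "\<And>j. j \<le> M \<Longrightarrow> coeff P j = u j"
proof (rule that)
  let ?P = "\<Sum>j\<le>M. monom (u j) j"
  show "degree ?P \<le> M" by (intro degree_sum_le) (auto intro: order_trans[OF degree_monom_le])
  show "coeff ?P j = u j" if "j \<le> M" for j using that by (simp add: coeff_sum)
qed

text \<open>The N + 1 vectors x, f x, ..., \<open>(f ^^ N) x\<close> are dependent over the
  integers. The generators e may be linearly dependent over the reals, as are the eight generators
  used for H4.\<close>

lemma lat_annihilator:
  assumes "linear f" "\<And>x. x \<in> lat e N \<Longrightarrow> f x \<in> lat e N" "x \<in> lat e N"
  obtains P where "P \<noteq> 0" "degree P \<le> N" "papp P f x = 0"
proof -
  obtain u :: "nat \<Rightarrow> int" where u: "\<exists>j\<in>{..N}. u j \<noteq> 0" "(\<Sum>j\<in>{..N}. of_int (u j) *\<^sub>R (f ^^ j) x) = 0"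
    using lat_dependent[of "{..N}" N "\<lambda>j. (f ^^ j) x" e] lat_iterate[OF assms(2,3)] by auto
  obtain P where P: "degree P \<le> N" "\<And>j. j \<le> N \<Longrightarrow> coeff P j = u j"
    by (rule poly_of_coeffs[of N u]) blast
  have "papp P f x = 0" using papp_sum_coeffs[OF assms(1) P(1)] u(2) P(2) by simp
  moreover have "P \<noteq> 0" using u(1) P(2) by force
  ultimately show ?thesis using that P by blast
qed

text \<open>The vectors y, x, f x, ... up to exponent N - 1 are dependent over the integers, and y
  occurs with nonzero coefficient because x has no annihilator of degree below N. The bound
  \<open>max N 1\<close> accounts for N = 0, where P = 0 still has degree 0.\<close>

lemma lat_multiple_in_cyclic:
  assumes "linear f" "\<And>x. x \<in> lat e N \<Longrightarrow> f x \<in> lat e N" "x \<in> lat e N"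
    and min: "\<And>P. P \<noteq> 0 \<Longrightarrow> papp P f x = 0 \<Longrightarrow> N \<le> degree P" and y: "y \<in> lat e N"
  obtains a P where "a \<noteq> 0" "of_int a *\<^sub>R y = papp P f x" "degree P < max N 1"
proof -
  let ?v = "\<lambda>j. if j = N then y else (f ^^ j) x"
  have "?v j \<in> lat e N" for j using lat_iterate[of e N f x, OF assms(2,3)] y by simp
  then have "\<exists>u :: nat \<Rightarrow> int. (\<exists>j\<in>{..N}. u j \<noteq> 0) \<and> (\<Sum>j\<in>{..N}. of_int (u j) *\<^sub>R ?v j) = 0"
    by (intro lat_dependent[of "{..N}" N ?v e]) simp_all
  then obtain u :: "nat \<Rightarrow> int" where u: "\<exists>j\<in>{..N}. u j \<noteq> 0" "(\<Sum>j\<in>{..N}. of_int (u j) *\<^sub>R ?v j) = 0"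
    by blast
  obtain P where P: "degree P \<le> N - 1" "\<And>j. j \<le> N - 1 \<Longrightarrow> coeff P j = (if j < N then u j else 0)"
    by (rule poly_of_coeffs[of "N - 1" "\<lambda>j. if j < N then u j else 0"]) blast
  have "papp P f x = (\<Sum>j<N. of_int (u j) *\<^sub>R (f ^^ j) x)"
  proof (cases N)
    case 0
    then show ?thesis using papp_sum_coeffs[OF assms(1) P(1)] P(2) by simp
  next
    case (Suc M)
    then show ?thesis using papp_sum_coeffs[OF assms(1) P(1)] P(2) by (simp add: lessThan_Suc_atMost)
  qed
  moreover have "(\<Sum>j\<in>{..N}. of_int (u j) *\<^sub>R ?v j) = (\<Sum>j<N. of_int (u j) *\<^sub>R (f ^^ j) x) + of_int (u N) *\<^sub>R y"
    by (simp flip: lessThan_Suc_atMost)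
  ultimately have eq: "papp P f x + of_int (u N) *\<^sub>R y = 0" using u(2) by simp
  have "u N \<noteq> 0"
  proof
    assume "u N = 0"
    then have z: "papp P f x = 0" using eq by simp
    obtain j where j: "j \<le> N" "u j \<noteq> 0" using u(1) by auto
    then have "j < N" using \<open>u N = 0\<close> by (metis le_neq_implies_less)
    then have "coeff P j \<noteq> 0" using P(2)[of j] j by simp
    then have "P \<noteq> 0" by auto
    then show False using min[OF _ z] P(1) \<open>j < N\<close> by simp
  qed
  moreover have "of_int (- u N) *\<^sub>R y = papp P f x" using eq by (simp add: add_eq_0_iff2)
  moreover have "degree P < max N 1" using P(1) by auto
  ultimately show ?thesis using that[of "- u N" P] by auto
qed

lemma papp_in_span_iterates:
  assumes "linear f" "degree P < N"
  shows "papp P f x \<in> span ((\<lambda>j. (f ^^ j) x) ` {..<N})"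
proof -
  have "papp P f x = (\<Sum>j\<le>degree P. of_int (coeff P j) *\<^sub>R (f ^^ j) x)"
    by (rule papp_sum_coeffs) (use assms in auto)
  also have "\<dots> \<in> span ((\<lambda>j. (f ^^ j) x) ` {..<N})"
    using assms(2) by (intro span_sum span_scale span_base) auto
  finally show ?thesis .
qed

lemma lat_cyclic_span:
  assumes "linear f" "\<And>x. x \<in> lat e N \<Longrightarrow> f x \<in> lat e N" "x \<in> lat e N"
    and min: "\<And>P. P \<noteq> 0 \<Longrightarrow> papp P f x = 0 \<Longrightarrow> N \<le> degree P"
    and sp: "span (e ` {..<N}) = UNIV" and N: "N > 0"
  shows "span ((\<lambda>j. (f ^^ j) x) ` {..<N}) = UNIV"
proof -
  have "e i \<in> span ((\<lambda>j. (f ^^ j) x) ` {..<N})" if i: "i < N" for i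
  proof -
    obtain a P where aP: "a \<noteq> 0" "of_int a *\<^sub>R e i = papp P f x" "degree P < max N 1"
      by (rule lat_multiple_in_cyclic[OF assms(1-3) _ lat_base[OF i]]) (use min in auto)
    have "e i = (1 / of_int a) *\<^sub>R papp P f x" using aP(1) by (simp flip: aP(2))
    then show ?thesis using papp_in_span_iterates[OF assms(1), of P N x] aP(3) N
      by (simp add: span_scale)
  qed
  then have "span (e ` {..<N}) \<subseteq> span ((\<lambda>j. (f ^^ j) x) ` {..<N})"
    by (intro span_minimal) auto
  then show ?thesis using sp by auto
qed

context finite_coxeter_rep
begin

section \<open>Regular eigenfunctionals and the centralizer\<close>

lemma pow_in_W [simp]: "c \<in> W \<Longrightarrow> c [^]\<^bsub>G\<^esub> (j::nat) \<in> W"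
  using monoid.nat_pow_closed[OF group.is_monoid[OF group_G]] .

lemma pow_apply: "c \<in> W \<Longrightarrow> (c [^]\<^bsub>G\<^esub> (j::nat)) *v x = (((*v) c) ^^ j) x"
proof (induction j arbitrary: x)
  case 0
  then show ?case using monoid.nat_pow_0[OF group.is_monoid[OF group_G]] by simp
next
  case (Suc j)
  have "c [^]\<^bsub>G\<^esub> Suc j = c ** c [^]\<^bsub>G\<^esub> j"
    using monoid.nat_pow_Suc2[OF group.is_monoid[OF group_G] Suc.prems] by simp
  then show ?case using Suc by (simp flip: matrix_vector_mul_assoc)
qed

lemma iterate_root: "c \<in> W \<Longrightarrow> b \<in> roots \<Longrightarrow> (((*v) c) ^^ j) b \<in> roots"
  by (induction j) auto

text \<open>The dual form of a regular eigenvector: pairing with a vector off all reflecting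
  hyperplanes gives a functional without zeros among the roots.\<close>

definition regular_functional :: "(real^'n \<Rightarrow> complex) \<Rightarrow> bool" where
  "regular_functional \<psi> \<longleftrightarrow> linear \<psi> \<and> (\<forall>b\<in>roots. \<psi> b \<noteq> 0)"

lemma roots_nonempty: "\<alpha> 0 \<in> roots"
  using card_n by (intro simple_root) (metis zero_less_card_finite)

text \<open>\<open>\<psi>\<close> is the bilinear pairing with the eigenvector. Moving c to the
  other side inverts it, so \<nu> is the inverse of the given eigenvalue.\<close>

lemma regular_element_functional:
  assumes "c \<in> W" "regular_element T c"
  obtains \<psi> \<nu> where "regular_functional \<psi>" "\<And>x. \<psi> (c *v x) = \<nu> * \<psi> x"
proof -
  obtain v \<mu> where v: "complexify c *v v = \<mu> *s v" "\<And>t. t \<in> T \<Longrightarrow> v \<notin> reflecting_hyperplane t"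
    using assms(2) by (auto simp: regular_element_def)
  define p q where "p = (\<chi> i. Re (v $ i))" "q = (\<chi> i. Im (v $ i))"
  have vpq: "v = cvec p q" unfolding p_q_def by (rule cvec_collapse)
  define \<psi> where "\<psi> = (\<lambda>x. Complex (p \<bullet> x) (q \<bullet> x))"
  have lin: "linear \<psi>"
    by (rule linearI) (auto simp: \<psi>_def inner_add_right complex_eq_iff)
  have root: "\<psi> b \<noteq> 0" if b: "b \<in> roots" for b
  proof
    assume "\<psi> b = 0"
    then have "b \<bullet> p = 0" "b \<bullet> q = 0" by (auto simp: \<psi>_def complex_eq_iff inner_commute)
    then have "complexify (reflection_matrix b) *v v = v"
      unfolding vpq complexify_cvec
      using reflection_unit_fixed_iff[OF root_unit[OF b], of p] reflection_unit_fixed_iff[OF root_unit[OF b], of q] by metis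
    then show False using v(2)[of "reflection_matrix b"] T_iff b by (auto simp: reflecting_hyperplane_def)
  qed
  have eig: "c *v p = Re \<mu> *\<^sub>R p - Im \<mu> *\<^sub>R q" "c *v q = Im \<mu> *\<^sub>R p + Re \<mu> *\<^sub>R q"
    using v(1) unfolding vpq complexify_cvec scalar_cvec cvec_eq_iff by auto
  have inv: "\<psi> (inv\<^bsub>G\<^esub> c *v x) = \<mu> * \<psi> x" for x
    using W_inner_inv[OF assms(1), of p x] W_inner_inv[OF assms(1), of q x]
    by (simp add: \<psi>_def eig complex_eq_iff inner_diff_left inner_add_left)
  have "\<mu> \<noteq> 0"
  proof
    assume "\<mu> = 0"
    then have "\<psi> (inv\<^bsub>G\<^esub> c *v \<alpha> 0) = 0" using inv by simp
    then show False using root roots_nonempty assms(1) by simp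
  qed
  moreover have "\<psi> x = \<mu> * \<psi> (c *v x)" for x using inv[of "c *v x"] assms(1) by simp
  ultimately have "\<psi> (c *v x) = inverse \<mu> * \<psi> x" for x by (metis mult.assoc left_inverse mult_1)
  moreover have "regular_functional \<psi>" unfolding regular_functional_def using lin root by blast
  ultimately show ?thesis by (rule that[rotated])
qed

text \<open>For A \<noteq> 1 the moved space contains a root b = A x - x, and \<psi> would vanish at
  it.\<close>

lemma regular_functional_stabilizer:
  assumes "regular_functional \<psi>" "A \<in> W" "\<And>x. \<psi> (A *v x) = \<psi> x"
  shows "A = mat 1"
proof (rule ccontr)
  assume "A \<noteq> mat 1"
  then obtain b x where b: "b \<in> roots" "b = A *v x - x" using root_in_range[OF assms(2)] by metis
  then have "\<psi> b = 0" using assms by (simp add: regular_functional_def linear_diff)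
  then show False using assms(1) b by (simp add: regular_functional_def)
qed

lemma regular_functional_pow:
  fixes \<psi> :: "real^'n \<Rightarrow> complex"
  assumes "c \<in> W" "\<And>x. \<psi> (c *v x) = \<nu> * \<psi> x"
  shows "\<psi> (c [^]\<^bsub>G\<^esub> (j::nat) *v x) = \<nu> ^ j * \<psi> x"
  unfolding pow_apply[OF assms(1)] by (induction j) (auto simp: assms)

lemma ord_pos: "c \<in> W \<Longrightarrow> group.ord G c > 0"
  using group.ord_ge_1[OF group_G fin_W] by fastforce

lemma regular_exact_order:
  assumes "regular_functional \<psi>" "c \<in> W" "\<And>x. \<psi> (c *v x) = \<nu> * \<psi> x"
  shows "exact_order \<nu> (group.ord G c)"
proof -
  have iff: "\<nu> ^ j = 1 \<longleftrightarrow> c [^]\<^bsub>G\<^esub> j = mat 1" for j :: nat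
  proof
    assume "\<nu> ^ j = 1"
    then show "c [^]\<^bsub>G\<^esub> j = mat 1"
      using regular_functional_stabilizer[OF assms(1), of "c [^]\<^bsub>G\<^esub> j"] regular_functional_pow[OF assms(2), of \<psi> \<nu>]
        assms(2,3) by simp
  next
    assume "c [^]\<^bsub>G\<^esub> j = mat 1"
    then have "\<psi> (\<alpha> 0) = \<nu> ^ j * \<psi> (\<alpha> 0)"
      using regular_functional_pow[of c \<psi> \<nu> j "\<alpha> 0"] assms(2,3) by simp
    then show "\<nu> ^ j = 1" using assms(1) roots_nonempty by (simp add: regular_functional_def)
  qed
  have "c [^]\<^bsub>G\<^esub> j = mat 1 \<longleftrightarrow> group.ord G c dvd j" for j :: nat
    using group.pow_eq_id[OF group_G assms(2), of j] by simp
  then show ?thesis unfolding exact_order_def iff using ord_pos[OF assms(2)] nat_dvd_not_less by auto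
qed

text \<open>Applied to c itself and, in \<open>cyclic_centralizer\<close>, to any element of W with
  eigenfunctional \<psi>: an annihilator of a root in the lattice has degree at most N and vanishes
  at the eigenvalue.\<close>

lemma regular_totient_bound:
  assumes "regular_functional \<psi>" "c \<in> W" "\<And>x. \<psi> (c *v x) = \<nu> * \<psi> x"
    and "exact_order \<nu> m" "b \<in> roots" "b \<in> lat e N" "\<And>x. x \<in> lat e N \<Longrightarrow> c *v x \<in> lat e N"
  shows "totient m \<le> N"
proof -
  obtain P where P: "P \<noteq> 0" "degree P \<le> N" "papp P ((*v) c) b = 0"
    using lat_annihilator[OF matrix_vector_mul_linear assms(7,6)] by blast
  have "ieval P \<nu> * \<psi> b = 0"
    using papp_eigen[of "(*v) c" \<psi> \<nu> P b] assms(1,3) P(3)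
    by (simp add: regular_functional_def matrix_vector_mul_linear linear_0)
  then have "ieval P \<nu> = 0" using assms(1,5) by (auto simp: regular_functional_def)
  then show ?thesis using totient_le_degree[OF assms(4) P(1)] P(2) by simp
qed

text \<open>As the orbit of b spans, an element commuting with c multiplies \<psi> by a scalar
  \<open>lam z\<close>, and \<open>lam\<close> is injective by regularity. Its image consists of M
  distinct M-th roots of unity, where M is the size of the centralizer, so it contains a primitive
  one. The order of c divides M, and \<open>bound\<close> gives M = h.\<close>

lemma centralizer_card:
  assumes \<psi>: "regular_functional \<psi>" "c \<in> W" "\<And>x. \<psi> (c *v x) = \<nu> * \<psi> x" and h: "group.ord G c = h"
    and b: "b \<in> roots" "span ((\<lambda>j. (((*v) c) ^^ j) b) ` {..<N}) = UNIV"
    and bound: "\<And>z \<kappa> M. z \<in> W \<Longrightarrow> (\<And>x. \<psi> (z *v x) = \<kappa> * \<psi> x) \<Longrightarrow> exact_order \<kappa> M \<Longrightarrow> h dvd M \<Longrightarrow> M = h"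
  shows "card {z \<in> W. z ** c = c ** z} = h"
proof -
  let ?Z = "{z \<in> W. z ** c = c ** z}"
  define lam where "lam = (\<lambda>z. \<psi> (z *v b) / \<psi> b)"
  have lin: "linear \<psi>" and b0: "\<psi> b \<noteq> 0" using \<psi>(1) b(1) by (auto simp: regular_functional_def)
  have lam: "\<psi> (z *v x) = lam z * \<psi> x" if z: "z \<in> ?Z" for z x
  proof -
    have comm: "z *v (((*v) c) ^^ j) b = (((*v) c) ^^ j) (z *v b)" for j
    proof (induction j)
      case (Suc j)
      have "z *v (c *v y) = c *v (z *v y)" for y using z by (simp add: matrix_vector_mul_assoc)
      then show ?case using Suc by simp
    qed simp
    have pw: "\<psi> ((((*v) c) ^^ j) y) = \<nu> ^ j * \<psi> y" for j y
      by (induction j) (auto simp: \<psi>(3))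
    have "\<psi> (z *v x) - lam z * \<psi> x = 0"
    proof (rule span_induct[of x "(\<lambda>j. (((*v) c) ^^ j) b) ` {..<N}" "\<lambda>x. \<psi> (z *v x) - lam z * \<psi> x = 0"])
      show "x \<in> span ((\<lambda>j. (((*v) c) ^^ j) b) ` {..<N})" using b(2) by simp
      show "subspace {x. \<psi> (z *v x) - lam z * \<psi> x = 0}"
        by (auto simp: subspace_def linear_0[OF lin] linear_add[OF lin] linear_cmul[OF lin]
            matrix_vector_right_distrib matrix_vector_mult_scaleR algebra_simps)
    next
      fix y assume "y \<in> (\<lambda>j. (((*v) c) ^^ j) b) ` {..<N}"
      then obtain j where "y = (((*v) c) ^^ j) b" by blast
      then show "\<psi> (z *v y) - lam z * \<psi> y = 0" using b0 by (simp add: comm pw lam_def)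
    qed
    then show ?thesis by simp
  qed
  have fin: "finite ?Z" using fin_W by simp
  have one: "mat 1 \<in> ?Z" by simp
  have mul: "x ** y \<in> ?Z" if "x \<in> ?Z" "y \<in> ?Z" for x y
    using that by simp (metis matrix_mul_assoc)
  have invZ: "inv\<^bsub>G\<^esub> z \<in> ?Z" if "z \<in> ?Z" for z
  proof -
    have zc: "z \<in> W" "z ** c = c ** z" using that by auto
    have "inv\<^bsub>G\<^esub> z ** c = inv\<^bsub>G\<^esub> z ** c ** (z ** inv\<^bsub>G\<^esub> z)" using zc by simp
    also have "\<dots> = inv\<^bsub>G\<^esub> z ** (c ** z) ** inv\<^bsub>G\<^esub> z" by (simp only: matrix_mul_assoc)
    also have "\<dots> = (inv\<^bsub>G\<^esub> z ** z) ** c ** inv\<^bsub>G\<^esub> z" unfolding zc(2)[symmetric] by (simp only: matrix_mul_assoc)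
    also have "\<dots> = c ** inv\<^bsub>G\<^esub> z" using zc by simp
    finally show ?thesis using that by simp
  qed
  have lam_mult: "lam (x ** y) = lam x * lam y" if "x \<in> ?Z" "y \<in> ?Z" for x y
    using lam[OF mul[OF that], of b] lam[OF that(1), of "y *v b"] lam[OF that(2), of b] b0
    by (simp flip: matrix_vector_mul_assoc)
  have lam0: "lam z \<noteq> 0" if "z \<in> ?Z" for z
    using lam_mult[OF that invZ[OF that]] b0 that by (auto simp: lam_def)
  have inj: "inj_on lam ?Z"
  proof (rule inj_onI)
    fix x y assume xy: "x \<in> ?Z" "y \<in> ?Z" "lam x = lam y"
    have "lam (inv\<^bsub>G\<^esub> y ** x) = lam (inv\<^bsub>G\<^esub> y ** y)"
      unfolding lam_mult[OF invZ[OF xy(2)] xy(1)] lam_mult[OF invZ[OF xy(2)] xy(2)] xy(3) ..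
    also have "\<dots> = 1" using xy b0 by (simp add: lam_def)
    finally have "inv\<^bsub>G\<^esub> y ** x = mat 1"
      using regular_functional_stabilizer[OF \<psi>(1), of "inv\<^bsub>G\<^esub> y ** x"] lam[OF mul[OF invZ[OF xy(2)] xy(1)]] xy by simp
    then have "y ** (inv\<^bsub>G\<^esub> y ** x) = y" by simp
    moreover have "y ** (inv\<^bsub>G\<^esub> y ** x) = x" using xy(2) by (subst matrix_mul_assoc) simp
    ultimately show "x = y" by simp
  qed
  define M where "M = card ?Z"
  have "?Z \<noteq> {}" using one by blast
  then have M0: "M > 0" unfolding M_def using fin by (simp add: card_gt_0_iff)
  \<comment> \<open>Multiplication by z permutes the centralizer, so the product of all values of
    \<open>lam\<close> equals itself times \<open>lam z ^ M\<close>.\<close>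
  have pow1: "lam z ^ M = 1" if z: "z \<in> ?Z" for z
  proof -
    have "(\<Prod>y\<in>?Z. lam y) = (\<Prod>y\<in>?Z. lam (z ** y))"
      by (rule prod.reindex_bij_witness[of _ "\<lambda>y. z ** y" "\<lambda>y. inv\<^bsub>G\<^esub> z ** y"])
         (use z mul invZ in \<open>auto simp: matrix_mul_assoc\<close>)
    also have "\<dots> = (\<Prod>y\<in>?Z. lam z * lam y)" using lam_mult z by (intro prod.cong) auto
    also have "\<dots> = lam z ^ M * (\<Prod>y\<in>?Z. lam y)" by (simp add: prod.distrib M_def)
    finally have "(\<Prod>y\<in>?Z. lam y) = lam z ^ M * (\<Prod>y\<in>?Z. lam y)" .
    moreover have "(\<Prod>y\<in>?Z. lam y) \<noteq> 0" using lam0 prod_zero_iff[OF fin, of lam] by blast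
    ultimately show ?thesis by simp
  qed
  have "lam ` ?Z = {z. z ^ M = 1}"
  proof (rule card_subset_eq)
    show "finite {z::complex. z ^ M = 1}" using M0 by (intro finite_nth_roots)
    show "lam ` ?Z \<subseteq> {z. z ^ M = 1}" using pow1 by blast
    show "card (lam ` ?Z) = card {z::complex. z ^ M = 1}"
      using inj M0 by (simp add: card_image M_def[symmetric] card_roots_unity_eq)
  qed
  moreover have ex: "exact_order (cis (2 * pi / M)) M" by (rule exact_order_cis[OF M0])
  moreover have "cis (2 * pi / M) \<in> {z. z ^ M = 1}" using ex by (simp add: exact_order_def)
  ultimately have "cis (2 * pi / M) \<in> lam ` ?Z" by blast
  then obtain z where z: "z \<in> ?Z" "lam z = cis (2 * pi / M)" by (rule imageE) simp
  have "c \<in> ?Z" using \<psi>(2) by simp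
  moreover have "lam c = \<nu>" using \<psi>(3) b0 by (simp add: lam_def)
  ultimately have "h dvd M"
    using pow1[of c] exact_order_pow_eq_1_iff[OF regular_exact_order[OF \<psi>]] h by simp
  then have "M = h" using bound[of z "cis (2 * pi / M)" M] lam[OF z(1)] z ex by simp
  then show ?thesis by (simp add: M_def)
qed

lemma sum_iterates_telescope:
  "(\<Sum>i<k. (((*v) c) ^^ i) (c *v x - x)) = (((*v) c) ^^ k) x - (x :: real^'n)"
proof (induction k)
  case (Suc k)
  have "(((*v) c) ^^ k) (c *v x - x) = (((*v) c) ^^ Suc k) x - (((*v) c) ^^ k) x"
    by (induction k) (simp_all add: matrix_vector_mult_diff_distrib)
  then show ?case using Suc by simp
qed simp

theorem pop_periodic_orbits:
  assumes c: "c \<in> W" "group.ord G c = h" "fixsp c = {0}"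
    and cen: "card {z \<in> W. z ** c = c ** z} = h"
    and nr: "\<And>k b. 1 < k \<Longrightarrow> k < h - 1 \<Longrightarrow> coprime k h \<Longrightarrow> b \<in> roots \<Longrightarrow>
      (\<Sum>i<k. (((*v) c) ^^ i) b) \<notin> roots"
    and ex: "\<exists>k>1. k < h - 1 \<and> coprime k h \<and> (\<exists>g\<in>W. c ** g = g ** c [^]\<^bsub>G\<^esub> k)"
  shows "(\<exists>Orb. periodic_orbit_on W (\<lambda>w. PopT G T w c) Orb \<and> card Orb = h) \<and>
    (\<forall>k::int. coprime k (int h) \<longrightarrow>
       \<not> [k = 1] (mod int h) \<longrightarrow> \<not> [k = - 1] (mod int h) \<longrightarrow>
       (\<exists>g\<in>W. g \<otimes>\<^bsub>G\<^esub> c \<otimes>\<^bsub>G\<^esub> inv\<^bsub>G\<^esub> g = c [^]\<^bsub>G\<^esub> k) \<longrightarrow>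
       periodic_orbit_on W (\<lambda>w. PopT G T w c)
         {w \<in> W. inv\<^bsub>G\<^esub> w \<otimes>\<^bsub>G\<^esub> c \<otimes>\<^bsub>G\<^esub> w = c [^]\<^bsub>G\<^esub> k} \<and>
       card {w \<in> W. inv\<^bsub>G\<^esub> w \<otimes>\<^bsub>G\<^esub> c \<otimes>\<^bsub>G\<^esub> w = c [^]\<^bsub>G\<^esub> k} = h)"
proof -
  interpret gr: group G by (rule group_G)
  have h0: "h > 0" using ord_pos c by auto
  have main: "periodic_orbit_on W (\<lambda>w. PopT G T w c)
         {w \<in> W. inv\<^bsub>G\<^esub> w \<otimes>\<^bsub>G\<^esub> c \<otimes>\<^bsub>G\<^esub> w = c [^]\<^bsub>G\<^esub> k} \<and>
       card {w \<in> W. inv\<^bsub>G\<^esub> w \<otimes>\<^bsub>G\<^esub> c \<otimes>\<^bsub>G\<^esub> w = c [^]\<^bsub>G\<^esub> k} = h"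
    if k: "1 < k" "k < h - 1" "coprime k h" and g: "g \<in> W" "inv\<^bsub>G\<^esub> g \<otimes>\<^bsub>G\<^esub> c \<otimes>\<^bsub>G\<^esub> g = c [^]\<^bsub>G\<^esub> k" for k :: nat and g
  proof (rule gr.conjugating_coset_periodic_orbit[OF c(1,2) h0 _ g])
    show "card {z \<in> W. z \<otimes>\<^bsub>G\<^esub> c = c \<otimes>\<^bsub>G\<^esub> z} = h" using cen by simp
    show "c \<otimes>\<^bsub>G\<^esub> c [^]\<^bsub>G\<^esub> k = c [^]\<^bsub>G\<^esub> k \<otimes>\<^bsub>G\<^esub> c"
      using gr.nat_pow_Suc2[OF c(1), of k] gr.nat_pow_Suc[of c k] by simp
    fix w assume w: "w \<in> W" "inv\<^bsub>G\<^esub> w \<otimes>\<^bsub>G\<^esub> c \<otimes>\<^bsub>G\<^esub> w = c [^]\<^bsub>G\<^esub> k"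
    have "nc_proj G T w c = c"
    proof (rule nc_proj_eq_coxeter[OF c(1,3) w(1)])
      fix x assume x: "w *v x = x"
      show "c *v x - x \<notin> roots"
      proof
        assume b: "c *v x - x \<in> roots"
        have iw: "inv\<^bsub>G\<^esub> w *v x = x" using x w(1) by (metis inv_apply(1))
        have "(c [^]\<^bsub>G\<^esub> k) *v x = inv\<^bsub>G\<^esub> w *v (c *v (w *v x))"
          using w(2) by (simp add: matrix_vector_mul_assoc matrix_mul_assoc flip: w(2))
        then have "inv\<^bsub>G\<^esub> w *v (c *v x - x) = (((*v) c) ^^ k) x - x"
          using x iw by (simp add: matrix_vector_mult_diff_distrib pow_apply[OF c(1)])
        also have "\<dots> = (\<Sum>i<k. (((*v) c) ^^ i) (c *v x - x))" by (rule sum_iterates_telescope[symmetric])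
        finally have "(\<Sum>i<k. (((*v) c) ^^ i) (c *v x - x)) \<in> roots" using b w(1) by (metis W_root inv_in_W)
        then show False using nr[OF k b] by simp
      qed
    qed
    then show "PopT G T w c = w \<otimes>\<^bsub>G\<^esub> inv\<^bsub>G\<^esub> c" by (simp add: PopT_def)
  qed
  obtain k g where kg: "1 < k" "k < h - 1" "coprime k h" "g \<in> W" "c ** g = g ** c [^]\<^bsub>G\<^esub> k"
    using ex by blast
  have "inv\<^bsub>G\<^esub> g \<otimes>\<^bsub>G\<^esub> c \<otimes>\<^bsub>G\<^esub> g = c [^]\<^bsub>G\<^esub> k"
  proof -
    have "inv\<^bsub>G\<^esub> g ** (c ** g) = (inv\<^bsub>G\<^esub> g ** g) ** c [^]\<^bsub>G\<^esub> k" unfolding kg(5) by (simp add: matrix_mul_assoc)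
    then show ?thesis using kg(4) by (simp add: matrix_mul_assoc)
  qed
  then have first: "\<exists>Orb. periodic_orbit_on W (\<lambda>w. PopT G T w c) Orb \<and> card Orb = h"
    using main kg(1-4) by blast
  have second: "periodic_orbit_on W (\<lambda>w. PopT G T w c)
         {w \<in> W. inv\<^bsub>G\<^esub> w \<otimes>\<^bsub>G\<^esub> c \<otimes>\<^bsub>G\<^esub> w = c [^]\<^bsub>G\<^esub> k} \<and>
       card {w \<in> W. inv\<^bsub>G\<^esub> w \<otimes>\<^bsub>G\<^esub> c \<otimes>\<^bsub>G\<^esub> w = c [^]\<^bsub>G\<^esub> k} = h"
    if k: "coprime k (int h)" "\<not> [k = 1] (mod int h)" "\<not> [k = - 1] (mod int h)"
      and g: "g \<in> W" "g \<otimes>\<^bsub>G\<^esub> c \<otimes>\<^bsub>G\<^esub> inv\<^bsub>G\<^esub> g = c [^]\<^bsub>G\<^esub> k" for k :: int and g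
  proof -
    define j where "j = nat (k mod int h)"
    have j: "int j = k mod int h" using h0 by (simp add: j_def)
    have ck: "c [^]\<^bsub>G\<^esub> k = c [^]\<^bsub>G\<^esub> j"
    proof -
      have "c [^]\<^bsub>G\<^esub> k = c [^]\<^bsub>G\<^esub> (int j + int h * (k div int h))" unfolding j by simp
      also have "\<dots> = c [^]\<^bsub>G\<^esub> int j \<otimes>\<^bsub>G\<^esub> (c [^]\<^bsub>G\<^esub> int h) [^]\<^bsub>G\<^esub> (k div int h)"
        using c(1) by (metis gr.int_pow_mult gr.int_pow_pow)
      also have "c [^]\<^bsub>G\<^esub> int h = \<one>\<^bsub>G\<^esub>"
        using gr.pow_ord_eq_1[OF c(1)] c(2) int_pow_int[of G c h] by simp
      finally show ?thesis using int_pow_int[of G c j] gr.int_pow_one by simp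
    qed
    have cop: "coprime j h"
    proof -
      have "coprime (int j) (int h)" unfolding j using k(1) h0 by (simp add: coprime_mod_left_iff)
      then show ?thesis by simp
    qed
    have "j < h" using j h0 by (metis of_nat_less_iff pos_mod_bound of_nat_0_less_iff)
    have "h \<noteq> 1" using k(2) by (auto simp: cong_def)
    have "j \<noteq> 0" using cop \<open>h \<noteq> 1\<close> by (metis coprime_0_left_iff nat_dvd_1_iff_1)
    moreover have "j \<noteq> 1"
    proof
      assume "j = 1"
      then have "k mod int h = 1 mod int h" using j \<open>j < h\<close> by simp
      then show False using k(2) by (simp add: cong_def)
    qed
    moreover have "j \<noteq> h - 1"
    proof
      assume "j = h - 1"
      then have "int j + 1 = int h" using h0 by simp
      then have "int h dvd k - (-1)" using j by (metis add.commute diff_minus_eq_add dvd_refl mod_add_left_eq mod_eq_0_iff_dvd)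
      then show False using k(3) by (simp add: cong_iff_dvd_diff)
    qed
    ultimately have j12: "1 < j" "j < h - 1" using \<open>j < h\<close> by auto
    have "inv\<^bsub>G\<^esub> (inv\<^bsub>G\<^esub> g) \<otimes>\<^bsub>G\<^esub> c \<otimes>\<^bsub>G\<^esub> inv\<^bsub>G\<^esub> g = c [^]\<^bsub>G\<^esub> j"
      using g ck gr.inv_inv[OF g(1)] by simp
    \<comment> \<open>The hypothesis has g to the left of c while the set has w to the right of it,
      so the inverse of g is the element of the set to start from.\<close>
    then show ?thesis unfolding ck using main[OF j12 cop inv_in_W[OF g(1)]] by blast
  qed
  show ?thesis using first second by blast
qed

end

section \<open>Root systems in coordinates\<close>

definition dotl :: "int list \<Rightarrow> int list \<Rightarrow> int" where
  "dotl xs ys = sum_list (map2 (*) xs ys)"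

fun lrank :: "coxeter_type \<Rightarrow> nat" where
  "lrank H4 = 8" | "lrank D = coxeter_rank D"

text \<open>Integer coordinates are taken with respect to the simple roots for \<open>E\<^sub>n\<close>, to
  \<open>\<alpha>\<^sub>0, \<alpha>\<^sub>1, \<surd>2 \<alpha>\<^sub>2, \<surd>2 \<alpha>\<^sub>3\<close> for \<open>F\<^sub>4\<close> and to \<open>\<alpha>\<^sub>0, \<dots>, \<alpha>\<^sub>3, \<phi>\<alpha>\<^sub>0, \<dots>, \<phi>\<alpha>\<^sub>3\<close> (\<open>\<phi>\<close> the golden ratio) for \<open>H\<^sub>4\<close>.
  The \<open>i\<close>-th simple reflection subtracts multiples of the \<open>i\<close>-th and, for \<open>H\<^sub>4\<close>, the \<open>(i + 4)\<close>-th basis vector,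
  given by row \<open>i\<close> of \<open>cartan1\<close> and \<open>cartan2\<close>. For \<open>F\<^sub>4\<close> only the roots in the orbits of \<open>\<alpha>\<^sub>0\<close> and \<open>\<alpha>\<^sub>1\<close> are listed:
  reversing the diagram covers the other ones.\<close>

fun cartan1 :: "coxeter_type \<Rightarrow> int list list" where
  "cartan1 E6 =
    [[2,0,-1,0,0,0],[0,2,0,-1,0,0],[-1,0,2,-1,0,0],[0,-1,-1,2,-1,0],[0,0,0,-1,2,-1],[0,0,0,0,-1,2]]" |
  "cartan1 E7 =
    [[2,0,-1,0,0,0,0],[0,2,0,-1,0,0,0],[-1,0,2,-1,0,0,0],[0,-1,-1,2,-1,0,0],[0,0,0,-1,2,-1,0],
    [0,0,0,0,-1,2,-1],[0,0,0,0,0,-1,2]]" |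
  "cartan1 E8 =
    [[2,0,-1,0,0,0,0,0],[0,2,0,-1,0,0,0,0],[-1,0,2,-1,0,0,0,0],[0,-1,-1,2,-1,0,0,0],[0,0,0,-1,2,-1,0,0],
    [0,0,0,0,-1,2,-1,0],[0,0,0,0,0,-1,2,-1],[0,0,0,0,0,0,-1,2]]" |
  "cartan1 F4 =
    [[2,-1,0,0],[-1,2,-2,0],[0,-1,2,-1],[0,0,-1,2]]" |
  "cartan1 H4 =
    [[2,0,0,0,0,-1,0,0],[0,2,-1,0,-1,0,0,0],[0,-1,2,-1,0,0,0,0],[0,0,-1,2,0,0,0,0]]"

fun cartan2 :: "coxeter_type \<Rightarrow> int list list" where
  "cartan2 E6 =
    [[],[],[],[],[],[]]" |
  "cartan2 E7 =
    [[],[],[],[],[],[],[]]" |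
  "cartan2 E8 =
    [[],[],[],[],[],[],[],[]]" |
  "cartan2 F4 =
    [[],[],[],[]]" |
  "cartan2 H4 =
    [[0,-1,0,0,2,-1,0,0],[-1,0,0,0,-1,2,-1,0],[0,0,0,0,0,-1,2,-1],[0,0,0,0,0,0,-1,2]]"

fun pos_roots :: "coxeter_type \<Rightarrow> int list list" where
  "pos_roots E6 =
    [[1,0,0,0,0,0],[0,1,0,0,0,0],[0,0,1,0,0,0],[0,0,0,1,0,0],[0,0,0,0,1,0],[0,0,0,0,0,1],[1,0,1,0,0,0],
    [0,1,0,1,0,0],[0,0,1,1,0,0],[0,0,0,1,1,0],[0,0,0,0,1,1],[1,0,1,1,0,0],[0,1,1,1,0,0],[0,1,0,1,1,0],
    [0,0,1,1,1,0],[0,0,0,1,1,1],[1,1,1,1,0,0],[1,0,1,1,1,0],[0,1,1,1,1,0],[0,1,0,1,1,1],[0,0,1,1,1,1],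
    [1,1,1,1,1,0],[1,0,1,1,1,1],[0,1,1,2,1,0],[0,1,1,1,1,1],[1,1,1,2,1,0],[1,1,1,1,1,1],[0,1,1,2,1,1],
    [1,1,2,2,1,0],[1,1,1,2,1,1],[0,1,1,2,2,1],[1,1,2,2,1,1],[1,1,1,2,2,1],[1,1,2,2,2,1],[1,1,2,3,2,1],
    [1,2,2,3,2,1]]" |
  "pos_roots E7 =
    [[1,0,0,0,0,0,0],[0,1,0,0,0,0,0],[0,0,1,0,0,0,0],[0,0,0,1,0,0,0],[0,0,0,0,1,0,0],[0,0,0,0,0,1,0],
    [0,0,0,0,0,0,1],[1,0,1,0,0,0,0],[0,1,0,1,0,0,0],[0,0,1,1,0,0,0],[0,0,0,1,1,0,0],[0,0,0,0,1,1,0],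
    [0,0,0,0,0,1,1],[1,0,1,1,0,0,0],[0,1,1,1,0,0,0],[0,1,0,1,1,0,0],[0,0,1,1,1,0,0],[0,0,0,1,1,1,0],
    [0,0,0,0,1,1,1],[1,1,1,1,0,0,0],[1,0,1,1,1,0,0],[0,1,1,1,1,0,0],[0,1,0,1,1,1,0],[0,0,1,1,1,1,0],
    [0,0,0,1,1,1,1],[1,1,1,1,1,0,0],[1,0,1,1,1,1,0],[0,1,1,2,1,0,0],[0,1,1,1,1,1,0],[0,1,0,1,1,1,1],
    [0,0,1,1,1,1,1],[1,1,1,2,1,0,0],[1,1,1,1,1,1,0],[1,0,1,1,1,1,1],[0,1,1,2,1,1,0],[0,1,1,1,1,1,1],
    [1,1,2,2,1,0,0],[1,1,1,2,1,1,0],[1,1,1,1,1,1,1],[0,1,1,2,2,1,0],[0,1,1,2,1,1,1],[1,1,2,2,1,1,0],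
    [1,1,1,2,2,1,0],[1,1,1,2,1,1,1],[0,1,1,2,2,1,1],[1,1,2,2,2,1,0],[1,1,2,2,1,1,1],[1,1,1,2,2,1,1],
    [0,1,1,2,2,2,1],[1,1,2,3,2,1,0],[1,1,2,2,2,1,1],[1,1,1,2,2,2,1],[1,2,2,3,2,1,0],[1,1,2,3,2,1,1],
    [1,1,2,2,2,2,1],[1,2,2,3,2,1,1],[1,1,2,3,2,2,1],[1,2,2,3,2,2,1],[1,1,2,3,3,2,1],[1,2,2,3,3,2,1],
    [1,2,2,4,3,2,1],[1,2,3,4,3,2,1],[2,2,3,4,3,2,1]]" |
  "pos_roots E8 =
    [[1,0,0,0,0,0,0,0],[0,1,0,0,0,0,0,0],[0,0,1,0,0,0,0,0],[0,0,0,1,0,0,0,0],[0,0,0,0,1,0,0,0],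
    [0,0,0,0,0,1,0,0],[0,0,0,0,0,0,1,0],[0,0,0,0,0,0,0,1],[1,0,1,0,0,0,0,0],[0,1,0,1,0,0,0,0],
    [0,0,1,1,0,0,0,0],[0,0,0,1,1,0,0,0],[0,0,0,0,1,1,0,0],[0,0,0,0,0,1,1,0],[0,0,0,0,0,0,1,1],
    [1,0,1,1,0,0,0,0],[0,1,1,1,0,0,0,0],[0,1,0,1,1,0,0,0],[0,0,1,1,1,0,0,0],[0,0,0,1,1,1,0,0],
    [0,0,0,0,1,1,1,0],[0,0,0,0,0,1,1,1],[1,1,1,1,0,0,0,0],[1,0,1,1,1,0,0,0],[0,1,1,1,1,0,0,0],
    [0,1,0,1,1,1,0,0],[0,0,1,1,1,1,0,0],[0,0,0,1,1,1,1,0],[0,0,0,0,1,1,1,1],[1,1,1,1,1,0,0,0],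
    [1,0,1,1,1,1,0,0],[0,1,1,2,1,0,0,0],[0,1,1,1,1,1,0,0],[0,1,0,1,1,1,1,0],[0,0,1,1,1,1,1,0],
    [0,0,0,1,1,1,1,1],[1,1,1,2,1,0,0,0],[1,1,1,1,1,1,0,0],[1,0,1,1,1,1,1,0],[0,1,1,2,1,1,0,0],
    [0,1,1,1,1,1,1,0],[0,1,0,1,1,1,1,1],[0,0,1,1,1,1,1,1],[1,1,2,2,1,0,0,0],[1,1,1,2,1,1,0,0],
    [1,1,1,1,1,1,1,0],[1,0,1,1,1,1,1,1],[0,1,1,2,2,1,0,0],[0,1,1,2,1,1,1,0],[0,1,1,1,1,1,1,1],
    [1,1,2,2,1,1,0,0],[1,1,1,2,2,1,0,0],[1,1,1,2,1,1,1,0],[1,1,1,1,1,1,1,1],[0,1,1,2,2,1,1,0],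
    [0,1,1,2,1,1,1,1],[1,1,2,2,2,1,0,0],[1,1,2,2,1,1,1,0],[1,1,1,2,2,1,1,0],[1,1,1,2,1,1,1,1],
    [0,1,1,2,2,2,1,0],[0,1,1,2,2,1,1,1],[1,1,2,3,2,1,0,0],[1,1,2,2,2,1,1,0],[1,1,2,2,1,1,1,1],
    [1,1,1,2,2,2,1,0],[1,1,1,2,2,1,1,1],[0,1,1,2,2,2,1,1],[1,2,2,3,2,1,0,0],[1,1,2,3,2,1,1,0],
    [1,1,2,2,2,2,1,0],[1,1,2,2,2,1,1,1],[1,1,1,2,2,2,1,1],[0,1,1,2,2,2,2,1],[1,2,2,3,2,1,1,0],
    [1,1,2,3,2,2,1,0],[1,1,2,3,2,1,1,1],[1,1,2,2,2,2,1,1],[1,1,1,2,2,2,2,1],[1,2,2,3,2,2,1,0],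
    [1,2,2,3,2,1,1,1],[1,1,2,3,3,2,1,0],[1,1,2,3,2,2,1,1],[1,1,2,2,2,2,2,1],[1,2,2,3,3,2,1,0],
    [1,2,2,3,2,2,1,1],[1,1,2,3,3,2,1,1],[1,1,2,3,2,2,2,1],[1,2,2,4,3,2,1,0],[1,2,2,3,3,2,1,1],
    [1,2,2,3,2,2,2,1],[1,1,2,3,3,2,2,1],[1,2,3,4,3,2,1,0],[1,2,2,4,3,2,1,1],[1,2,2,3,3,2,2,1],
    [1,1,2,3,3,3,2,1],[2,2,3,4,3,2,1,0],[1,2,3,4,3,2,1,1],[1,2,2,4,3,2,2,1],[1,2,2,3,3,3,2,1],
    [2,2,3,4,3,2,1,1],[1,2,3,4,3,2,2,1],[1,2,2,4,3,3,2,1],[2,2,3,4,3,2,2,1],[1,2,3,4,3,3,2,1],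
    [1,2,2,4,4,3,2,1],[2,2,3,4,3,3,2,1],[1,2,3,4,4,3,2,1],[2,2,3,4,4,3,2,1],[1,2,3,5,4,3,2,1],
    [2,2,3,5,4,3,2,1],[1,3,3,5,4,3,2,1],[2,3,3,5,4,3,2,1],[2,2,4,5,4,3,2,1],[2,3,4,5,4,3,2,1],
    [2,3,4,6,4,3,2,1],[2,3,4,6,5,3,2,1],[2,3,4,6,5,4,2,1],[2,3,4,6,5,4,3,1],[2,3,4,6,5,4,3,2]]" |
  "pos_roots F4 =
    [[1,0,0,0],[0,1,0,0],[1,1,0,0],[0,1,1,0],[1,1,1,0],[0,1,1,1],[1,2,1,0],[1,1,1,1],[1,2,1,1],
    [1,2,2,1],[1,3,2,1],[2,3,2,1]]" |
  "pos_roots H4 =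
    [[1,0,0,0,0,0,0,0],[0,1,0,0,0,0,0,0],[0,0,1,0,0,0,0,0],[0,0,0,1,0,0,0,0],[1,0,0,0,0,1,0,0],
    [0,1,0,0,1,0,0,0],[0,1,1,0,0,0,0,0],[0,0,1,1,0,0,0,0],[0,0,0,0,1,1,0,0],[1,0,0,0,0,1,1,0],
    [0,1,1,0,1,0,0,0],[0,1,1,1,0,0,0,0],[0,0,0,0,1,1,1,0],[1,0,0,0,0,1,1,1],[0,1,1,0,1,1,0,0],
    [0,1,1,1,1,0,0,0],[0,1,0,0,1,1,1,0],[0,0,0,0,1,1,1,1],[1,1,1,0,1,1,0,0],[0,1,1,1,1,1,0,0],
    [1,1,0,0,1,1,1,0],[0,1,0,0,1,1,1,1],[1,1,1,1,1,1,0,0],[0,1,1,1,1,1,1,0],[1,0,0,0,1,2,1,0],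
    [1,1,0,0,1,1,1,1],[0,1,1,0,1,1,1,1],[1,1,1,1,1,1,1,0],[1,0,0,0,1,2,1,1],[1,1,1,0,1,1,1,1],
    [1,1,1,1,1,2,1,0],[1,0,0,0,1,2,2,1],[1,1,1,0,1,2,1,1],[1,1,1,1,2,2,1,0],[1,1,0,0,1,2,2,1],
    [1,1,1,0,2,2,1,1],[1,2,1,1,2,2,1,0],[1,1,0,0,2,2,2,1],[1,2,1,0,2,2,1,1],[1,2,2,1,2,2,1,0],
    [1,1,0,0,2,3,2,1],[1,2,1,0,2,2,2,1],[1,2,2,1,2,2,1,1],[2,1,0,0,2,3,2,1],[1,1,1,0,2,3,2,1],
    [1,2,1,1,2,2,2,1],[2,1,1,0,2,3,2,1],[1,1,1,1,2,3,2,1],[2,2,1,0,2,3,2,1],[2,1,1,1,2,3,2,1],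
    [1,2,1,0,3,3,2,1],[2,2,1,1,2,3,2,1],[1,2,1,1,3,3,2,1],[2,2,2,1,2,3,2,1],[1,2,2,1,3,3,2,1],
    [1,3,2,1,3,3,2,1],[2,3,2,1,3,3,2,1],[2,2,2,1,3,4,2,1],[2,2,1,1,3,4,3,1],[2,2,1,0,3,4,3,2]]"

text \<open>Outside H4 the row of \<open>cartan2\<close> is empty, so \<open>dotl\<close> gives 0
  and the second update is the identity, also where i + 4 is out of range.\<close>

definition sact :: "coxeter_type \<Rightarrow> nat \<Rightarrow> int list \<Rightarrow> int list" where
  "sact D i y = (let z = y[i := y ! i - dotl (cartan1 D ! i) y]
     in z[i + 4 := z ! (i + 4) - dotl (cartan2 D ! i) y])"

text \<open>A certificate: nonnegative coordinates, and closure under the simple reflections up to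
  sign. It yields both the finiteness of the roots and the sign dichotomy.\<close>

definition roots_closed :: "coxeter_type \<Rightarrow> bool" where
  "roots_closed D \<longleftrightarrow> list_all (\<lambda>y. length y = lrank D \<and> list_all ((\<le>) 0) y \<and>
     list_all (\<lambda>i. let z = sact D i y in z = y \<or> z \<in> set (pos_roots D) \<or>
       map uminus z \<in> set (pos_roots D)) [0..<coxeter_rank D]) (pos_roots D)"

lemma roots_closed_F4: "roots_closed F4" by code_simp
lemma roots_closed_H4: "roots_closed H4" by code_simp
lemma roots_closed_E6: "roots_closed E6" by code_simp
lemma roots_closed_E7: "roots_closed E7" by code_simp
lemma roots_closed_E8: "roots_closed E8" by code_simp

lemma roots_closed: "roots_closed D"
  using roots_closed_E6 roots_closed_E7 roots_closed_E8 roots_closed_F4 roots_closed_H4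
  by (cases D) simp_all

section \<open>The golden ratio, Gram matrices and the action on coordinates\<close>

definition phi :: real where "phi = (1 + sqrt 5) / 2"

lemma phi_sq: "phi * phi = phi + 1"
  by (simp add: phi_def field_simps)

lemma phi_bounds: "1.61 < phi" "phi < 1.62"
proof -
  have "2.22 < sqrt 5" by (rule real_less_rsqrt) (simp add: power2_eq_square)
  moreover have "sqrt 5 < 2.24" by (rule real_less_lsqrt) (simp_all add: power2_eq_square)
  ultimately show "1.61 < phi" "phi < 1.62" by (simp_all add: phi_def)
qed

text \<open>The angles 3 pi/5 and 2 pi/5 are supplementary; the formulas for double and triple
  angles turn this into a polynomial equation for the cosine.\<close>

lemma cos_pi_5: "cos (pi / 5) = phi / 2"
proof -
  let ?x = "cos (pi / 5)"
  have pos: "?x > 0" using pi_gt_zero by (intro cos_gt_zero_pi) linarith+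
  have "cos (3 * (pi / 5)) = - cos (2 * (pi / 5))"
    using cos_pi_minus[of "2 * (pi / 5)"] by (simp add: field_simps)
  then have "4 * ?x ^ 3 - 3 * ?x = - (2 * ?x\<^sup>2 - 1)"
    by (simp only: cos_treble_cos cos_double_cos)
  then have "(?x + 1) * (4 * ?x * ?x - 2 * ?x - 1) = 0"
    by (simp add: algebra_simps power2_eq_square power3_eq_cube)
  then have q: "4 * ?x * ?x - 2 * ?x - 1 = 0" using pos by simp
  have "(2 * ?x - phi) * (2 * ?x + phi - 1) = 4 * ?x * ?x - 2 * ?x - (phi * phi - phi)"
    by (simp add: algebra_simps)
  also have "\<dots> = 0" using q phi_sq by simp
  finally have "2 * ?x - phi = 0" using pos phi_bounds by simp
  then show ?thesis by simp
qed

definition ebas :: "coxeter_type \<Rightarrow> (nat \<Rightarrow> 'v::real_vector) \<Rightarrow> nat \<Rightarrow> 'v" where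
  "ebas D \<alpha> j = (case D of F4 \<Rightarrow> (if j < 2 then \<alpha> j else sqrt 2 *\<^sub>R \<alpha> j)
     | H4 \<Rightarrow> (if j < 4 then \<alpha> j else phi *\<^sub>R \<alpha> (j - 4)) | _ \<Rightarrow> \<alpha> j)"

definition ev :: "coxeter_type \<Rightarrow> (nat \<Rightarrow> 'v::real_vector) \<Rightarrow> int list \<Rightarrow> 'v" where
  "ev D \<alpha> y = (\<Sum>j<lrank D. of_int (y ! j) *\<^sub>R ebas D \<alpha> j)"

definition ecoef :: "coxeter_type \<Rightarrow> int list \<Rightarrow> nat \<Rightarrow> real" where
  "ecoef D y j = (case D of F4 \<Rightarrow> (if j < 2 then of_int (y ! j) else sqrt 2 * of_int (y ! j))
     | H4 \<Rightarrow> of_int (y ! j) + phi * of_int (y ! (j + 4)) | _ \<Rightarrow> of_int (y ! j))"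

lemma ev_alpha: "ev D \<alpha> y = (\<Sum>j<coxeter_rank D. ecoef D y j *\<^sub>R \<alpha> j)"
proof (cases D)
  case F4
  then show ?thesis unfolding ev_def by (auto simp: ebas_def ecoef_def mult.commute intro!: sum.cong)
next
  case H4
  have "(\<Sum>j<8. f j) = (\<Sum>j<4. f j + f (j + 4))" for f :: "nat \<Rightarrow> 'a"
    by (simp add: eval_nat_numeral sum.distrib algebra_simps)
  then show ?thesis unfolding ev_def using H4
    by (auto simp: ebas_def ecoef_def scaleR_add_left mult.commute intro!: sum.cong)
qed (auto simp: ev_def ebas_def ecoef_def)

lemma less_numeral_cases:
  "(i::nat) < 4 \<longleftrightarrow> i \<in> {0,1,2,3}" "(i::nat) < 6 \<longleftrightarrow> i \<in> {0,1,2,3,4,5}"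
  "(i::nat) < 7 \<longleftrightarrow> i \<in> {0,1,2,3,4,5,6}" "(i::nat) < 8 \<longleftrightarrow> i \<in> {0,1,2,3,4,5,6,7}"
  by auto

lemma gram_simps:
  assumes "simple_roots D \<alpha>" "i < coxeter_rank D" "j < coxeter_rank D"
  shows "coxeter_matrix D i j = 1 \<Longrightarrow> \<alpha> i \<bullet> \<alpha> j = 1" "coxeter_matrix D i j = 2 \<Longrightarrow> \<alpha> i \<bullet> \<alpha> j = 0"
    "coxeter_matrix D i j = 3 \<Longrightarrow> \<alpha> i \<bullet> \<alpha> j = - 1 / 2" "coxeter_matrix D i j = 4 \<Longrightarrow> \<alpha> i \<bullet> \<alpha> j = - sqrt 2 / 2"
    "coxeter_matrix D i j = 5 \<Longrightarrow> \<alpha> i \<bullet> \<alpha> j = - phi / 2"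
  using assms by (simp_all add: simple_roots_def cos_60 cos_45 cos_pi_5)

definition gram :: "coxeter_type \<Rightarrow> nat \<Rightarrow> nat \<Rightarrow> real" where
  "gram D i j = (let m = coxeter_matrix D i j in if m = 1 then 1 else if m = 2 then 0
     else if m = 3 then - 1 / 2 else if m = 4 then - sqrt 2 / 2 else - phi / 2)"

lemma inner_simple:
  assumes "simple_roots D \<alpha>" "i < coxeter_rank D" "j < coxeter_rank D"
  shows "\<alpha> i \<bullet> \<alpha> j = gram D i j"
proof -
  have "coxeter_matrix D i j \<in> {1,2,3,4,5}" by (cases D) (auto simp: coxeter_matrix_def)
  then show ?thesis using gram_simps[OF assms] by (auto simp: gram_def Let_def)
qed

text \<open>Pairing the combination with each simple root gives a linear system with the Gram
  matrix, solved by elimination. For F4 it comes down to 9 \<noteq> 8, for H4 to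
  \<open>5 - 3 * phi \<noteq> 0\<close>.\<close>

lemma simple_roots_indep:
  assumes "simple_roots D \<alpha>" "(\<Sum>i<coxeter_rank D. x i *\<^sub>R \<alpha> i) = 0" "i < coxeter_rank D"
  shows "x i = 0"
proof -
  have eq: "(\<Sum>i<coxeter_rank D. x i * gram D j i) = 0" if "j < coxeter_rank D" for j
  proof -
    have "\<alpha> j \<bullet> (\<Sum>i<coxeter_rank D. x i *\<^sub>R \<alpha> i) = (\<Sum>i<coxeter_rank D. x i * gram D j i)"
      unfolding inner_sum_right by (intro sum.cong) (auto simp: inner_simple[OF assms(1) that])
    then show ?thesis using assms(2) by simp
  qed
  note expand = eval_nat_numeral gram_def coxeter_matrix_def
  show ?thesis
  proof (cases D)
    case E6
    have "x 0 = 0 \<and> x 1 = 0 \<and> x 2 = 0 \<and> x 3 = 0 \<and> x 4 = 0 \<and> x 5 = 0"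
      using eq[of 0] eq[of 1] eq[of 2] eq[of 3] eq[of 4] eq[of 5] E6 by (simp add: expand)
    then show ?thesis using assms(3) E6 by (auto simp: less_numeral_cases)
  next
    case E7
    have "x 0 = 0 \<and> x 1 = 0 \<and> x 2 = 0 \<and> x 3 = 0 \<and> x 4 = 0 \<and> x 5 = 0 \<and> x 6 = 0"
      using eq[of 0] eq[of 1] eq[of 2] eq[of 3] eq[of 4] eq[of 5] eq[of 6] E7 by (simp add: expand)
    then show ?thesis using assms(3) E7 by (auto simp: less_numeral_cases)
  next
    case E8
    have "x 0 = 0 \<and> x 1 = 0 \<and> x 2 = 0 \<and> x 3 = 0 \<and> x 4 = 0 \<and> x 5 = 0 \<and> x 6 = 0 \<and> x 7 = 0"
      using eq[of 0] eq[of 1] eq[of 2] eq[of 3] eq[of 4] eq[of 5] eq[of 6] eq[of 7] E8 by (simp add: expand)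
    then show ?thesis using assms(3) E8 by (auto simp: less_numeral_cases)
  next
    case F4
    have e: "2 * x 0 = x 1" "2 * x 1 = x 0 + sqrt 2 * x 2" "2 * x 2 = sqrt 2 * x 1 + x 3" "2 * x 3 = x 2"
      using eq[of 0] eq[of 1] eq[of 2] eq[of 3] F4 by (simp_all add: expand algebra_simps)
    have a: "3 * x 0 = 2 * (sqrt 2 * x 3)" "3 * x 3 = 2 * (sqrt 2 * x 0)"
    proof -
      have "sqrt 2 * x 2 = sqrt 2 * (2 * x 3)" "sqrt 2 * x 1 = sqrt 2 * (2 * x 0)" using e by simp_all
      then show "3 * x 0 = 2 * (sqrt 2 * x 3)" "3 * x 3 = 2 * (sqrt 2 * x 0)" using e by linarith+
    qed
    have "3 * (sqrt 2 * x 0) = sqrt 2 * (3 * x 0)" by simp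
    also have "\<dots> = 2 * (sqrt 2 * sqrt 2) * x 3" unfolding a(1) by (simp only: mult_ac)
    finally have "3 * (sqrt 2 * x 0) = 4 * x 3" by simp
    then have "x 3 = 0" using a(2) by simp
    then have "x 0 = 0 \<and> x 1 = 0 \<and> x 2 = 0 \<and> x 3 = 0" using e a by simp
    then show ?thesis using assms(3) F4 by (auto simp: less_numeral_cases)
  next
    case H4
    have e: "2 * x 0 = phi * x 1" using eq[of 0] H4 by (simp add: expand mult.commute)
    have e': "2 * x 1 = phi * x 0 + x 2" using eq[of 1] H4 by (simp add: expand mult.commute)
    have e'': "2 * x 2 = x 1 + x 3" using eq[of 2] H4 by (simp add: expand)
    have e''': "2 * x 3 = x 2" using eq[of 3] H4 by (simp add: expand)
    have a: "x 2 = 2 * x 3" "x 1 = 3 * x 3" "phi * x 0 = 4 * x 3" using e' e'' e''' by auto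
    have "8 * x 3 = phi * (2 * x 0)" using a by simp
    also have "\<dots> = phi * phi * (3 * x 3)" using e a by simp
    also have "\<dots> = 3 * (phi * x 3) + 3 * x 3" by (simp add: phi_sq algebra_simps)
    finally have "(5 - 3 * phi) * x 3 = 0" by (simp add: algebra_simps)
    then have "x 3 = 0" using phi_bounds by simp
    then have "x 0 = 0 \<and> x 1 = 0 \<and> x 2 = 0 \<and> x 3 = 0" using a phi_bounds by auto
    then show ?thesis using assms(3) H4 by (auto simp: less_numeral_cases)
  qed
qed

definition c1 :: "coxeter_type \<Rightarrow> nat \<Rightarrow> nat \<Rightarrow> int" where
  "c1 D i j = cartan1 D ! i ! j"

text \<open>The case distinction avoids entries of the empty rows of \<open>cartan2\<close>, which
  are unspecified.\<close>

definition c2 :: "coxeter_type \<Rightarrow> nat \<Rightarrow> nat \<Rightarrow> int" where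
  "c2 D i j = (if D = H4 then cartan2 D ! i ! j else 0)"

lemma cartan_action:
  assumes "simple_roots D \<alpha>" "i < coxeter_rank D" "j < lrank D"
  shows "(2 * (\<alpha> i \<bullet> ebas D \<alpha> j)) *\<^sub>R \<alpha> i =
    of_int (c1 D i j) *\<^sub>R ebas D \<alpha> i + of_int (c2 D i j) *\<^sub>R ebas D \<alpha> (i + 4)"
proof (cases D)
  case E6
  then show ?thesis using assms
    by (simp add: inner_simple[OF assms(1)] ebas_def c1_def c2_def less_numeral_cases)
       (elim disjE; simp add: gram_def coxeter_matrix_def)
next
  case E7
  then show ?thesis using assms
    by (simp add: inner_simple[OF assms(1)] ebas_def c1_def c2_def less_numeral_cases)
       (elim disjE; simp add: gram_def coxeter_matrix_def)
next
  case E8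
  then show ?thesis using assms
    by (simp add: inner_simple[OF assms(1)] ebas_def c1_def c2_def less_numeral_cases)
       (elim disjE; simp add: gram_def coxeter_matrix_def)
next
  case F4
  then show ?thesis using assms
    by (simp add: less_numeral_cases)
       (elim disjE; simp add: inner_simple[OF assms(1)] ebas_def c1_def c2_def gram_def coxeter_matrix_def)
next
  case H4
  have p: "phi * (phi * r) = phi * r + r" for r
    using phi_sq by (metis distrib_right mult.assoc mult_1)
  show ?thesis using assms H4
    by (simp add: less_numeral_cases)
       (elim disjE; simp add: inner_simple[OF assms(1)] ebas_def c1_def c2_def gram_def coxeter_matrix_def p phi_sq algebra_simps add_divide_distrib)
qed

lemma cartan_lengths:
  assumes "i < coxeter_rank D"
  shows "length (cartan1 D ! i) = lrank D" "length (cartan2 D ! i) = (if D = H4 then 8 else 0)"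
  using assms by (cases D; auto simp: less_numeral_cases)+

lemma dotl_sum:
  assumes "length xs = length ys"
  shows "dotl xs ys = (\<Sum>j<length ys. xs ! j * ys ! j)"
  using assms by (simp add: dotl_def sum_list_sum_nth atLeast0LessThan)

lemma ev_update:
  assumes "k < lrank D" "length y = lrank D"
  shows "ev D \<alpha> (y[k := y ! k - d]) = ev D \<alpha> y - of_int d *\<^sub>R ebas D \<alpha> k"
proof -
  have "ev D \<alpha> (y[k := y ! k - d]) =
     (\<Sum>j<lrank D. of_int (y ! j) *\<^sub>R ebas D \<alpha> j - (if j = k then of_int d *\<^sub>R ebas D \<alpha> k else 0))"
    unfolding ev_def using assms by (intro sum.cong refl) (auto simp: nth_list_update scaleR_diff_left)
  also have "\<dots> = ev D \<alpha> y - of_int d *\<^sub>R ebas D \<alpha> k"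
    using assms(1) by (simp add: sum_subtractf ev_def)
  finally show ?thesis .
qed

lemma length_sact [simp]: "length (sact D i y) = length y"
  by (simp add: sact_def Let_def)

lemma coxeter_rank_le_lrank: "coxeter_rank D \<le> lrank D"
  by (cases D) auto

context coxeter_rep
begin

section \<open>Lattice coordinates of roots\<close>

abbreviation "e \<equiv> ebas D \<alpha>"
abbreviation "N \<equiv> lrank D"

lemma s_ebas:
  assumes "i < n" "j < N"
  shows "s i *v e j = e j - (of_int (c1 D i j) *\<^sub>R e i + of_int (c2 D i j) *\<^sub>R e (i + 4))"
  using cartan_action[OF sr assms] assms by (simp add: s_apply)

lemma s_ev:
  assumes i: "i < n" and y: "length y = N"
  shows "s i *v ev D \<alpha> y = ev D \<alpha> (sact D i y)"
proof -
  let ?d1 = "dotl (cartan1 D ! i) y" and ?d2 = "dotl (cartan2 D ! i) y"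
  have iN: "i < N" using i coxeter_rank_le_lrank[of D] by linarith
  have d1: "?d1 = (\<Sum>j<N. c1 D i j * y ! j)"
    using dotl_sum[of "cartan1 D ! i" y] cartan_lengths(1)[OF i] y by (simp add: c1_def)
  have d2: "?d2 = (\<Sum>j<N. c2 D i j * y ! j)"
  proof (cases "D = H4")
    case True
    then show ?thesis using dotl_sum[of "cartan2 D ! i" y] cartan_lengths(2)[OF i] y by (simp add: c2_def)
  next
    case False
    then show ?thesis using cartan_lengths(2)[OF i] by (simp add: c2_def dotl_def)
  qed
  have "s i *v ev D \<alpha> y = (\<Sum>j<N. of_int (y ! j) *\<^sub>R (s i *v e j))"
    by (simp add: ev_def linear_sum[OF matrix_vector_mul_linear] matrix_vector_mult_scaleR)
  also have "\<dots> = (\<Sum>j<N. of_int (y ! j) *\<^sub>R e j - (of_int (c1 D i j * y ! j) *\<^sub>R e i + of_int (c2 D i j * y ! j) *\<^sub>R e (i + 4)))"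
    by (intro sum.cong refl) (simp add: s_ebas i scaleR_diff_right scaleR_add_right mult.commute)
  also have "\<dots> = ev D \<alpha> y - (of_int ?d1 *\<^sub>R e i + of_int ?d2 *\<^sub>R e (i + 4))"
    unfolding d1 d2 by (simp add: ev_def sum_subtractf sum.distrib scaleR_sum_left)
  finally have *: "s i *v ev D \<alpha> y = \<dots>" .
  define z where "z = y[i := y ! i - ?d1]"
  have z: "ev D \<alpha> z = ev D \<alpha> y - of_int ?d1 *\<^sub>R e i" "length z = N"
    unfolding z_def using ev_update[OF iN y] y by auto
  have sz: "sact D i y = z[i + 4 := z ! (i + 4) - ?d2]" by (simp add: sact_def Let_def z_def)
  show ?thesis
  proof (cases "D = H4")
    case True
    then have "i + 4 < N" using i by simp
    then show ?thesis unfolding sz using ev_update[of "i + 4" D z \<alpha> ?d2] z * by simp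
  next
    case False
    then have "?d2 = 0" using cartan_lengths(2)[OF i] by (simp add: dotl_def)
    then show ?thesis unfolding sz using z * by simp
  qed
qed

lemma ev_uminus: "length y = N \<Longrightarrow> ev D \<alpha> (map uminus y) = - ev D \<alpha> y"
  by (simp add: ev_def sum_negf)

definition lidx :: "nat set" where "lidx = (if D = F4 then {..<2} else {..<n})"

text \<open>The roots that the lattice coordinates describe: all of them except for F4, where these
  are the orbits of \<open>\<alpha> 0\<close> and \<open>\<alpha> 1\<close>; the lattice contains
  \<open>sqrt 2 *\<^sub>R \<alpha> 2\<close> but not \<open>\<alpha> 2\<close>.\<close>

definition lroots :: "(real^'n) set" where
  "lroots = {A *v \<alpha> i | A i. A \<in> W \<and> i \<in> lidx}"

lemma lidx_less: "i \<in> lidx \<Longrightarrow> i < n"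
  by (auto simp: lidx_def split: if_splits)

lemma lroots_subset: "lroots \<subseteq> roots"
  using lidx_less by (auto simp: lroots_def roots_def)

lemma pos_roots_length: "y \<in> set (pos_roots D) \<Longrightarrow> length y = N"
  using roots_closed[of D] by (auto simp: roots_closed_def list_all_iff)

lemma pos_roots_nonneg: "y \<in> set (pos_roots D) \<Longrightarrow> a \<in> set y \<Longrightarrow> 0 \<le> a"
  using roots_closed[of D] by (auto simp: roots_closed_def list_all_iff)

definition pmroots :: "int list set" where
  "pmroots = set (pos_roots D) \<union> map uminus ` set (pos_roots D)"

lemma map_uminus_uminus: "map uminus (map uminus (y :: int list)) = y"
  by (simp add: comp_def)

lemma sact_pmroots_pos:
  assumes "y \<in> set (pos_roots D)" "i < n"
  shows "sact D i y \<in> pmroots"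
proof -
  have "sact D i y = y \<or> sact D i y \<in> set (pos_roots D) \<or> map uminus (sact D i y) \<in> set (pos_roots D)"
    using roots_closed[of D] assms by (auto simp: roots_closed_def list_all_iff Let_def)
  then show ?thesis using assms(1) unfolding pmroots_def
    by (metis UnCI image_eqI map_uminus_uminus)
qed

lemma s_ev_pmroots:
  assumes "y \<in> pmroots" "i < n"
  shows "\<exists>z\<in>pmroots. s i *v ev D \<alpha> y = ev D \<alpha> z"
proof -
  consider "y \<in> set (pos_roots D)" | x where "x \<in> set (pos_roots D)" "y = map uminus x"
    using assms(1) by (auto simp: pmroots_def)
  then show ?thesis
  proof cases
    case 1
    then show ?thesis using sact_pmroots_pos assms(2) s_ev pos_roots_length by blast
  next
    case 2
    have 3: "sact D i x \<in> pmroots" using sact_pmroots_pos 2 assms(2) by blast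
    have "s i *v ev D \<alpha> y = - (s i *v ev D \<alpha> x)"
      using 2 pos_roots_length by (simp add: ev_uminus matrix_vector_mult_uminus)
    also have "\<dots> = ev D \<alpha> (map uminus (sact D i x))"
      using s_ev[OF assms(2)] 2 pos_roots_length by (simp add: ev_uminus)
    finally show ?thesis using 3 unfolding pmroots_def
      by (metis (no_types, lifting) UnE UnI1 UnI2 image_iff map_uminus_uminus)
  qed
qed

lemma simple_pmroots: "i \<in> lidx \<Longrightarrow> \<exists>y\<in>pmroots. \<alpha> i = ev D \<alpha> y"
proof -
  assume i: "i \<in> lidx"
  define y where "y = map (\<lambda>j. if j = i then 1 else 0 :: int) [0..<N]"
  have iN: "i < N" using lidx_less[OF i] coxeter_rank_le_lrank[of D] by linarith
  have il: "i \<in> (if D = F4 then {..<2} else {..<n})" using i by (simp add: lidx_def)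
  have "y \<in> set (pos_roots D)" using il unfolding y_def
    by (cases D) (auto simp: less_numeral_cases eval_nat_numeral upt_rec less_Suc_eq)
  moreover have "ev D \<alpha> y = (\<Sum>j<N. (if j = i then e i else 0))"
    unfolding ev_def y_def by (intro sum.cong) auto
  moreover have "e i = \<alpha> i" using il by (cases D) (auto simp: ebas_def)
  ultimately show ?thesis using iN unfolding pmroots_def by (intro bexI[of _ y]) auto
qed

lemma lroots_coords: "b \<in> lroots \<Longrightarrow> \<exists>y\<in>pmroots. b = ev D \<alpha> y"
proof -
  assume "b \<in> lroots"
  then obtain A i where Ai: "A \<in> W" "i \<in> lidx" "b = A *v \<alpha> i" by (auto simp: lroots_def)
  obtain ws where ws: "set ws \<subseteq> {..<n}" "A = wprod ws" using W_word Ai by blast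
  have "\<exists>y\<in>pmroots. wprod ws *v \<alpha> i = ev D \<alpha> y" using ws(1)
  proof (induction ws)
    case Nil
    then show ?case using simple_pmroots Ai by simp
  next
    case (Cons j ws)
    then obtain y where "y \<in> pmroots" "wprod ws *v \<alpha> i = ev D \<alpha> y" by auto
    then show ?case using s_ev_pmroots[of y j] Cons.prems by (simp flip: matrix_vector_mul_assoc)
  qed
  then show ?thesis using Ai ws by simp
qed

lemma finite_lroots: "finite lroots"
proof -
  have "lroots \<subseteq> ev D \<alpha> ` pmroots" using lroots_coords by blast
  then show ?thesis by (rule finite_subset) (simp add: pmroots_def)
qed

lemma ecoef_nonneg: "length y = N \<Longrightarrow> (\<And>a. a \<in> set y \<Longrightarrow> 0 \<le> a) \<Longrightarrow> j < n \<Longrightarrow> 0 \<le> ecoef D y j"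
  using phi_bounds by (cases D) (auto simp: ecoef_def)

lemma lroots_dichotomy:
  assumes "b \<in> lroots"
  shows "(\<forall>i<n. cf b i \<ge> 0) \<or> (\<forall>i<n. cf b i \<le> 0)"
proof -
  obtain y where y: "y \<in> pmroots" "b = ev D \<alpha> y" using lroots_coords[OF assms] by blast
  have pos: "\<forall>i<n. cf (ev D \<alpha> x) i \<ge> 0" if x: "x \<in> set (pos_roots D)" for x
  proof (intro allI impI)
    fix i assume "i < n"
    then have "cf (ev D \<alpha> x) i = ecoef D x i" by (intro cf_unique ev_alpha)
    then show "cf (ev D \<alpha> x) i \<ge> 0"
      using ecoef_nonneg[of x i] pos_roots_length[OF x] pos_roots_nonneg[OF x] \<open>i < n\<close> by simp
  qed
  consider "y \<in> set (pos_roots D)" | x where "x \<in> set (pos_roots D)" "y = map uminus x"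
    using y(1) by (auto simp: pmroots_def)
  then show ?thesis
  proof cases
    case 1
    then show ?thesis using pos y(2) by blast
  next
    case 2
    then have "b = - ev D \<alpha> x" using y(2) pos_roots_length ev_uminus by simp
    then show ?thesis using pos[OF 2(1)] by (simp add: cf_uminus)
  qed
qed

lemma lroots_lat: "lroots \<subseteq> lat e N"
  using lroots_coords by (auto simp: ev_def lat_def)

lemma W_lat: "A \<in> W \<Longrightarrow> x \<in> lat e N \<Longrightarrow> A *v x \<in> lat e N"
proof -
  assume "A \<in> W" and x: "x \<in> lat e N"
  then obtain ws where ws: "set ws \<subseteq> {..<n}" "A = wprod ws" using W_word by blast
  have sl: "s i *v y \<in> lat e N" if i: "i < n" and y: "y \<in> lat e N" for i y
  proof (rule lat_stable[OF matrix_vector_mul_linear _ y])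
    fix j assume j: "j < N"
    have iN: "i < N" using i coxeter_rank_le_lrank[of D] by linarith
    have "of_int (c2 D i j) *\<^sub>R e (i + 4) \<in> lat e N"
    proof (cases "D = H4")
      case True
      then show ?thesis using i by (intro lat_scale lat_base) simp
    qed (simp add: c2_def)
    then have "of_int (-1) *\<^sub>R (of_int (c1 D i j) *\<^sub>R e i + of_int (c2 D i j) *\<^sub>R e (i + 4)) \<in> lat e N"
      using iN by (intro lat_scale[of "_ + _"] lat_add) (auto intro: lat_scale lat_base)
    then have "e j + of_int (-1) *\<^sub>R (of_int (c1 D i j) *\<^sub>R e i + of_int (c2 D i j) *\<^sub>R e (i + 4)) \<in> lat e N"
      using j by (intro lat_add lat_base)
    then show "s i *v e j \<in> lat e N" unfolding s_ebas[OF i j] by (simp only: of_int_minus of_int_1 scaleR_minus_left scaleR_one diff_conv_add_uminus)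
  qed
  have "wprod ws *v x \<in> lat e N" using ws(1)
    by (induction ws) (auto simp: x sl simp flip: matrix_vector_mul_assoc)
  then show ?thesis using ws by simp
qed

lemma span_ebas: "span (e ` {..<N}) = UNIV"
proof -
  have "\<alpha> i \<in> span (e ` {..<N})" if i: "i < n" for i
  proof -
    have "i < N" using i coxeter_rank_le_lrank[of D] by linarith
    then have ei: "e i \<in> span (e ` {..<N})" by (intro span_base) auto
    have "\<exists>r. \<alpha> i = r *\<^sub>R e i"
    proof (cases "e i = \<alpha> i")
      case True
      then show ?thesis by (intro exI[of _ 1]) simp
    next
      case False
      then have "e i = sqrt 2 *\<^sub>R \<alpha> i" using i by (cases D) (auto simp: ebas_def split: if_splits)
      then show ?thesis by (intro exI[of _ "1 / sqrt 2"]) simp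
    qed
    then show ?thesis using ei span_scale by metis
  qed
  then have "span (\<alpha> ` {..<n}) \<subseteq> span (e ` {..<N})" by (intro span_minimal) auto
  then show ?thesis using simple_span by auto
qed

end

section \<open>Autocorrelations of roots\<close>

definition dst :: "nat \<Rightarrow> nat \<Rightarrow> nat" where
  "dst i j = (if i \<le> j then j - i else i - j)"

lemma papp_Poly:
  assumes "linear f"
  shows "papp (Poly cs) f x = (\<Sum>i<length cs. of_int (cs ! i) *\<^sub>R (f ^^ i) x)"
proof (induction cs)
  case (Cons a cs)
  have "f (papp (Poly cs) f x) = (\<Sum>i<length cs. of_int (cs ! i) *\<^sub>R (f ^^ Suc i) x)"
    unfolding Cons by (simp add: linear_sum[OF assms] linear_cmul[OF assms])
  then show ?case by (simp add: assms sum.lessThan_Suc_shift del: sum.lessThan_Suc)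
qed simp

lemma sum_sum_dst:
  fixes g :: "nat \<Rightarrow> real"
  shows "(\<Sum>i<k. \<Sum>j<k. g (dst i j)) = k * g 0 + 2 * (\<Sum>j\<in>{1..<k}. (real k - j) * g j)"
proof (induction k)
  case (Suc k)
  have row: "(\<Sum>j<k. g (dst k j)) = (\<Sum>j\<in>{1..<Suc k}. g j)"
    by (rule sum.reindex_bij_witness[of _ "\<lambda>j. k - j" "\<lambda>j. k - j"]) (auto simp: dst_def)
  have col: "(\<Sum>j<k. g (dst j k)) = (\<Sum>j\<in>{1..<Suc k}. g j)"
    by (rule sum.reindex_bij_witness[of _ "\<lambda>j. k - j" "\<lambda>j. k - j"]) (auto simp: dst_def)
  have "(\<Sum>j\<in>{1..<Suc k}. (real (Suc k) - j) * g j) = (\<Sum>j\<in>{1..<Suc k}. (real k - j) * g j) + (\<Sum>j\<in>{1..<Suc k}. g j)"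
    by (simp add: algebra_simps flip: sum.distrib)
  also have "(\<Sum>j\<in>{1..<Suc k}. (real k - j) * g j) = (\<Sum>j\<in>{1..<k}. (real k - j) * g j)"
    by (cases "k = 0") (auto simp: sum.atLeastLessThan_Suc)
  finally show ?case using Suc row col by (simp add: sum.distrib dst_def[of k k] algebra_simps)
qed simp

text \<open>An arbitrary regular element with a chosen eigenfunctional; its order \<open>h\<close>
  is not yet tied to the Coxeter number.\<close>

locale regular_elt = finite_coxeter_rep D \<alpha> for D and \<alpha> :: "nat \<Rightarrow> real^'n" +
  fixes c :: "real^'n^'n" and \<psi> :: "real^'n \<Rightarrow> complex" and \<nu> :: complex
  assumes cW [simp]: "c \<in> W" and reg: "regular_functional \<psi>" and eig: "\<psi> (c *v x) = \<nu> * \<psi> x"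
begin

abbreviation f where "f \<equiv> (*v) c"
abbreviation h where "h \<equiv> group.ord G c"

lemma lin_f [simp]: "linear f"
  by (rule matrix_vector_mul_linear)

lemma order_h: "exact_order \<nu> h"
  using regular_exact_order[OF reg cW eig] .

lemma h_pos: "h > 0"
  using ord_pos[OF cW] .

lemma f_inner: "(f x) \<bullet> (f y) = x \<bullet> y"
  by (rule W_inner[OF cW])

lemma iter_inner: "((f ^^ j) x) \<bullet> ((f ^^ j) y) = x \<bullet> y"
  by (induction j) (simp_all add: f_inner)

lemma iter_h [simp]: "(f ^^ h) x = x"
  using pow_apply[OF cW, of h x] group.pow_ord_eq_1[OF group_G cW] by simp

lemma iter_mod: "(f ^^ (m mod h)) x = (f ^^ m) x"
proof -
  have "(f ^^ (h * q + j)) x = (f ^^ j) x" for q j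
    by (induction q) (simp_all add: funpow_add algebra_simps)
  from this[of "m div h" "m mod h"] show ?thesis by simp
qed

lemma linear_iter: "linear (f ^^ j)"
proof (induction j)
  case (Suc j)
  then show ?case using linear_compose[of "f ^^ j" f] by (simp add: comp_def)
qed (simp add: linear_id[unfolded id_def])

lemma psi_iter: "\<psi> ((f ^^ j) x) = \<nu> ^ j * \<psi> x"
  by (induction j) (simp_all add: eig)

lemma psi_root: "b \<in> roots \<Longrightarrow> \<psi> b \<noteq> 0"
  using reg by (simp add: regular_functional_def)

lemma lin_psi: "linear \<psi>"
  using reg by (simp add: regular_functional_def)

lemma iter_root: "b \<in> roots \<Longrightarrow> (f ^^ j) b \<in> roots"
  using iterate_root[OF cW] .

text \<open>The factor 2 makes the values integral on \<open>lroots\<close> for all types other than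
  H4.\<close>

definition ac :: "real^'n \<Rightarrow> nat \<Rightarrow> real" where
  "ac b j = 2 * (b \<bullet> (f ^^ j) b)"

lemma ac_dst: "2 * ((f ^^ i) b \<bullet> (f ^^ j) b) = ac b (dst i j)"
proof -
  have *: "(f ^^ i) b \<bullet> (f ^^ j) b = b \<bullet> (f ^^ (j - i)) b" if "i \<le> j" for i j
  proof -
    have "(f ^^ j) b = (f ^^ i) ((f ^^ (j - i)) b)" using that by (metis funpow_add le_add_diff_inverse o_apply)
    then show ?thesis by (simp add: iter_inner)
  qed
  show ?thesis using *[of i j] *[of j i] by (auto simp: ac_def dst_def inner_commute)
qed

lemma ac_0: "b \<in> roots \<Longrightarrow> ac b 0 = 2"
  by (simp add: ac_def)

lemma ac_sym: "j \<le> h \<Longrightarrow> ac b (h - j) = ac b j"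
proof -
  assume j: "j \<le> h"
  have "ac b (dst h j) = ac b j" using ac_dst[of h b j] by (simp add: ac_def)
  then show "ac b (h - j) = ac b j" using j by (cases "j = h") (auto simp: dst_def)
qed

text \<open>The relation, shifted by u, is paired with the t-th iterate of b. A choice of t inside
  the range of exponents folds the relation by the symmetry of the autocorrelation.\<close>

lemma ac_recurrence:
  assumes "papp (Poly cs) f b = 0"
  shows "(\<Sum>i<length cs. of_int (cs ! i) * ac b (dst t (i + u))) = 0"
proof -
  have "0 = (f ^^ u) (papp (Poly cs) f b)" using assms linear_0[OF linear_iter] by simp
  also have "\<dots> = (\<Sum>i<length cs. of_int (cs ! i) *\<^sub>R (f ^^ (i + u)) b)"
    by (simp add: papp_Poly linear_sum[OF linear_iter] linear_cmul[OF linear_iter] add.commute[of _ u] funpow_add)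
  finally have "0 = 2 * ((f ^^ t) b \<bullet> (\<Sum>i<length cs. of_int (cs ! i) *\<^sub>R (f ^^ (i + u)) b))" by simp
  also have "\<dots> = (\<Sum>i<length cs. of_int (cs ! i) * (2 * ((f ^^ t) b \<bullet> (f ^^ (i + u)) b)))"
    by (simp add: inner_sum_right sum_distrib_left algebra_simps)
  finally show ?thesis by (simp add: ac_dst)
qed

lemma unit_inner_eq:
  fixes x y :: "real^'n"
  assumes "x \<bullet> x = 1" "y \<bullet> y = 1"
  shows "x \<bullet> y \<le> 1" "x \<bullet> y = 1 \<Longrightarrow> x = y"
proof -
  have "(x - y) \<bullet> (x - y) = 2 - 2 * (x \<bullet> y)"
    using assms by (simp add: inner_diff_left inner_diff_right inner_commute)
  then show "x \<bullet> y \<le> 1" "x \<bullet> y = 1 \<Longrightarrow> x = y"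
    using inner_ge_zero[of "x - y"] by (auto simp: inner_eq_zero_iff)
qed

text \<open>Equality in the Cauchy-Schwarz bound means that the j-th power of c sends b to b or -b,
  so \<nu> ^ j is 1 or -1. The first is impossible for 0 < j < h, the second unless 2 j = h.\<close>

lemma ac_bounds:
  assumes b: "b \<in> roots" and j: "0 < j" "j < h"
  shows "ac b j < 2" "ac b j \<ge> -2" "ac b j = -2 \<Longrightarrow> (f ^^ j) b = - b" "2 * j \<noteq> h \<Longrightarrow> ac b j > -2"
proof -
  have u: "b \<bullet> b = 1" "(f ^^ j) b \<bullet> (f ^^ j) b = 1" "(- b) \<bullet> (- b) = 1" using b iter_inner by auto
  have "b \<bullet> (f ^^ j) b \<noteq> 1"
  proof
    assume "b \<bullet> (f ^^ j) b = 1"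
    then have "(f ^^ j) b = b" using unit_inner_eq(2)[OF u(1,2)] by simp
    then have "\<nu> ^ j = 1" using psi_iter[of j b] psi_root[OF b] by simp
    then show False using order_h j by (simp add: exact_order_def)
  qed
  then show "ac b j < 2" using unit_inner_eq(1)[OF u(1,2)] by (simp add: ac_def)
  show ge: "ac b j \<ge> -2" using unit_inner_eq(1)[OF u(3,2)] by (simp add: ac_def)
  show neg: "(f ^^ j) b = - b" if "ac b j = -2"
    using unit_inner_eq(2)[OF u(3,2)] that by (simp add: ac_def)
  show "ac b j > -2" if "2 * j \<noteq> h"
  proof (rule ccontr)
    assume "\<not> ac b j > -2"
    then have "(f ^^ j) b = - b" using ge neg by simp
    then have "\<nu> ^ j * \<psi> b = - \<psi> b" using psi_iter[of j b] linear_neg[OF lin_psi] by simp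
    then have "(\<nu> ^ j + 1) * \<psi> b = 0" by (simp add: distrib_right)
    then have "\<nu> ^ j = -1" using psi_root[OF b] by (simp add: add_eq_0_iff2)
    then have "\<nu> ^ (2 * j) = 1" by (simp add: mult_2 power_add)
    then have "h dvd 2 * j" using exact_order_pow_eq_1_iff[OF order_h] by simp
    then obtain q where q: "2 * j = h * q" by blast
    have "q = 1"
    proof (rule ccontr)
      assume "q \<noteq> 1"
      then consider "q = 0" | "q \<ge> 2" by linarith
      then show False
      proof cases
        case 2
        then have "h * 2 \<le> h * q" by (rule mult_le_mono2)
        then have "h * 2 \<le> 2 * j" using q by simp
        then show False using j by simp
      qed (use q j in simp)
    qed
    then show False using q that by simp
  qed
qed

text \<open>A root has squared length 1. In the expansion of the sum each distance j \<ge> 1 occurs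
  for 2 (k - j) ordered pairs, and \<open>ac b 0 = 2\<close>.\<close>

lemma root_sum_norm:
  assumes b: "b \<in> roots" and s: "(\<Sum>i<k. (f ^^ i) b) \<in> roots"
  shows "(\<Sum>j\<in>{1..<k}. (real k - j) * ac b j) = 1 - k"
proof -
  let ?s = "\<Sum>i<k. (f ^^ i) b"
  have "2 = 2 * (?s \<bullet> ?s)" using s by simp
  also have "\<dots> = (\<Sum>i<k. \<Sum>j<k. 2 * ((f ^^ i) b \<bullet> (f ^^ j) b))"
    unfolding inner_sum_left inner_sum_right sum_distrib_left by (rule sum.swap)
  also have "\<dots> = (\<Sum>i<k. \<Sum>j<k. ac b (dst i j))" by (simp add: ac_dst)
  also have "\<dots> = k * ac b 0 + 2 * (\<Sum>j\<in>{1..<k}. (real k - j) * ac b j)" by (rule sum_sum_dst)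
  finally show ?thesis using ac_0[OF b] by simp
qed

text \<open>The sum over a full period is fixed by c, hence 0, so the sums of k and of h - k terms
  agree up to sign and a power of c.\<close>

lemma root_sum_complement:
  assumes "fixsp c = {0}" "b \<in> roots" "k \<le> h" "(\<Sum>i<k. (f ^^ i) b) \<in> roots"
  shows "(\<Sum>i<h - k. (f ^^ i) b) \<in> roots"
proof -
  let ?S = "\<lambda>k. \<Sum>i<k. (f ^^ i) b"
  have "f (?S h) - ?S h = (f ^^ h) b - b"
    using sum_lessThan_telescope[of "\<lambda>i. (f ^^ i) b" h] by (simp add: linear_sum[OF lin_f] sum_subtractf)
  then have "?S h = 0" using assms(1) by (auto simp: fixsp_def)
  moreover have "?S h = ?S k + (f ^^ k) (?S (h - k))"
  proof -
    have "?S h = ?S k + (\<Sum>i\<in>{k..<h}. (f ^^ i) b)"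
      using assms(3) by (metis atLeast0LessThan sum.atLeastLessThan_concat zero_le)
    also have "(\<Sum>i\<in>{k..<h}. (f ^^ i) b) = (\<Sum>i<h - k. (f ^^ (k + i)) b)"
      by (rule sum.reindex_bij_witness[of _ "\<lambda>i. k + i" "\<lambda>i. i - k"]) (use assms(3) in auto)
    finally show ?thesis by (simp add: linear_sum[OF linear_iter] funpow_add)
  qed
  ultimately have "(f ^^ k) (?S (h - k)) = - ?S k" by (simp add: add_eq_0_iff2)
  then have r: "(f ^^ k) (?S (h - k)) \<in> roots" using assms(4) by simp
  have "?S (h - k) = (f ^^ (h - k)) ((f ^^ k) (?S (h - k)))"
    using assms(3) by (simp flip: funpow_add[THEN fun_cong, simplified])
  then show ?thesis using iter_root[OF r, of "h - k"] by simp
qed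

text \<open>Pairing with a fixed vector x turns P(c) into multiplication by P(1), so x is orthogonal
  to every root.\<close>

lemma all_roots_fixsp:
  assumes "\<And>b. b \<in> roots \<Longrightarrow> \<exists>P. papp P f b = 0 \<and> poly P 1 \<noteq> 0"
  shows "fixsp c = {0}"
proof -
  have "x = 0" if x: "f x = x" for x
  proof (rule orthogonal_all_roots)
    fix b assume "b \<in> roots"
    then obtain P where P: "papp P f b = 0" "poly P 1 \<noteq> 0" using assms by blast
    have "papp Q f b \<bullet> x = of_int (poly Q 1) * (b \<bullet> x)" for Q
    proof (induction Q)
      case (pCons a Q)
      have "f (papp Q f b) \<bullet> x = papp Q f b \<bullet> x" using f_inner[of "papp Q f b" x] x by simp
      then show ?case using pCons by (simp add: inner_add_left algebra_simps)
    qed simp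
    then show "b \<bullet> x = 0" using P by (metis inner_zero_left mult_eq_0_iff of_int_eq_0_iff)
  qed
  then show ?thesis by (auto simp: fixsp_def)
qed

text \<open>An annihilator of degree at most N contains the cyclotomic factor C. For the orders that
  finally occur, the cofactor q is constant for E8, F4 and H4, at most linear for E7 and at most
  quadratic for E6.\<close>

lemma root_annihilator:
  assumes b: "b \<in> roots" "b \<in> lroots"
    and C: "ieval C \<nu> = 0" "C \<noteq> 0" "degree C = totient h"
  obtains q where "q \<noteq> 0" "totient h + degree q \<le> N" "papp q f (papp C f b) = 0"
proof -
  have bl: "b \<in> lat e N" using lroots_lat b(2) by blast
  obtain P where P: "P \<noteq> 0" "degree P \<le> N" "papp P f b = 0"
    by (rule lat_annihilator[of f e N b, OF lin_f W_lat[OF cW] bl])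
  have "ieval P \<nu> * \<psi> b = 0"
    using papp_eigen[of f \<psi> \<nu> P b] lin_psi eig P(3) by (simp add: linear_0[OF lin_psi])
  then have "ieval P \<nu> = 0" using psi_root[OF b(1)] by simp
  then obtain a q where q: "a \<noteq> 0" "Polynomial.smult a P = C * q" "q \<noteq> 0" "degree P = totient h + degree q"
    by (rule cyclotomic_factor[OF order_h C(1,2,3) _ P(1)])
  have "papp (C * q) f b = 0" unfolding q(2)[symmetric] using P(3) by simp
  then have "papp (q * C) f b = 0" by (simp only: mult.commute)
  then show ?thesis using that[of q] q P(2) by simp
qed

lemma totient_le_N: "totient h \<le> N"
proof -
  have n0: "n > 0" by (cases D) auto
  then have "\<alpha> 0 \<in> lroots" unfolding lroots_def
    by (intro CollectI exI[of _ "mat 1"] exI[of _ 0]) (auto simp: lidx_def)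
  then have "\<alpha> 0 \<in> roots" "\<alpha> 0 \<in> lat e N" using lroots_subset lroots_lat by auto
  then show ?thesis
    by (intro regular_totient_bound[of \<psi> c \<nu> h "\<alpha> 0" e N] reg cW eig order_h W_lat)
qed

lemma degree_annihilator_ge:
  assumes b: "b \<in> roots" and P: "P \<noteq> 0" "papp P f b = 0"
  shows "ieval P \<nu> = 0" "totient h \<le> degree P"
proof -
  have "ieval P \<nu> * \<psi> b = 0"
    using papp_eigen[of f \<psi> \<nu> P b] lin_psi eig P(2) by (simp add: linear_0[OF lin_psi])
  then show "ieval P \<nu> = 0" using psi_root[OF b] by simp
  then show "totient h \<le> degree P" using totient_le_degree[OF order_h P(1)] by simp
qed

text \<open>A root without annihilators of degree below N has a spanning orbit, and the Euler
  function bound for eigenvalues supplies the last premise of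
  \<open>centralizer_card\<close>.\<close>

lemma cyclic_centralizer:
  assumes b: "b \<in> lroots" and min: "\<And>P. P \<noteq> 0 \<Longrightarrow> papp P f b = 0 \<Longrightarrow> N \<le> degree P"
    and bound: "\<And>M. h dvd M \<Longrightarrow> M > 0 \<Longrightarrow> totient M \<le> N \<Longrightarrow> M = h"
  shows "span ((\<lambda>j. (f ^^ j) b) ` {..<N}) = UNIV" "card {z \<in> W. z ** c = c ** z} = h"
proof -
  have N: "N > 0" by (cases D) auto
  have bl: "b \<in> lat e N" and br: "b \<in> roots" using b lroots_lat lroots_subset by auto
  show sp: "span ((\<lambda>j. (f ^^ j) b) ` {..<N}) = UNIV"
    by (rule lat_cyclic_span[of f e N b, OF lin_f W_lat[OF cW] bl min span_ebas N])
  show "card {z \<in> W. z ** c = c ** z} = h"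
  proof (rule centralizer_card[OF reg cW eig refl br sp])
    fix z \<kappa> M assume z: "z \<in> W" "\<And>x. \<psi> (z *v x) = \<kappa> * \<psi> x" "exact_order \<kappa> M" "h dvd M"
    have "totient M \<le> N" by (rule regular_totient_bound[OF reg z(1,2,3) br bl W_lat[OF z(1)]])
    then show "M = h" using bound[OF z(4)] z(3) by (simp add: exact_order_def)
  qed
qed

end

text \<open>Vectors are written in the basis \<open>b, cb, c\<^sup>2b, \<dots>\<close>. The list \<open>cs\<close> holds the coefficients of a monic annihilator
  of \<open>b\<close> without the leading 1, and \<open>as\<close>, \<open>bs\<close> hold integers with \<open>2 (b, c\<^sup>jb) = as\<^sub>j + \<tau> bs\<^sub>j\<close>, where \<open>\<tau>b = c\<^sup>3b + c\<^sup>-\<^sup>3b\<close>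
  (needed for \<open>H\<^sub>4\<close> only). A word \<open>ws\<close> stands for the product of the reflections in the roots \<open>c\<^sup>ib\<close>.\<close>

definition shiftl :: "int list \<Rightarrow> int list \<Rightarrow> int list" where
  "shiftl cs y = (let t = last y in map2 (\<lambda>a p. a - t * p) (0 # butlast y) cs)"

fun powl :: "int list \<Rightarrow> nat \<Rightarrow> int list \<Rightarrow> int list list" where
  "powl cs 0 y = []" | "powl cs (Suc k) y = y # powl cs k (shiftl cs y)"

text \<open>\<open>xs\<close> lists the coordinates of the iterates of b over a full period. Twice
  the inner product of y with the i-th iterate is \<open>m + \<tau> k\<close>, and \<tau> times this
  iterate is the sum of the iterates i + 3 and i - 3.\<close>

definition refll :: "int list \<Rightarrow> int list \<Rightarrow> int list list \<Rightarrow> nat \<Rightarrow> int list \<Rightarrow> int list" where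
  "refll as bs xs i y = (let z = map (\<lambda>j. dst i j) [0..<length y];
       m = dotl y (map ((!) as) z); k = dotl y (map ((!) bs) z);
       y' = map2 (\<lambda>a d. a - m * d) y (xs ! i)
     in if k = 0 then y'
        else map2 (\<lambda>a d. a - k * d) y' (map2 (+) (xs ! ((i + 3) mod length xs)) (xs ! ((i + (length xs - 3)) mod length xs))))"

fun wordl :: "int list \<Rightarrow> int list \<Rightarrow> int list list \<Rightarrow> nat list \<Rightarrow> int list \<Rightarrow> int list" where
  "wordl as bs xs [] y = y"
| "wordl as bs xs (i # ws) y = refll as bs xs i (wordl as bs xs ws y)"

text \<open>The identity g c^k = c g, for g the product of reflections given by \<open>ws\<close>,
  tested on the j-th iterate of b.\<close>

definition conj_at :: "int list \<Rightarrow> int list \<Rightarrow> int list \<Rightarrow> int list list \<Rightarrow> nat \<Rightarrow> nat list \<Rightarrow> nat \<Rightarrow> bool" where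
  "conj_at cs as bs xs k ws j \<longleftrightarrow>
     wordl as bs xs ws (xs ! (k + j)) = shiftl cs (wordl as bs xs ws (xs ! j))"

definition conj_check :: "int list \<Rightarrow> int list \<Rightarrow> int list \<Rightarrow> int list list \<Rightarrow> nat \<Rightarrow> nat list \<Rightarrow> bool" where
  "conj_check cs as bs xs k ws \<longleftrightarrow> list_all (\<lambda>i. i < length as \<and> i < length xs) ws \<and>
     length cs \<le> length as \<and> length bs = length as \<and> length cs + k \<le> length xs \<and>
     list_all (conj_at cs as bs xs k ws) [0..<length cs]"

definition unitl :: "nat \<Rightarrow> int list" where
  "unitl k = 1 # replicate (k - 1) 0"

lemma length_shiftl [simp]: "y \<noteq> [] \<Longrightarrow> length (shiftl cs y) = min (length y) (length cs)"
  by (simp add: shiftl_def Let_def)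

lemma length_powl [simp]: "length (powl cs k y) = k"
  by (induction k arbitrary: y) auto

lemma powl_nth: "i < k \<Longrightarrow> powl cs k y ! i = (shiftl cs ^^ i) y"
proof (induction k arbitrary: y i)
  case (Suc k)
  then show ?case by (cases i) (auto simp: funpow_swap1)
qed simp

context regular_elt
begin

definition evx :: "real^'n \<Rightarrow> nat \<Rightarrow> int list \<Rightarrow> real^'n" where
  "evx b k y = (\<Sum>j<k. of_int (y ! j) *\<^sub>R (f ^^ j) b)"

lemma evx_shiftl:
  assumes cs: "papp (Poly (cs @ [1])) f b = 0" "cs \<noteq> []" and y: "length y = length cs"
  shows "evx b (length cs) (shiftl cs y) = f (evx b (length cs) y)"
proof -
  obtain k where k: "length cs = Suc k" using cs(2) by (cases cs) auto
  let ?t = "y ! k"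
  have t: "last y = ?t" using y k by (simp add: last_conv_nth flip: length_greater_0_conv)
  have nth: "shiftl cs y ! j = (if j = 0 then 0 else y ! (j - 1)) - ?t * cs ! j" if "j < Suc k" for j
    using that y k unfolding shiftl_def Let_def t by (cases j) (auto simp: nth_butlast)
  have "(\<Sum>j<Suc k. of_int (cs ! j) *\<^sub>R (f ^^ j) b) = - (f ^^ Suc k) b"
    using cs(1) unfolding papp_Poly[OF lin_f]
    by (simp add: k nth_append sum.lessThan_Suc[of _ "Suc k"] add_eq_0_iff2 del: sum.lessThan_Suc funpow.simps)
  then have red: "(\<Sum>j<Suc k. of_int (?t * cs ! j) *\<^sub>R (f ^^ j) b) = - (of_int ?t *\<^sub>R (f ^^ Suc k) b)"
    by (simp add: scaleR_sum_right[symmetric] del: sum.lessThan_Suc funpow.simps flip: scaleR_scaleR)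
  have "evx b (length cs) (shiftl cs y) = (\<Sum>j<Suc k. of_int (if j = 0 then 0 else y ! (j - 1)) *\<^sub>R (f ^^ j) b)
     - (\<Sum>j<Suc k. of_int (?t * cs ! j) *\<^sub>R (f ^^ j) b)"
    unfolding evx_def k sum_subtractf[symmetric] by (intro sum.cong refl) (simp add: nth scaleR_diff_left)
  also have "(\<Sum>j<Suc k. of_int (if j = 0 then 0 else y ! (j - 1)) *\<^sub>R (f ^^ j) b) =
     (\<Sum>j<k. of_int (y ! j) *\<^sub>R (f ^^ Suc j) b)"
    by (subst sum.lessThan_Suc_shift) simp
  also have "\<dots> - (\<Sum>j<Suc k. of_int (?t * cs ! j) *\<^sub>R (f ^^ j) b) = (\<Sum>j<Suc k. of_int (y ! j) *\<^sub>R (f ^^ Suc j) b)"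
    unfolding red by simp
  also have "\<dots> = f (evx b (length cs) y)"
    unfolding evx_def k by (simp add: linear_sum[OF lin_f] linear_cmul[OF lin_f] linear_add[OF lin_f])
  finally show ?thesis .
qed

lemma evx_powl:
  assumes cs: "papp (Poly (cs @ [1])) f b = 0" "cs \<noteq> []"
  shows "length ((shiftl cs ^^ i) (unitl (length cs))) = length cs \<and>
    evx b (length cs) ((shiftl cs ^^ i) (unitl (length cs))) = (f ^^ i) b"
proof (induction i)
  case 0
  obtain k where k: "length cs = Suc k" using cs(2) by (cases cs) auto
  have "evx b (Suc k) (unitl (Suc k)) = b" unfolding evx_def unitl_def
    by (subst sum.lessThan_Suc_shift) simp
  then show ?case using k by (simp add: unitl_def)
next
  case (Suc i)
  let ?y = "(shiftl cs ^^ i) (unitl (length cs))"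
  have "?y \<noteq> []" using Suc cs(2) by auto
  then show ?case using Suc evx_shiftl[OF cs, of ?y] by simp
qed

lemma evx_map2_diff:
  assumes "length y = k" "length d = k"
  shows "evx b k (map2 (\<lambda>a d. a - m * d) y d) = evx b k y - of_int m *\<^sub>R evx b k d"
  using assms by (simp add: evx_def scaleR_diff_left sum_subtractf scaleR_sum_right)

lemma evx_map2_add:
  assumes "length y = k" "length d = k"
  shows "evx b k (map2 (+) y d) = evx b k y + evx b k d"
  using assms by (simp add: evx_def scaleR_add_left sum.distrib)

lemma evx_refll:
  assumes b: "b \<in> roots" and cs: "papp (Poly (cs @ [1])) f b = 0" "cs \<noteq> []"
    and as: "\<And>j. j < length as \<Longrightarrow> ac b j = of_int (as ! j) + \<tau> * of_int (bs ! j)"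
    and bs: "length bs = length as" "(\<forall>a\<in>set bs. a = 0) \<or> \<tau> *\<^sub>R b = (f ^^ 3) b + (f ^^ (h - 3)) b"
    and i: "i < length as" "i < h" "length cs \<le> length as"
    and y: "length y = length cs" and xs: "xs = powl cs h (unitl (length cs))"
  shows "length (refll as bs xs i y) = length cs \<and>
    evx b (length cs) (refll as bs xs i y) = reflection_matrix ((f ^^ i) b) *v evx b (length cs) y"
proof -
  let ?k = "length cs"
  define m where "m = dotl y (map ((!) as) (map (dst i) [0..<length y]))"
  define l where "l = dotl y (map ((!) bs) (map (dst i) [0..<length y]))"
  have x: "length (xs ! j) = ?k \<and> evx b ?k (xs ! j) = (f ^^ j) b" if "j < h" for j
    using evx_powl[OF cs, of j] that unfolding xs by (simp add: powl_nth)
  have dl: "dst i j < length as" if "j < ?k" for j using that i by (auto simp: dst_def)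
  have m': "m = (\<Sum>j<?k. y ! j * as ! dst i j)" "l = (\<Sum>j<?k. y ! j * bs ! dst i j)"
    unfolding m_def l_def using y by (simp_all add: dotl_sum)
  have "2 * ((f ^^ i) b \<bullet> evx b ?k y) = (\<Sum>j<?k. of_int (y ! j) * (2 * ((f ^^ i) b \<bullet> (f ^^ j) b)))"
    by (simp add: evx_def inner_sum_right sum_distrib_left algebra_simps)
  also have "\<dots> = (\<Sum>j<?k. of_int (y ! j) * (of_int (as ! dst i j) + \<tau> * of_int (bs ! dst i j)))"
    by (intro sum.cong refl) (simp add: ac_dst as dl)
  also have "\<dots> = of_int m + \<tau> * of_int l"
    unfolding m' by (simp add: sum.distrib sum_distrib_left algebra_simps)
  finally have ip: "2 * ((f ^^ i) b \<bullet> evx b ?k y) = of_int m + \<tau> * of_int l" .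
  have unit: "(f ^^ i) b \<bullet> (f ^^ i) b = 1" using b iter_inner by simp
  have refl: "reflection_matrix ((f ^^ i) b) *v evx b ?k y =
    evx b ?k y - of_int m *\<^sub>R (f ^^ i) b - of_int l *\<^sub>R (\<tau> *\<^sub>R (f ^^ i) b)"
    unfolding reflection_unit_apply[OF unit] ip by (simp add: scaleR_add_left mult.commute)
  let ?y = "map2 (\<lambda>a d. a - m * d) y (xs ! i)"
  have y': "length ?y = ?k" "evx b ?k ?y = evx b ?k y - of_int m *\<^sub>R (f ^^ i) b"
    using x[of i] i y evx_map2_diff[of y ?k "xs ! i" b m] by auto
  show ?thesis
  proof (cases "l = 0")
    case True
    then have "refll as bs xs i y = ?y" by (simp add: refll_def Let_def m_def l_def)
    then show ?thesis using y' refl True by simp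
  next
    case False
    have "\<not> (\<forall>a\<in>set bs. a = 0)"
    proof
      assume z: "\<forall>a\<in>set bs. a = 0"
      have "bs ! dst i j = 0" if "j < ?k" for j using z dl[OF that] bs(1) by simp
      then have "l = 0" unfolding m'(2) by simp
      then show False using False by simp
    qed
    then have \<tau>: "\<tau> *\<^sub>R b = (f ^^ 3) b + (f ^^ (h - 3)) b" using bs(2) by blast
    define j where "j = (i + (h - 3)) mod h"
    define j3 where "j3 = (i + 3) mod h"
    have j: "j < h" "j3 < h" using h_pos by (simp_all add: j_def j3_def)
    have jj: "(f ^^ j) b = (f ^^ (i + (h - 3))) b" "(f ^^ j3) b = (f ^^ (i + 3)) b"
      by (simp_all add: j_def j3_def iter_mod)
    have "\<tau> *\<^sub>R (f ^^ i) b = (f ^^ i) (\<tau> *\<^sub>R b)" by (simp add: linear_cmul[OF linear_iter])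
    also have "\<dots> = (f ^^ j3) b + (f ^^ j) b"
      unfolding \<tau> jj by (simp add: linear_add[OF linear_iter] funpow_add)
    finally have ti: "\<tau> *\<^sub>R (f ^^ i) b = (f ^^ j3) b + (f ^^ j) b" .
    have r: "refll as bs xs i y = map2 (\<lambda>a d. a - l * d) ?y (map2 (+) (xs ! j3) (xs ! j))"
      using False by (simp add: refll_def Let_def m_def l_def j_def j3_def xs)
    have z: "length (map2 (+) (xs ! j3) (xs ! j)) = ?k"
      "evx b ?k (map2 (+) (xs ! j3) (xs ! j)) = (f ^^ j3) b + (f ^^ j) b"
      using x[of j3] x[of j] j evx_map2_add[of "xs ! j3" ?k "xs ! j" b] by auto
    show ?thesis unfolding r using evx_map2_diff[OF y'(1) z(1), of b l] y' z refl ti by simp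
  qed
qed

text \<open>The list functions mirror the linear maps, and both sides of g c^k = c g are linear, so
  tests on the spanning vectors suffice.\<close>

lemma conj_check_sound:
  assumes b: "b \<in> roots" and cs: "papp (Poly (cs @ [1])) f b = 0" "cs \<noteq> []"
    and as: "\<And>j. j < length as \<Longrightarrow> ac b j = of_int (as ! j) + \<tau> * of_int (bs ! j)"
    and bs: "(\<forall>a\<in>set bs. a = 0) \<or> \<tau> *\<^sub>R b = (f ^^ 3) b + (f ^^ (h - 3)) b"
    and chk: "conj_check cs as bs (powl cs h (unitl (length cs))) k ws"
    and sp: "span ((\<lambda>j. (f ^^ j) b) ` {..<length cs}) = UNIV"
  shows "\<exists>g\<in>W. c ** g = g ** c [^]\<^bsub>G\<^esub> k"
proof -
  let ?k = "length cs" and ?xs = "powl cs h (unitl (length cs))"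
  have ws: "\<And>i. i \<in> set ws \<Longrightarrow> i < length as \<and> i < h" and la: "?k \<le> length as"
    and lb: "length bs = length as" and lx: "?k + k \<le> h"
    and eq: "\<And>j. j < ?k \<Longrightarrow> wordl as bs ?xs ws (?xs ! (k + j)) = shiftl cs (wordl as bs ?xs ws (?xs ! j))"
    using chk by (auto simp: conj_check_def conj_at_def list_all_iff)
  define g where "g = foldr (\<lambda>i A. reflection_matrix ((f ^^ i) b) ** A) ws (mat 1)"
  have gW: "g \<in> W" unfolding g_def using b by (induction ws) (auto simp: iter_root)
  have word: "length (wordl as bs ?xs ws y) = ?k \<and> evx b ?k (wordl as bs ?xs ws y) = g *v evx b ?k y"
    if "length y = ?k" for y
    using ws unfolding g_def
  proof (induction ws)
    case Nil
    then show ?case using that by simp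
  next
    case (Cons i ws)
    then show ?case
      using evx_refll[OF b cs as lb bs _ _ la _ refl, of i "wordl as bs ?xs ws y"]
      by (simp flip: matrix_vector_mul_assoc)
  qed
  have x: "length (?xs ! j) = ?k \<and> evx b ?k (?xs ! j) = (f ^^ j) b" if "j < h" for j
    using evx_powl[OF cs, of j] that by (simp add: powl_nth)
  have "c *v (g *v (f ^^ j) b) = g *v (f ^^ (k + j)) b" if j: "j < ?k" for j
  proof -
    have "c *v (g *v (f ^^ j) b) = f (evx b ?k (wordl as bs ?xs ws (?xs ! j)))"
      using word x[of j] j lx by simp
    also have "\<dots> = evx b ?k (shiftl cs (wordl as bs ?xs ws (?xs ! j)))"
      using evx_shiftl[OF cs] word x[of j] j lx by simp
    also have "\<dots> = g *v (f ^^ (k + j)) b" unfolding eq[OF j, symmetric] using word x[of "k + j"] j lx by simp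
    finally show ?thesis .
  qed
  then have on: "(c ** g) *v y = (g ** c [^]\<^bsub>G\<^esub> k) *v y" if "y \<in> (\<lambda>j. (f ^^ j) b) ` {..<?k}" for y
    using that by (auto simp: pow_apply[OF cW] funpow_add simp flip: matrix_vector_mul_assoc)
  have "(c ** g) *v y = (g ** c [^]\<^bsub>G\<^esub> k) *v y" for y
  proof (rule linear_eq_on_span[OF matrix_vector_mul_linear matrix_vector_mul_linear on])
    show "y \<in> span ((\<lambda>j. (f ^^ j) b) ` {..<?k})" using sp by simp
  qed
  then show ?thesis using gW by (intro bexI[of _ g]) (auto simp: matrix_eq)
qed

end

section \<open>Cyclotomic polynomials of the orders that occur\<close>

abbreviation "Phi12 \<equiv> [:1, 0, -1, 0, 1:] :: int poly"
abbreviation "Phi14 \<equiv> [:1, -1, 1, -1, 1, -1, 1:] :: int poly"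
abbreviation "Phi18 \<equiv> [:1, 0, 0, -1, 0, 0, 1:] :: int poly"
abbreviation "Phi30 \<equiv> [:1, 1, 0, -1, -1, -1, 0, 1, 1:] :: int poly"

lemma totient_values: "totient 12 = 4" "totient 14 = 6" "totient 18 = 6" "totient 30 = 8"
  by code_simp+

lemma prime_dvd_small:
  fixes p :: nat
  assumes "prime p"
  shows "p dvd 12 \<Longrightarrow> p \<in> {2, 3}" "p dvd 18 \<Longrightarrow> p \<in> {2, 3}" "p dvd 30 \<Longrightarrow> p \<in> {2, 3, 5}"
proof -
  have 2: "p dvd 2 \<Longrightarrow> p = 2" and 3: "p dvd 3 \<Longrightarrow> p = 3" and 5: "p dvd 5 \<Longrightarrow> p = 5"
    using primes_dvd_imp_eq[OF assms] by auto
  show "p \<in> {2, 3}" if "p dvd 12"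
  proof -
    have "p dvd 2 * (2 * 3)" using that by simp
    then show ?thesis using 2 3 prime_dvd_mult_iff[OF assms] by blast
  qed
  show "p \<in> {2, 3}" if "p dvd 18"
  proof -
    have "p dvd 2 * (3 * 3)" using that by simp
    then show ?thesis using 2 3 prime_dvd_mult_iff[OF assms] by blast
  qed
  show "p \<in> {2, 3, 5}" if "p dvd 30"
  proof -
    have "p dvd 2 * (3 * 5)" using that by simp
    then show ?thesis using 2 3 5 prime_dvd_mult_iff[OF assms] by blast
  qed
qed

lemma exact_orderI:
  assumes "m > 0" "z ^ m = 1" "\<And>p. prime p \<Longrightarrow> p dvd m \<Longrightarrow> z ^ (m div p) \<noteq> 1"
  shows "exact_order z m"
proof -
  define d where "d = (LEAST d. d > 0 \<and> z ^ d = 1)"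
  have d: "d > 0 \<and> z ^ d = 1" unfolding d_def by (rule LeastI[of _ m]) (use assms in simp)
  have min: "z ^ j \<noteq> 1" if "0 < j" "j < d" for j
    using not_less_Least[of j "\<lambda>d. d > 0 \<and> z ^ d = 1"] that by (auto simp: d_def)
  have ex: "exact_order z d" using d min by (simp add: exact_order_def)
  then have "d dvd m" using exact_order_pow_eq_1_iff assms(2) by blast
  then obtain q where q: "m = d * q" by blast
  have "q = 1"
  proof (rule ccontr)
    assume "q \<noteq> 1"
    then obtain p where p: "prime p" "p dvd q" using prime_factor_nat by blast
    then obtain r where r: "q = p * r" by blast
    have "m div p = d * r" using q r prime_gt_0_nat[OF p(1)] by simp
    then have "z ^ (m div p) = 1" using d by (simp add: power_mult)
    then show False using assms(3)[OF p(1)] p(2) q by simp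
  qed
  then show ?thesis using ex q by simp
qed

lemma ieval_Phi:
  "ieval Phi12 z = z ^ 4 - z ^ 2 + 1" "ieval Phi18 z = z ^ 6 - z ^ 3 + 1"
  "ieval Phi14 z = z ^ 6 - z ^ 5 + z ^ 4 - z ^ 3 + z ^ 2 - z + 1"
  "ieval Phi30 z = z ^ 8 + z ^ 7 - z ^ 5 - z ^ 4 - z ^ 3 + z + 1"
  by (simp_all add: eval_nat_numeral algebra_simps)

lemma exact_order_half:
  assumes "exact_order z (2 * m)" "m > 0"
  shows "z ^ m = -1"
proof -
  have "(z ^ m - 1) * (z ^ m + 1) = 0"
    using assms by (simp add: exact_order_def algebra_simps power_mult power2_eq_square)
  moreover have "z ^ m \<noteq> 1" using assms by (auto simp: exact_order_def)
  ultimately show ?thesis by (simp add: add_eq_0_iff2)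
qed

lemma exact_order_12: "exact_order z 12 \<longleftrightarrow> ieval Phi12 z = 0"
proof
  assume e: "exact_order z 12"
  then have "z ^ 6 = -1" using exact_order_half[of z 6] by simp
  then have "(z ^ 2 + 1) * (z ^ 4 - z ^ 2 + 1) = 0" by (simp add: algebra_simps eval_nat_numeral)
  moreover have "z ^ 2 + 1 \<noteq> 0"
  proof
    assume "z ^ 2 + 1 = 0"
    then have "z ^ 2 = -1" by (simp add: add_eq_0_iff2)
    then have "z ^ 4 = 1" using power_mult[of z 2 2] by simp
    then show False using e by (simp add: exact_order_def)
  qed
  ultimately show "ieval Phi12 z = 0" unfolding ieval_Phi by simp
next
  assume "ieval Phi12 z = 0"
  then have p: "z ^ 4 - z ^ 2 + 1 = 0" unfolding ieval_Phi .
  have "z ^ 6 + 1 = (z ^ 2 + 1) * (z ^ 4 - z ^ 2 + 1)" by (simp add: algebra_simps eval_nat_numeral)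
  then have z6: "z ^ 6 = -1" using p by (simp add: add_eq_0_iff2)
  show "exact_order z 12"
  proof (rule exact_orderI)
    show "z ^ 12 = 1" using power_mult[of z 6 2] z6 by simp
    fix q :: nat assume q: "prime q" "q dvd 12"
    then have "q = 2 \<or> q = 3" using prime_dvd_small(1) by auto
    moreover have "z ^ 4 \<noteq> 1"
    proof
      assume "z ^ 4 = 1"
      then have "z ^ 2 = -1" using z6 power_add[of z 4 2] by simp
      then show False using p \<open>z ^ 4 = 1\<close> by simp
    qed
    ultimately show "z ^ (12 div q) \<noteq> 1" using z6 by auto
  qed simp
qed

lemma exact_order_18: "exact_order z 18 \<longleftrightarrow> ieval Phi18 z = 0"
proof
  assume e: "exact_order z 18"
  then have "z ^ 9 = -1" using exact_order_half[of z 9] by simp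
  then have "(z ^ 3 + 1) * (z ^ 6 - z ^ 3 + 1) = 0" by (simp add: algebra_simps eval_nat_numeral)
  moreover have "z ^ 3 + 1 \<noteq> 0"
  proof
    assume "z ^ 3 + 1 = 0"
    then have "z ^ 3 = -1" by (simp add: add_eq_0_iff2)
    then have "z ^ 6 = 1" using power_mult[of z 3 2] by simp
    then show False using e by (simp add: exact_order_def)
  qed
  ultimately show "ieval Phi18 z = 0" unfolding ieval_Phi by simp
next
  assume "ieval Phi18 z = 0"
  then have p: "z ^ 6 - z ^ 3 + 1 = 0" unfolding ieval_Phi .
  have "z ^ 9 + 1 = (z ^ 3 + 1) * (z ^ 6 - z ^ 3 + 1)" by (simp add: algebra_simps eval_nat_numeral)
  then have z9: "z ^ 9 = -1" using p by (simp add: add_eq_0_iff2)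
  show "exact_order z 18"
  proof (rule exact_orderI)
    show "z ^ 18 = 1" using power_mult[of z 9 2] z9 by simp
    fix q :: nat assume q: "prime q" "q dvd 18"
    then have "q = 2 \<or> q = 3" using prime_dvd_small(2) by auto
    moreover have "z ^ 6 \<noteq> 1"
    proof
      assume "z ^ 6 = 1"
      then have "z ^ 3 = -1" using z9 power_add[of z 6 3] by simp
      then show False using p \<open>z ^ 6 = 1\<close> by simp
    qed
    ultimately show "z ^ (18 div q) \<noteq> 1" using z9 by auto
  qed simp
qed

lemma exact_order_14: "exact_order z 14 \<Longrightarrow> ieval Phi14 z = 0"
proof -
  assume e: "exact_order z 14"
  then have "z ^ 7 = -1" using exact_order_half[of z 7] by simp
  then have "(z + 1) * (z ^ 6 - z ^ 5 + z ^ 4 - z ^ 3 + z ^ 2 - z + 1) = 0"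
    by (simp add: algebra_simps eval_nat_numeral)
  moreover have "z + 1 \<noteq> 0"
  proof
    assume "z + 1 = 0"
    then have "z = -1" by (simp add: add_eq_0_iff2)
    then have "z ^ 2 = 1" by simp
    then show False using e by (simp add: exact_order_def)
  qed
  ultimately show "ieval Phi14 z = 0" unfolding ieval_Phi by simp
qed

text \<open>\<open>Phi30\<close> is isolated by \<open>fac3\<close> and \<open>fac1\<close> from the
  polynomial x^15 + 1; its multiple in \<open>fac2\<close> excludes
  \<open>z ^ 6 = 1\<close>.\<close>

lemma exact_order_30: "exact_order z 30 \<longleftrightarrow> ieval Phi30 z = 0"
proof -
  have fac1: "z ^ 10 - z ^ 5 + 1 = (z ^ 2 - z + 1) * (z ^ 8 + z ^ 7 - z ^ 5 - z ^ 4 - z ^ 3 + z + 1)"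
    by (simp add: algebra_simps eval_nat_numeral)
  have fac2: "z ^ 12 - z ^ 9 + z ^ 6 - z ^ 3 + 1 =
    (z ^ 4 - z ^ 3 + z ^ 2 - z + 1) * (z ^ 8 + z ^ 7 - z ^ 5 - z ^ 4 - z ^ 3 + z + 1)"
    by (simp add: algebra_simps eval_nat_numeral)
  have fac3: "z ^ 15 + 1 = (z ^ 5 + 1) * (z ^ 10 - z ^ 5 + 1)"
    by (simp add: algebra_simps eval_nat_numeral)
  show ?thesis
  proof
    assume e: "exact_order z 30"
    then have "z ^ 15 = -1" using exact_order_half[of z 15] by simp
    then have "(z ^ 5 + 1) * (z ^ 10 - z ^ 5 + 1) = 0" using fac3 by simp
    moreover have "z ^ 5 + 1 \<noteq> 0"
    proof
      assume "z ^ 5 + 1 = 0"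
      then have "z ^ 5 = -1" by (simp add: add_eq_0_iff2)
      then have "z ^ 10 = 1" using power_mult[of z 5 2] by simp
      then show False using e by (simp add: exact_order_def)
    qed
    ultimately have "(z ^ 2 - z + 1) * (z ^ 8 + z ^ 7 - z ^ 5 - z ^ 4 - z ^ 3 + z + 1) = 0"
      unfolding fac1 by simp
    moreover have "z ^ 2 - z + 1 \<noteq> 0"
    proof
      assume "z ^ 2 - z + 1 = 0"
      moreover have "z ^ 3 + 1 = (z + 1) * (z ^ 2 - z + 1)" by (simp add: algebra_simps eval_nat_numeral)
      ultimately have "z ^ 3 = -1" by (simp add: add_eq_0_iff2)
      then have "z ^ 6 = 1" using power_mult[of z 3 2] by simp
      then show False using e by (simp add: exact_order_def)
    qed
    ultimately show "ieval Phi30 z = 0" unfolding ieval_Phi by simp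
  next
    assume "ieval Phi30 z = 0"
    then have p: "z ^ 8 + z ^ 7 - z ^ 5 - z ^ 4 - z ^ 3 + z + 1 = 0" unfolding ieval_Phi .
    have f1: "z ^ 10 - z ^ 5 + 1 = 0" unfolding fac1 p by simp
    have f2: "z ^ 12 - z ^ 9 + z ^ 6 - z ^ 3 + 1 = 0" unfolding fac2 p by simp
    have z15: "z ^ 15 = -1" using fac3 f1 by (simp add: add_eq_0_iff2)
    show "exact_order z 30"
    proof (rule exact_orderI)
      show "z ^ 30 = 1" using power_mult[of z 15 2] z15 by simp
      fix q :: nat assume q: "prime q" "q dvd 30"
      then have "q = 2 \<or> q = 3 \<or> q = 5" using prime_dvd_small(3) by auto
      moreover have "z ^ 10 \<noteq> 1"
      proof
        assume "z ^ 10 = 1"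
        then have "z ^ 5 = -1" using z15 power_add[of z 10 5] by simp
        then show False using f1 \<open>z ^ 10 = 1\<close> by simp
      qed
      moreover have "z ^ 6 \<noteq> 1"
      proof
        assume z6: "z ^ 6 = 1"
        then have "z ^ 12 = 1" using power_mult[of z 6 2] by simp
        then have z3: "z ^ 3 = -1" using z15 power_add[of z 12 3] by simp
        then have "z ^ 9 = -1" using z6 power_add[of z 6 3] by simp
        then show False using f2 z6 z3 \<open>z ^ 12 = 1\<close> by simp
      qed
      ultimately show "z ^ (30 div q) \<noteq> 1" using z15 by auto
    qed simp
  qed
qed

section \<open>A lower bound for the largest degree from an explicit Coxeter element\<close>

fun cox_num :: "coxeter_type \<Rightarrow> nat" where
  "cox_num E6 = 12" | "cox_num E7 = 18" | "cox_num E8 = 30" | "cox_num F4 = 12" | "cox_num H4 = 30"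

fun cox_cyc :: "coxeter_type \<Rightarrow> int list" where
  "cox_cyc E6 = [1, 0, -1, 0, 1]" | "cox_cyc E7 = [1, 0, 0, -1, 0, 0, 1]"
| "cox_cyc E8 = [1, 1, 0, -1, -1, -1, 0, 1, 1]" | "cox_cyc F4 = [1, 0, -1, 0, 1]"
| "cox_cyc H4 = [1, 1, 0, -1, -1, -1, 0, 1, 1]"

text \<open>The product of the simple reflections has characteristic polynomial Phi12 (x^2 + x + 1)
  for E6 and Phi18 (x + 1) for E7. Applying the cofactor to a basis vector produces a vector killed
  by \<open>cox_cyc\<close>.\<close>

fun cox_cofac :: "coxeter_type \<Rightarrow> int list" where
  "cox_cofac E6 = [1, 1, 1]" | "cox_cofac E7 = [1, 1]" | "cox_cofac D = [1]"

lemma cox_cyc_exact_order: "ieval (Poly (cox_cyc D)) z = 0 \<Longrightarrow> exact_order z (cox_num D)"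
  by (cases D) (simp_all del: ieval_pCons add: exact_order_12 exact_order_18 exact_order_30)

fun sactl :: "coxeter_type \<Rightarrow> nat list \<Rightarrow> int list \<Rightarrow> int list" where
  "sactl D [] y = y"
| "sactl D (i # is) y = sact D i (sactl D is y)"

definition coxl :: "coxeter_type \<Rightarrow> int list \<Rightarrow> int list" where
  "coxl D y = sactl D [0..<coxeter_rank D] y"

fun polyl :: "coxeter_type \<Rightarrow> int list \<Rightarrow> int list \<Rightarrow> int list" where
  "polyl D [] y = replicate (lrank D) 0"
| "polyl D (a # cs) y = map2 (+) (map ((*) a) y) (coxl D (polyl D cs y))"

text \<open>For H4 a nonzero coordinate list does not guarantee a nonzero vector, as
  \<open>1\<close> and \<open>phi\<close> are dependent over the reals; there \<open>u\<close> is
  required to be the first basis vector.\<close>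

definition cox_ok :: "coxeter_type \<Rightarrow> bool" where
  "cox_ok D \<longleftrightarrow> (let u = polyl D (cox_cofac D) (unitl (lrank D)) in
     polyl D (cox_cyc D) u = replicate (lrank D) 0 \<and> (if D = H4 then u = unitl 8 else list_ex (\<lambda>a. a \<noteq> 0) u))"

lemma cox_ok: "cox_ok D"
proof -
  have "cox_ok E6" "cox_ok E7" "cox_ok E8" "cox_ok F4" "cox_ok H4" by code_simp+
  then show ?thesis by (cases D) simp_all
qed

context coxeter_rep
begin

lemma length_coxl [simp]: "length (coxl D y) = length y"
proof -
  have "length (sactl D is y) = length y" for "is" by (induction "is") auto
  then show ?thesis by (simp add: coxl_def)
qed

lemma length_polyl [simp]: "length y = N \<Longrightarrow> length (polyl D cs y) = N"
  by (induction cs) auto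

lemma coxl_ev: "length y = N \<Longrightarrow> wprod [0..<n] *v ev D \<alpha> y = ev D \<alpha> (coxl D y)"
proof -
  assume y: "length y = N"
  have "set is \<subseteq> {..<n} \<Longrightarrow> length (sactl D is y) = N \<and>
    wprod is *v ev D \<alpha> y = ev D \<alpha> (sactl D is y)" for "is"
    by (induction "is") (auto simp: y s_ev simp flip: matrix_vector_mul_assoc)
  from this[of "[0..<n]"] show ?thesis by (simp add: coxl_def atLeast0LessThan)
qed

lemma ev_add_scale:
  "length y = N \<Longrightarrow> length z = N \<Longrightarrow>
    ev D \<alpha> (map2 (+) (map ((*) a) y) z) = of_int a *\<^sub>R ev D \<alpha> y + ev D \<alpha> z"
  by (simp add: ev_def scaleR_add_left sum.distrib scaleR_sum_right)

lemma polyl_ev: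
  assumes y: "length y = N"
  shows "papp (Poly cs) ((*v) (wprod [0..<n])) (ev D \<alpha> y) = ev D \<alpha> (polyl D cs y)"
proof (induction cs)
  case Nil
  then show ?case by (simp add: ev_def)
next
  case (Cons a cs)
  then show ?case using y
    by (simp add: matrix_vector_mul_linear ev_add_scale coxl_ev)
qed

lemma ev_nz:
  assumes "length y = N" "if D = H4 then y = unitl 8 else list_ex (\<lambda>a. a \<noteq> 0) y"
  shows "ev D \<alpha> y \<noteq> 0"
proof
  assume "ev D \<alpha> y = 0"
  then have z: "ecoef D y j = 0" if "j < n" for j
    using indep[of "ecoef D y" j] that unfolding ev_alpha by simp
  show False
  proof (cases "D = H4")
    case True
    then show False using z[of 0] assms by (simp add: ecoef_def unitl_def)
  next
    case False
    then obtain j where j: "j < N" "y ! j \<noteq> 0" using assms by (auto simp: list_ex_iff in_set_conv_nth)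
    have "N = n" using False by (cases D) auto
    then have "ecoef D y j = 0" using z j by simp
    then show False using j(2) False by (cases D) (auto simp: ecoef_def split: if_splits)
  qed
qed

end

text \<open>The kernel vector found by computation leads to an eigenvector of the product of the
  simple reflections whose eigenvalue has exact order \<open>cox_num D\<close>. This element of W is
  unrelated to the given c.\<close>

lemma (in finite_coxeter_rep) cox_num_le_degree:
  assumes "fundamental_invariants W f d"
  shows "\<exists>i. cox_num D \<le> d i"
proof -
  define u where "u = polyl D (cox_cofac D) (unitl N)"
  have N: "N > 0" by (cases D) auto
  then have lu: "length u = N" unfolding u_def by (intro length_polyl) (simp add: unitl_def)
  have ok: "polyl D (cox_cyc D) u = replicate N 0" "if D = H4 then u = unitl 8 else list_ex (\<lambda>a. a \<noteq> 0) u"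
    using cox_ok[of D] unfolding cox_ok_def u_def Let_def by auto
  have "papp (Poly (cox_cyc D)) ((*v) (wprod [0..<n])) (ev D \<alpha> u) = 0"
    unfolding polyl_ev[OF lu] ok(1) by (simp add: ev_def)
  moreover have "ev D \<alpha> u \<noteq> 0" using ev_nz[OF lu ok(2)] .
  moreover have "Poly (cox_cyc D) \<noteq> 0" by (cases D) auto
  ultimately obtain \<mu> p q where mu: "ieval (Poly (cox_cyc D)) \<mu> = 0" "p \<noteq> 0 \<or> q \<noteq> 0"
    "wprod [0..<n] *v p = Re \<mu> *\<^sub>R p - Im \<mu> *\<^sub>R q" "wprod [0..<n] *v q = Im \<mu> *\<^sub>R p + Re \<mu> *\<^sub>R q"
    using papp_eigenvector[of "Poly (cox_cyc D)" "ev D \<alpha> u" "wprod [0..<n]"] by blast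
  have "wprod [0..<n] \<in> W" by (rule wprod_in_W) auto
  then show ?thesis
    using invariant_degree_ge[OF assms _ mu(2-4) cox_cyc_exact_order[OF mu(1)]] by blast
qed

section \<open>Integral inner products and autocorrelations\<close>

lemma (in coxeter_rep) ebas_scale:
  assumes "D \<noteq> H4"
  obtains t where "e i = t *\<^sub>R \<alpha> i" "t * t = 1 \<or> t * t = 2" "t \<noteq> 0"
proof -
  have "e i = 1 *\<^sub>R \<alpha> i \<or> e i = sqrt 2 *\<^sub>R \<alpha> i" using assms by (cases D) (auto simp: ebas_def)
  then show ?thesis using that[of 1] that[of "sqrt 2"] by auto
qed

lemma (in coxeter_rep) ebas_inner_int:
  assumes "D \<noteq> H4" "i < N" "j < N"
  shows "\<exists>k::int. 2 * (e i \<bullet> e j) = of_int k"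
proof -
  have N: "N = n" using assms(1) by (cases D) auto
  obtain t where t: "e i = t *\<^sub>R \<alpha> i" "t * t = 1 \<or> t * t = 2" "t \<noteq> 0" using ebas_scale[OF assms(1)] by blast
  have "(2 * (\<alpha> i \<bullet> e j)) *\<^sub>R \<alpha> i = (of_int (c1 D i j) * t) *\<^sub>R \<alpha> i"
    using cartan_action[OF sr, of i j] assms N by (simp add: c2_def t(1))
  then have "((2 * (\<alpha> i \<bullet> e j)) *\<^sub>R \<alpha> i) \<bullet> \<alpha> i = ((of_int (c1 D i j) * t) *\<^sub>R \<alpha> i) \<bullet> \<alpha> i" by (rule arg_cong)
  then have "2 * (\<alpha> i \<bullet> e j) = of_int (c1 D i j) * t"
    unfolding inner_scaleR_left using assms N by simp
  then have eq: "2 * (e i \<bullet> e j) = of_int (c1 D i j) * (t * t)" unfolding t(1) by simp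
  show ?thesis using t(2)
  proof
    assume "t * t = 1"
    then show ?thesis using eq by (intro exI[of _ "c1 D i j"]) simp
  next
    assume "t * t = 2"
    then show ?thesis using eq by (intro exI[of _ "c1 D i j * 2"]) simp
  qed
qed

lemma (in coxeter_rep) lat_inner_int:
  assumes "D \<noteq> H4" "x \<in> lat e N" "y \<in> lat e N"
  shows "\<exists>k::int. 2 * (x \<bullet> y) = of_int k"
proof -
  obtain u v where x: "x = (\<Sum>i<N. of_int (u i) *\<^sub>R e i)" and y: "y = (\<Sum>i<N. of_int (v i) *\<^sub>R e i)"
    using assms(2,3) by (auto simp: lat_def)
  define K where "K = (\<lambda>i j. SOME k::int. 2 * (e i \<bullet> e j) = of_int k)"
  have K: "2 * (e i \<bullet> e j) = of_int (K i j)" if "i < N" "j < N" for i j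
    unfolding K_def by (rule someI_ex[OF ebas_inner_int[OF assms(1) that]])
  have "2 * (x \<bullet> y) = (\<Sum>i<N. \<Sum>j<N. of_int (u i) * of_int (v j) * (2 * (e i \<bullet> e j)))"
    unfolding x y inner_sum_left inner_sum_right sum_distrib_left
    by (subst sum.swap) (simp add: algebra_simps)
  also have "\<dots> = (\<Sum>i<N. \<Sum>j<N. of_int (u i * v j * K i j))"
    by (intro sum.cong refl) (simp add: K)
  also have "\<dots> = of_int (\<Sum>i<N. \<Sum>j<N. u i * v j * K i j)" by simp
  finally show ?thesis by blast
qed

context regular_elt
begin

lemma full_cyclotomic:
  assumes "b \<in> lroots" "totient h = N" "ieval C \<nu> = 0" "C \<noteq> 0" "degree C = N"
  shows "papp C f b = 0"
proof -
  have br: "b \<in> roots" using assms(1) lroots_subset by blast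
  obtain q where q: "q \<noteq> 0" "totient h + degree q \<le> N" "papp q f (papp C f b) = 0"
    by (rule root_annihilator[OF br assms(1,3,4)]) (use assms in auto)
  then obtain a where a: "q = [:a:]" using assms(2) by (metis add_le_same_cancel1 degree_eq_zeroE le_zero_eq)
  then have "a \<noteq> 0" using q(1) by simp
  then show ?thesis using q(3) unfolding a by (simp add: linear_0)
qed

text \<open>For D \<noteq> H4 and b in \<open>lroots\<close> the value is already an integer; the
  floor only changes its type, so that integer arithmetic applies.\<close>

definition az :: "real^'n \<Rightarrow> nat \<Rightarrow> int" where
  "az b j = \<lfloor>ac b j\<rfloor>"

lemma
  assumes D: "D \<noteq> H4" and b: "b \<in> lroots"
  shows ac_az: "ac b j = of_int (az b j)"
    and az_0: "az b 0 = 2"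
    and az_bounds: "0 < j \<Longrightarrow> j < h \<Longrightarrow> -2 \<le> az b j \<and> az b j \<le> 1"
    and az_ge: "0 < j \<Longrightarrow> j < h \<Longrightarrow> 2 * j \<noteq> h \<Longrightarrow> -1 \<le> az b j"
    and az_neg: "0 < j \<Longrightarrow> j < h \<Longrightarrow> az b j = -2 \<Longrightarrow> (f ^^ j) b = - b"
    and az_recurrence: "papp (Poly cs) f b = 0 \<Longrightarrow> (\<Sum>i<length cs. cs ! i * az b (dst t (i + u))) = 0"
    and az_root_sum: "(\<Sum>i<k. (f ^^ i) b) \<in> roots \<Longrightarrow> (\<Sum>j\<in>{1..<k}. (int k - int j) * az b j) = 1 - int k"
    and az_norm: "2 * (evx b (length w) w \<bullet> evx b (length w) w) =
      of_int (\<Sum>i<length w. \<Sum>j<length w. w ! i * w ! j * az b (dst i j))"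
proof -
  have br: "b \<in> roots" using b lroots_subset by blast
  have A: "ac b j = of_int (az b j)" for j
  proof -
    have "b \<in> lat e N" using lroots_lat b by blast
    moreover have "(f ^^ j) b \<in> lat e N" using lat_iterate[of e N f b j] W_lat[OF cW] calculation by blast
    ultimately obtain k :: int where "ac b j = of_int k" unfolding ac_def using lat_inner_int[OF D] by blast
    then show ?thesis by (simp add: az_def)
  qed
  then show "ac b j = of_int (az b j)" .
  show "az b 0 = 2" using ac_0[OF br] A[of 0] by simp
  show "-2 \<le> az b j \<and> az b j \<le> 1" if "0 < j" "j < h"
    using ac_bounds(1,2)[OF br that] unfolding A by linarith
  show "-1 \<le> az b j" if "0 < j" "j < h" "2 * j \<noteq> h"
    using ac_bounds(4)[OF br that] unfolding A by linarith
  show "(f ^^ j) b = - b" if "0 < j" "j < h" "az b j = -2"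
    using ac_bounds(3)[OF br that(1,2)] that(3) unfolding A by simp
  show "(\<Sum>i<length cs. cs ! i * az b (dst t (i + u))) = 0" if "papp (Poly cs) f b = 0"
  proof -
    have "of_int (\<Sum>i<length cs. cs ! i * az b (dst t (i + u))) = (0::real)"
      using ac_recurrence[OF that, of t u] by (simp add: A)
    then show ?thesis by (simp only: of_int_eq_0_iff)
  qed
  show "(\<Sum>j\<in>{1..<k}. (int k - int j) * az b j) = 1 - int k" if "(\<Sum>i<k. (f ^^ i) b) \<in> roots"
  proof -
    have "of_int (\<Sum>j\<in>{1..<k}. (int k - int j) * az b j) = (of_int (1 - int k) :: real)"
      using root_sum_norm[OF br that] by (simp add: A)
    then show ?thesis by (simp only: of_int_eq_iff)
  qed
  show "2 * (evx b (length w) w \<bullet> evx b (length w) w) =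
    of_int (\<Sum>i<length w. \<Sum>j<length w. w ! i * w ! j * az b (dst i j))"
  proof -
    let ?x = "evx b (length w) w"
    have "2 * (?x \<bullet> ?x) = (\<Sum>i<length w. \<Sum>j<length w. of_int (w ! i) * of_int (w ! j) * (2 * ((f ^^ i) b \<bullet> (f ^^ j) b)))"
      unfolding evx_def inner_sum_left inner_sum_right sum_distrib_left
      by (subst sum.swap) (simp add: algebra_simps)
    also have "\<dots> = of_int (\<Sum>i<length w. \<Sum>j<length w. w ! i * w ! j * az b (dst i j))"
      by (simp add: ac_dst A)
    finally show ?thesis .
  qed
qed

lemma lroots_eq: "D \<noteq> F4 \<Longrightarrow> lroots = roots"
  by (simp add: lroots_def roots_def lidx_def)

lemma annihilate_all:
  assumes "\<And>b. b \<in> roots \<Longrightarrow> papp P f b = 0"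
  shows "papp P f x = 0"
proof -
  have "x = (\<Sum>i<n. cf x i *\<^sub>R \<alpha> i)" by (rule cf_expand)
  then have "papp P f x = (\<Sum>i<n. cf x i *\<^sub>R papp P f (\<alpha> i))"
    using linear_sum[OF linear_papp[OF lin_f]] linear_cmul[OF linear_papp[OF lin_f]]
    by (metis (no_types, lifting) sum.cong)
  then show ?thesis using assms by simp
qed

text \<open>A vector that all reflections fix modulo \<open>m\<close> (the radical of the Gram matrix modulo the
  determinant of the lattice) is multiplied by \<open>P(1)\<close> modulo \<open>m\<close> under \<open>P(c)\<close>.\<close>

lemma fixed_vector_mod:
  assumes D: "D \<noteq> H4" "D \<noteq> F4" and u: "length u = N" "k < N" "u ! k = 1"
    and fixed: "\<And>i. i < n \<Longrightarrow> m dvd dotl (cartan1 D ! i) u"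
    and P: "\<And>b. b \<in> roots \<Longrightarrow> papp P f b = 0"
  shows "m dvd poly P 1"
proof -
  have N: "N = n" using D by (cases D) auto
  let ?u = "ev D \<alpha> u"
  have st: "\<exists>z\<in>lat e N. s i *v ?u = ?u + of_int m *\<^sub>R z" if i: "i < n" for i
  proof -
    obtain d where d: "dotl (cartan1 D ! i) u = m * d" using fixed[OF i] by blast
    have "dotl (cartan2 D ! i) u = 0" using cartan_lengths(2)[OF i] D(1) by (simp add: dotl_def)
    then have "sact D i u = u[i := u ! i - m * d]" by (simp add: sact_def Let_def d)
    then have "s i *v ?u = ?u - of_int (m * d) *\<^sub>R e i"
      using s_ev[OF i u(1)] ev_update[of i D u \<alpha> "m * d"] i u(1) N by simp
    then have "s i *v ?u = ?u + of_int m *\<^sub>R (of_int (- d) *\<^sub>R e i)" by simp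
    moreover have "of_int (- d) *\<^sub>R e i \<in> lat e N" using i N by (intro lat_scale lat_base) simp
    ultimately show ?thesis by blast
  qed
  have wd: "\<exists>z\<in>lat e N. wprod ws *v ?u = ?u + of_int m *\<^sub>R z" if "set ws \<subseteq> {..<n}" for ws
    using that
  proof (induction ws)
    case Nil
    then show ?case by (intro bexI[of _ 0]) auto
  next
    case (Cons i ws)
    then obtain z z' where z: "z \<in> lat e N" "wprod ws *v ?u = ?u + of_int m *\<^sub>R z"
      "z' \<in> lat e N" "s i *v ?u = ?u + of_int m *\<^sub>R z'" using st[of i] by auto
    have "wprod (i # ws) *v ?u = ?u + of_int m *\<^sub>R (z' + s i *v z)"
      using z by (simp add: matrix_vector_right_distrib matrix_vector_mult_scaleR scaleR_add_right
          flip: matrix_vector_mul_assoc)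
    moreover have "z' + s i *v z \<in> lat e N" using z W_lat[of "s i"] Cons.prems by (intro lat_add) auto
    ultimately show ?case by blast
  qed
  obtain ws where "set ws \<subseteq> {..<n}" "c = wprod ws" using W_word[OF cW] by blast
  then obtain z0 where z0: "z0 \<in> lat e N" "f ?u = ?u + of_int m *\<^sub>R z0" using wd by blast
  have "\<exists>z\<in>lat e N. papp Q f ?u = of_int (poly Q 1) *\<^sub>R ?u + of_int m *\<^sub>R z" for Q
  proof (induction Q)
    case 0
    then show ?case by (intro bexI[of _ 0]) auto
  next
    case (pCons a Q)
    then obtain z where z: "z \<in> lat e N" "papp Q f ?u = of_int (poly Q 1) *\<^sub>R ?u + of_int m *\<^sub>R z" by blast
    have "papp (pCons a Q) f ?u = of_int (poly (pCons a Q) 1) *\<^sub>R ?u + of_int m *\<^sub>R (of_int (poly Q 1) *\<^sub>R z0 + f z)"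
      using z z0(2) by (simp add: matrix_vector_right_distrib matrix_vector_mult_scaleR scaleR_add_right scaleR_add_left mult.commute)
    moreover have "of_int (poly Q 1) *\<^sub>R z0 + f z \<in> lat e N"
      using z z0 W_lat[OF cW] by (intro lat_add lat_scale) auto
    ultimately show ?case by blast
  qed
  then obtain z where z: "z \<in> lat e N" "papp P f ?u = of_int (poly P 1) *\<^sub>R ?u + of_int m *\<^sub>R z" by blast
  obtain y where y: "z = (\<Sum>i<N. of_int (y i) *\<^sub>R e i)" using z(1) by (auto simp: lat_def)
  have ea: "e i = \<alpha> i" for i using D by (cases D) (auto simp: ebas_def)
  have "0 = of_int (poly P 1) *\<^sub>R ?u + of_int m *\<^sub>R z" using annihilate_all[OF P, of ?u] z(2) by simp
  also have "\<dots> = (\<Sum>i<n. of_int (poly P 1 * u ! i + m * y i) *\<^sub>R \<alpha> i)"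
    unfolding ev_def y N ea by (simp add: scaleR_sum_right scaleR_add_left sum.distrib)
  finally have "(\<Sum>i<n. of_int (poly P 1 * u ! i + m * y i) *\<^sub>R \<alpha> i) = 0" by simp
  then have "of_int (poly P 1 * u ! k + m * y k) = (0::real)"
    using indep[of "\<lambda>i. of_int (poly P 1 * u ! i + m * y i)" k] u(2) N by simp
  then have "poly P 1 + m * y k = 0" using u(3) by (simp only: of_int_eq_0_iff mult_1_right)
  then have "poly P 1 = m * (- y k)" by (simp add: add_eq_0_iff2)
  then show ?thesis by (rule dvdI)
qed

end

section \<open>Conjugacy of powers, checked in coordinates\<close>

text \<open>The words were found by a computer search, one for each possible autocorrelation sequence.\<close>

lemma E8_conj_checks:
  "conj_check [1, 1, 0, -1, -1, -1, 0, 1]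
    [2, -1, 0, 0, 0, 1, -1, 0, 0, 1, -1, 0, 0, 0, 1] (replicate 15 0)
    (powl [1, 1, 0, -1, -1, -1, 0, 1] 30 (unitl 8)) 7
    [0, 9, 11, 14, 0, 14, 13, 4, 7, 13, 8, 2, 1, 2, 8, 9, 8, 7, 6, 7, 8, 9]"
  "conj_check [1, 1, 0, -1, -1, -1, 0, 1]
    [2, -1, 0, 1, -1, 1, 0, -1, 1, 0, -1, 1, -1, 0, 1] (replicate 15 0)
    (powl [1, 1, 0, -1, -1, -1, 0, 1] 30 (unitl 8)) 11
    [0, 1, 8, 12, 10, 2, 10, 6, 3, 6, 13, 9, 13, 9, 10, 3, 10, 9]"
  "conj_check [1, 1, 0, -1, -1, -1, 0, 1]
    [2, -1, 1, 0, 0, 1, -1, 1, -1, 1, -1, 0, 0, -1, 1] (replicate 15 0)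
    (powl [1, 1, 0, -1, -1, -1, 0, 1] 30 (unitl 8)) 7
    [0, 2, 6, 9, 1, 9, 4, 3, 4, 13, 7, 11, 13, 11, 2, 0, 2, 11]"
  "conj_check [1, 1, 0, -1, -1, -1, 0, 1]
    [2, 0, -1, 0, 1, 1, -1, -1, 1, 1, -1, -1, 0, 1, 0] (replicate 15 0)
    (powl [1, 1, 0, -1, -1, -1, 0, 1] 30 (unitl 8)) 11
    [0, 1, 2, 3, 1, 3, 11, 4, 5, 11, 10, 6, 10, 14, 7, 14]"
  "conj_check [1, 1, 0, -1, -1, -1, 0, 1]
    [2, 0, 0, 0, 1, 1, -1, 0, 0, 1, -1, -1, 0, 0, 0] (replicate 15 0)
    (powl [1, 1, 0, -1, -1, -1, 0, 1] 30 (unitl 8)) 7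
    [0, 2, 4, 9, 0, 9, 8, 2, 8, 13, 4, 0, 4, 13, 10, 6, 2, 6, 14, 3, 14, 10]"
  "conj_check [1, 1, 0, -1, -1, -1, 0, 1]
    [2, 0, 0, 1, 0, 1, 0, -1, 1, 0, -1, 0, -1, 0, 0] (replicate 15 0)
    (powl [1, 1, 0, -1, -1, -1, 0, 1] 30 (unitl 8)) 7
    [0, 1, 2, 12, 3, 0, 3, 14, 7, 0, 7, 14, 11, 7, 4, 7, 3, 10, 2, 10, 3, 11]"
  "conj_check [1, 1, 0, -1, -1, -1, 0, 1]
    [2, 0, 1, 1, 0, 1, 0, 0, 0, 0, -1, 0, -1, -1, 0] (replicate 15 0)
    (powl [1, 1, 0, -1, -1, -1, 0, 1] 30 (unitl 8)) 7
    [0, 3, 7, 13, 0, 13, 11, 8, 11, 14, 11, 14, 2, 4, 1, 4, 2, 12, 14, 3, 1, 3, 14, 12]"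
  "conj_check [1, 1, 0, -1, -1, -1, 0, 1]
    [2, 1, 1, 1, 1, 1, 0, 0, 0, 0, -1, -1, -1, -1, -1] (replicate 15 0)
    (powl [1, 1, 0, -1, -1, -1, 0, 1] 30 (unitl 8)) 7
    [0, 1, 9, 11, 14, 0, 14, 2, 1, 2, 12, 10, 12, 7, 11, 0, 11, 7]"
  by code_simp+

lemma E7_conj_checks:
  "conj_check [1, 1, 0, -1, -1, 0, 1]
    [2, -1, 0, 0, 1, -1, 0, 0, 1] (replicate 9 0)
    (powl [1, 1, 0, -1, -1, 0, 1] 18 (unitl 7)) 7
    [1, 0, 1, 4, 0, 4, 5, 0, 5, 7, 3, 6, 2, 1, 0, 1, 2, 7]"
  "conj_check [1, 1, 0, -1, -1, 0, 1]
    [2, -1, 1, 0, 0, 0, 0, -1, 1] (replicate 9 0)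
    (powl [1, 1, 0, -1, -1, 0, 1] 18 (unitl 7)) 7
    [0, 1, 3, 6, 7, 0, 7, 8, 1, 8, 7, 5, 7]"
  "conj_check [1, 1, 0, -1, -1, 0, 1]
    [2, 0, 1, 0, 1, -1, 0, -1, 0] (replicate 9 0)
    (powl [1, 1, 0, -1, -1, 0, 1] 18 (unitl 7)) 7
    [0, 1, 3, 2, 0, 2, 8, 4, 5, 1, 5, 8, 7, 3, 5, 0, 5, 3, 7]"
  by code_simp+

lemma E6_conj_checks:
  "conj_check [1, 1, 0, -1, 0, 1]
    [2, -1, 0, 1, -1, 0, 0, 0, -1, 1] (replicate 10 0)
    (powl [1, 1, 0, -1, 0, 1] 12 (unitl 6)) 5
    [2, 3, 5, 0, 6, 4, 3]"
  "conj_check [1, 1, 0, -1, 0, 1]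
    [2, 0, 0, 1, -1, -1, 0, -1, -1, 1] (replicate 10 0)
    (powl [1, 1, 0, -1, 0, 1] 12 (unitl 6)) 5
    [2, 3, 5, 7, 0, 2, 9]"
  by code_simp+

lemma F4_conj_checks:
  "conj_check [1, 0, -1, 0]
    [2, -1, 1, 0, -1, 1] (replicate 6 0)
    (powl [1, 0, -1, 0] 12 (unitl 4)) 7
    [4, 5, 2, 1]"
  "conj_check [1, 0, -1, 0]
    [2, 0, 1, 0, -1, 0] (replicate 6 0)
    (powl [1, 0, -1, 0] 12 (unitl 4)) 5
    [4, 1]"
  "conj_check [1, 0, -1, 0]
    [2, 1, 1, 0, -1, -1] (replicate 6 0)
    (powl [1, 0, -1, 0] 12 (unitl 4)) 7
    [4, 3, 0, 1]"
  by code_simp+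

lemma H4_conj_checks:
  "conj_check [1, 1, 0, -1, -1, -1, 0, 1]
    [2, 0, -1, 0, 1, 1, -1, -1, 1, 1, -1, -1, 0, 1, 0]
    [0, 0, 1, 1, -1, 0, 1, 0, 0, -1, 0, 1, -1, -1, 0]
    (powl [1, 1, 0, -1, -1, -1, 0, 1] 30 (unitl 8)) 11
    [12, 5, 4, 2, 1, 0]"
  "conj_check [1, 1, 0, -1, -1, -1, 0, 1]
    [2, -1, 0, 0, 0, 1, -1, 0, 0, 1, -1, 0, 0, 0, 1]
    [0, 0, 0, 1, -1, 0, 1, -1, 1, -1, 0, 1, -1, 0, 0]
    (powl [1, 1, 0, -1, -1, -1, 0, 1] 30 (unitl 8)) 11
    [9, 8, 4, 0, 1, 0]"
  "conj_check [1, 1, 0, -1, -1, -1, 0, 1]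
    [2, 0, 0, 0, 1, 1, -1, 0, 0, 1, -1, -1, 0, 0, 0]
    [0, 1, 1, 1, 0, 0, 1, 0, 0, -1, 0, 0, -1, -1, -1]
    (powl [1, 1, 0, -1, -1, -1, 0, 1] 30 (unitl 8)) 11
    [6, 2, 3, 0, 1, 0]"
  "conj_check [1, 1, 0, -1, -1, -1, 0, 1]
    [2, -1, 1, 0, 0, 1, -1, 1, -1, 1, -1, 0, 0, -1, 1]
    [0, 1, 0, 1, 0, 0, 1, -1, 1, -1, 0, 0, -1, 0, -1]
    (powl [1, 1, 0, -1, -1, -1, 0, 1] 30 (unitl 8)) 11
    [8, 1, 2, 0, 1, 0]"
  by code_simp+

section \<open>The types one by one\<close>

lemma coprime_12: "1 < k \<Longrightarrow> 2 * k < 12 \<Longrightarrow> coprime k (12::nat) \<Longrightarrow> k = 5"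
  and coprime_18: "1 < k \<Longrightarrow> 2 * k < 18 \<Longrightarrow> coprime k (18::nat) \<Longrightarrow> k = 5 \<or> k = 7"
  and coprime_30: "1 < k \<Longrightarrow> 2 * k < 30 \<Longrightarrow> coprime k (30::nat) \<Longrightarrow> k = 7 \<or> k = 11 \<or> k = 13"
proof -
  have 12: "\<forall>k\<in>set [2..<6]. coprime k (12::nat) \<longrightarrow> k = 5" by code_simp
  have 18: "\<forall>k\<in>set [2..<9]. coprime k (18::nat) \<longrightarrow> k = 5 \<or> k = 7" by code_simp
  have 30: "\<forall>k\<in>set [2..<15]. coprime k (30::nat) \<longrightarrow> k = 7 \<or> k = 11 \<or> k = 13" by code_simp
  show "1 < k \<Longrightarrow> 2 * k < 12 \<Longrightarrow> coprime k (12::nat) \<Longrightarrow> k = 5"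
    by (rule bspec[OF 12, rule_format]) (simp_all only: set_upt atLeastLessThan_iff, arith)
  show "1 < k \<Longrightarrow> 2 * k < 18 \<Longrightarrow> coprime k (18::nat) \<Longrightarrow> k = 5 \<or> k = 7"
    by (rule bspec[OF 18, rule_format]) (simp_all only: set_upt atLeastLessThan_iff, arith)
  show "1 < k \<Longrightarrow> 2 * k < 30 \<Longrightarrow> coprime k (30::nat) \<Longrightarrow> k = 7 \<or> k = 11 \<or> k = 13"
    by (rule bspec[OF 30, rule_format]) (simp_all only: set_upt atLeastLessThan_iff, arith)
qed

lemma coprime_examples: "coprime (5::nat) 12" "coprime (7::nat) 12" "coprime (7::nat) 18" "coprime (7::nat) 30" "coprime (11::nat) 30"
  by code_simp+

lemma upt_lists:
  "[0..<6] = [0, 1, 2, 3, 4, 5]"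
  "[0..<9] = [0, 1, 2, 3, 4, 5, 6, 7, 8]"
  "[0..<10] = [0, 1, 2, 3, 4, 5, 6, 7, 8, 9]"
  "[0..<15] = [0, 1, 2, 3, 4, 5, 6, 7, 8, 9, 10, 11, 12, 13, 14]"
  by code_simp+

context regular_elt
begin

section \<open>Conditions to be verified for each type\<close>

definition orbit_conditions :: bool where
  "orbit_conditions \<longleftrightarrow> fixsp c = {0} \<and> card {z \<in> W. z ** c = c ** z} = h \<and>
    (\<forall>k b. 1 < k \<longrightarrow> k < h - 1 \<longrightarrow> coprime k h \<longrightarrow> b \<in> roots \<longrightarrow> (\<Sum>i<k. (f ^^ i) b) \<notin> roots) \<and>
    (\<exists>k>1. k < h - 1 \<and> coprime k h \<and> (\<exists>g\<in>W. c ** g = g ** c [^]\<^bsub>G\<^esub> k))"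

text \<open>\<open>root_sum_complement\<close> exchanges k and h - k, and 2 k = h is impossible for
  k > 1 coprime to h.\<close>

lemma nonroot_half:
  assumes fx: "fixsp c = {0}"
    and half: "\<And>k b. 1 < k \<Longrightarrow> 2 * k < h \<Longrightarrow> coprime k h \<Longrightarrow> b \<in> roots \<Longrightarrow> (\<Sum>i<k. (f ^^ i) b) \<notin> roots"
    and k: "1 < k" "k < h - 1" "coprime k h" and b: "b \<in> roots"
  shows "(\<Sum>i<k. (f ^^ i) b) \<notin> roots"
proof (cases "2 * k < h")
  case True
  then show ?thesis using half k b by blast
next
  case False
  have "2 * k \<noteq> h"
  proof
    assume "2 * k = h"
    then have "k dvd h" by (metis dvd_triv_right)
    then have "is_unit k" using k(3) by (metis coprime_common_divisor dvd_refl)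
    then show False using k(1) by simp
  qed
  then have j: "1 < h - k" "2 * (h - k) < h" using False k(2) by auto
  have "coprime (h - k) h"
  proof (rule coprimeI)
    fix d assume d: "d dvd h - k" "d dvd h"
    have "d dvd h - (h - k)" by (rule dvd_diff_nat[OF d(2,1)])
    then have "d dvd k" using k(2) by simp
    then show "is_unit d" using d(2) k(3) coprime_common_divisor by blast
  qed
  then have "(\<Sum>i<h - k. (f ^^ i) b) \<notin> roots" using half[OF j] b by blast
  then show ?thesis using root_sum_complement[OF fx b, of k] k(2) by (meson diff_le_self less_imp_le order_trans)
qed

lemma exists_conj:
  assumes chk: "conj_check cs as (replicate K 0) (powl cs h (unitl N)) k ws"
    and as: "map (az b) [0..<K] = as"
    and D: "D \<noteq> H4" and b: "b \<in> lroots" and cs: "papp (Poly (cs @ [1])) f b = 0" "length cs = N"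
    and sp: "span ((\<lambda>j. (f ^^ j) b) ` {..<N}) = UNIV"
  shows "\<exists>g\<in>W. c ** g = g ** c [^]\<^bsub>G\<^esub> k"
proof -
  have K: "K = length as" using as by auto
  have "N > 0" by (cases D) auto
  then have ne: "cs \<noteq> []" using cs(2) by auto
  show ?thesis
  proof (rule conj_check_sound[OF _ cs(1) ne, where \<tau> = 0])
    show "b \<in> roots" using b lroots_subset by blast
    fix j assume j: "j < length as"
    have "as ! j = az b j" using j arg_cong[OF as, of "\<lambda>l. l ! j"] K by simp
    then show "ac b j = of_int (as ! j) + 0 * of_int (replicate K 0 ! j)" using ac_az[OF D b] K j by simp
  qed (use chk sp cs(2) in simp_all)
qed

lemma orbit_conditionsI:
  assumes fx: "fixsp c = {0}" and cen: "card {z \<in> W. z ** c = c ** z} = h"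
    and half: "\<And>k b. 1 < k \<Longrightarrow> 2 * k < h \<Longrightarrow> coprime k h \<Longrightarrow> b \<in> roots \<Longrightarrow> (\<Sum>i<k. (f ^^ i) b) \<notin> roots"
    and k: "1 < k" "k < h - 1" "coprime k h" "\<exists>g\<in>W. c ** g = g ** c [^]\<^bsub>G\<^esub> k"
  shows orbit_conditions
  unfolding orbit_conditions_def using fx cen nonroot_half[OF fx half] k by blast

section \<open>Type E8\<close>

lemma az_pos: "D \<noteq> H4 \<Longrightarrow> b \<in> lroots \<Longrightarrow> 0 \<le> (\<Sum>i<length w. \<Sum>j<length w. w ! i * w ! j * az b (dst i j))"
proof -
  assume a: "D \<noteq> H4" "b \<in> lroots"
  have "0 \<le> 2 * (evx b (length w) w \<bullet> evx b (length w) w)" by simp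
  then show ?thesis unfolding az_norm[OF a] by (simp only: of_int_0_le_iff)
qed

text \<open>The recurrence given by \<open>Phi30\<close> expresses all autocorrelations through
  those at 1, 2 and 3. They lie in {-1, 0, 1} for 0 < j < 15, and \<open>az b 6 = az b 3 - 1\<close>
  then excludes the value -1 at 3.\<close>

lemma E8_az:
  assumes D: "D = E8" and hh: "h = 30" and b: "b \<in> roots"
  shows "papp Phi30 f b = 0"
    "az b 4 = 1 + az b 1 - az b 3 \<and> az b 5 = 1 \<and> az b 6 = az b 3 - 1 \<and> az b 7 = az b 2 - az b 3 \<and>
     az b 8 = az b 3 - az b 2 \<and> az b 9 = 1 - az b 3 \<and> az b 10 = -1 \<and> az b 11 = az b 3 - az b 1 - 1 \<and>
     az b 12 = - az b 3 \<and> az b 13 = - az b 2 \<and> az b 14 = - az b 1"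
    "az b 1 = -1 \<or> az b 1 = 0 \<or> az b 1 = 1" "az b 2 = -1 \<or> az b 2 = 0 \<or> az b 2 = 1" "az b 3 = 0 \<or> az b 3 = 1"
proof -
  have D': "D \<noteq> H4" and bl: "b \<in> lroots" using D b lroots_eq by auto
  have N8: "N = 8" using D by simp
  show ann: "papp Phi30 f b = 0"
    by (rule full_cyclotomic[OF bl])
       (use order_h in \<open>simp_all add: hh N8 totient_values exact_order_30 del: ieval_pCons\<close>)
  let ?A = "az b"
  have A0: "?A 0 = 2" using az_0[OF D' bl] .
  let ?cs = "[1, 1, 0, -1, -1, -1, 0, 1, 1] :: int list"
  have r: "(\<Sum>i<length ?cs. ?cs ! i * ?A (dst t (i + u))) = 0" for t u
    by (rule az_recurrence[OF D' bl, where cs = ?cs]) (use ann in simp)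
  note x = eval_nat_numeral dst_def
  have a4: "?A 4 = 1 + ?A 1 - ?A 3" using r[of 4 0] A0 by (simp add: x)
  have a5: "?A 5 = 1" using r[of 3 0] A0 a4 by (simp add: x)
  have a6: "?A 6 = ?A 3 - 1" using r[of 2 0] A0 a5 by (simp add: x)
  have a7: "?A 7 = ?A 2 - ?A 3" using r[of 1 0] A0 a4 a6 by (simp add: x)
  have a8: "?A 8 = ?A 3 - ?A 2" using r[of 0 0] A0 a4 a5 a7 by (simp add: x)
  have a9: "?A 9 = 1 - ?A 3" using r[of 0 1] a4 a5 a6 a8 by (simp add: x)
  have a10: "?A 10 = -1" using r[of 0 2] a5 a6 a7 a9 by (simp add: x)
  have a11: "?A 11 = ?A 3 - ?A 1 - 1" using r[of 0 3] a4 a6 a7 a8 a10 by (simp add: x)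
  have a12: "?A 12 = - ?A 3" using r[of 0 4] a4 a5 a7 a8 a9 a11 by (simp add: x)
  have a13: "?A 13 = - ?A 2" using r[of 0 5] a5 a6 a8 a9 a10 a12 by (simp add: x)
  have a14: "?A 14 = - ?A 1" using r[of 0 6] a6 a7 a9 a10 a11 a13 by (simp add: x)
  show "?A 4 = 1 + ?A 1 - ?A 3 \<and> ?A 5 = 1 \<and> ?A 6 = ?A 3 - 1 \<and> ?A 7 = ?A 2 - ?A 3 \<and>
     ?A 8 = ?A 3 - ?A 2 \<and> ?A 9 = 1 - ?A 3 \<and> ?A 10 = -1 \<and> ?A 11 = ?A 3 - ?A 1 - 1 \<and>
     ?A 12 = - ?A 3 \<and> ?A 13 = - ?A 2 \<and> ?A 14 = - ?A 1"
    using a4 a5 a6 a7 a8 a9 a10 a11 a12 a13 a14 by blast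
  have bd: "-1 \<le> ?A j \<and> ?A j \<le> 1" if "0 < j" "j < 15" for j
    using az_bounds[OF D' bl, of j] az_ge[OF D' bl, of j] that hh by auto
  have sv: "x = -1 \<or> x = 0 \<or> x = 1" if "-1 \<le> x \<and> x \<le> 1" for x :: int using that by linarith
  show "?A 1 = -1 \<or> ?A 1 = 0 \<or> ?A 1 = 1" "?A 2 = -1 \<or> ?A 2 = 0 \<or> ?A 2 = 1"
    by (intro sv bd; simp)+
  have "-1 \<le> ?A 3 \<and> ?A 3 \<le> 1" "-1 \<le> ?A 6 \<and> ?A 6 \<le> 1" by (intro bd; simp)+
  then show "?A 3 = 0 \<or> ?A 3 = 1" using a6 by linarith
qed

lemma E8_orbit_conditions:
  assumes D: "D = E8" and hh: "h = 30"
  shows orbit_conditions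
proof -
  have N8: "N = 8" and D': "D \<noteq> H4" using D by simp_all
  have roots_l: "lroots = roots" using D lroots_eq by simp
  note data = E8_az[OF D hh]
  have fx: "fixsp c = {0}"
    by (rule all_roots_fixsp, intro exI[of _ Phi30]) (use data(1) in simp)
  have half: "(\<Sum>i<k. (f ^^ i) b) \<notin> roots" if k: "1 < k" "2 * k < h" "coprime k h" and b: "b \<in> roots" for k b
  proof
    assume s: "(\<Sum>i<k. (f ^^ i) b) \<in> roots"
    let ?A = "az b"
    note n = az_root_sum[OF D' _ s, unfolded roots_l, OF b]
    note A = data(2)[OF b] data(3)[OF b] data(4)[OF b] data(5)[OF b]
    have "k = 7 \<or> k = 11 \<or> k = 13" using coprime_30[of k] k hh by simp
    then show False
    proof (elim disjE)
      assume "k = 7"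
      then have "6 * ?A 1 + 5 * ?A 2 + 4 * ?A 3 + 3 * ?A 4 + 2 * ?A 5 + ?A 6 = -6" using n by (simp add: eval_nat_numeral)
      then show False using A by (elim disjE conjE; linarith)
    next
      assume "k = 11"
      then have "10 * ?A 1 + 9 * ?A 2 + 8 * ?A 3 + 7 * ?A 4 + 6 * ?A 5 + 5 * ?A 6 + 4 * ?A 7 + 3 * ?A 8 + 2 * ?A 9 + ?A 10 = -10"
        using n by (simp add: eval_nat_numeral)
      then show False using A by (elim disjE conjE; linarith)
    next
      assume "k = 13"
      then have "12 * ?A 1 + 11 * ?A 2 + 10 * ?A 3 + 9 * ?A 4 + 8 * ?A 5 + 7 * ?A 6 + 6 * ?A 7 + 5 * ?A 8 + 4 * ?A 9
        + 3 * ?A 10 + 2 * ?A 11 + ?A 12 = -12"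
        using n by (simp add: eval_nat_numeral)
      then show False using A by (elim disjE conjE; linarith)
    qed
  qed
  \<comment> \<open>Every root has a spanning orbit here, so a simple root will do.\<close>
  define b where "b = \<alpha> 0"
  have b: "b \<in> roots" and bl: "b \<in> lroots" using roots_nonempty roots_l by (simp_all add: b_def)
  let ?A = "az b"
  note ann = data(1)[OF b] and A = data(2)[OF b] and A0 = az_0[OF D' bl]
  have min: "N \<le> degree P" if "P \<noteq> 0" "papp P f b = 0" for P
    using degree_annihilator_ge(2)[OF b that] by (simp add: hh N8 totient_values)
  have bound: "M = h" if M: "h dvd M" "M > 0" "totient M \<le> N" for M
  proof -
    have "M \<le> 30" using totient_le_8_bound[of M] M N8 by simp
    then show ?thesis using M hh by (auto elim!: dvdE)
  qed
  note sp = cyclic_centralizer(1)[OF bl min bound] and cen = cyclic_centralizer(2)[OF bl min bound]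
  note x = eval_nat_numeral dst_def
  \<comment> \<open>The squared lengths of four combinations of the iterates must be nonnegative.
    With the bounds for \<open>az b 4\<close> and \<open>az b 7\<close> this leaves 8 of the 18
    triples, exactly those for which words are given.\<close>
  have p1: "0 \<le> 8 + 6 * ?A 1 + 4 * ?A 2 + 2 * ?A 3" using az_pos[OF D' bl, of "[1,1,1,1]"] A0 by (simp add: x)
  have p2: "0 \<le> 8 - 6 * ?A 2 + 4 * ?A 4 - 2 * ?A 6" using az_pos[OF D' bl, of "[1,0,-1,0,1,0,-1]"] A0 by (simp add: x)
  have p3: "0 \<le> 10 + 2 * (- ?A 1 - ?A 4 + ?A 6 - ?A 7 + ?A 3 - ?A 5 + ?A 6 - ?A 2 + ?A 3 - ?A 1)"
    using az_pos[OF D' bl, of "[1,-1,0,0,-1,0,1,-1]"] A0 by (simp add: x)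
  have p4: "0 \<le> 12 + 2 * (- 5 * ?A 1 + 4 * ?A 2 - 3 * ?A 3 + 2 * ?A 4 - ?A 5)"
    using az_pos[OF D' bl, of "[1,-1,1,-1,1,-1]"] A0 by (simp add: x)
  have bd: "-1 \<le> ?A 4" "?A 4 \<le> 1" "-1 \<le> ?A 7" "?A 7 \<le> 1"
    using az_bounds[OF D' bl, of 4] az_ge[OF D' bl, of 4] az_bounds[OF D' bl, of 7] az_ge[OF D' bl, of 7] hh by auto
  have list: "map ?A [0..<15] = [2, ?A 1, ?A 2, ?A 3, 1 + ?A 1 - ?A 3, 1, ?A 3 - 1, ?A 2 - ?A 3, ?A 3 - ?A 2, 1 - ?A 3,
    -1, ?A 3 - ?A 1 - 1, - ?A 3, - ?A 2, - ?A 1]"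
    unfolding upt_lists using A A0 by simp
  have ex: "\<exists>g\<in>W. c ** g = g ** c [^]\<^bsub>G\<^esub> k"
    if ck: "conj_check [1, 1, 0, -1, -1, -1, 0, 1] as (replicate 15 0)
        (powl [1, 1, 0, -1, -1, -1, 0, 1] 30 (unitl 8)) k ws"
      and as: "map ?A [0..<15] = as" for as k ws
    by (rule exists_conj[OF _ as D' bl, where ws = ws and cs = "[1, 1, 0, -1, -1, -1, 0, 1]"])
      (use ann sp N8 ck hh in \<open>simp_all\<close>)
  have triples: "(a, b, d) \<in> {(-1,0,0), (-1,0,1), (-1,1,0), (0,-1,0), (0,0,0), (0,0,1), (0,1,1), (1,1,1)}"
    if "a = -1 \<or> a = 0 \<or> a = 1" "b = -1 \<or> b = 0 \<or> b = 1" "d = 0 \<or> d = 1"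
      "0 \<le> 8 + 6 * a + 4 * b + 2 * d" "0 \<le> 14 - 6 * b + 4 * a - 6 * d"
      "0 \<le> 2 + 2 * (- 3 * a - 2 * b + 6 * d)" "0 \<le> 14 + 2 * (- 3 * a + 4 * b - 5 * d)"
      "-1 \<le> 1 + a - d \<and> 1 + a - d \<le> 1" "-1 \<le> b - d \<and> b - d \<le> 1" for a b d :: int
    using that by (elim disjE; simp)
  have "(?A 1, ?A 2, ?A 3) \<in> {(-1,0,0), (-1,0,1), (-1,1,0), (0,-1,0), (0,0,0), (0,0,1), (0,1,1), (1,1,1)}"
  proof (rule triples[OF data(3-5)[OF b]])
    note e = conjunct1[OF A] A[THEN conjunct2, THEN conjunct1] A[THEN conjunct2, THEN conjunct2, THEN conjunct1]
      A[THEN conjunct2, THEN conjunct2, THEN conjunct2, THEN conjunct1]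
    show "0 \<le> 8 + 6 * ?A 1 + 4 * ?A 2 + 2 * ?A 3" by (rule p1)
    show "0 \<le> 14 - 6 * ?A 2 + 4 * ?A 1 - 6 * ?A 3" using p2 e by linarith
    show "0 \<le> 2 + 2 * (- 3 * ?A 1 - 2 * ?A 2 + 6 * ?A 3)" using p3 unfolding e by (simp add: algebra_simps)
    show "0 \<le> 14 + 2 * (- 3 * ?A 1 + 4 * ?A 2 - 5 * ?A 3)" using p4 unfolding e by (simp add: algebra_simps)
    show "-1 \<le> 1 + ?A 1 - ?A 3 \<and> 1 + ?A 1 - ?A 3 \<le> 1" "-1 \<le> ?A 2 - ?A 3 \<and> ?A 2 - ?A 3 \<le> 1" using bd e by linarith+
  qed
  then consider "?A 1 = -1" "?A 2 = 0" "?A 3 = 0" | "?A 1 = -1" "?A 2 = 0" "?A 3 = 1" | "?A 1 = -1" "?A 2 = 1" "?A 3 = 0" | "?A 1 = 0" "?A 2 = -1" "?A 3 = 0" | "?A 1 = 0" "?A 2 = 0" "?A 3 = 0" | "?A 1 = 0" "?A 2 = 0" "?A 3 = 1" | "?A 1 = 0" "?A 2 = 1" "?A 3 = 1" | "?A 1 = 1" "?A 2 = 1" "?A 3 = 1" by auto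
  then have "(\<exists>g\<in>W. c ** g = g ** c [^]\<^bsub>G\<^esub> (7::nat)) \<or> (\<exists>g\<in>W. c ** g = g ** c [^]\<^bsub>G\<^esub> (11::nat))"
  proof cases
    case 1
    show ?thesis using ex[OF E8_conj_checks(1)] list 1 by simp
  next
    case 2
    show ?thesis using ex[OF E8_conj_checks(2)] list 2 by simp
  next
    case 3
    show ?thesis using ex[OF E8_conj_checks(3)] list 3 by simp
  next
    case 4
    show ?thesis using ex[OF E8_conj_checks(4)] list 4 by simp
  next
    case 5
    show ?thesis using ex[OF E8_conj_checks(5)] list 5 by simp
  next
    case 6
    show ?thesis using ex[OF E8_conj_checks(6)] list 6 by simp
  next
    case 7
    show ?thesis using ex[OF E8_conj_checks(7)] list 7 by simp
  next
    case 8
    show ?thesis using ex[OF E8_conj_checks(8)] list 8 by simp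
  qed
  then show ?thesis
    using orbit_conditionsI[OF fx cen half, of 7] orbit_conditionsI[OF fx cen half, of 11] hh coprime_examples by auto
qed

end

context regular_elt
begin

section \<open>Type E7\<close>

lemma f_eq_0: "f y = 0 \<Longrightarrow> y = 0"
  using f_inner[of y y] by simp

text \<open>A nonzero y with such an annihilator is an eigenvector of the isometry c, and a real
  eigenvalue of an isometry is 1 or -1.\<close>

lemma linear_annihilator:
  assumes q: "q \<noteq> 0" "degree q \<le> 1" "papp q f y = 0"
  shows "y = 0 \<or> f y = y \<or> f y = - y"
proof -
  define a0 a1 where "a0 = coeff q 0" and "a1 = coeff q 1"
  have qq: "q = [:a0, a1:]"
  proof (rule poly_eqI)
    fix i show "coeff q i = coeff [:a0, a1:] i"
      using q(2) coeff_eq_0[of q i] by (cases i; cases "i - 1") (auto simp: a0_def a1_def)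
  qed
  have eq: "of_int a0 *\<^sub>R y + of_int a1 *\<^sub>R f y = 0"
    using q(3) unfolding qq by (simp add: linear_cmul[OF lin_f])
  show ?thesis
  proof (cases "a1 = 0")
    case True
    then show ?thesis using eq q(1) qq by auto
  next
    case False
    define t :: real where "t = - of_int a0 / of_int a1"
    have "of_int a1 *\<^sub>R f y = - of_int a0 *\<^sub>R y" using eq by (simp add: add_eq_0_iff)
    then have "(1 / of_int a1) *\<^sub>R (of_int a1 *\<^sub>R f y) = (1 / of_int a1) *\<^sub>R (- of_int a0 *\<^sub>R y)" by simp
    then have fy: "f y = t *\<^sub>R y" using False by (simp add: t_def)
    then have "(t * t - 1) * (y \<bullet> y) = 0" using f_inner[of y y] by (simp add: algebra_simps)
    then have "y = 0 \<or> (t - 1) * (t + 1) = 0" by (auto simp: algebra_simps)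
    then show ?thesis using fy by (auto simp: add_eq_0_iff2)
  qed
qed

lemma cyclotomic_cofactor:
  assumes b: "b \<in> roots" and C: "ieval C \<nu> = 0" "C \<noteq> 0" "degree C = totient h"
    and P: "P \<noteq> 0" "papp P f b = 0"
  obtains q where "q \<noteq> 0" "degree P = totient h + degree q" "papp q f (papp C f b) = 0"
proof -
  have "ieval P \<nu> = 0" using degree_annihilator_ge(1)[OF b P] .
  then obtain a q where q: "a \<noteq> 0" "Polynomial.smult a P = C * q" "q \<noteq> 0" "degree P = totient h + degree q"
    by (rule cyclotomic_factor[OF order_h C(1,2,3) _ P(1)])
  have "papp (C * q) f b = 0" unfolding q(2)[symmetric] using P(2) by simp
  then have "papp (q * C) f b = 0" by (simp only: mult.commute)
  then show ?thesis using that[of q] q by simp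
qed

text \<open>The cofactor of \<open>Phi18\<close> is linear, so y = Phi18(c) b is 0 or c y is y or
  -y. If c y = y, the recurrence gives \<open>az b 9 = 4 * az b 3 - 6\<close>, which forces
  \<open>az b 9 = -2\<close>; then c^9 b = -b, so c^3 y = -y and y = 0.\<close>

lemma E7_annihilator:
  assumes D: "D = E7" and hh: "h = 18" and b: "b \<in> roots"
  shows "(f ^^ 9) b = - b" "papp [:1, 1, 0, -1, -1, 0, 1, 1:] f b = 0"
proof -
  have D': "D \<noteq> H4" and bl: "b \<in> lroots" using D b lroots_eq by auto
  have N7: "N = 7" using D by simp
  have C: "ieval Phi18 \<nu> = 0" "Phi18 \<noteq> 0" "degree Phi18 = totient h"
    using order_h by (simp_all add: hh totient_values exact_order_18 del: ieval_pCons)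
  define y where "y = papp Phi18 f b"
  obtain q where q: "q \<noteq> 0" "totient h + degree q \<le> N" "papp q f y = 0"
    unfolding y_def by (rule root_annihilator[OF b bl C])
  then have "degree q \<le> 1" by (simp add: hh N7 totient_values)
  then have cas: "y = 0 \<or> f y = y \<or> f y = - y" using linear_annihilator[OF q(1) _ q(3)] by blast
  have y: "y = b - (f ^^ 3) b + (f ^^ 6) b"
    by (simp add: y_def eval_nat_numeral linear_add[OF lin_f] linear_neg[OF lin_f] linear_diff[OF lin_f] algebra_simps)
  have f3y: "(f ^^ 3) y = (f ^^ 3) b - (f ^^ 6) b + (f ^^ 9) b"
    by (simp add: y eval_nat_numeral linear_add[OF lin_f] linear_diff[OF lin_f])
  have 9: "(f ^^ 9) b = - b \<and> (y = 0 \<or> f y = - y)"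
  proof (cases "y = 0 \<or> f y = - y")
    case True
    then have "(f ^^ 3) y = - y" by (auto simp: eval_nat_numeral linear_neg[OF lin_f] linear_0[OF lin_f])
    then have "(f ^^ 9) b = - b" using f3y y by (simp add: algebra_simps eq_neg_iff_add_eq_0)
    then show ?thesis using True by blast
  next
    case False
    then have fy: "f y = y" using cas by blast
    let ?A = "az b" and ?cs = "[-1, 1, 0, 1, -1, 0, -1, 1] :: int list"
    have "papp [:-1, 1:] f y = 0" using fy by simp
    then have "papp ([:-1, 1:] * Phi18) f b = 0" by (simp only: papp_mult[OF lin_f] y_def)
    then have ann: "papp (Poly ?cs) f b = 0" by simp
    note r = az_recurrence[OF D' bl ann] and A0 = az_0[OF D' bl]
    note x = eval_nat_numeral dst_def
    have "?A 7 - ?A 6 - ?A 4 + ?A 3 + ?A 1 - 2 = 0" using r[of 0 0] A0 by (simp add: x)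
    moreover have "?A 6 - ?A 5 - ?A 3 + ?A 2 + 2 - ?A 1 = 0" using r[of 1 0] A0 by (simp add: x)
    moreover have "?A 5 - ?A 4 - ?A 2 + ?A 1 + ?A 1 - ?A 2 = 0" using r[of 2 0] A0 by (simp add: x)
    moreover have "?A 4 - ?A 3 - ?A 1 + 2 + ?A 2 - ?A 3 = 0" using r[of 3 0] A0 by (simp add: x)
    moreover have "?A 8 - ?A 7 - ?A 5 + ?A 4 + ?A 2 - ?A 1 = 0" using r[of 0 1] A0 by (simp add: x)
    moreover have "?A 9 - ?A 8 - ?A 6 + ?A 5 + ?A 3 - ?A 2 = 0" using r[of 0 2] A0 by (simp add: x)
    ultimately have "?A 9 = 4 * ?A 3 - 6" by linarith
    moreover have "?A 3 \<le> 1" "-2 \<le> ?A 9" using az_bounds[OF D' bl, of 3] az_bounds[OF D' bl, of 9] hh by auto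
    ultimately have "?A 9 = -2" by linarith
    then have 9: "(f ^^ 9) b = - b" using az_neg[OF D' bl, of 9] hh by simp
    have "(f ^^ 3) y = y" using fy by (simp add: eval_nat_numeral)
    moreover have "(f ^^ 3) y = - (b - (f ^^ 3) b + (f ^^ 6) b)" unfolding f3y 9 by simp
    ultimately have "y = - y" unfolding y[symmetric] by simp
    then have "y \<bullet> y = - (y \<bullet> y)" by (metis inner_minus_left)
    then show ?thesis using False by simp
  qed
  then show "(f ^^ 9) b = - b" by blast
  have "papp [:1, 1:] f y = 0" using 9 by (auto simp: linear_0[OF lin_f])
  then have "papp ([:1, 1:] * Phi18) f b = 0" by (simp only: papp_mult[OF lin_f] y_def)
  then show "papp [:1, 1, 0, -1, -1, 0, 1, 1:] f b = 0" by simp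
qed

lemma E7_az:
  assumes D: "D = E7" and hh: "h = 18" and b: "b \<in> roots"
  shows "az b 4 = 2 + az b 1 - az b 2 - 2 * az b 3" "az b 5 = - az b 4" "az b 6 = - az b 3"
    "az b 7 = - az b 2" "az b 8 = - az b 1"
    "az b 1 = -1 \<or> az b 1 = 0 \<or> az b 1 = 1" "az b 2 = -1 \<or> az b 2 = 0 \<or> az b 2 = 1"
    "az b 3 = -1 \<or> az b 3 = 0 \<or> az b 3 = 1" "-1 \<le> az b 4" "az b 4 \<le> 1"
proof -
  have D': "D \<noteq> H4" and bl: "b \<in> lroots" using D b lroots_eq by auto
  let ?A = "az b" and ?cs = "[1, 1, 0, -1, -1, 0, 1, 1] :: int list"
  have ann: "papp (Poly ?cs) f b = 0" using E7_annihilator(2)[OF D hh b] by simp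
  note r = az_recurrence[OF D' bl ann] and A0 = az_0[OF D' bl]
  note x = eval_nat_numeral dst_def
  show a4: "?A 4 = 2 + ?A 1 - ?A 2 - 2 * ?A 3" using r[of 3 0] A0 by (simp add: x)
  show a5: "?A 5 = - ?A 4" using r[of 2 0] A0 a4 by (simp add: x)
  show a6: "?A 6 = - ?A 3" using r[of 1 0] A0 a4 a5 by (simp add: x)
  show a7: "?A 7 = - ?A 2" using r[of 0 0] A0 a4 a5 a6 by (simp add: x)
  show a8: "?A 8 = - ?A 1" using r[of 0 1] A0 a4 a5 a6 a7 by (simp add: x)
  have bd: "-1 \<le> ?A j \<and> ?A j \<le> 1" if "0 < j" "j < 9" for j
    using az_bounds[OF D' bl, of j] az_ge[OF D' bl, of j] that hh by auto
  have sv: "x = -1 \<or> x = 0 \<or> x = 1" if "-1 \<le> x \<and> x \<le> 1" for x :: int using that by linarith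
  show "?A 1 = -1 \<or> ?A 1 = 0 \<or> ?A 1 = 1" "?A 2 = -1 \<or> ?A 2 = 0 \<or> ?A 2 = 1" "?A 3 = -1 \<or> ?A 3 = 0 \<or> ?A 3 = 1"
    by (intro sv bd; simp)+
  show "-1 \<le> ?A 4" "?A 4 \<le> 1" using bd[of 4] by auto
qed

lemma E7_orbit_conditions:
  assumes D: "D = E7" and hh: "h = 18"
  shows orbit_conditions
proof -
  have N7: "N = 7" and D': "D \<noteq> H4" "D \<noteq> F4" using D by simp_all
  have roots_l: "lroots = roots" using D lroots_eq by simp
  note data = E7_az[OF D hh]
  have fx: "fixsp c = {0}"
    by (rule all_roots_fixsp, intro exI[of _ "[:1, 1, 0, -1, -1, 0, 1, 1:]"])
      (use E7_annihilator(2)[OF D hh] in simp)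
  have half: "(\<Sum>i<k. (f ^^ i) b) \<notin> roots" if k: "1 < k" "2 * k < h" "coprime k h" and b: "b \<in> roots" for k b
  proof
    assume s: "(\<Sum>i<k. (f ^^ i) b) \<in> roots"
    let ?A = "az b"
    note n = az_root_sum[OF D'(1) _ s, unfolded roots_l, OF b]
    note A = data[OF b]
    have "k = 5 \<or> k = 7" using coprime_18[of k] k hh by simp
    then show False
    proof
      assume "k = 5"
      then have "4 * ?A 1 + 3 * ?A 2 + 2 * ?A 3 + ?A 4 = -4" using n by (simp add: eval_nat_numeral)
      then have "5 * ?A 1 + 2 * ?A 2 = -6" using A(1) by linarith
      then show False using A(6,7) by (elim disjE) linarith+
    next
      assume "k = 7"
      then have "6 * ?A 1 + 5 * ?A 2 + 4 * ?A 3 + 3 * ?A 4 + 2 * ?A 5 + ?A 6 = -6" using n by (simp add: eval_nat_numeral)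
      then have "7 * ?A 1 + 4 * ?A 2 + ?A 3 = -8" using A(1-3) by linarith
      moreover have "2 + ?A 1 - ?A 2 - 2 * ?A 3 \<le> 1" using A(1,10) by linarith
      ultimately show False using A(6-8) by (elim disjE) linarith+
    qed
  qed
  \<comment> \<open>A root not annihilated by \<open>Phi18\<close> has no annihilator of degree
    below 7, so its orbit spans. It exists, for otherwise Phi18(1) = 1 would be even.\<close>
  have "\<exists>b\<in>roots. papp Phi18 f b \<noteq> 0"
  proof (rule ccontr)
    assume "\<not> ?thesis"
    then have all: "papp Phi18 f b = 0" if "b \<in> roots" for b using that by blast
    \<comment> \<open>These are the coordinates of \<alpha> 1 + \<alpha> 4 + \<alpha> 6, which spans
      the radical of the Cartan matrix modulo 2.\<close>
    have "list_all (\<lambda>r. 2 dvd dotl r [0,1,0,0,1,0,1]) (cartan1 E7)" by code_simp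
    then have "2 dvd dotl (cartan1 D ! i) [0,1,0,0,1,0,1]" if "i < n" for i
      using that cartan_lengths D by (auto simp: list_all_length)
    then have "(2::int) dvd poly Phi18 1"
      by (intro fixed_vector_mod[of "[0,1,0,0,1,0,1]" 1, OF D' _ _ _ _ all]) (simp_all add: N7)
    then show False by simp
  qed
  then obtain b where b: "b \<in> roots" and y: "papp Phi18 f b \<noteq> 0" by blast
  have bl: "b \<in> lroots" using b roots_l by simp
  let ?A = "az b"
  note A = data[OF b] and A0 = az_0[OF D'(1) bl]
  have C: "ieval Phi18 \<nu> = 0" "Phi18 \<noteq> 0" "degree Phi18 = totient h"
    using order_h by (simp_all add: hh totient_values exact_order_18 del: ieval_pCons)
  have min: "N \<le> degree P" if P: "P \<noteq> 0" "papp P f b = 0" for P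
  proof -
    obtain q where q: "q \<noteq> 0" "degree P = totient h + degree q" "papp q f (papp Phi18 f b) = 0"
      by (rule cyclotomic_cofactor[OF b C P])
    have "degree q \<noteq> 0"
    proof
      assume "degree q = 0"
      then obtain a where "q = [:a:]" by (rule degree_eq_zeroE)
      then show False using q y by (simp add: linear_0[OF lin_f])
    qed
    then show ?thesis using q(2) by (simp add: N7 hh totient_values)
  qed
  have bound: "M = h" if M: "h dvd M" "M > 0" "totient M \<le> N" for M
  proof -
    have "M \<le> 18" using totient_le_8_bound[of M] M N7 by simp
    then show ?thesis using M hh by (auto elim!: dvdE)
  qed
  note sp = cyclic_centralizer(1)[OF bl min bound] and cen = cyclic_centralizer(2)[OF bl min bound]
  \<comment> \<open>The coefficients of \<open>Phi18\<close>: the squared length of the nonzero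
    vector Phi18(c) b is positive, which rules out \<open>az b 3 = 1\<close>.\<close>
  let ?w = "[1, 0, 0, -1, 0, 0, 1] :: int list"
  have "evx b (length ?w) ?w = papp Phi18 f b"
    by (simp add: evx_def eval_nat_numeral linear_add[OF lin_f] linear_neg[OF lin_f] linear_diff[OF lin_f] algebra_simps)
  then have "0 < 2 * (evx b (length ?w) ?w \<bullet> evx b (length ?w) ?w)" using y by simp
  then have "0 < (\<Sum>i<length ?w. \<Sum>j<length ?w. ?w ! i * ?w ! j * ?A (dst i j))"
    unfolding az_norm[OF D'(1) bl] by (simp only: of_int_0_less_iff)
  then have "0 < 6 - 4 * ?A 3 + 2 * ?A 6" using A0 by (simp add: eval_nat_numeral dst_def)
  then have "?A 3 \<noteq> 1" using A(3) by linarith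
  moreover have "?A 3 \<noteq> -1" using A(1,6,7,10) by (elim disjE) linarith+
  ultimately have a3: "?A 3 = 0" using A(8) by blast
  have list: "map ?A [0..<9] = [2, ?A 1, ?A 2, 0, 2 + ?A 1 - ?A 2, ?A 2 - ?A 1 - 2, 0, - ?A 2, - ?A 1]"
    unfolding upt_lists using A(1-5) A0 a3 by simp
  have ex: "\<exists>g\<in>W. c ** g = g ** c [^]\<^bsub>G\<^esub> k"
    if ck: "conj_check [1, 1, 0, -1, -1, 0, 1] as (replicate 9 0)
        (powl [1, 1, 0, -1, -1, 0, 1] 18 (unitl 7)) k ws"
      and as: "map ?A [0..<9] = as" for as k ws
    by (rule exists_conj[OF _ as D'(1) bl, where ws = ws and cs = "[1, 1, 0, -1, -1, 0, 1]"])
      (use E7_annihilator(2)[OF D hh b] sp N7 ck hh in simp_all)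
  have lt: "2 + ?A 1 - ?A 2 \<le> 1" using A(1,10) a3 by simp
  consider "?A 1 = -1" "?A 2 = 0" | "?A 1 = -1" "?A 2 = 1" | "?A 1 = 0" "?A 2 = 1"
    using A(6,7) lt by fastforce
  then have "\<exists>g\<in>W. c ** g = g ** c [^]\<^bsub>G\<^esub> (7::nat)"
  proof cases
    case 1
    show ?thesis using ex[OF E7_conj_checks(1)] list 1 by simp
  next
    case 2
    show ?thesis using ex[OF E7_conj_checks(2)] list 2 by simp
  next
    case 3
    show ?thesis using ex[OF E7_conj_checks(3)] list 3 by simp
  qed
  then show ?thesis using orbit_conditionsI[OF fx cen half, of 7] hh coprime_examples by auto
qed

section \<open>Type E6\<close>

lemma quadratic_not_linear:
  assumes z: "z \<noteq> 0" "papp [:1, r, 1:] f z = 0" "r = -1 \<or> r = 0 \<or> r = 1" and q: "q \<noteq> 0" "degree q \<le> 1"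
  shows "papp q f z \<noteq> 0"
proof
  assume "papp q f z = 0"
  then have "f z = z \<or> f z = - z" using linear_annihilator[OF q] z(1) by blast
  then obtain t :: real where t: "f z = t *\<^sub>R z" "t = 1 \<or> t = -1" by (metis scaleR_minus1_left scaleR_one)
  have "z + of_int r *\<^sub>R f z + f (f z) = 0"
    using z(2) by (simp add: linear_add[OF lin_f] linear_cmul[OF lin_f] algebra_simps)
  then have "(1 + of_int r * t + t * t) *\<^sub>R z = 0"
    unfolding t(1) by (simp add: linear_cmul[OF lin_f] t(1) scaleR_add_left)
  then have "1 + of_int r * t + t * t = 0" using z(1) by simp
  then show False using t(2) z(3) by auto
qed

text \<open>Both q and x^2 + r x + 1 kill g(c) y. Subtracting a multiple leaves an annihilator of
  degree at most 1, which must be 0 since x^2 + r x + 1 vanishes at neither 1 nor -1. So q is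
  proportional to the quadratic.\<close>

lemma quadratic_annihilator:
  assumes q: "q \<noteq> 0" "degree q \<le> 2" "papp q f y = 0"
    and r: "r = -1 \<or> r = 0 \<or> r = 1" and g: "papp g f y \<noteq> 0" "papp [:1, r, 1:] f (papp g f y) = 0"
  shows "papp [:1, r, 1:] f y = 0"
proof -
  define k where "k = coeff q 2"
  define p where "p = q - Polynomial.smult k [:1, r, 1:]"
  have "degree p \<le> 1"
  proof (rule degree_le, intro allI impI)
    fix i :: nat assume i: "1 < i"
    show "coeff p i = 0"
    proof (cases "i = 2")
      case True
      then show ?thesis by (simp add: p_def k_def eval_nat_numeral)
    next
      case False
      then have i2: "i > 2" using i by simp
      then have "coeff q i = 0" using q(2) by (intro coeff_eq_0) simp
      moreover have "coeff [:1, r, 1:] i = 0" using i2 by (intro coeff_eq_0) simp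
      ultimately show ?thesis unfolding p_def by (simp only: coeff_diff coeff_smult)
    qed
  qed
  moreover have "papp p f (papp g f y) = 0"
  proof -
    have "papp q f (papp g f y) = papp (g * q) f y" by (simp only: papp_mult[OF lin_f, symmetric] mult.commute)
    then have "papp q f (papp g f y) = 0" using q(3) by simp
    then show ?thesis unfolding p_def using g(2) by (simp only: papp_diff[OF lin_f] papp_smult[OF lin_f]) simp
  qed
  ultimately have "p = 0" using quadratic_not_linear[OF g r] by blast
  then have e: "q = Polynomial.smult k [:1, r, 1:]" by (simp add: p_def)
  then have "k \<noteq> 0" using q(1) by auto
  then show ?thesis using q(3) unfolding e by (simp only: papp_smult[OF lin_f]) simp
qed

text \<open>As x^12 - 1 is the product of Phi12, x^2 + x + 1, x^2 + 1, x^2 - x + 1 and x^2 - 1, the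
  vector y = Phi12(c) b is killed by one of the last four. All cases but the first give the second
  annihilator, whose value 2 at 1 is prime to the determinant 3. For x^2 - 1 this holds because the
  recurrence forces \<open>az b 6 = -2\<close>.\<close>

lemma E6_annihilators:
  assumes D: "D = E6" and hh: "h = 12" and b: "b \<in> roots"
  shows "papp [:1, 1, 1:] f (papp Phi12 f b) = 0 \<or> papp ([:1, 0, 0, 0, 0, 0, 1:] * [:1, -1, 1:]) f b = 0"
proof -
  have D': "D \<noteq> H4" and bl: "b \<in> lroots" using D b lroots_eq by auto
  have N6: "N = 6" using D by simp
  have C: "ieval Phi12 \<nu> = 0" "Phi12 \<noteq> 0" "degree Phi12 = totient h"
    using order_h by (simp_all add: hh totient_values exact_order_12 del: ieval_pCons)
  define y where "y = papp Phi12 f b"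
  let ?R = "\<lambda>r. [:1, r, 1:] :: int poly" and ?M = "[:-1, 0, 1:] :: int poly"
  obtain q where q: "q \<noteq> 0" "totient h + degree q \<le> N" "papp q f y = 0"
    unfolding y_def by (rule root_annihilator[OF b bl C])
  have dq: "degree q \<le> 2" using q(2) by (simp add: hh N6 totient_values)
  have "papp (?R 1 * (?M * ?R 0 * ?R (-1))) f y = papp (?R 1 * (?M * ?R 0 * ?R (-1)) * Phi12) f b"
    by (simp only: y_def papp_mult[OF lin_f])
  also have "?R 1 * (?M * ?R 0 * ?R (-1)) * Phi12 = monom 1 12 - 1"
    by (simp add: monom_altdef eval_nat_numeral one_pCons)
  finally have tot: "papp (?R 1 * (?M * ?R 0 * ?R (-1))) f y = 0"
    using iter_h[of b] by (simp only: papp_diff[OF lin_f] papp_monom[OF lin_f]) (simp add: hh)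
  \<comment> \<open>If y is killed by each of the three products that omit one quadratic, then a
    combination of them shows that x^2 - 1 kills y. Otherwise one of these products maps y to a
    nonzero vector killed by the omitted quadratic, and q is a multiple of it.\<close>
  consider (3) "papp (?R 1) f y = 0" | (4) "papp (?R 0) f y = 0" | (6) "papp (?R (-1)) f y = 0"
    | (2) "papp ?M f y = 0"
  proof (cases "papp (?M * ?R 0 * ?R (-1)) f y = 0 \<and> papp (?M * ?R 1 * ?R (-1)) f y = 0 \<and>
      papp (?M * ?R 1 * ?R 0) f y = 0")
    case True
    have "papp (?M * ?R 1 * ?R 0 - ?M * ?R 0 * ?R (-1)) f y = 0"
      using True by (simp only: papp_diff[OF lin_f] diff_self)
    moreover have "?M * ?R 1 * ?R 0 - ?M * ?R 0 * ?R (-1) = [:0, 2:] * (?M * ?R 0)" by simp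
    ultimately have "papp [:0, 2:] f (papp (?M * ?R 0) f y) = 0" by (simp only: papp_mult[OF lin_f])
    then have z: "papp (?M * ?R 0) f y = 0"
      using f_eq_0 by (simp add: linear_cmul[OF lin_f] del: mult_pCons_left mult_pCons_right)
    have "?M = ?M * ?R 1 * ?R (-1) - [:0, 0, 1:] * (?M * ?R 0)" by simp
    then have "papp ?M f y = papp (?M * ?R 1 * ?R (-1) - [:0, 0, 1:] * (?M * ?R 0)) f y" by (rule arg_cong)
    also have "\<dots> = 0" using True z
      by (simp only: papp_diff[OF lin_f] papp_mult[OF lin_f, of "[:0, 0, 1:]"]) simp
    finally show ?thesis using that(4) by blast
  next
    case False
    have com: "?R 1 * (?M * ?R 0 * ?R (-1)) = ?R 0 * (?M * ?R 1 * ?R (-1))"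
      "?R 1 * (?M * ?R 0 * ?R (-1)) = ?R (-1) * (?M * ?R 1 * ?R 0)" by simp_all
    have "papp (?R 1) f (papp (?M * ?R 0 * ?R (-1)) f y) = 0" using tot by (simp only: papp_mult[OF lin_f])
    moreover have "papp (?R 0) f (papp (?M * ?R 1 * ?R (-1)) f y) = 0"
      using tot unfolding com(1) by (simp only: papp_mult[OF lin_f])
    moreover have "papp (?R (-1)) f (papp (?M * ?R 1 * ?R 0) f y) = 0"
      using tot unfolding com(2) by (simp only: papp_mult[OF lin_f])
    ultimately show ?thesis
      using False that(1-3) quadratic_annihilator[OF q(1) dq q(3), of 1 "?M * ?R 0 * ?R (-1)"]
        quadratic_annihilator[OF q(1) dq q(3), of 0 "?M * ?R 1 * ?R (-1)"]
        quadratic_annihilator[OF q(1) dq q(3), of "-1" "?M * ?R 1 * ?R 0"] by blast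
  qed
  then show ?thesis
  proof cases
    case 3
    then show ?thesis by (simp add: y_def)
  next
    case 4
    have "papp ([:1, 0, 0, 0, 0, 0, 1:] * [:1, -1, 1:]) f b = papp (?R (-1) * ?R 0 * Phi12) f b" by simp
    also have "\<dots> = papp (?R (-1)) f (papp (?R 0) f y)" by (simp only: y_def papp_mult[OF lin_f])
    finally show ?thesis using 4 papp_vec_0[OF lin_f] by metis
  next
    case 6
    have "papp ([:1, 0, 0, 0, 0, 0, 1:] * [:1, -1, 1:]) f b = papp (?R 0 * ?R (-1) * Phi12) f b" by simp
    also have "\<dots> = papp (?R 0) f (papp (?R (-1)) f y)" by (simp only: y_def papp_mult[OF lin_f])
    finally show ?thesis using 6 papp_vec_0[OF lin_f] by metis
  next
    case 2
    let ?A = "az b" and ?cs = "[-1, 0, 2, 0, -2, 0, 1] :: int list"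
    have "papp (?M * Phi12) f b = 0" using 2 by (simp only: papp_mult[OF lin_f] y_def)
    then have ann: "papp (Poly ?cs) f b = 0" by simp
    note r = az_recurrence[OF D' bl ann] and A0 = az_0[OF D' bl]
    note x = eval_nat_numeral dst_def
    have "?A 6 - 2 * ?A 4 + 2 * ?A 2 - 2 = 0" using r[of 0 0] A0 by (simp add: x)
    moreover have "?A 4 - 2 * ?A 2 + 4 - ?A 2 = 0" using r[of 2 0] A0 by (simp add: x)
    moreover have "?A 2 \<le> 1" "-1 \<le> ?A 4"
      using az_bounds[OF D' bl, of 2] az_ge[OF D' bl, of 4] hh by auto
    ultimately have "?A 6 = -2" by linarith
    then have "(f ^^ 6) b = - b" using az_neg[OF D' bl, of 6] hh by simp
    then have "papp [:1, 0, 0, 0, 0, 0, 1:] f b = 0"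
      by (simp add: eval_nat_numeral linear_0[OF lin_f])
    then have "papp ([:1, -1, 1:] * [:1, 0, 0, 0, 0, 0, 1:]) f b = 0"
      by (simp only: papp_mult[OF lin_f] papp_vec_0[OF lin_f])
    then show ?thesis by (simp only: mult.commute simp_thms)
  qed
qed

lemma E6_orbit_conditions:
  assumes D: "D = E6" and hh: "h = 12"
  shows orbit_conditions
proof -
  have N6: "N = 6" and D': "D \<noteq> H4" "D \<noteq> F4" using D by simp_all
  have roots_l: "lroots = roots" using D lroots_eq by simp
  \<comment> \<open>For such a root the annihilators have degree at least 6, so its orbit spans.
    Without one, all roots would share the second annihilator of
    \<open>E6_annihilators\<close>.\<close>
  have "\<exists>b\<in>roots. papp [:1, 1, 1:] f (papp Phi12 f b) = 0 \<and> papp Phi12 f b \<noteq> 0"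
  proof (rule ccontr)
    assume no: "\<not> ?thesis"
    have all: "papp ([:1, 0, 0, 0, 0, 0, 1:] * [:1, -1, 1:]) f b = 0" if b: "b \<in> roots" for b
    proof (cases "papp Phi12 f b = 0")
      case True
      have "papp ([:1, 0, 0, 0, 0, 0, 1:] * [:1, -1, 1:]) f b = papp ([:1, -1, 1:] * [:1, 0, 1:] * Phi12) f b" by simp
      also have "\<dots> = papp ([:1, -1, 1:] * [:1, 0, 1:]) f (papp Phi12 f b)" by (rule papp_mult[OF lin_f])
      finally show ?thesis using True by (simp only: papp_vec_0[OF lin_f])
    next
      case False
      then show ?thesis using E6_annihilators[OF D hh b] no b by blast
    qed
    \<comment> \<open>This vector spans the radical of the Cartan matrix modulo 3.\<close>
    have "list_all (\<lambda>r. 3 dvd dotl r [1,0,2,0,1,2]) (cartan1 E6)" by code_simp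
    then have "3 dvd dotl (cartan1 D ! i) [1,0,2,0,1,2]" if "i < n" for i
      using that cartan_lengths D by (auto simp: list_all_length)
    then have "(3::int) dvd poly ([:1, 0, 0, 0, 0, 0, 1:] * [:1, -1, 1:]) 1"
      by (intro fixed_vector_mod[of "[1,0,2,0,1,2]" 0, OF D' _ _ _ _ all]) (simp_all add: N6)
    then show False by simp
  qed
  then obtain b where b: "b \<in> roots" and y3: "papp [:1, 1, 1:] f (papp Phi12 f b) = 0"
    and y: "papp Phi12 f b \<noteq> 0" by blast
  have bl: "b \<in> lroots" using b roots_l by simp
  let ?P = "[:1, 1, 0, -1, 0, 1, 1:] :: int poly"
  have "papp ([:1, 1, 1:] * Phi12) f b = 0" using y3 by (simp only: papp_mult[OF lin_f])
  then have annb: "papp ?P f b = 0" by simp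
  have C: "ieval Phi12 \<nu> = 0" "Phi12 \<noteq> 0" "degree Phi12 = totient h"
    using order_h by (simp_all add: hh totient_values exact_order_12 del: ieval_pCons)
  have min: "N \<le> degree P" if P: "P \<noteq> 0" "papp P f b = 0" for P
  proof -
    obtain q where q: "q \<noteq> 0" "degree P = totient h + degree q" "papp q f (papp Phi12 f b) = 0"
      by (rule cyclotomic_cofactor[OF b C P])
    have "\<not> degree q \<le> 1" using quadratic_not_linear[OF y y3 _ q(1)] q(3) by auto
    then show ?thesis using q(2) by (simp add: N6 hh totient_values)
  qed
  have bound: "M = h" if M: "h dvd M" "M > 0" "totient M \<le> N" for M
  proof -
    have "12 \<le> M" using dvd_imp_le[OF M(1,2)] hh by simp
    then have "M \<in> {12, 14, 18}" using totient_le_8_bound[of M] M N6 by simp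
    then show ?thesis using M hh by auto
  qed
  note sp = cyclic_centralizer(1)[OF bl min bound] and cen = cyclic_centralizer(2)[OF bl min bound]
  \<comment> \<open>The annihilator of one root with spanning orbit annihilates the whole space, so
    the recurrence holds for every root.\<close>
  have "papp ?P f x = 0" for x
  proof (rule linear_eq_0_on_span[OF linear_papp[OF lin_f]])
    show "x \<in> span ((\<lambda>j. (f ^^ j) b) ` {..<N})" using sp by simp
    fix z assume "z \<in> (\<lambda>j. (f ^^ j) b) ` {..<N}"
    then obtain j where "z = (f ^^ j) b" by blast
    moreover have "(f ^^ j) (papp ?P f b) = papp ?P f ((f ^^ j) b)"
      by (rule papp_commute_linear[OF lin_f lin_f linear_iter]) (metis funpow_swap1)
    ultimately show "papp ?P f z = 0" using annb linear_0[OF linear_iter] by simp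
  qed
  note ann = this
  have fx: "fixsp c = {0}" by (rule all_roots_fixsp, intro exI[of _ ?P]) (use ann in simp)
  have data: "az b 3 = 1 - az b 2" "az b 4 = -1" "az b 5 = az b 2 - az b 1 - 1" "az b 6 = -2 * az b 2"
    "az b 7 = az b 5" "az b 8 = -1" "az b 9 = az b 3"
    "az b 1 = -1 \<or> az b 1 = 0 \<or> az b 1 = 1" "az b 2 = 0 \<or> az b 2 = 1" "-1 \<le> az b 5"
    if bl: "b \<in> lroots" for b
  proof -
    let ?A = "az b" and ?cs = "[1, 1, 0, -1, 0, 1, 1] :: int list"
    have an: "papp (Poly ?cs) f b = 0" using ann[of b] by simp
    note r = az_recurrence[OF D'(1) bl an] and A0 = az_0[OF D'(1) bl]
    note x = eval_nat_numeral dst_def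
    show a3: "?A 3 = 1 - ?A 2" using r[of 3 0] A0 by (simp add: x)
    show a4: "?A 4 = -1" using r[of 2 0] A0 a3 by (simp add: x)
    show a5: "?A 5 = ?A 2 - ?A 1 - 1" using r[of 1 0] A0 a3 a4 by (simp add: x)
    show a6: "?A 6 = -2 * ?A 2" using r[of 0 0] A0 a3 a4 a5 by (simp add: x)
    show a7: "?A 7 = ?A 5" using r[of 0 1] A0 a3 a4 a5 a6 by (simp add: x)
    show a8: "?A 8 = -1" using r[of 0 2] A0 a3 a4 a5 a6 a7 by (simp add: x)
    show a9: "?A 9 = ?A 3" using r[of 0 3] A0 a3 a4 a5 a6 a7 a8 by (simp add: x)
    have bd: "-1 \<le> ?A j \<and> ?A j \<le> 1" if "0 < j" "j < 6" for j
      using az_bounds[OF D'(1) bl, of j] az_ge[OF D'(1) bl, of j] that hh by auto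
    have sv: "x = -1 \<or> x = 0 \<or> x = 1" if "-1 \<le> x \<and> x \<le> 1" for x :: int using that by linarith
    show "?A 1 = -1 \<or> ?A 1 = 0 \<or> ?A 1 = 1" by (intro sv bd; simp)
    have "-1 \<le> ?A 2 \<and> ?A 2 \<le> 1" "-1 \<le> ?A 3 \<and> ?A 3 \<le> 1" by (intro bd; simp)+
    then show "?A 2 = 0 \<or> ?A 2 = 1" using a3 by linarith
    show "-1 \<le> ?A 5" using bd[of 5] by simp
  qed
  have half: "(\<Sum>i<k. (f ^^ i) b) \<notin> roots" if k: "1 < k" "2 * k < h" "coprime k h" and b: "b \<in> roots" for k b
  proof
    assume s: "(\<Sum>i<k. (f ^^ i) b) \<in> roots"
    let ?A = "az b"
    have bl: "b \<in> lroots" using b roots_l by simp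
    have "k = 5" using coprime_12[of k] k hh by simp
    then have "4 * ?A 1 + 3 * ?A 2 + 2 * ?A 3 + ?A 4 = -4"
      using az_root_sum[OF D'(1) bl s] by (simp add: eval_nat_numeral)
    then have "4 * ?A 1 + ?A 2 = -5" using data(1,2)[OF bl] by linarith
    then show False using data(8,9)[OF bl] by (elim disjE) linarith+
  qed
  let ?A = "az b"
  note A = data[OF bl] and A0 = az_0[OF D'(1) bl]
  \<comment> \<open>The value 1 would give c^6 b = -b, so that x^2 + 1 as well as x^2 + x + 1 kills
    the nonzero vector Phi12(c) b; their difference is x.\<close>
  have "?A 2 \<noteq> 1"
  proof
    assume "?A 2 = 1"
    then have "(f ^^ 6) b = - b" using az_neg[OF D'(1) bl, of 6] hh A(4) by simp
    then have "papp [:1, 0, 0, 0, 0, 0, 1:] f b = 0" by (simp add: eval_nat_numeral linear_0[OF lin_f])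
    moreover have "[:1, 0, 0, 0, 0, 0, 1:] = [:1, 0, 1:] * Phi12" by simp
    ultimately have y4: "papp [:1, 0, 1:] f (papp Phi12 f b) = 0" by (simp only: papp_mult[OF lin_f])
    have "papp ([:1, 1, 1:] - [:1, 0, 1:]) f (papp Phi12 f b) = 0"
      using y3 y4 by (simp only: papp_diff[OF lin_f] diff_self)
    then have "f (papp Phi12 f b) = 0" by (simp add: linear_0[OF lin_f])
    then show False using f_eq_0 y by blast
  qed
  then have a2: "?A 2 = 0" using A(9) by blast
  have list: "map ?A [0..<10] = [2, ?A 1, 0, 1, -1, - ?A 1 - 1, 0, - ?A 1 - 1, -1, 1]"
    unfolding upt_lists using A(1-7) A0 a2 by simp
  have ex: "\<exists>g\<in>W. c ** g = g ** c [^]\<^bsub>G\<^esub> k"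
    if ck: "conj_check [1, 1, 0, -1, 0, 1] as (replicate 10 0)
        (powl [1, 1, 0, -1, 0, 1] 12 (unitl 6)) k ws"
      and as: "map ?A [0..<10] = as" for as k ws
    by (rule exists_conj[OF _ as D'(1) bl, where ws = ws and cs = "[1, 1, 0, -1, 0, 1]"])
      (use annb sp N6 ck hh in simp_all)
  have "?A 1 \<noteq> 1" using A(3,10) a2 by linarith
  then have "?A 1 = -1 \<or> ?A 1 = 0" using A(8) by blast
  then have "\<exists>g\<in>W. c ** g = g ** c [^]\<^bsub>G\<^esub> (5::nat)"
  proof
    assume a: "?A 1 = -1"
    show ?thesis using ex[OF E6_conj_checks(1)] list a by simp
  next
    assume a: "?A 1 = 0"
    show ?thesis using ex[OF E6_conj_checks(2)] list a by simp
  qed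
  then show ?thesis using orbit_conditionsI[OF fx cen half, of 5] hh coprime_examples by auto
qed

section \<open>Type F4\<close>

lemma F4_az:
  assumes D: "D = F4" and hh: "h = 12" and bl: "b \<in> lroots"
  shows "papp Phi12 f b = 0" "az b 2 = 1" "az b 3 = 0" "az b 4 = -1" "az b 5 = - az b 1"
    "az b 1 = -1 \<or> az b 1 = 0 \<or> az b 1 = 1"
proof -
  have D': "D \<noteq> H4" and N4: "N = 4" using D by auto
  show ann: "papp Phi12 f b = 0"
    by (rule full_cyclotomic[OF bl])
       (use order_h in \<open>simp_all add: hh N4 totient_values exact_order_12 del: ieval_pCons\<close>)
  let ?A = "az b" and ?cs = "[1, 0, -1, 0, 1] :: int list"
  have an: "papp (Poly ?cs) f b = 0" using ann by simp
  note r = az_recurrence[OF D' bl an] and A0 = az_0[OF D' bl]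
  note x = eval_nat_numeral dst_def
  show a2: "?A 2 = 1" using r[of 2 0] A0 by (simp add: x)
  show a3: "?A 3 = 0" using r[of 1 0] A0 by (simp add: x)
  show a4: "?A 4 = -1" using r[of 0 0] A0 a2 by (simp add: x)
  show a5: "?A 5 = - ?A 1" using r[of 0 1] A0 a3 by (simp add: x)
  have "-1 \<le> ?A 1 \<and> ?A 1 \<le> 1" using az_bounds[OF D' bl, of 1] az_ge[OF D' bl, of 1] hh by auto
  then show "?A 1 = -1 \<or> ?A 1 = 0 \<or> ?A 1 = 1" by linarith
qed

lemma F4_root_sum:
  assumes D: "D = F4" and hh: "h = 12" and bl: "b \<in> lroots"
    and k: "1 < k" "2 * k < h" "coprime k h"
  shows "(\<Sum>i<k. (f ^^ i) b) \<notin> roots"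
proof
  assume s: "(\<Sum>i<k. (f ^^ i) b) \<in> roots"
  have D': "D \<noteq> H4" using D by auto
  have "k = 5" using coprime_12[of k] k hh by simp
  then have "4 * az b 1 + 3 * az b 2 + 2 * az b 3 + az b 4 = -4"
    using az_root_sum[OF D' bl s] by (simp add: eval_nat_numeral)
  then have "4 * az b 1 = -6" using F4_az(2-4)[OF D hh bl] by linarith
  then show False using F4_az(6)[OF D hh bl] by (elim disjE) linarith+
qed

text \<open>The last two premises concern all roots, whereas the lattice covers only one of the two
  orbits; the other orbit is supplied by the reversed diagram.\<close>

lemma F4_orbit_conditionsI:
  assumes D: "D = F4" and hh: "h = 12"
    and ann: "\<And>b. b \<in> roots \<Longrightarrow> papp Phi12 f b = 0"
    and half: "\<And>k b. 1 < k \<Longrightarrow> 2 * k < h \<Longrightarrow> coprime k h \<Longrightarrow> b \<in> roots \<Longrightarrow> (\<Sum>i<k. (f ^^ i) b) \<notin> roots"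
  shows orbit_conditions
proof -
  have D': "D \<noteq> H4" and N4: "N = 4" using D by auto
  have fx: "fixsp c = {0}" by (rule all_roots_fixsp, intro exI[of _ Phi12]) (use ann in simp)
  define b where "b = \<alpha> 0"
  have "0 < n" using D by simp
  then have "b \<in> lroots" unfolding lroots_def b_def
    by (intro CollectI exI[of _ "mat 1"] exI[of _ 0]) (auto simp: lidx_def)
  note bl = this
  have b: "b \<in> roots" using bl lroots_subset by blast
  have min: "N \<le> degree P" if "P \<noteq> 0" "papp P f b = 0" for P
    using degree_annihilator_ge(2)[OF b that] by (simp add: hh N4 totient_values)
  have bound: "M = h" if M: "h dvd M" "M > 0" "totient M \<le> N" for M
  proof -
    have "M \<le> 12" using totient_le_8_bound[of M] M N4 by simp
    then show ?thesis using M hh by (auto elim!: dvdE)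
  qed
  note sp = cyclic_centralizer(1)[OF bl min bound] and cen = cyclic_centralizer(2)[OF bl min bound]
  let ?A = "az b"
  note A = F4_az[OF D hh bl] and A0 = az_0[OF D' bl]
  have list: "map ?A [0..<6] = [2, ?A 1, 1, 0, -1, - ?A 1]"
    unfolding upt_lists using A(2-5) A0 by simp
  have ex: "\<exists>g\<in>W. c ** g = g ** c [^]\<^bsub>G\<^esub> k"
    if ck: "conj_check [1, 0, -1, 0] as (replicate 6 0) (powl [1, 0, -1, 0] 12 (unitl 4)) k ws"
      and as: "map ?A [0..<6] = as" for as k ws
    by (rule exists_conj[OF _ as D' bl, where ws = ws and cs = "[1, 0, -1, 0]"])
      (use A(1) sp N4 ck hh in simp_all)
  from A(6) have "(\<exists>g\<in>W. c ** g = g ** c [^]\<^bsub>G\<^esub> (7::nat)) \<or> (\<exists>g\<in>W. c ** g = g ** c [^]\<^bsub>G\<^esub> (5::nat))"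
  proof (elim disjE)
    assume a: "?A 1 = -1"
    show ?thesis using ex[OF F4_conj_checks(1)] list a by simp
  next
    assume a: "?A 1 = 0"
    show ?thesis using ex[OF F4_conj_checks(2)] list a by simp
  next
    assume a: "?A 1 = 1"
    show ?thesis using ex[OF F4_conj_checks(3)] list a by simp
  qed
  then show ?thesis using orbit_conditionsI[OF fx cen half, of 7] orbit_conditionsI[OF fx cen half, of 5] hh coprime_examples by auto
qed

end

section \<open>Type H4\<close>

definition H4_values :: "(int \<times> int) list" where
  "H4_values = [(0,0), (1,0), (-1,0), (2,0), (-2,0), (0,1), (0,-1), (-1,1), (1,-1)]"

text \<open>A pair (p, q) stands for p + q \<open>phi\<close>. The nine values are 0, \<plusminus>1,
  \<plusminus>2, \<plusminus>\<open>phi\<close>, \<plusminus>(\<open>phi\<close> - 1), twice the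
  cosines of multiples of pi/2, pi/3 and pi/5.\<close>

lemma H4_values_pos_roots:
  "list_all (\<lambda>y. list_all (\<lambda>i. (dotl (cartan1 H4 ! i) y, dotl (cartan2 H4 ! i) y) \<in> set H4_values) [0..<4]) (pos_roots H4)"
  by code_simp

lemma (in coxeter_rep) H4_inner_simple:
  assumes D: "D = H4" and i: "i < n" and b: "b \<in> roots"
  shows "\<exists>(p, q)\<in>set H4_values. 2 * (\<alpha> i \<bullet> b) = of_int p + of_int q * phi"
proof -
  have N8: "N = 8" and n4: "n = 4" using D by auto
  have ie: "2 * (\<alpha> i \<bullet> e j) = of_int (c1 D i j) + of_int (c2 D i j) * phi" if j: "j < N" for j
  proof -
    have ei: "e i = \<alpha> i" "e (i + 4) = phi *\<^sub>R \<alpha> i" using D i by (auto simp: ebas_def)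
    have "(2 * (\<alpha> i \<bullet> e j)) *\<^sub>R \<alpha> i \<bullet> \<alpha> i = (of_int (c1 D i j) *\<^sub>R e i + of_int (c2 D i j) *\<^sub>R e (i + 4)) \<bullet> \<alpha> i"
      using cartan_action[OF sr i j] by (rule arg_cong)
    then show ?thesis unfolding ei using i by (simp add: inner_add_left)
  qed
  have ev: "2 * (\<alpha> i \<bullet> ev D \<alpha> y) = of_int (dotl (cartan1 D ! i) y) + of_int (dotl (cartan2 D ! i) y) * phi"
    if y: "length y = N" for y
  proof -
    have "2 * (\<alpha> i \<bullet> ev D \<alpha> y) = (\<Sum>j<N. of_int (y ! j) * (2 * (\<alpha> i \<bullet> e j)))"
      by (simp add: ev_def inner_sum_right sum_distrib_left algebra_simps)
    also have "\<dots> = (\<Sum>j<N. of_int (y ! j) * (of_int (c1 D i j) + of_int (c2 D i j) * phi))"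
      by (intro sum.cong refl) (simp add: ie)
    also have "\<dots> = of_int (dotl (cartan1 D ! i) y) + of_int (dotl (cartan2 D ! i) y) * phi"
      using y cartan_lengths[OF i] D N8
      by (simp add: dotl_sum c1_def c2_def sum.distrib sum_distrib_left sum_distrib_right algebra_simps)
    finally show ?thesis .
  qed
  have "D \<noteq> F4" using D by simp
  then have "b \<in> lroots" using b by (simp add: lroots_def roots_def lidx_def)
  then obtain y where y: "y \<in> pmroots" "b = ev D \<alpha> y" using lroots_coords by blast
  have val: "\<exists>(p, q)\<in>set H4_values. 2 * (\<alpha> i \<bullet> ev D \<alpha> z) = of_int p + of_int q * phi"
    if z: "z \<in> set (pos_roots D)" for z
  proof
    have "i \<in> set [0..<4]" using i n4 by simp
    then show "(dotl (cartan1 D ! i) z, dotl (cartan2 D ! i) z) \<in> set H4_values"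
      using H4_values_pos_roots[unfolded list_all_iff] z unfolding D by blast
    show "case (dotl (cartan1 D ! i) z, dotl (cartan2 D ! i) z) of (p, q) \<Rightarrow>
      2 * (\<alpha> i \<bullet> ev D \<alpha> z) = of_int p + of_int q * phi"
      unfolding prod.case by (rule ev[OF pos_roots_length[OF z]])
  qed
  from y(1) show ?thesis unfolding pmroots_def
  proof
    assume "y \<in> set (pos_roots D)"
    then show ?thesis using val y(2) by simp
  next
    assume "y \<in> map uminus ` set (pos_roots D)"
    then obtain z where z: "z \<in> set (pos_roots D)" "y = map uminus z" by blast
    then obtain p q where pq: "(p, q) \<in> set H4_values" "2 * (\<alpha> i \<bullet> ev D \<alpha> z) = of_int p + of_int q * phi"
      using val by blast
    have "b = - ev D \<alpha> z" using y(2) z ev_uminus pos_roots_length by simp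
    then have "2 * (\<alpha> i \<bullet> b) = of_int (- p) + of_int (- q) * phi" using pq(2) by simp
    moreover have "(- p, - q) \<in> set H4_values" using pq(1) by (auto simp: H4_values_def)
    ultimately show ?thesis by blast
  qed
qed

context regular_elt
begin

text \<open>W moves the first of the two roots to a simple one, where the list of values
  applies.\<close>

lemma H4_ac_values:
  assumes D: "D = H4" and b: "b \<in> roots"
  shows "\<exists>(p, q)\<in>set H4_values. ac b j = of_int p + of_int q * phi"
proof -
  obtain A i where A: "A \<in> W" "i < n" "b = A *v \<alpha> i" using b by (auto simp: roots_def)
  obtain B where B: "B \<in> W" "B ** A = mat 1"
  proof (rule that[of "inv\<^bsub>G\<^esub> A"])
    show "inv\<^bsub>G\<^esub> A \<in> W" using group.inv_closed[OF group_G A(1)] .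
    show "inv\<^bsub>G\<^esub> A ** A = mat 1" using group.l_inv[OF group_G A(1)] by simp
  qed
  have r: "B *v ((f ^^ j) b) \<in> roots" using iter_root[OF b] B(1) by simp
  have "B *v b = \<alpha> i" unfolding A(3) by (simp add: matrix_vector_mul_assoc B(2))
  then have "ac b j = 2 * (\<alpha> i \<bullet> (B *v (f ^^ j) b))"
    unfolding ac_def using W_inner[OF B(1), of b "(f ^^ j) b"] by simp
  then show ?thesis using H4_inner_simple[OF D A(2) r] by simp
qed

lemma eigenvalue_root:
  assumes all: "\<And>x. papp Q f x = 0" and pq: "p \<noteq> 0 \<or> q \<noteq> 0"
    and p: "f p = Re \<mu> *\<^sub>R p - Im \<mu> *\<^sub>R q" and q: "f q = Im \<mu> *\<^sub>R p + Re \<mu> *\<^sub>R q"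
  shows "ieval Q \<mu> = 0"
proof -
  have *: "papp P f p = Re (ieval P \<mu>) *\<^sub>R p - Im (ieval P \<mu>) *\<^sub>R q \<and>
    papp P f q = Im (ieval P \<mu>) *\<^sub>R p + Re (ieval P \<mu>) *\<^sub>R q" for P
  proof (induction P)
    case (pCons a P)
    then have e: "papp P f p = Re (ieval P \<mu>) *\<^sub>R p - Im (ieval P \<mu>) *\<^sub>R q"
      "papp P f q = Im (ieval P \<mu>) *\<^sub>R p + Re (ieval P \<mu>) *\<^sub>R q" by blast+
    show ?case unfolding papp_pCons[OF lin_f] e
      by (simp add: linear_add[OF lin_f] linear_diff[OF lin_f] linear_cmul[OF lin_f] p q
          scaleR_add_right scaleR_diff_right scaleR_add_left scaleR_diff_left algebra_simps)
  qed simp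
  let ?r = "Re (ieval Q \<mu>)" and ?i = "Im (ieval Q \<mu>)"
  have e: "?r *\<^sub>R p = ?i *\<^sub>R q" "?i *\<^sub>R p = - (?r *\<^sub>R q)"
    using *[of Q] all by (simp_all add: eq_neg_iff_add_eq_0)
  have "?r *\<^sub>R (?r *\<^sub>R p) + ?i *\<^sub>R (?i *\<^sub>R p) = 0" unfolding e by (simp add: mult.commute)
  then have "(?r * ?r + ?i * ?i) *\<^sub>R p = 0" by (simp add: scaleR_add_left)
  moreover have "?i *\<^sub>R (?i *\<^sub>R q) + ?r *\<^sub>R (?r *\<^sub>R q) = 0"
    using arg_cong[OF e(1), of "(*\<^sub>R) ?i"] arg_cong[OF e(2), of "(*\<^sub>R) ?r"] by (simp add: mult.commute)
  then have "(?r * ?r + ?i * ?i) *\<^sub>R q = 0" by (simp add: scaleR_add_left add.commute)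
  ultimately have "?r * ?r + ?i * ?i = 0" using pq by auto
  then show ?thesis by (simp add: complex_eq_iff sum_squares_eq_zero_iff)
qed

lemma H4_annihilator:
  assumes D: "D = H4" and hh: "h = 30"
  shows "papp Phi30 f x = 0"
proof (rule annihilate_all)
  fix b assume "b \<in> roots"
  then have bl: "b \<in> lroots" using D lroots_eq by simp
  have N8: "N = 8" using D by simp
  show "papp Phi30 f b = 0"
    by (rule full_cyclotomic[OF bl])
       (use order_h in \<open>simp_all add: hh N8 totient_values exact_order_30 del: ieval_pCons\<close>)
qed

text \<open>As \<open>Phi30\<close> annihilates the whole space, every complex eigenvalue of c has
  exact order 30; hence the degree bound holds for all nonzero vectors and not only for
  roots.\<close>

lemma H4_degree:
  assumes D: "D = H4" and hh: "h = 30" and P: "P \<noteq> 0" "papp P f x = 0" "x \<noteq> 0"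
  shows "8 \<le> degree P"
proof -
  obtain \<mu> p q where mu: "ieval P \<mu> = 0" "p \<noteq> 0 \<or> q \<noteq> 0"
    "f p = Re \<mu> *\<^sub>R p - Im \<mu> *\<^sub>R q" "f q = Im \<mu> *\<^sub>R p + Re \<mu> *\<^sub>R q"
    by (rule papp_eigenvector[OF P(1,3,2)])
  have ex: "exact_order \<mu> 30"
    unfolding exact_order_30 by (rule eigenvalue_root[OF H4_annihilator[OF D hh] mu(2-4)])
  show ?thesis using totient_le_degree[OF ex P(1) mu(1)] by (simp add: totient_values)
qed

text \<open>\<open>\<theta> = c\<^sup>3 + c\<^sup>-\<^sup>3\<close> satisfies \<open>\<theta>\<^sup>2 = \<theta> + 1\<close>; since \<open>c\<close> acts cyclically on the lattice of rank 8
  over the integers, \<open>\<theta>\<close> is a scalar.\<close>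

lemma H4_scalar:
  assumes D: "D = H4" and hh: "h = 30" and b: "b \<in> roots"
  obtains \<tau> where "\<tau> = phi \<or> \<tau> = 1 - phi" "\<tau> *\<^sub>R b = (f ^^ 3) b + (f ^^ 27) b"
proof -
  define \<theta> where "\<theta> x = (f ^^ 3) x + (f ^^ 27) x" for x
  have lin: "linear \<theta>" unfolding \<theta>_def
    by (intro linear_compose_add linear_iter)
  have N8: "N = 8" using D by simp
  have bl: "b \<in> lat e N" using b lroots_lat D lroots_eq by auto
  have iter_lat: "(f ^^ j) x \<in> lat e N" if "x \<in> lat e N" for j x
    using lat_iterate[of e N f x j] W_lat[OF cW] that by blast
  have 30: "(f ^^ (30 + j)) x = (f ^^ j) x" for j x
    using iter_mod[of "30 + j" x] iter_mod[of j x] by (simp add: hh)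
  have sq: "\<theta> (\<theta> x) = \<theta> x + x" for x
  proof -
    \<comment> \<open>The product is x^4 - x^3 + x^2 - x + 1 evaluated at x^3, the relation behind
      \<open>\<theta> (\<theta> x) = \<theta> x + x\<close>.\<close>
    have "papp ([:1, -1, 1, -1, 1:] * Phi30) f y = 0" for y
      by (simp only: papp_mult[OF lin_f] H4_annihilator[OF D hh] papp_vec_0[OF lin_f])
    moreover have "[:1, -1, 1, -1, 1:] * Phi30 = Poly [1, 0, 0, -1, 0, 0, 1, 0, 0, -1, 0, 0, 1]" by simp
    ultimately have z: "papp (Poly [1, 0, 0, -1, 0, 0, 1, 0, 0, -1, 0, 0, 1]) f y = 0" for y by metis
    define u where "u = (f ^^ 24) x"
    have "u - (f ^^ 3) u + (f ^^ 6) u - (f ^^ 9) u + (f ^^ 12) u = 0"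
      using z[of u] unfolding papp_Poly[OF lin_f] by (simp add: eval_nat_numeral)
    then have "(f ^^ 24) x - (f ^^ 27) x + x - (f ^^ 3) x + (f ^^ 6) x = 0"
      using 30[of 0 x] 30[of 3 x] 30[of 6 x] by (simp add: u_def flip: funpow_add[THEN fun_cong, unfolded o_apply])
    moreover have "\<theta> (\<theta> x) = (f ^^ 6) x + x + x + (f ^^ 24) x"
      using 30[of 0 x] 30[of 24 x]
      by (simp add: \<theta>_def linear_add[OF linear_iter] flip: funpow_add[THEN fun_cong, unfolded o_apply])
    ultimately show ?thesis by (simp add: \<theta>_def algebra_simps)
  qed
  \<comment> \<open>\<open>\<theta> - phi\<close> kills x, because (t - phi)(t - (1 - phi)) = t^2 -
    t - 1. If x is nonzero, a multiple of b is a polynomial in c applied to x, so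
    \<open>\<theta> - phi\<close> kills b too.\<close>
  define x where "x = \<theta> b - (1 - phi) *\<^sub>R b"
  have phib: "phi *\<^sub>R y \<in> lat e N" if "y \<in> lat e N" for y
  proof (rule lat_stable[of "(*\<^sub>R) phi" N e, OF _ _ that])
    fix j assume j: "j < N"
    show "phi *\<^sub>R e j \<in> lat e N"
    proof (cases "j < 4")
      case True
      then have "phi *\<^sub>R e j = e (j + 4)" using D by (simp add: ebas_def)
      then show ?thesis using True N8 by simp
    next
      case False
      then have "j - 4 < 4" using j N8 by simp
      then have "phi *\<^sub>R e j = e j + e (j - 4)"
        using False D j N8 phi_sq by (simp add: ebas_def scaleR_add_left)
      then show ?thesis using False j by (simp add: lat_add)
    qed
  qed (simp add: linear_scaleR)
  have xl: "x \<in> lat e N"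
  proof -
    have "\<theta> b + (of_int (-1) *\<^sub>R b + phi *\<^sub>R b) \<in> lat e N"
      unfolding \<theta>_def using bl by (intro lat_add lat_scale phib iter_lat)
    then show ?thesis by (simp add: x_def scaleR_diff_left algebra_simps)
  qed
  show ?thesis
  proof (cases "x = 0")
    case True
    then show ?thesis using that[of "1 - phi"] by (simp add: x_def \<theta>_def)
  next
    case False
    have min: "N \<le> degree P" if "P \<noteq> 0" "papp P f x = 0" for P
      using H4_degree[OF D hh that False] N8 by simp
    obtain a P where P: "a \<noteq> 0" "of_int a *\<^sub>R b = papp P f x" "degree P < max N 1"
      by (rule lat_multiple_in_cyclic[OF lin_f W_lat[OF cW] xl min bl])
    define g where "g y = \<theta> y - phi *\<^sub>R y" for y
    have lg: "linear g" unfolding g_def by (intro linear_compose_sub lin linear_scaleR)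
    have com: "g (f y) = f (g y)" for y
      by (simp add: g_def \<theta>_def linear_diff[OF lin_f] linear_add[OF lin_f] linear_cmul[OF lin_f] funpow_swap1)
    have "g x = 0" unfolding g_def x_def
      by (simp add: linear_diff[OF lin] linear_add[OF lin] linear_cmul[OF lin] sq scaleR_diff_left scaleR_diff_right phi_sq scaleR_add_left algebra_simps)
    then have "g (papp P f x) = 0"
      using papp_commute_linear[OF lin_f lin_f lg com, of P x] by simp
    then have "of_int a *\<^sub>R g b = 0" unfolding P(2)[symmetric] by (simp add: linear_cmul[OF lg])
    then show ?thesis using that[of phi] P(1) by (simp add: g_def \<theta>_def)
  qed
qed

text \<open>The relation \<open>\<tau> * ac b j = ac b (dst j 3) + ac b (j + 3)\<close> and
  \<open>ac b 5 = 1\<close> determine all autocorrelations from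
  \<open>ac b 1 = m + n * \<tau>\<close>, for which four values are possible.\<close>

lemma H4_ac:
  assumes D: "D = H4" and hh: "h = 30" and b: "b \<in> roots"
  obtains \<tau> :: real and m n :: int
  where "\<tau> *\<^sub>R b = (f ^^ 3) b + (f ^^ (h - 3)) b" "(m, n) \<in> {(0, 0), (-1, 0), (0, 1), (-1, 1)}"
    "1.61 < \<tau> \<and> \<tau> < 1.62 \<or> -0.62 < \<tau> \<and> \<tau> < -0.61"
    "map (ac b) [0..<15] = [2, m + n * \<tau>, (n - 1 - m) + (1 + m) * \<tau>, \<tau>, (1 + m) + (n - 1) * \<tau>, 1, \<tau> - 1,
      (n - 1 - m) + m * \<tau>, (1 + m - n) - m * \<tau>, 1 - \<tau>, -1, (-1 - m) + (1 - n) * \<tau>, - \<tau>,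
      (1 + m - n) - (1 + m) * \<tau>, - m - n * \<tau>]"
proof -
  obtain \<tau> where \<tau>: "\<tau> = phi \<or> \<tau> = 1 - phi" "\<tau> *\<^sub>R b = (f ^^ 3) b + (f ^^ 27) b"
    by (rule H4_scalar[OF D hh b])
  have bd: "1.61 < \<tau> \<and> \<tau> < 1.62 \<or> -0.62 < \<tau> \<and> \<tau> < -0.61" using \<tau>(1) phi_bounds by auto
  have tt: "\<tau> * \<tau> = \<tau> + 1" using \<tau>(1)
  proof
    assume "\<tau> = 1 - phi"
    have "(1 - phi) * (1 - phi) = 1 - phi + 1" using phi_sq by (simp add: algebra_simps)
    then show ?thesis unfolding \<open>\<tau> = 1 - phi\<close> .
  qed (simp add: phi_sq)
  let ?A = "ac b"
  have A0: "?A 0 = 2" using ac_0[OF b] .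
  have st: "\<tau> * ?A j = ?A (dst j 3) + ?A (j + 3)" if j: "j \<le> 27" for j
  proof -
    have "\<tau> * ?A j = 2 * ((f ^^ j) b \<bullet> (\<tau> *\<^sub>R b))" by (simp add: ac_def inner_commute)
    also have "\<dots> = 2 * ((f ^^ j) b \<bullet> (f ^^ 3) b) + 2 * ((f ^^ j) b \<bullet> (f ^^ 27) b)"
      unfolding \<tau>(2) by (simp add: inner_add_right)
    also have "\<dots> = ?A (dst j 3) + ?A (dst j 27)" unfolding ac_dst ..
    also have "?A (dst j 27) = ?A (j + 3)"
      using ac_sym[of "j + 3" b] j hh by (simp add: dst_def)
    finally show ?thesis .
  qed
  have a5: "?A 5 = 1"
  proof -
    \<comment> \<open>The product is x^10 - x^5 + 1; pairing it with the fifth iterate of b gives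
      \<open>2 * ac b 5 = ac b 0\<close>.\<close>
    have "papp ([:1, -1, 1:] * Phi30) f b = 0"
      by (simp only: papp_mult[OF lin_f] H4_annihilator[OF D hh] papp_vec_0[OF lin_f])
    then have z: "papp (Poly [1, 0, 0, 0, 0, -1, 0, 0, 0, 0, 1]) f b = 0" by simp
    show ?thesis using ac_recurrence[OF z, of 5 0] A0 by (simp add: eval_nat_numeral dst_def)
  qed
  note x = dst_def
  have a3: "?A 3 = \<tau>" using st[of 0] A0 by (simp add: x)
  have a4: "?A 4 = \<tau> * ?A 1 - ?A 2" using st[of 1] by (simp add: x)
  have "\<tau> * ?A 2 = 1 + ?A 1" using st[of 2] a5 by (simp add: x)
  then have "\<tau> * (\<tau> * ?A 2) = \<tau> * (1 + ?A 1)" by simp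
  then have "(\<tau> * \<tau>) * ?A 2 = \<tau> * (1 + ?A 1)" by (simp only: mult.assoc)
  then have "\<tau> * ?A 2 + ?A 2 = \<tau> * (1 + ?A 1)" unfolding tt by (simp add: algebra_simps)
  then have a2: "?A 2 = (\<tau> - 1) * (1 + ?A 1)" using \<open>\<tau> * ?A 2 = 1 + ?A 1\<close> by (simp add: algebra_simps)
  have vals: "?A j \<in> {0, 1, -1, 2, -2, \<tau>, - \<tau>, \<tau> - 1, 1 - \<tau>}" for j
    using H4_ac_values[OF D b, of j] \<tau>(1) by (auto simp: H4_values_def)
  have lt: "?A 1 < 2" "-2 < ?A 1" using ac_bounds(1,4)[OF b, of 1] hh by auto
  \<comment> \<open>These are the values of \<open>ac b 2 = (\<tau> - 1) * (1 + ac b 1)\<close> for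
    \<open>ac b 1\<close> equal to 1, -\<tau> and 1 - \<tau>. None of them is twice an inner product
    of roots.\<close>
  have bad: "x \<notin> {0, 1, -1, 2, -2, \<tau>, - \<tau>, \<tau> - 1, 1 - \<tau>}" if "x \<in> {2 * \<tau> - 2, \<tau> - 2, 2 * \<tau> - 3}" for x
    using bd that by auto
  have "?A 1 \<in> {0, -1, \<tau>, \<tau> - 1}"
  proof (rule ccontr)
    assume "?A 1 \<notin> {0, -1, \<tau>, \<tau> - 1}"
    then have "?A 1 = 1 \<or> ?A 1 = - \<tau> \<or> ?A 1 = 1 - \<tau>" using vals[of 1] lt by auto
    then have "?A 2 \<in> {2 * \<tau> - 2, \<tau> - 2, 2 * \<tau> - 3}"
    proof (elim disjE)
      assume a: "?A 1 = 1"
      show ?thesis unfolding a2 a by simp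
    next
      assume a: "?A 1 = - \<tau>"
      have "(\<tau> - 1) * (1 + - \<tau>) = \<tau> - 2" using tt by (simp add: algebra_simps)
      then show ?thesis unfolding a2 a by simp
    next
      assume a: "?A 1 = 1 - \<tau>"
      have "(\<tau> - 1) * (1 + (1 - \<tau>)) = 2 * \<tau> - 3" using tt by (simp add: algebra_simps)
      then show ?thesis unfolding a2 a by simp
    qed
    then show False using bad vals by blast
  qed
  then obtain m n :: int where mn: "(m, n) \<in> {(0, 0), (-1, 0), (0, 1), (-1, 1)}" "?A 1 = m + n * \<tau>"
  proof (elim insertE)
    assume "?A 1 = 0" then show ?thesis using that[of 0 0] by simp
  next
    assume "?A 1 = -1" then show ?thesis using that[of "-1" 0] by simp
  next
    assume "?A 1 = \<tau>" then show ?thesis using that[of 0 1] by simp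
  next
    assume "?A 1 = \<tau> - 1" then show ?thesis using that[of "-1" 1] by simp
  qed simp
  have tt': "\<tau> * (\<tau> * r) = \<tau> * r + r" for r using tt by (metis distrib_right mult.assoc mult_1)
  note y = tt tt' algebra_simps
  have a2': "?A 2 = (n - 1 - m) + (1 + m) * \<tau>" unfolding a2 mn(2) by (simp add: y)
  have a4': "?A 4 = (1 + m) + (n - 1) * \<tau>" unfolding a4 a2' mn(2) by (simp add: y)
  have a6: "?A 6 = \<tau> - 1" using st[of 3] A0 a3 tt by (simp add: x)
  have a7: "?A 7 = (n - 1 - m) + m * \<tau>" using st[of 4] a4' mn(2) by (simp add: x y)
  have a8: "?A 8 = (1 + m - n) - m * \<tau>" using st[of 5] a5 a2' by (simp add: x y)
  have a9: "?A 9 = 1 - \<tau>" using st[of 6] a6 a3 by (simp add: x y)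
  have a10: "?A 10 = -1" using st[of 7] a7 a4' by (simp add: x y)
  have a11: "?A 11 = (-1 - m) + (1 - n) * \<tau>" using st[of 8] a8 a5 by (simp add: x y)
  have a12: "?A 12 = - \<tau>" using st[of 9] a9 a6 by (simp add: x y)
  have a13: "?A 13 = (1 + m - n) - (1 + m) * \<tau>"
  proof -
    have "?A 13 = \<tau> * ?A 10 - ?A 7" using st[of 10] by (simp add: x)
    then show ?thesis unfolding a10 a7 by (simp add: y)
  qed
  have a14: "?A 14 = - m - n * \<tau>"
  proof -
    have "?A 14 = \<tau> * ?A 11 - ?A 8" using st[of 11] by (simp add: x)
    then show ?thesis unfolding a11 a8 by (simp add: y)
  qed
  have l: "map ?A [0..<15] = [2, m + n * \<tau>, (n - 1 - m) + (1 + m) * \<tau>, \<tau>, (1 + m) + (n - 1) * \<tau>, 1, \<tau> - 1,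
      (n - 1 - m) + m * \<tau>, (1 + m - n) - m * \<tau>, 1 - \<tau>, -1, (-1 - m) + (1 - n) * \<tau>, - \<tau>,
      (1 + m - n) - (1 + m) * \<tau>, - m - n * \<tau>]"
    unfolding upt_lists list.map A0 mn(2) a2' a3 a4' a5 a6 a7 a8 a9 a10 a11 a12 a13 a14 by (rule refl)
  show ?thesis by (rule that[OF _ mn(1) bd l]) (use \<tau>(2) hh in simp)
qed

lemma H4_orbit_conditions:
  assumes D: "D = H4" and hh: "h = 30"
  shows orbit_conditions
proof -
  have N8: "N = 8" using D by simp
  have roots_l: "lroots = roots" using D lroots_eq by simp
  have fx: "fixsp c = {0}"
    by (rule all_roots_fixsp, intro exI[of _ Phi30]) (use H4_annihilator[OF D hh] in simp)
  have half: "(\<Sum>i<k. (f ^^ i) b) \<notin> roots" if k: "1 < k" "2 * k < h" "coprime k h" and b: "b \<in> roots" for k b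
  proof
    assume s: "(\<Sum>i<k. (f ^^ i) b) \<in> roots"
    note n = root_sum_norm[OF b s]
    let ?A = "ac b"
    obtain \<tau> :: real and m n :: int where mn: "\<tau> *\<^sub>R b = (f ^^ 3) b + (f ^^ (h - 3)) b"
      "(m, n) \<in> {(0, 0), (-1, 0), (0, 1), (-1, 1)}"
      "1.61 < \<tau> \<and> \<tau> < 1.62 \<or> -0.62 < \<tau> \<and> \<tau> < -0.61"
      "map ?A [0..<15] = [2, m + n * \<tau>, (n - 1 - m) + (1 + m) * \<tau>, \<tau>, (1 + m) + (n - 1) * \<tau>, 1, \<tau> - 1,
        (n - 1 - m) + m * \<tau>, (1 + m - n) - m * \<tau>, 1 - \<tau>, -1, (-1 - m) + (1 - n) * \<tau>, - \<tau>,
        (1 + m - n) - (1 + m) * \<tau>, - m - n * \<tau>]"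
      by (rule H4_ac[OF D hh b])
    have A: "?A 1 = m + n * \<tau>" "?A 2 = (n - 1 - m) + (1 + m) * \<tau>" "?A 3 = \<tau>" "?A 4 = (1 + m) + (n - 1) * \<tau>"
      "?A 5 = 1" "?A 6 = \<tau> - 1" "?A 7 = (n - 1 - m) + m * \<tau>" "?A 8 = (1 + m - n) - m * \<tau>" "?A 9 = 1 - \<tau>"
      "?A 10 = -1" "?A 11 = (-1 - m) + (1 - n) * \<tau>" "?A 12 = - \<tau>"
      using mn(4) unfolding upt_lists by simp_all
    have cs: "m = 0 \<and> n = 0 \<or> m = -1 \<and> n = 0 \<or> m = 0 \<and> n = 1 \<or> m = -1 \<and> n = 1" using mn(2) by auto
    have "k = 7 \<or> k = 11 \<or> k = 13" using coprime_30[of k] k hh by simp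
    then show False
    proof (elim disjE)
      assume "k = 7"
      then have "6 * ?A 1 + 5 * ?A 2 + 4 * ?A 3 + 3 * ?A 4 + 2 * ?A 5 + ?A 6 = -6" using n by (simp add: eval_nat_numeral)
      then show False unfolding A using cs mn(3) by (elim disjE conjE; simp)
    next
      assume "k = 11"
      then have "10 * ?A 1 + 9 * ?A 2 + 8 * ?A 3 + 7 * ?A 4 + 6 * ?A 5 + 5 * ?A 6 + 4 * ?A 7 + 3 * ?A 8 + 2 * ?A 9 + ?A 10 = -10"
        using n by (simp add: eval_nat_numeral)
      then show False unfolding A using cs mn(3) by (elim disjE conjE; simp)
    next
      assume "k = 13"
      then have "12 * ?A 1 + 11 * ?A 2 + 10 * ?A 3 + 9 * ?A 4 + 8 * ?A 5 + 7 * ?A 6 + 6 * ?A 7 + 5 * ?A 8 + 4 * ?A 9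
        + 3 * ?A 10 + 2 * ?A 11 + ?A 12 = -12"
        using n by (simp add: eval_nat_numeral)
      then show False unfolding A using cs mn(3) by (elim disjE conjE; simp)
    qed
  qed
  define b where "b = \<alpha> 0"
  have b: "b \<in> roots" and bl: "b \<in> lroots" using roots_nonempty roots_l by (simp_all add: b_def)
  have min: "N \<le> degree P" if "P \<noteq> 0" "papp P f b = 0" for P
    using degree_annihilator_ge(2)[OF b that] by (simp add: hh N8 totient_values)
  have bound: "M = h" if M: "h dvd M" "M > 0" "totient M \<le> N" for M
  proof -
    have "M \<le> 30" using totient_le_8_bound[of M] M N8 by simp
    then show ?thesis using M hh by (auto elim!: dvdE)
  qed
  note sp = cyclic_centralizer(1)[OF bl min bound] and cen = cyclic_centralizer(2)[OF bl min bound]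
  obtain \<tau> :: real and m n :: int where mn: "\<tau> *\<^sub>R b = (f ^^ 3) b + (f ^^ (h - 3)) b"
    "(m, n) \<in> {(0, 0), (-1, 0), (0, 1), (-1, 1)}"
    "1.61 < \<tau> \<and> \<tau> < 1.62 \<or> -0.62 < \<tau> \<and> \<tau> < -0.61"
    "map (ac b) [0..<15] = [2, m + n * \<tau>, (n - 1 - m) + (1 + m) * \<tau>, \<tau>, (1 + m) + (n - 1) * \<tau>, 1, \<tau> - 1,
      (n - 1 - m) + m * \<tau>, (1 + m - n) - m * \<tau>, 1 - \<tau>, -1, (-1 - m) + (1 - n) * \<tau>, - \<tau>,
      (1 + m - n) - (1 + m) * \<tau>, - m - n * \<tau>]"
    by (rule H4_ac[OF D hh b])
  have ex: "\<exists>g\<in>W. c ** g = g ** c [^]\<^bsub>G\<^esub> k"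
    if ck: "conj_check [1, 1, 0, -1, -1, -1, 0, 1] as bs (powl [1, 1, 0, -1, -1, -1, 0, 1] 30 (unitl 8)) k ws"
      and l: "length as = 15" and ab: "map (ac b) [0..<15] = map2 (\<lambda>p q. of_int p + \<tau> * of_int q) as bs"
    for as bs k ws
  proof (rule conj_check_sound[OF b, where cs = "[1, 1, 0, -1, -1, -1, 0, 1]" and as = as and bs = bs and ws = ws and \<tau> = \<tau>])
    have lb: "length bs = 15" using ck l by (simp add: conj_check_def)
    fix j assume "j < length as"
    then show "ac b j = of_int (as ! j) + \<tau> * of_int (bs ! j)"
      using arg_cong[OF ab, of "\<lambda>xs. xs ! j"] l lb by simp
  qed (use H4_annihilator[OF D hh, of b] sp N8 ck hh mn(1) in \<open>simp_all add: eval_nat_numeral\<close>)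
  from mn(2) have "\<exists>g\<in>W. c ** g = g ** c [^]\<^bsub>G\<^esub> (11::nat)"
  proof (elim insertE)
    assume "(m, n) = (0, 0)"
    then show ?thesis by (intro ex[OF H4_conj_checks(1)]) (simp_all add: mn(4))
  next
    assume "(m, n) = (-1, 0)"
    then show ?thesis by (intro ex[OF H4_conj_checks(2)]) (simp_all add: mn(4))
  next
    assume "(m, n) = (0, 1)"
    then show ?thesis by (intro ex[OF H4_conj_checks(3)]) (simp_all add: mn(4))
  next
    assume "(m, n) = (-1, 1)"
    then show ?thesis by (intro ex[OF H4_conj_checks(4)]) (simp_all add: mn(4))
  qed simp
  then show ?thesis using orbit_conditionsI[OF fx cen half, of 11] hh coprime_examples by auto
qed

end

section \<open>Diagram reversal for F4, the order of the Coxeter element, and the conclusion\<close>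

lemma coxeter_repI: "simple_roots D \<alpha> \<Longrightarrow> coxeter_rep D \<alpha>"
  using simple_roots_indep by unfold_locales blast+

abbreviation (input) rev4 :: "(nat \<Rightarrow> 'a) \<Rightarrow> nat \<Rightarrow> 'a" where
  "rev4 \<alpha> \<equiv> \<lambda>j. \<alpha> (3 - j)"

text \<open>Reversal is a symmetry of the Coxeter matrix, so the reversed simple roots define the
  same group and the same roots. Their first two are the old last two, so the two sets
  \<open>lroots\<close> together cover all roots.\<close>

lemma F4_reverse:
  assumes "simple_roots F4 \<alpha>"
  shows "simple_roots F4 (rev4 \<alpha>)" "coxeter_group F4 (rev4 \<alpha>) = coxeter_group F4 \<alpha>"
    "coxeter_rep.roots F4 (rev4 \<alpha>) = coxeter_rep.roots F4 \<alpha>"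
    "coxeter_rep.roots F4 \<alpha> = coxeter_rep.lroots F4 \<alpha> \<union> coxeter_rep.lroots F4 (rev4 \<alpha>)"
    "b \<in> coxeter_rep.roots F4 \<alpha> \<Longrightarrow> i < 4 \<Longrightarrow> coxeter_rep.cf F4 (rev4 \<alpha>) b i = coxeter_rep.cf F4 \<alpha> b (3 - i)"
proof -
  have m: "coxeter_matrix F4 (3 - i) (3 - j) = coxeter_matrix F4 i j" if "i < 4" "j < 4" for i j
    using that unfolding less_numeral_cases by (elim insertE emptyE; simp add: coxeter_matrix_def)
  show rev: "simple_roots F4 (rev4 \<alpha>)"
    unfolding simple_roots_def
  proof (intro conjI allI impI)
    show "CARD('a) = coxeter_rank F4" using assms by (simp add: simple_roots_def)
    fix i j assume ij: "i < coxeter_rank F4" "j < coxeter_rank F4"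
    have "\<alpha> (3 - i) \<bullet> \<alpha> (3 - j) = - cos (pi / real (coxeter_matrix F4 (3 - i) (3 - j)))"
      using assms by (simp add: simple_roots_def)
    then show "\<alpha> (3 - i) \<bullet> \<alpha> (3 - j) = - cos (pi / real (coxeter_matrix F4 i j))" using m ij by simp
  qed
  interpret r: coxeter_rep F4 \<alpha> by (rule coxeter_repI[OF assms])
  interpret r': coxeter_rep F4 "rev4 \<alpha>" by (rule coxeter_repI[OF rev])
  have img: "{3 - j | j. j < 4} = {..<4::nat}"
  proof (intro equalityI subsetI)
    fix i :: nat assume "i \<in> {..<4}"
    then show "i \<in> {3 - j | j. j < 4}" by (intro CollectI exI[of _ "3 - i"]) auto
  qed auto
  have "simple_reflections F4 (rev4 \<alpha>) = (\<lambda>i. reflection_matrix (\<alpha> i)) ` {3 - j | j. j < 4}"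
    by (auto simp: simple_reflections_def)
  also have "\<dots> = simple_reflections F4 \<alpha>" unfolding img by (simp add: simple_reflections_def)
  finally show G: "coxeter_group F4 (rev4 \<alpha>) = coxeter_group F4 \<alpha>" by (simp add: coxeter_group_def)
  show "r'.roots = r.roots"
  proof (intro equalityI subsetI)
    fix b assume "b \<in> r'.roots"
    then obtain A i where "A \<in> carrier (coxeter_group F4 \<alpha>)" "i < 4" "b = A *v \<alpha> (3 - i)"
      unfolding r'.roots_def G by auto
    then show "b \<in> r.roots" unfolding r.roots_def by (intro CollectI exI[of _ A] exI[of _ "3 - i"]) auto
  next
    fix b assume "b \<in> r.roots"
    then obtain A i where "A \<in> carrier (coxeter_group F4 \<alpha>)" "i < 4" "b = A *v \<alpha> i"
      unfolding r.roots_def by auto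
    then show "b \<in> r'.roots" unfolding r'.roots_def G by (intro CollectI exI[of _ A] exI[of _ "3 - i"]) auto
  qed
  then have sub: "r'.lroots \<subseteq> r.roots" using r'.lroots_subset by simp
  show "r.roots = r.lroots \<union> r'.lroots"
  proof (intro equalityI subsetI)
    fix b assume "b \<in> r.roots"
    then obtain A i where A: "A \<in> carrier (coxeter_group F4 \<alpha>)" "i < 4" "b = A *v \<alpha> i"
      unfolding r.roots_def by auto
    show "b \<in> r.lroots \<union> r'.lroots"
    proof (cases "i < 2")
      case True
      then show ?thesis using A by (auto simp: r.lroots_def r.lidx_def)
    next
      case False
      then have "b \<in> r'.lroots" using A unfolding r'.lroots_def r'.lidx_def G
        by (intro CollectI exI[of _ A] exI[of _ "3 - i"]) auto
      then show ?thesis by simp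
    qed
  qed (use sub r.lroots_subset in auto)
  show "r'.cf b i = r.cf b (3 - i)" if "i < 4"
  proof -
    have "b = (\<Sum>i<4. r.cf b i *\<^sub>R \<alpha> i)" using r.cf_expand[of b] by simp
    also have "\<dots> = (\<Sum>i<4. r.cf b (3 - i) *\<^sub>R \<alpha> (3 - i))"
      by (rule sum.reindex_bij_witness[of _ "\<lambda>i. 3 - i" "\<lambda>i. 3 - i"]) auto
    finally show ?thesis using that by (intro r'.cf_unique) simp_all
  qed
qed

lemma finite_coxeter_repI:
  assumes sr: "simple_roots D \<alpha>"
  shows "finite_coxeter_rep D \<alpha>"
proof -
  interpret coxeter_rep D \<alpha> by (rule coxeter_repI[OF sr])
  show ?thesis
  proof (cases "D = F4")
    case False
    then have eq: "lroots = roots" by (simp add: lroots_def roots_def lidx_def)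
    show ?thesis
      by unfold_locales (use finite_lroots lroots_dichotomy eq in auto)
  next
    case True
    then have F: "simple_roots F4 \<alpha>" using sr by simp
    interpret r: coxeter_rep F4 \<alpha> by (rule coxeter_repI[OF F])
    interpret r': coxeter_rep F4 "rev4 \<alpha>" by (rule coxeter_repI[OF F4_reverse(1)[OF F]])
    have "finite_coxeter_rep F4 \<alpha>"
    proof unfold_locales
      show "finite r.roots" unfolding F4_reverse(4)[OF F] using r.finite_lroots r'.finite_lroots by simp
      fix b assume b: "b \<in> r.roots"
      then consider "b \<in> r.lroots" | "b \<in> r'.lroots" unfolding F4_reverse(4)[OF F] by blast
      then show "(\<forall>i<coxeter_rank F4. 0 \<le> r.cf b i) \<or> (\<forall>i<coxeter_rank F4. r.cf b i \<le> 0)"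
      proof cases
        case 1
        then show ?thesis by (rule r.lroots_dichotomy)
      next
        case 2
        have cf: "r.cf b i = r'.cf b (3 - i)" if "i < 4" for i
          using F4_reverse(5)[OF F b, of "3 - i"] that by simp
        show ?thesis using r'.lroots_dichotomy[OF 2] cf by auto
      qed
    qed
    then show ?thesis using True by simp
  qed
qed

text \<open>The Euler function bound leaves only the orders 14 and 18 for E6 to be excluded. There
  the cyclotomic polynomial would annihilate the space, but its value 1 at 1 is not divisible by
  3.\<close>

lemma (in regular_elt) order_eq_cox_num:
  assumes "cox_num D \<le> h"
  shows "h = cox_num D"
proof -
  note b = totient_le_8_bound[OF h_pos] and t = totient_le_N
  have N: "totient h \<le> 8" using t by (cases D) auto
  have no: "\<not> ((h = 14 \<or> h = 18) \<and> D = E6)"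
  proof
    assume a: "(h = 14 \<or> h = 18) \<and> D = E6"
    then have D: "D = E6" and D': "D \<noteq> H4" "D \<noteq> F4" and N6: "N = 6" by auto
    obtain P where P: "ieval P \<nu> = 0" "P \<noteq> 0" "degree P = N" "poly P 1 = 1" "totient h = N"
    proof (cases "h = 14")
      case True
      then show ?thesis using order_h exact_order_14
        by (intro that[of Phi14]) (simp_all add: N6 totient_values del: ieval_pCons)
    next
      case False
      then have "h = 18" using a by blast
      then show ?thesis using order_h exact_order_18
        by (intro that[of Phi18]) (simp_all add: N6 totient_values del: ieval_pCons)
    qed
    have all: "papp P f b = 0" if "b \<in> roots" for b
      using full_cyclotomic[of b P] P that lroots_eq D by simp
    have "list_all (\<lambda>r. 3 dvd dotl r [1,0,2,0,1,2]) (cartan1 E6)" by code_simp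
    then have "3 dvd dotl (cartan1 D ! i) [1,0,2,0,1,2]" if "i < n" for i
      using that cartan_lengths D by (auto simp: list_all_length)
    then have "(3::int) dvd poly P 1"
      by (intro fixed_vector_mod[of "[1,0,2,0,1,2]" 0, OF D' _ _ _ _ all]) (simp_all add: N6)
    then show False using P(4) by simp
  qed
  show ?thesis using b t N no assms by (cases D) auto
qed

text \<open>The same c, \<psi> and \<nu> form a regular element for the reversed simple roots, whose
  lattice contains the other orbit.\<close>

lemma (in regular_elt) F4_orbit_conditions:
  assumes D: "D = F4" and hh: "h = 12"
  shows orbit_conditions
proof -
  have F: "simple_roots F4 \<alpha>" using sr D by simp
  note rv = F4_reverse[OF F]
  interpret r': finite_coxeter_rep F4 "rev4 \<alpha>" by (rule finite_coxeter_repI[OF rv(1)])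
  have rr: "r'.roots = roots" using rv(3) D by simp
  interpret r': regular_elt F4 "rev4 \<alpha>" c \<psi> \<nu>
  proof unfold_locales
    show "c \<in> carrier (coxeter_group F4 (rev4 \<alpha>))" using rv(2) cW D by simp
    show "r'.regular_functional \<psi>" using reg unfolding regular_functional_def r'.regular_functional_def rr .
    show "\<psi> (c *v x) = \<nu> * \<psi> x" for x by (rule eig)
  qed
  have h': "r'.h = 12" using hh rv(2) D by simp
  have un: "roots = lroots \<union> r'.lroots" using rv(4) D by simp
  show ?thesis
  proof (rule F4_orbit_conditionsI[OF D hh])
    show "papp Phi12 f b = 0" if "b \<in> roots" for b
      using that F4_az(1)[OF D hh] r'.F4_az(1)[OF refl h'] un by blast
    show "(\<Sum>i<k. (f ^^ i) b) \<notin> roots" if k: "1 < k" "2 * k < h" "coprime k h" and b: "b \<in> roots" for k b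
    proof (cases "b \<in> lroots")
      case True
      then show ?thesis using F4_root_sum[OF D hh _ k] by blast
    next
      case False
      then have "b \<in> r'.lroots" using b un by blast
      then show ?thesis using r'.F4_root_sum[OF refl h'] k hh h' rr by simp
    qed
  qed
qed

theorem theorem7p1:
  fixes D :: coxeter_type
    and \<alpha> :: "nat \<Rightarrow> real^'n"
    and W :: "(real^'n^'n) monoid"
    and T :: "(real^'n^'n) set"
    and h :: nat
    and c :: "real^'n^'n"
  assumes "simple_roots D \<alpha>"
    and "W = coxeter_group D \<alpha>"
    and "T = reflections W (simple_reflections D \<alpha>)"
    and "is_coxeter_number (carrier W) h"
    and "coxeter_element W T h c"
  shows "(\<exists>Orb. periodic_orbit_on (carrier W) (\<lambda>w. PopT W T w c) Orb \<and> card Orb = h) \<and>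
    (\<forall>k::int. coprime k (int h) \<longrightarrow>
       \<not> [k = 1] (mod int h) \<longrightarrow> \<not> [k = - 1] (mod int h) \<longrightarrow>
       (\<exists>g\<in>carrier W. g \<otimes>\<^bsub>W\<^esub> c \<otimes>\<^bsub>W\<^esub> inv\<^bsub>W\<^esub> g = c [^]\<^bsub>W\<^esub> k) \<longrightarrow>
       periodic_orbit_on (carrier W) (\<lambda>w. PopT W T w c)
         {w \<in> carrier W. inv\<^bsub>W\<^esub> w \<otimes>\<^bsub>W\<^esub> c \<otimes>\<^bsub>W\<^esub> w = c [^]\<^bsub>W\<^esub> k} \<and>
       card {w \<in> carrier W. inv\<^bsub>W\<^esub> w \<otimes>\<^bsub>W\<^esub> c \<otimes>\<^bsub>W\<^esub> w = c [^]\<^bsub>W\<^esub> k} = h)"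
proof -
  interpret R: finite_coxeter_rep D \<alpha> by (rule finite_coxeter_repI[OF assms(1)])
  note WT = assms(2) assms(3)[unfolded assms(2)]
  have c: "c \<in> R.W" "regular_element R.T c" "group.ord R.G c = h"
    using assms(5) unfolding WT coxeter_element_def by auto
  obtain \<psi> \<nu> where psi: "R.regular_functional \<psi>" "\<And>x. \<psi> (c *v x) = \<nu> * \<psi> x"
    using R.regular_element_functional[OF c(1,2)] by blast
  interpret E: regular_elt D \<alpha> c \<psi> \<nu>
    by unfold_locales (use c(1) psi in auto)
  obtain f d where fd: "fundamental_invariants R.W f d" "h = Max (range d)"
    using assms(4) unfolding WT is_coxeter_number_def by auto
  \<comment> \<open>\<open>h\<close> is both the largest degree and the order of c, so the degree
    bound obtained from one explicit element bounds the order of the given c from below.\<close>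
  obtain i where "cox_num D \<le> d i" using R.cox_num_le_degree[OF fd(1)] by blast
  also have "d i \<le> h" unfolding fd(2) by simp
  finally have "E.h = cox_num D" using E.order_eq_cox_num c(3) by simp
  then have E.orbit_conditions
    using E.E6_orbit_conditions E.E7_orbit_conditions E.E8_orbit_conditions E.F4_orbit_conditions E.H4_orbit_conditions by (cases D) auto
  then show ?thesis unfolding E.orbit_conditions_def WT c(3) by (intro R.pop_periodic_orbits[OF c(1,3)]) blast+
qed

end
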